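(* For every regular uncountable cardinal $\kappa$ satisfying the combinatorial principle $\square(\kappa)$, there exists a Shelah group of size $\kappa$.
   Context: The ambient theory is ZFC. For a group $G$, a subset $X\subseteq G$ and a positive integer $n$, $X^n$ denotes the set of all products $x_1x_2\cdots x_n$ with $x_1,\ldots,x_n\in X$. A subset $X\subseteq G$ is of full size if $|X|=|G|$. A group $G$ is $n$-Shelah if $X^n=G$ for every $X\subseteq G$ of full size, and it is Shelah if it is $n$-Shelah for some positive integer $n$. For a set of ordinals $C$, $\mathrm{acc}(C)=\{\alpha\in C\mid \sup(C\cap\alpha)=\alpha>0\}$. For a regular uncountable cardinal $\kappa$, $\square(\kappa)$ is the standard principle asserting the existence of a sequence $\langle C_\alpha\mid\alpha<\kappa,\ \alpha\text{ a nonzero limit ordinal}\rangle$ such that: each $C_\alpha$ is a closed unbounded subset of $\alpha$; for every $\alpha$ and every $\beta\in\mathrm{acc}(C_\alpha)$, $C_\beta=C_\alpha\cap\beta$; and there is no closed unbounded $C\subseteq\kappa$ such that $C\cap\alpha=C_\alpha$ for every $\alpha\in\mathrm{acc}(C)$. *)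

theory Defs
  imports "HOL-Algebra.Group"
begin

unbundle cardinal_syntax

section \<open>Shelah groups\<close>

definition power_set :: "('a, 'b) monoid_scheme \<Rightarrow> 'a set \<Rightarrow> nat \<Rightarrow> 'a set"
  where "power_set G X n =
    {foldr (\<otimes>\<^bsub>G\<^esub>) xs \<one>\<^bsub>G\<^esub> | xs. set xs \<subseteq> X \<and> length xs = n}"

definition full_size :: "('a, 'b) monoid_scheme \<Rightarrow> 'a set \<Rightarrow> bool"
  where "full_size G X \<longleftrightarrow> X \<subseteq> carrier G \<and> |X| =o |carrier G|"

definition n_Shelah :: "nat \<Rightarrow> ('a, 'b) monoid_scheme \<Rightarrow> bool"
  where "n_Shelah n G \<longleftrightarrow> (\<forall>X. full_size G X \<longrightarrow> power_set G X n = carrier G)"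

definition Shelah :: "('a, 'b) monoid_scheme \<Rightarrow> bool"
  where "Shelah G \<longleftrightarrow> (\<exists>n>0. n_Shelah n G)"

section \<open>The square principle\<close>

text \<open>
  A cardinal \<open>\<kappa>\<close> is a well-order relation \<open>r\<close> with \<^prop>\<open>Card_order r\<close>. The ordinals below
  \<open>\<kappa>\<close> are the elements of \<^term>\<open>Field r\<close>, and an ordinal \<open>\<alpha> < \<kappa>\<close>, viewed as the set of its
  predecessors, is \<^term>\<open>underS r \<alpha>\<close>. In particular \<open>\<alpha> > 0\<close> means \<^prop>\<open>underS r \<alpha> \<noteq> {}\<close>.
  The supremum of the empty set is the least element of \<^term>\<open>Field r\<close>, that is \<open>0\<close>.
\<close>

definition nonzero_limit :: "'a rel \<Rightarrow> 'a \<Rightarrow> bool"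
  where "nonzero_limit r \<alpha> \<longleftrightarrow>
    \<alpha> \<in> Field r \<and> underS r \<alpha> \<noteq> {} \<and> wo_rel.supr r (underS r \<alpha>) = \<alpha>"

text \<open>\<open>accumulates r C \<alpha>\<close> is \<open>sup (C \<inter> \<alpha>) = \<alpha> > 0\<close>.\<close>

definition accumulates :: "'a rel \<Rightarrow> 'a set \<Rightarrow> 'a \<Rightarrow> bool"
  where "accumulates r C \<alpha> \<longleftrightarrow>
    underS r \<alpha> \<noteq> {} \<and> wo_rel.supr r (C \<inter> underS r \<alpha>) = \<alpha>"

definition acc_pts :: "'a rel \<Rightarrow> 'a set \<Rightarrow> 'a set"
  where "acc_pts r C = {\<alpha> \<in> C. accumulates r C \<alpha>}"

text \<open>
  \<open>C\<close> is closed and unbounded in the initial segment \<open>A\<close>, which is either \<^term>\<open>underS r \<alpha>\<close> for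
  a limit \<open>\<alpha>\<close>, or all of \<^term>\<open>Field r\<close>, representing \<open>\<kappa>\<close> itself.
\<close>

definition club_in :: "'a rel \<Rightarrow> 'a set \<Rightarrow> 'a set \<Rightarrow> bool"
  where "club_in r A C \<longleftrightarrow>
    C \<subseteq> A \<and>
    (\<forall>\<beta>\<in>A. \<exists>\<gamma>\<in>C. \<beta> \<in> underS r \<gamma>) \<and>
    (\<forall>\<beta>\<in>A. accumulates r C \<beta> \<longrightarrow> \<beta> \<in> C)"

text \<open>The values of the sequence outside the nonzero limit ordinals are irrelevant.\<close>

definition square :: "'a rel \<Rightarrow> bool"
  where "square r \<longleftrightarrow> (\<exists>C :: 'a \<Rightarrow> 'a set.
    (\<forall>\<alpha>. nonzero_limit r \<alpha> \<longrightarrow> club_in r (underS r \<alpha>) (C \<alpha>)) \<and>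
    (\<forall>\<alpha>. nonzero_limit r \<alpha> \<longrightarrow>
      (\<forall>\<beta> \<in> acc_pts r (C \<alpha>). C \<beta> = C \<alpha> \<inter> underS r \<beta>)) \<and>
    \<not> (\<exists>D. club_in r (Field r) D \<and> (\<forall>\<alpha> \<in> acc_pts r D. D \<inter> underS r \<alpha> = C \<alpha>)))"

end

theory Submission
  imports Defs "HOL-Algebra.Weak_Morphisms"
begin

text \<open>
  Walks along a coherent sequence without thread yield a function \<open>lev\<close> on pairs below \<open>\<kappa>\<close> that
  satisfies the two ultrametric inequalities and is unbounded on every unbounded set, and a colouring
  \<open>col\<close> taking every value on suitable pairs of high level. A group \<open>G(\<gamma>, j)\<close> is then defined by recursion:
  it contains the \<open>G(\<beta>, n)\<close> with \<open>\<beta> < \<gamma>\<close>, \<open>n \<le> j\<close> and \<open>lev \<beta> \<gamma> \<le> n\<close>, and \<open>G(\<gamma>, j + 1)\<close> is a small cancellation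
  quotient of the amalgam of \<open>G(\<gamma>, j)\<close> with the union of the \<open>G(\<beta>, j + 1)\<close>. Its relators equate one fixed
  word in letters of indices \<open>q < p < \<gamma>\<close> with an element prescribed by \<open>col p q \<gamma>\<close>. Malnormality of
  the amalgamated subgroup survives each quotient and keeps the pieces of the relators short. In a set
  of full size the colouring finds, for any prescribed \<open>z\<close>, three elements whose word is \<open>z\<close>.\<close>

section \<open>Groups acting on trees of half-spaces\<close>

text \<open>The obstacle is that values cannot be prescribed freely. If the letters of one relator
  arise from those of another by multiplying with elements of the amalgamated subgroup, the two axes
  in the Bass-Serre tree share, after a translation, a segment of almost a full period, and small
  cancellation forces the prescribed values to be related in the same way. A value is therefore
  prescribed only up to a conjugation computed from the letter \<open>s\<close>, and a pressing-down
  argument finds letters for which this conjugation is known in advance. For the same reason the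
  letters enter at different levels: \<open>a\<close> is new at the stage where its relator is
  imposed, and this confines the elements relating two relators to those below \<open>a\<close>. The
  gaps of the fixed word grow, so that a long window shows position and orientation; its 43265
  syllables come from the inequality \<open>14 * p + 2 \<le> l\<close> between pieces and relators.
  The Greendlinger lemma comes from windmills: growing vertex sets with growing groups that absorb
  the translations of all axes met.\<close>

inductive_set gen :: "'g::group_add set => 'g set" for S where
  gen_0: "0 \<in> gen S"
| gen_add: "s \<in> S ==> n \<in> gen S ==> s + n \<in> gen S"

lemma gen_base: "s \<in> S ==> s \<in> gen S"
  using gen_add[OF _ gen_0] by force

lemma gen_closed_add: "m \<in> gen S ==> n \<in> gen S ==> m + n \<in> gen S"
  by (induction rule: gen.induct) (auto simp: add.assoc intro: gen_add)

lemma gen_closed_neg: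
  assumes "\<And>s. s \<in> S ==> - s \<in> S" and "m \<in> gen S"
  shows "- m \<in> gen S"
  using assms(2)
proof (induction rule: gen.induct)
  case gen_0
  then show ?case by (simp add: gen.gen_0)
next
  case (gen_add s n)
  then show ?case using assms(1) gen_closed_add gen_base by (metis minus_add)
qed

lemma gen_least:
  assumes "S \<subseteq> T" "0 \<in> T" "\<And>a b. a \<in> T ==> b \<in> T ==> a + b \<in> T"
  shows "gen S \<subseteq> T"
proof
  fix x assume "x \<in> gen S"
  then show "x \<in> T" by (induction rule: gen.induct) (use assms in auto)
qed

primrec mult_nat :: "nat => 'g::group_add => 'g" where
  "mult_nat 0 g = 0"
| "mult_nat (Suc k) g = g + mult_nat k g"

lemma mult_nat_commute: "mult_nat k g + g = g + mult_nat k g"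
  by (induction k) (auto simp: add.assoc)

lemma mult_nat_conj: "f + mult_nat k g - f = mult_nat k (f + g - f)"
proof (induction k)
  case (Suc k)
  have "f + mult_nat (Suc k) g - f = (f + g - f) + (f + mult_nat k g - f)"
    by (simp add: diff_conv_add_uminus add.assoc del: add_uminus_conv_diff)
  then show ?case using Suc by simp
qed simp

text \<open>Half-spaces are the oriented edges of a tree: \<open>nested\<close> excludes crossings
  and \<open>fin_sep\<close> makes distances finite. Points of \<open>V\<close> are only names of
  vertices, since distinct points may be separated by no half-space; this allows cosets to be given
  later by representatives.\<close>

locale tree_action =
  fixes F :: "'g::group_add set" and V :: "'v set" and act :: "'g => 'v => 'v" and HS :: "'v set set"
  assumes F_0: "0 \<in> F" and F_add: "\<And>f g. f \<in> F ==> g \<in> F ==> f + g \<in> F"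
    and F_neg: "\<And>f. f \<in> F ==> - f \<in> F"
    and act_0: "\<And>v. act 0 v = v" and act_add: "\<And>f g v. act (f + g) v = act f (act g v)"
    and act_V: "\<And>f v. f \<in> F ==> v \<in> V ==> act f v \<in> V"
    and HS_sub: "\<And>A. A \<in> HS ==> A \<subseteq> V" and HS_ne: "\<And>A. A \<in> HS ==> A \<noteq> {}"
    and HS_compl: "\<And>A. A \<in> HS ==> V - A \<in> HS"
    and HS_act: "\<And>f A. f \<in> F ==> A \<in> HS ==> act f ` A \<in> HS"
    and nested: "\<And>A B. A \<in> HS ==> B \<in> HS ==> A \<subseteq> B \<or> B \<subseteq> A \<or> A \<inter> B = {} \<or> A \<union> B = V"
    and fin_sep: "\<And>u v. u \<in> V ==> v \<in> V ==> finite {A \<in> HS. u \<in> A \<and> v \<notin> A}"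
    and connected: "\<And>u v. u \<in> V ==> v \<in> V ==>
      (u, v) \<in> {(x, y). x \<in> V \<and> y \<in> V \<and> card {A \<in> HS. x \<in> A \<and> y \<notin> A} \<le> 1}\<^sup>*"
begin

definition sep :: "'v => 'v => 'v set set"
  where "sep u v = {A \<in> HS. u \<in> A \<and> v \<notin> A}"

text \<open>An axis of \<open>h\<close> with translation length \<open>l\<close>: the half-spaces
  shrink towards the attracting end, and the \<open>z i\<close> are the vertices on the axis,
  consecutive ones being separated by a single edge.\<close>

definition line :: "int => 'g => (int => 'v set) => bool"
  where "line l h e \<longleftrightarrow> h \<in> F \<and> (\<forall>i. e i \<in> HS) \<and> (\<forall>i. e (i + 1) \<subset> e i) \<and> (\<forall>i. act h ` e i = e (i + l)) \<and>
    (\<exists>z. \<forall>i. z i \<in> V \<and> sep (z i) (z (i - 1)) = {e i} \<and> act h (z i) = z (i + l))"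

definition crosses :: "'v set => 'v set => bool"
  where "crosses U A \<longleftrightarrow> U \<inter> A \<noteq> {} \<and> \<not> U \<subseteq> A"

lemma act_inv [simp]: "act (- f) (act f v) = v" "act f (act (- f) v) = v"
  by (simp_all flip: act_add add: act_0)

lemma inj_act: "inj (act f)"
  by (metis act_inv(1) injI)

lemma act_image_add: "act (f + g) ` A = act f ` act g ` A"
  by (simp add: act_add image_image)

lemma act_image_0 [simp]: "act 0 ` A = A"
  by (simp add: act_0)

lemma act_image_inv [simp]: "act (- f) ` act f ` A = A" "act f ` act (- f) ` A = A"
  by (simp_all add: image_image)

lemma act_image_V: "f \<in> F ==> act f ` V = V"
proof -
  assume f: "f \<in> F"
  have "V = act f ` act (- f) ` V" by simp
  also have "\<dots> \<subseteq> act f ` V" using act_V F_neg f by blast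
  finally show ?thesis using act_V f by blast
qed

lemma act_image_compl: "f \<in> F ==> act f ` (V - A) = V - act f ` A"
  by (simp add: image_set_diff[OF inj_act] act_image_V)

lemma act_image_subset_iff: "act f ` A \<subseteq> act f ` B \<longleftrightarrow> A \<subseteq> B"
  by (simp add: inj_act inj_image_subset_iff)

lemma act_image_Int: "act f ` (A \<inter> B) = act f ` A \<inter> act f ` B"
  by (simp add: image_Int inj_act)

lemma mem_act_image: "v \<in> act f ` A \<longleftrightarrow> act (- f) v \<in> A"
  by (metis act_inv imageE imageI)

lemma crosses_act: "crosses (act f ` U) (act f ` A) \<longleftrightarrow> crosses U A"
  by (metis act_image_Int act_image_subset_iff crosses_def image_is_empty)

lemma sep_act: "f \<in> F ==> sep (act f u) (act f v) = (\<lambda>A. act f ` A) ` sep u v"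
proof (rule Set.set_eqI)
  fix A assume f: "f \<in> F"
  have "A \<in> sep (act f u) (act f v) ==> A \<in> (\<lambda>A. act f ` A) ` sep u v"
    unfolding sep_def using f
    by (intro image_eqI[of _ _ "act (- f) ` A"]) (auto simp: mem_act_image HS_act F_neg)
  then show "A \<in> sep (act f u) (act f v) \<longleftrightarrow> A \<in> (\<lambda>A. act f ` A) ` sep u v"
    using f by (auto simp: sep_def HS_act dest: injD[OF inj_act])
qed

lemma sep_trans: "sep u w \<subseteq> sep u v \<union> sep v w"
  by (auto simp: sep_def)

lemma finite_sep: "u \<in> V ==> v \<in> V ==> finite (sep u v)"
  unfolding sep_def by (rule fin_sep)

lemma sep_commute: "u \<in> V ==> v \<in> V ==> sep v u = (\<lambda>A. V - A) ` sep u v"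
proof (rule Set.set_eqI)
  fix A assume uv: "u \<in> V" "v \<in> V"
  have "A \<in> sep v u ==> A \<in> (\<lambda>A. V - A) ` sep u v"
    unfolding sep_def using uv HS_sub HS_compl
    by (intro image_eqI[of _ _ "V - A"]) auto
  then show "A \<in> sep v u \<longleftrightarrow> A \<in> (\<lambda>A. V - A) ` sep u v"
    using uv HS_compl by (auto simp: sep_def)
qed

lemma inj_on_compl: "inj_on (\<lambda>A. V - A) HS"
  using HS_sub by (intro inj_onI) blast

lemma card_sep_commute: "u \<in> V ==> v \<in> V ==> card (sep v u) = card (sep u v)"
  unfolding sep_commute[of u v]
  by (rule card_image, rule inj_on_subset[OF inj_on_compl]) (auto simp: sep_def)

lemma lineD:
  assumes "line l h e"
  shows "h \<in> F" "e i \<in> HS" "e (i + 1) \<subset> e i" "act h ` e i = e (i + l)"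
  using assms by (simp_all add: line_def)

lemma lineE:
  assumes "line l h e"
  obtains z where "\<And>i. z i \<in> V" "\<And>i. sep (z i) (z (i - 1)) = {e i}" "\<And>i. act h (z i) = z (i + l)"
proof -
  from assms have "\<exists>z. \<forall>i. z i \<in> V \<and> sep (z i) (z (i - 1)) = {e i} \<and> act h (z i) = z (i + l)"
    by (simp add: line_def)
  then show ?thesis using that by auto
qed

lemma line_mono:
  assumes "line l h e" "i \<le> j" shows "e j \<subseteq> e i"
  using assms(2)
proof (induction j rule: int_ge_induct)
  case (step k)
  then show ?case using lineD(3)[OF assms(1), of k] by blast
qed simp

lemma line_strict:
  assumes "line l h e" "i < j" shows "e j \<subset> e i"
proof -
  have "e j \<subseteq> e (i + 1)" using assms(2) by (intro line_mono[OF assms(1)]) simp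
  then show ?thesis using lineD(3)[OF assms(1), of i] by blast
qed

lemma line_subset_iff:
  assumes "line l h e" shows "e j \<subseteq> e i \<longleftrightarrow> i \<le> j"
proof (cases "i \<le> j")
  case True
  then show ?thesis using line_mono[OF assms, of i j] by simp
next
  case False
  then show ?thesis using line_strict[OF assms, of j i] by auto
qed

lemma line_inj:
  assumes "line l h e" shows "e j = e i \<longleftrightarrow> i = j"
proof
  assume "e j = e i"
  then show "i = j" using line_subset_iff[OF assms, of j i] line_subset_iff[OF assms, of i j] by simp
qed simp

text \<open>Two vertices on the axis are separated only by half-spaces of the axis, and
  \<open>A\<close> separates \<open>z m\<close> from \<open>z (d - 1)\<close>.\<close>

lemma line_convex:
  assumes "line l h e" "A \<in> HS" "e m \<subseteq> A" "A \<subseteq> e d"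
  shows "A \<in> range e"
proof -
  obtain z where z: "\<And>i. z i \<in> V" "\<And>i. sep (z i) (z (i - 1)) = {e i}"
    by (rule lineE[OF assms(1)]) blast
  have zin: "z i \<in> e i" "z (i - 1) \<notin> e i" for i using z(2)[of i] by (auto simp: sep_def)
  have "d \<le> m" using assms line_subset_iff[OF assms(1), of m d] by blast
  then have "d - 1 \<le> m" by simp
  have "sep (z m) (z j) \<subseteq> range e" if "j \<le> m" for j
    using that
  proof (induction m rule: int_ge_induct)
    case base
    then show ?case by (auto simp: sep_def)
  next
    case (step k)
    then show ?case using sep_trans[of "z (k+1)" "z j" "z k"] z(2)[of "k+1"] by auto
  qed
  moreover have "A \<in> sep (z m) (z (d - 1))"
    using assms zin[of m] zin[of d] by (auto simp: sep_def)
  ultimately show ?thesis using \<open>d - 1 \<le> m\<close> by blast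
qed

lemma nest_sub:
  assumes "A \<in> HS" "B \<in> HS" "U \<noteq> {}" "U \<subseteq> V" "U \<inter> A = {}" "U \<inter> B = {}" "A \<inter> B \<noteq> {}"
  shows "A \<subseteq> B \<or> B \<subseteq> A"
  using nested[OF assms(1,2)] assms by blast

lemma crossing_above:
  assumes "A \<in> HS" "B \<in> HS" "U \<subseteq> V" "U \<inter> A = {}" "crosses U B" "A \<inter> B \<noteq> {}"
  shows "A \<subseteq> B"
  using nested[OF assms(1,2)] assms unfolding crosses_def by blast

text \<open>A set \<open>U\<close> that is disjoint from \<open>A\<close> but crosses
  \<open>e d\<close> forces \<open>A\<close> below \<open>e d\<close>, and convexity puts
  \<open>A\<close> on the axis. Most overlaps of two axes are detected in this way.\<close>

lemma line_sandwich:
  assumes "line l h e" "A \<in> HS" "U \<subseteq> V" "U \<inter> A = {}" "crosses U (e d)" "e m \<subseteq> A" "d \<le> m"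
  shows "A \<in> range e"
proof -
  have "e m \<subseteq> e d" using line_mono[OF assms(1,7)] .
  then have "A \<inter> e d \<noteq> {}" using assms(6) HS_ne lineD(2)[OF assms(1), of m] by blast
  then have "A \<subseteq> e d" using crossing_above[OF assms(2) lineD(2)[OF assms(1)] assms(3,4,5)] by simp
  then show ?thesis using line_convex[OF assms(1,2,6)] by simp
qed

text \<open>Convexity of both axes: nothing of either lies strictly between neighbouring half-spaces
  of the other, so the indices advance in step.\<close>

lemma line_consecutive:
  assumes b: "line l h b" and b': "line l' h' b'" and rng: "\<And>t. 0 \<le> t ==> t < p ==> b (i + t) \<in> range b'"
  shows "\<exists>j. \<forall>t. 0 \<le> t --> t < p --> b (i + t) = b' (j + t)"
proof (cases "p \<le> 0")
  case False
  then obtain j where j: "b i = b' j" using rng[of 0] by auto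
  have "b (i + t) = b' (j + t)" if "0 \<le> t" "t < p" for t
    using that
  proof (induction t rule: int_ge_induct)
    case base
    then show ?case using j by simp
  next
    case (step k)
    then have k: "b (i + k) = b' (j + k)" by simp
    obtain s where s: "b (i + (k + 1)) = b' s" using rng[of "k+1"] step by auto
    have "b' s \<subset> b' (j + k)" using s k lineD(3)[OF b, of "i+k"] by (simp add: add.assoc)
    then have "j + k < s" using line_subset_iff[OF b', of "j + k" s] by auto
    have "b' (j + k + 1) \<in> range b"
      using line_convex[OF b, of "b' (j+k+1)" "i+(k+1)" "i+k"] lineD(2)[OF b'] k s
        line_mono[OF b', of "j+k+1" s] line_mono[OF b', of "j+k" "j+k+1"] \<open>j + k < s\<close> by auto
    then obtain u where u: "b' (j + k + 1) = b u" by auto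
    have "i + k < u" using u k line_strict[OF b', of "j+k" "j+k+1"] line_subset_iff[OF b, of "i+k" u] by auto
    moreover have "u \<le> i + (k + 1)"
      using u s line_mono[OF b', of "j+k+1" s] line_subset_iff[OF b, of "i+(k+1)" u] \<open>j + k < s\<close> by auto
    ultimately have "u = i + (k + 1)" by simp
    then show ?case using u by (simp add: add.assoc)
  qed
  then show ?thesis by blast
qed auto

lemma lineI:
  assumes "h \<in> F" "\<And>i. e i \<in> HS" "\<And>i. e (i + 1) \<subset> e i" "\<And>i. act h ` e i = e (i + l)"
    "\<And>i. z i \<in> V" "\<And>i. sep (z i) (z (i - 1)) = {e i}" "\<And>i. act h (z i) = z (i + l)"
  shows "line l h e"
  unfolding line_def by (intro conjI allI exI[of _ z]) (rule assms)+

lemma line_rev: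
  assumes "line l h e" shows "line l (- h) (\<lambda>i. V - e (- i))"
proof -
  obtain z where z: "\<And>i. z i \<in> V" "\<And>i. sep (z i) (z (i - 1)) = {e i}" "\<And>i. act h (z i) = z (i + l)"
    by (rule lineE[OF assms(1)]) blast
  note e = lineD[OF assms]
  show ?thesis
  \<comment> \<open>Reversal exchanges the two ends of each edge, hence the shift by one.\<close>
  proof (rule lineI[where z = "\<lambda>i. z (- i - 1)"])
    show "- h \<in> F" using e(1) by (rule F_neg)
    fix i
    show "V - e (- i) \<in> HS" using e(2) by (rule HS_compl)
    have "e (- i) \<subset> e (- (i + 1))" using e(3)[of "- (i + 1)"] by simp
    then show "V - e (- (i + 1)) \<subset> V - e (- i)" using HS_sub[OF e(2)[of "- (i + 1)"]] by blast
    have "act (- h) ` e (- i) = e (- (i + l))"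
      using e(4)[of "- (i + l)"] act_image_inv(1)[of h "e (- (i + l))"] by simp
    then show "act (- h) ` (V - e (- i)) = V - e (- (i + l))"
      using act_image_compl[OF F_neg[OF e(1)]] by simp
    show "z (- i - 1) \<in> V" by (rule z(1))
    have "sep (z (- i - 1)) (z (- i)) = (\<lambda>A. V - A) ` sep (z (- i)) (z (- i - 1))"
      by (rule sep_commute[OF z(1) z(1)])
    then show "sep (z (- i - 1)) (z (- (i - 1) - 1)) = {V - e (- i)}" using z(2)[of "- i"] by simp
    show "act (- h) (z (- i - 1)) = z (- (i + l) - 1)"
      using z(3)[of "- (i + l) - 1"] act_inv(1)[of h "z (- (i + l) - 1)"] by simp
  qed
qed

lemma line_act:
  assumes "line l h e" "f \<in> F" shows "line l (f + h - f) (\<lambda>i. act f ` e i)"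
proof -
  obtain z where z: "\<And>i. z i \<in> V" "\<And>i. sep (z i) (z (i - 1)) = {e i}" "\<And>i. act h (z i) = z (i + l)"
    by (rule lineE[OF assms(1)]) blast
  note e = lineD[OF assms(1)]
  have act_conj: "act (f + h - f) (act f v) = act f (act h v)" for v
    by (simp flip: act_add)
  show ?thesis
  proof (rule lineI[where z = "\<lambda>i. act f (z i)"])
    show "f + h - f \<in> F" using F_add[OF F_add[OF assms(2) e(1)] F_neg[OF assms(2)]] by simp
    fix i
    show "act f ` e i \<in> HS" using assms(2) e(2) by (rule HS_act)
    show "act f ` e (i + 1) \<subset> act f ` e i"
      using e(3)[of i] by (simp add: psubset_eq act_image_subset_iff inj_image_eq_iff[OF inj_act])
    show "act (f + h - f) ` act f ` e i = act f ` e (i + l)"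
      using e(4)[of i] by (simp add: image_image act_conj flip: image_image[of "act f" "act h"])
    show "act f (z i) \<in> V" using assms(2) z(1) by (rule act_V)
    show "sep (act f (z i)) (act f (z (i - 1))) = {act f ` e i}" using sep_act[OF assms(2)] z(2)[of i] by simp
    show "act (f + h - f) (act f (z i)) = act f (z (i + l))" using z(3)[of i] by (simp add: act_conj)
  qed
qed

lemma line_mult_nat:
  assumes "line l h e" shows "act (mult_nat k h) ` e i = e (i + int k * l)"
proof (induction k)
  case (Suc k)
  then show ?case using lineD(4)[OF assms] by (simp add: act_image_add algebra_simps)
qed simp

end

section \<open>Windmills and small cancellation\<close>

lemma conj_add_left: "(w + a - w) + (w + b) = w + (a + b :: 'g::group_add)"
  by (simp add: diff_conv_add_uminus add.assoc del: add_uminus_conv_diff)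

lemma conj_cancel: "w + a - w = w + b - w \<longleftrightarrow> a = (b :: 'g::group_add)"
proof
  assume "w + a - w = w + b - w"
  then have "w + a - w + w = w + b - w + w" by (rule arg_cong)
  then show "a = b" by simp
qed simp

text \<open>Small cancellation for axes: overlaps of \<open>p\<close> edges occur only between axes
  with the same translation up to sign, and never between an axis and a reversed translate of
  itself. The factor 14 is what \<open>no_fixed_displacement\<close> requires: of an overlap of
  \<open>l - 6 * p - 1\<close> edges at most \<open>l / 2\<close> lie on one leg, so at least
  \<open>p\<close> remain for the other.\<close>

locale windmill = tree_action F V act HS
  for F :: "'g::group_add set" and V :: "'v set" and act and HS +
  fixes LL :: "('g \<times> (int => 'v set)) set" and l p :: int
  assumes lines: "\<And>h e. (h, e) \<in> LL ==> line l h e"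
    and LL_conj: "\<And>h e f. (h, e) \<in> LL ==> f \<in> F ==> (f + h - f, \<lambda>i. act f ` e i) \<in> LL"
    and LL_rev: "\<And>h e. (h, e) \<in> LL ==> (- h, \<lambda>i. V - e (- i)) \<in> LL"
    and SC_same: "\<And>h e h' e' i j. (h, e) \<in> LL ==> (h', e') \<in> LL ==>
        (\<And>t. 0 \<le> t ==> t < p ==> e (i + t) = e' (j + t)) ==> h' = h \<or> h' = - h"
    and SC_opp: "\<And>h e f i j. (h, e) \<in> LL ==> f \<in> F ==>
        (\<And>t. 0 \<le> t ==> t < p ==> act f ` e (i + t) = V - e (j - t)) ==> False"
    and p_pos: "1 \<le> p" and l_large: "14 * p + 2 \<le> l" and V_ne: "V \<noteq> {}"
begin

abbreviation "M \<equiv> 2 * p + 1"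

lemma SC_range:
  assumes "(h, e) \<in> LL" "(h', e') \<in> LL" "\<And>t. 0 \<le> t ==> t < p ==> e (i + t) \<in> range e'"
  shows "h' = h \<or> h' = - h"
proof -
  obtain j where "\<forall>t. 0 \<le> t --> t < p --> e (i + t) = e' (j + t)"
    using line_consecutive[OF lines[OF assms(1)] lines[OF assms(2)], of p i] assms(3) by auto
  then show ?thesis using SC_same[OF assms(1,2), of i j] by simp
qed

lemma SC_range_rev:
  assumes "(h, e) \<in> LL" "(h', e') \<in> LL" "\<And>t. 0 \<le> t ==> t < p ==> V - e (i + t) \<in> range e'"
  shows "h' = h \<or> h' = - h"
proof -
  have "V - e (- (- (i + p - 1) + t)) \<in> range e'" if "0 \<le> t" "t < p" for t
    using assms(3)[of "p - 1 - t"] that by (simp add: algebra_simps)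
  then have "h' = - h \<or> h' = - (- h)"
    by (rule SC_range[OF LL_rev[OF assms(1)] assms(2), of "- (i + p - 1)"])
  then show ?thesis by auto
qed

text \<open>Says that \<open>U\<close> projects to a short segment of the axis around
  \<open>x\<close>.\<close>

definition narrow :: "'v set => (int => 'v set) => int => bool"
  where "narrow U e x \<longleftrightarrow> crosses U (e x) \<and> (\<forall>i\<le>x - M. U \<subseteq> e i) \<and> (\<forall>i\<ge>x + M. U \<inter> e i = {})"

lemma narrow_act: "narrow U e x ==> narrow (act f ` U) (\<lambda>i. act f ` e i) x"
  unfolding narrow_def by (simp add: crosses_act act_image_subset_iff flip: act_image_Int)

lemma narrow_shift:
  assumes "line l h e" "narrow U e x" shows "narrow (act (mult_nat k h) ` U) e (x + int k * l)"
proof -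
  have b: "e i = act (mult_nat k h) ` e (i - int k * l)" for i
    using line_mult_nat[OF assms(1), of k "i - int k * l"] by simp
  have n: "narrow (act (mult_nat k h) ` U) (\<lambda>i. act (mult_nat k h) ` e i) x"
    using assms(2) by (rule narrow_act)
  have "act (mult_nat k h) ` U \<subseteq> e i" if "i \<le> x + int k * l - M" for i
    using n that unfolding narrow_def by (subst b) simp
  moreover have "act (mult_nat k h) ` U \<inter> e i = {}" if "x + int k * l + M \<le> i" for i
    using n that unfolding narrow_def by (subst b) simp
  ultimately show ?thesis
    using n b[of "x + int k * l"] unfolding narrow_def by simp
qed

lemma crosses_compl: "U \<subseteq> V ==> crosses U A ==> crosses U (V - A)"
  unfolding crosses_def by blast

text \<open>Two axes through \<open>U\<close> with different translations diverge. Any other nested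
  position of the two half-spaces is refuted by \<open>U\<close> or makes \<open>p\<close>
  consecutive half-spaces of one axis lie on the other or on its reverse.\<close>

lemma branch:
  assumes LL: "(h, e) \<in> LL" "(h', e') \<in> LL" and ne: "h' \<noteq> h" "h' \<noteq> - h" and U: "U \<subseteq> V"
    and nar: "narrow U e y" "narrow U e' x" and m: "m \<le> y - M - p" "x + M + p \<le> m'"
  shows "e' m' \<subseteq> e m"
proof -
  note b = lines[OF LL(1)] and b' = lines[OF LL(2)]
  have cr: "crosses U (e y)" "crosses U (e' x)" using nar by (auto simp: narrow_def)
  have Um: "U \<subseteq> e i" if "i \<le> y - M" for i using nar(1) that by (simp add: narrow_def)
  have Um': "U \<inter> e' i = {}" if "x + M \<le> i" for i using nar(2) that by (simp add: narrow_def)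
  have Une: "U \<noteq> {}" using cr(1) by (auto simp: crosses_def)
  have m1: "U \<subseteq> e m" and m2: "U \<inter> e' m' = {}" using Um[of m] Um'[of m'] m p_pos by auto
  consider "e' m' \<subseteq> e m" | "e m \<subseteq> e' m'" | "e' m' \<inter> e m = {}" | "e' m' \<union> e m = V"
    using nested[OF lineD(2)[OF b', of m'] lineD(2)[OF b, of m]] by blast
  then show ?thesis
  proof cases
    case 2
    then show ?thesis using m1 m2 Une by blast
  next
    case 3
    \<comment> \<open>Disjointness lets the complements of the \<open>e (m + t)\<close> run along
      \<open>e'\<close>, so the axes would overlap with opposite orientation.\<close>
    have "V - e (m + t) \<in> range e'" if t: "0 \<le> t" "t < p" for t
    proof (rule line_sandwich[OF b' _ U _ cr(2), of _ m'])
      show "V - e (m + t) \<in> HS" using lineD(2)[OF b] by (rule HS_compl)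
      show "U \<inter> (V - e (m + t)) = {}" using Um[of "m + t"] m t by auto
      have "e (m + t) \<subseteq> e m" using t line_mono[OF b, of m "m + t"] by simp
      then show "e' m' \<subseteq> V - e (m + t)" using 3 HS_sub[OF lineD(2)[OF b', of m']] by blast
      show "x \<le> m'" using m p_pos by simp
    qed
    then have "h' = h \<or> h' = - h" by (rule SC_range_rev[OF LL])
    then show ?thesis using ne by simp
  next
    case 4
    let ?r = "\<lambda>i. V - e (- i)"
    \<comment> \<open>If the two half-spaces cover \<open>V\<close>, the \<open>p\<close>
      half-spaces of \<open>e'\<close> ending at \<open>m'\<close> run along the reverse of
      \<open>e\<close>.\<close>
    have "e' (m' - p + 1 + t) \<in> range ?r" if t: "0 \<le> t" "t < p" for t
    proof (rule line_sandwich[OF line_rev[OF b] _ U, of _ "- y" "- m"])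
      show "e' (m' - p + 1 + t) \<in> HS" by (rule lineD(2)[OF b'])
      show "U \<inter> e' (m' - p + 1 + t) = {}" using t m by (intro Um') simp
      show "crosses U (V - e (- (- y)))" using crosses_compl[OF U cr(1)] by simp
      have "e' m' \<subseteq> e' (m' - p + 1 + t)" using t by (intro line_mono[OF b']) simp
      then show "V - e (- (- m)) \<subseteq> e' (m' - p + 1 + t)" using 4 by auto
      show "- y \<le> - m" using m p_pos by simp
    qed
    then have "- h = h' \<or> - h = - h'" by (rule SC_range[OF LL(2) LL_rev[OF LL(1)]])
    then show ?thesis using ne by auto
  qed simp
qed

end

text \<open>A windmill: \<open>N\<close> acts on \<open>W\<close>, and an axis whose translation is
  not in \<open>N\<close> has at most \<open>M\<close> half-spaces crossed by \<open>W\<close>.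
  Enlarging the windmill absorbs the translations whose axes are crossed.\<close>

locale mill = windmill F V act HS LL l p
  for F :: "'g::group_add set" and V :: "'v set" and act and HS and LL and l p :: int +
  fixes W :: "'v set" and N :: "'g set"
  assumes W_V: "W \<subseteq> V" and W_ne: "W \<noteq> {}" and N_F: "N \<subseteq> F" and N_0: "0 \<in> N"
    and N_add: "\<And>a b. a \<in> N ==> b \<in> N ==> a + b \<in> N" and N_neg: "\<And>a. a \<in> N ==> - a \<in> N"
    and N_W: "\<And>n. n \<in> N ==> act n ` W = W"
    and inv: "\<And>h e i. (h, e) \<in> LL ==> h \<notin> N ==> W \<subseteq> e i \<or> W \<inter> e (i + M) = {}"
begin

definition S2 :: "('g \<times> (int => 'v set)) set"
  where "S2 = {(h, e). (h, e) \<in> LL \<and> h \<notin> N \<and> (\<exists>x. crosses W (e x))}"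

definition N' :: "'g set"
  where "N' = gen (N \<union> fst ` S2)"

lemma narrow_W:
  assumes "(h, e) \<in> LL" "h \<notin> N" "crosses W (e x)" shows "narrow W e x"
proof -
  have "W \<subseteq> e i" if "i \<le> x - M" for i
  proof -
    have "e x \<subseteq> e (i + M)" using that by (intro line_mono[OF lines[OF assms(1)]]) simp
    then have "W \<inter> e (i + M) \<noteq> {}" using assms(3) by (auto simp: crosses_def)
    then show ?thesis using inv[OF assms(1,2), of i] by simp
  qed
  moreover have "W \<inter> e i = {}" if "x + M \<le> i" for i
  proof -
    have "e (i - M) \<subseteq> e x" using that by (intro line_mono[OF lines[OF assms(1)]]) simp
    then have "\<not> W \<subseteq> e (i - M)" using assms(3) by (auto simp: crosses_def)
    then show ?thesis using inv[OF assms(1,2), of "i - M"] by simp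
  qed
  ultimately show ?thesis using assms(3) by (simp add: narrow_def)
qed

lemma conj_N: "n \<in> N ==> h \<notin> N ==> n + h - n \<notin> N"
proof
  assume n: "n \<in> N" and r: "h \<notin> N" and c: "n + h - n \<in> N"
  have "- n + (n + h - n + n) \<in> N" using n c by (intro N_add N_neg)
  then show False using r by (simp add: add.assoc)
qed

lemma S2_conj:
  assumes "(h, e) \<in> S2" "n \<in> N" shows "(n + h - n, \<lambda>i. act n ` e i) \<in> S2"
proof -
  obtain x where x: "(h, e) \<in> LL" "h \<notin> N" "crosses W (e x)" using assms(1) by (auto simp: S2_def)
  have "crosses (act n ` W) (act n ` e x)" using x(3) by (simp add: crosses_act)
  then have "crosses W (act n ` e x)" using N_W[OF assms(2)] by simp
  moreover have "(n + h - n, \<lambda>i. act n ` e i) \<in> LL" using x(1) assms(2) N_F by (intro LL_conj) auto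
  ultimately show ?thesis using conj_N[OF assms(2) x(2)] by (auto simp: S2_def)
qed

lemma S2_rev:
  assumes "(h, e) \<in> S2" shows "(- h, \<lambda>i. V - e (- i)) \<in> S2"
proof -
  obtain x where x: "(h, e) \<in> LL" "h \<notin> N" "crosses W (e x)" using assms(1) by (auto simp: S2_def)
  have "crosses W (V - e (- (- x)))" using crosses_compl[OF W_V x(3)] by simp
  moreover have "- h \<notin> N" using x(2) N_neg[of "- h"] by auto
  ultimately show ?thesis using LL_rev[OF x(1)] unfolding S2_def mem_Collect_eq case_prod_conv by blast
qed

lemma S2_F: "(h, e) \<in> S2 ==> h \<in> F"
  using lineD(1)[OF lines] by (auto simp: S2_def)

lemma N'_neg_gens: "s \<in> N \<union> fst ` S2 ==> - s \<in> N \<union> fst ` S2"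
  using N_neg S2_rev by force

lemma N'_F: "N' \<subseteq> F"
  unfolding N'_def using N_F S2_F by (intro gen_least) (auto simp: F_0 F_add)

lemma N'_add: "a \<in> N' ==> b \<in> N' ==> a + b \<in> N'"
  unfolding N'_def by (rule gen_closed_add)

lemma N'_neg: "a \<in> N' ==> - a \<in> N'"
  unfolding N'_def using N'_neg_gens by (rule gen_closed_neg)

lemma N'_conj: "a \<in> N' ==> h \<notin> N' ==> - a + h - - a \<notin> N'"
proof
  assume a: "a \<in> N'" and r: "h \<notin> N'" and c: "- a + h - - a \<in> N'"
  have "a + (- a + h - - a + - a) \<in> N'" by (intro N'_add N'_neg c a)
  then show False using r by (simp add: add.assoc del: add_uminus_conv_diff)
qed

lemma N_N': "N \<subseteq> N'"
  unfolding N'_def by (auto intro: gen_base)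

lemma S2_N': "(h, e) \<in> S2 ==> h \<in> N'"
  unfolding N'_def by (rule gen_base) force

lemma mult_nat_N': "h \<in> N' ==> mult_nat k h \<in> N'"
  using N'_add N_N' N_0 by (induction k) auto

text \<open>Reduced words for \<open>N'\<close>. Elements of \<open>N\<close> are collected at the
  end because conjugation by \<open>N\<close> permutes \<open>S2\<close>, and positive exponents
  suffice because \<open>S2\<close> contains the inverses. The second argument records the first
  syllable.\<close>

inductive NF :: "'g => 'g => bool" where
  NF_last: "(h, e) \<in> S2 ==> 1 \<le> k ==> w \<in> N ==> NF (mult_nat k h + w) h"
| NF_step: "(h, e) \<in> S2 ==> 1 \<le> k ==> NF n h' ==> h' \<noteq> h ==> h' \<noteq> - h ==> NF (mult_nat k h + n) h"

lemma NF_S2: "NF n h ==> \<exists>e. (h, e) \<in> S2"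
  by (induction rule: NF.induct) auto

lemma NF_conj:
  assumes "NF n h" "w \<in> N" shows "NF (w + n) (w + h - w)"
  using assms
proof (induction rule: NF.induct)
  case (NF_last h e k v)
  have "w + (mult_nat k h + v) = mult_nat k (w + h - w) + (w + v)"
    by (simp only: mult_nat_conj[symmetric] conj_add_left)
  then show ?case using NF.NF_last[OF S2_conj[OF NF_last(1) \<open>w \<in> N\<close>] NF_last(2)] N_add NF_last by simp
next
  case (NF_step h e k n h')
  have "w + (mult_nat k h + n) = mult_nat k (w + h - w) + (w + n)"
    by (simp only: mult_nat_conj[symmetric] conj_add_left)
  moreover have "w + h' - w \<noteq> w + h - w" using NF_step by (simp only: conj_cancel not_False_eq_True)
  moreover have "w + h' - w \<noteq> - (w + h - w)"
  proof
    assume "w + h' - w = - (w + h - w)"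
    also have "\<dots> = w + - h - w" by (simp add: minus_diff_eq diff_conv_add_uminus minus_add add.assoc del: add_uminus_conv_diff)
    finally show False using NF_step by (simp only: conj_cancel)
  qed
  ultimately show ?case
    using NF.NF_step[OF S2_conj[OF NF_step(1) \<open>w \<in> N\<close>] NF_step(2)] NF_step by simp
qed

lemma NF_cases: "NF n h ==> \<exists>k n'. 1 \<le> k \<and> n = mult_nat k h + n' \<and>
    (n' \<in> N \<or> (\<exists>h'. NF n' h' \<and> h' \<noteq> h \<and> h' \<noteq> - h))"
  by (erule NF.cases) blast+

lemma NF_mult:
  assumes "(h, e) \<in> S2" "1 \<le> k" "n' \<in> N \<or> (\<exists>h'. NF n' h' \<and> h' \<noteq> h \<and> h' \<noteq> - h)"
  shows "NF (mult_nat k h + n') h"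
  using assms NF.intros by blast

lemma NF_exists:
  assumes "n \<in> N'" shows "n \<in> N \<or> (\<exists>h. NF n h)"
  using assms unfolding N'_def
proof (induction rule: gen.induct)
  case gen_0
  then show ?case using N_0 by simp
next
  case (gen_add s n)
  show ?case
  proof (cases "s \<in> N")
    case True
    then show ?thesis using gen_add.IH N_add NF_conj by blast
  next
    case False
    then obtain e where s: "(s, e) \<in> S2" using gen_add.hyps by auto
    have one: "mult_nat 1 s = s" by simp
    show ?thesis
    proof (cases "n \<in> N \<or> (\<exists>h. NF n h \<and> h \<noteq> s \<and> h \<noteq> - s)")
      case True
      then have "NF (mult_nat 1 s + n) s" by (intro NF_mult[OF s]) auto
      then show ?thesis unfolding one by blast
    next
      case False
      then obtain h where h: "NF n h" "h = s \<or> h = - s" using gen_add.IH by blast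
      obtain k n' where k: "1 \<le> k" "n = mult_nat k h + n'" and n': "n' \<in> N \<or> (\<exists>h'. NF n' h' \<and> h' \<noteq> h \<and> h' \<noteq> - h)"
        using NF_cases[OF h(1)] by blast
      obtain e' where b': "(h, e') \<in> S2" using NF_S2[OF h(1)] by blast
      show ?thesis
      proof (cases "h = s")
        case True
        have "s + n = mult_nat (Suc k) h + n'" using k True by (simp add: add.assoc)
        then show ?thesis using NF_mult[OF b' _ n', of "Suc k"] by auto
      next
        case False
        then have sh: "s = - h" using h(2) by auto
        obtain k' where k': "k = Suc k'" using k(1) by (cases k) auto
        have sn: "s + n = mult_nat k' h + n'" using k(2) sh k' by (simp add: add.assoc)
        show ?thesis
        proof (cases "k' = 0")
          case True
          then show ?thesis using sn n' by auto
        next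
          case False
          then show ?thesis using sn NF_mult[OF b' _ n', of k'] by auto
        qed
      qed
    qed
  qed
qed


text \<open>Translated back to \<open>W\<close>, such an axis would have its translation in
  \<open>N\<close> or belong to \<open>S2\<close>; either way \<open>h\<close> would be in
  \<open>N'\<close>.\<close>

lemma foreign_not_crosses:
  assumes "(h, q) \<in> LL" "h \<notin> N'" "a \<in> N'" shows "\<not> crosses (act a ` W) (q i)"
proof
  assume "crosses (act a ` W) (q i)"
  then have "crosses (act (- a) ` act a ` W) (act (- a) ` q i)" by (simp add: crosses_act del: act_image_inv)
  then have cr: "crosses W (act (- a) ` q i)" by simp
  have a: "- a \<in> F" using N'_neg[OF assms(3)] N'_F by auto
  have "(- a + h - - a, \<lambda>i. act (- a) ` q i) \<in> LL" by (rule LL_conj[OF assms(1) a])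
  then have "- a + h - - a \<in> N \<or> (- a + h - - a, \<lambda>i. act (- a) ` q i) \<in> S2"
    using cr unfolding S2_def by blast
  then have c: "- a + h + a \<in> N'" using N_N' S2_N' by auto
  have "a + (- a + h + a + - a) \<in> N'" by (intro N'_add N'_neg c assms(3))
  then show False using assms(2) by (simp add: add.assoc del: add_uminus_conv_diff)
qed

text \<open>Otherwise the \<open>p\<close> half-spaces of \<open>q\<close> starting at
  \<open>i\<close> lie between \<open>e m\<close> and \<open>e x\<close>, hence on the axis
  \<open>e\<close>.\<close>

lemma overtake:
  assumes LL: "(h1, e) \<in> LL" "(h, q) \<in> LL" and ne: "h1 \<noteq> h" "h1 \<noteq> - h" and U: "U \<subseteq> V"
    and nar: "narrow U e x" and Z: "Z \<noteq> {}" "Z \<subseteq> e m" "Z \<subseteq> q (i + p - 1)" and m: "x + M \<le> m" and Ui: "U \<inter> q i = {}"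
  shows "q (i + p - 1) \<subseteq> e m"
proof (rule ccontr)
  assume contr: "\<not> q (i + p - 1) \<subseteq> e m"
  note b = lines[OF LL(1)] and a = lines[OF LL(2)]
  have cr: "crosses U (e x)" using nar by (simp add: narrow_def)
  have Une: "U \<noteq> {}" using cr by (auto simp: crosses_def)
  have dis: "U \<inter> q (i + t) = {}" if "0 \<le> t" for t using Ui line_mono[OF a, of i "i + t"] that by auto
  have Um: "U \<inter> e m = {}" using nar m by (simp add: narrow_def)
  have "U \<inter> q (i + p - 1) = {}" using dis[of "p - 1"] p_pos by (simp add: algebra_simps)
  then have bm: "e m \<subseteq> q (i + p - 1)"
    using nest_sub[OF lineD(2)[OF a] lineD(2)[OF b] Une U _ Um, of "i + p - 1"] Z contr by blast
  have "q (i + t) \<in> range e" if t: "0 \<le> t" "t < p" for t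
  proof (rule line_sandwich[OF b lineD(2)[OF a] U dis[OF t(1)] cr, of m])
    have "q (i + p - 1) \<subseteq> q (i + t)" using t by (intro line_mono[OF a]) simp
    then show "e m \<subseteq> q (i + t)" using bm by blast
    show "x \<le> m" using m p_pos by simp
  qed
  then have "h1 = h \<or> h1 = - h" by (rule SC_range[OF LL(2,1)])
  then show False using ne by simp
qed

text \<open>Otherwise all \<open>e (m + t)\<close> lie between \<open>q j\<close> and
  \<open>q i\<close>, hence on the axis \<open>q\<close>.\<close>

lemma overtake_first:
  assumes LL: "(h1, e) \<in> LL" "(h, q) \<in> LL" and ne: "h \<noteq> h1" "h \<noteq> - h1" and U: "U \<subseteq> V" "U \<noteq> {}" and Z: "Z \<noteq> {}" "Z \<subseteq> q i"
    and core: "\<And>t. 0 \<le> t ==> t < p ==> U \<inter> e (m + t) = {} \<and> Z \<subseteq> e (m + t) \<and> q j \<subseteq> e (m + t)"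
    and Ui: "U \<inter> q i = {}"
  shows "\<exists>t. 0 \<le> t \<and> t < p \<and> q i \<subseteq> e (m + t)"
proof (rule ccontr)
  assume contr: "\<not> ?thesis"
  note b = lines[OF LL(1)] and a = lines[OF LL(2)]
  have "e (m + t) \<in> range q" if t: "0 \<le> t" "t < p" for t
  proof (rule line_convex[OF a lineD(2)[OF b], of j _ i])
    show "q j \<subseteq> e (m + t)" using core[OF t] by simp
    have "q i \<subseteq> e (m + t) \<or> e (m + t) \<subseteq> q i"
      by (rule nest_sub[OF lineD(2)[OF a] lineD(2)[OF b] U(2,1) Ui]) (use core[OF t] Z in auto)
    then show "e (m + t) \<subseteq> q i" using contr t by blast
  qed
  then have "h = h1 \<or> h = - h1" by (rule SC_range[OF LL])
  then show False using ne by simp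
qed

lemma l_le_mult: "1 \<le> k ==> l \<le> int k * l"
proof -
  assume "1 \<le> k"
  then have "1 * l \<le> int k * l" using p_pos l_large by (intro mult_right_mono) auto
  then show ?thesis by simp
qed

lemma mult_nat_conj_neq:
  assumes "h' \<noteq> h" "h' \<noteq> - h"
  shows "mult_nat k h + h' - mult_nat k h \<noteq> h" "mult_nat k h + h' - mult_nat k h \<noteq> - h"
proof -
  let ?a = "mult_nat k h"
  have c: "- ?a + h + ?a = h" by (simp add: mult_nat_commute[symmetric] add.assoc)
  have "h' = - ?a + (?a + h' - ?a) + ?a" by (simp add: diff_conv_add_uminus add.assoc del: add_uminus_conv_diff)
  moreover have "- ?a + - h + ?a = - (- ?a + h + ?a)" by (simp add: minus_add add.assoc)
  ultimately show "?a + h' - ?a \<noteq> h" "?a + h' - ?a \<noteq> - h" using assms c by auto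
qed

text \<open>The first syllable moves \<open>W\<close> by at least \<open>l\<close> along its axis,
  past the whole window, and by \<open>branch\<close> the later syllables do not bring it back. The
  window has \<open>l - 6 * p - 1\<close> elements since
  \<open>2 * (M + p) = 6 * p + 2\<close>.\<close>

lemma NF_core:
  assumes "NF n h" "(h, e) \<in> LL" "crosses W (e x)" "x + M + p \<le> m" "m \<le> x + l - M - p"
  shows "act n ` W \<subseteq> e m"
  using assms
proof (induction arbitrary: e x m rule: NF.induct)
  case (NF_last h e0 k w)
  have "h \<notin> N" using NF_last(1) by (simp add: S2_def)
  then have "narrow (act (mult_nat k h) ` W) e (x + int k * l)"
    using narrow_shift[OF lines narrow_W] NF_last by blast
  moreover have "m \<le> x + int k * l - M" using l_le_mult[OF NF_last(2)] NF_last(7) p_pos by linarith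
  ultimately show ?case by (simp add: narrow_def act_image_add N_W[OF NF_last(3)])
next
  case (NF_step h e0 k n h')
  let ?a = "mult_nat k h"
  let ?U = "act ?a ` W"
  obtain e' x' where b': "(h', e') \<in> LL" "h' \<notin> N" "crosses W (e' x')"
    using NF_S2[OF NF_step(3)] by (auto simp: S2_def)
  have a: "?a \<in> F" using mult_nat_N'[OF S2_N'[OF NF_step(1)]] N'_F by auto
  have "h \<notin> N" using NF_step(1) by (simp add: S2_def)
  then have nar: "narrow ?U e (x + int k * l)"
    using narrow_shift[OF lines narrow_W] NF_step(7,8) by blast
  have nar': "narrow ?U (\<lambda>i. act ?a ` e' i) x'" using narrow_act narrow_W[OF b'] by blast
  have "act ?a ` e' (x' + M + p) \<subseteq> e m"
  proof (rule branch[OF NF_step(7) LL_conj[OF b'(1) a] _ _ _ nar nar'])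
    show "?U \<subseteq> V" using W_V a act_V by blast
    show "m \<le> x + int k * l - M - p" using l_le_mult[OF NF_step(2)] NF_step(10) by linarith
  qed (use mult_nat_conj_neq[OF NF_step(4,5)] in auto)
  moreover have "act n ` W \<subseteq> e' (x' + M + p)"
    using NF_step.IH[OF b'(1,3), of "x' + M + p"] l_large p_pos by simp
  ultimately show ?case unfolding act_image_add by blast
qed

lemma N'_foreign: "(h1, e) \<in> S2 ==> h \<notin> N' ==> h1 \<noteq> h \<and> h1 \<noteq> - h"
  using S2_N' N'_neg by force

text \<open>A foreign axis overlaps the axis of a syllable in fewer than \<open>p\<close> edges. One
  that separates \<open>n W\<close> from \<open>W\<close> by \<open>2 * p\<close> edges must
  therefore start inside the window of the first axis, and then also inside that of the second. So
  it starts beyond the translate of \<open>W\<close> between them, and induction applies to the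
  shorter word.\<close>

lemma NF_foreign:
  assumes "NF n h1" "(h, q) \<in> LL" "h \<notin> N'" "W \<inter> q i = {}" "act n ` W \<subseteq> q (i + 2 * p - 1)"
  shows False
  using assms
proof (induction arbitrary: h q i rule: NF.induct)
  case (NF_last h1 e k w)
  let ?a = "mult_nat k h1"
  let ?U = "act ?a ` W"
  obtain x where x: "(h1, e) \<in> LL" "h1 \<notin> N" "crosses W (e x)" using NF_last(1) by (auto simp: S2_def)
  note b = lines[OF x(1)] and a = lines[OF NF_last(4)]
  have UZ: "act (?a + w) ` W = ?U" by (simp add: act_image_add N_W[OF NF_last(3)])
  have nar: "narrow W e x" by (rule narrow_W[OF x])
  have narU: "narrow ?U e (x + int k * l)" by (rule narrow_shift[OF b nar])
  have "q (i + t) \<in> range e" if t: "0 \<le> t" "t < p" for t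
  proof (rule line_sandwich[OF b lineD(2)[OF a] W_V _ x(3), of _ "x + int k * l"])
    show d: "W \<inter> q (i + t) = {}" using NF_last(6) line_mono[OF a, of i "i + t"] t by auto
    have UA: "?U \<subseteq> q (i + t)"
      using NF_last(7) line_mono[OF a, of "i + t" "i + 2 * p - 1"] t unfolding UZ by auto
    have l: "x + M \<le> x + int k * l" using l_le_mult[OF NF_last(2)] l_large p_pos by linarith
    have d': "W \<inter> e (x + int k * l) = {}" using nar l unfolding narrow_def by blast
    have cr: "crosses ?U (e (x + int k * l))" using narU by (simp add: narrow_def)
    have "q (i + t) \<subseteq> e (x + int k * l) \<or> e (x + int k * l) \<subseteq> q (i + t)"
      by (rule nest_sub[OF lineD(2)[OF a] lineD(2)[OF b] W_ne W_V d d']) (use UA cr in \<open>auto simp: crosses_def\<close>)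
    then show "e (x + int k * l) \<subseteq> q (i + t)" using UA cr unfolding crosses_def by blast
    show "x \<le> x + int k * l" using l p_pos by simp
  qed
  then have "h1 = h \<or> h1 = - h" by (rule SC_range[OF NF_last(4) x(1)])
  then show False using N'_foreign[OF NF_last(1,5)] by simp
next
  case (NF_step h1 e k n h2)
  let ?a = "mult_nat k h1"
  let ?U = "act ?a ` W"
  let ?Z = "act (?a + n) ` W"
  obtain x where x: "(h1, e) \<in> LL" "h1 \<notin> N" "crosses W (e x)" using NF_step(1) by (auto simp: S2_def)
  obtain e' x' where x': "(h2, e') \<in> LL" "h2 \<notin> N" "crosses W (e' x')"
    using NF_S2[OF NF_step(3)] by (auto simp: S2_def)
  have aN: "?a \<in> N'" by (rule mult_nat_N'[OF S2_N'[OF NF_step(1)]])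
  then have aF: "?a \<in> F" using N'_F by auto
  let ?h2 = "?a + h2 - ?a" and ?e2 = "\<lambda>i. act ?a ` e' i"
  have L2: "(?h2, ?e2) \<in> LL" by (rule LL_conj[OF x'(1) aF])
  note b = lines[OF x(1)] and a = lines[OF NF_step(7)] and b2 = lines[OF L2]
  have Zne: "?Z \<noteq> {}" using W_ne by simp
  have UV: "?U \<subseteq> V" using W_V aF act_V by blast
  have Une: "?U \<noteq> {}" using W_ne by simp
  have nar: "narrow W e x" by (rule narrow_W[OF x])
  have narU: "narrow ?U e (x + int k * l)" by (rule narrow_shift[OF b nar])
  have narU2: "narrow ?U ?e2 x'" using narrow_act narrow_W[OF x'] by blast
  have ne1: "h1 \<noteq> h" "h1 \<noteq> - h" "h \<noteq> h1" "h \<noteq> - h1" using N'_foreign[OF NF_step(1,8)] by auto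
  have "?h2 \<in> N'"
  proof -
    have "h2 \<in> N'" using S2_N' NF_S2[OF NF_step(3)] by blast
    then show ?thesis using N'_add[OF N'_add[OF aN] N'_neg[OF aN]] by simp
  qed
  then have ne2: "?h2 \<noteq> h" "?h2 \<noteq> - h" "h \<noteq> ?h2" "h \<noteq> - ?h2" using NF_step(8) N'_neg by force+
  have NFn: "NF (?a + n) h1" using NF.NF_step[OF NF_step(1-5)] .
  have core1: "?Z \<subseteq> e m" if "x + M + p \<le> m" "m \<le> x + l - M - p" for m
    by (rule NF_core[OF NFn x(1,3) that])
  have core2: "?Z \<subseteq> ?e2 m" if "x' + M + p \<le> m" "m \<le> x' + l - M - p" for m
    using NF_core[OF NF_step(3) x'(1,3) that] unfolding act_image_add by (simp add: act_image_subset_iff)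
  have W1: "W \<inter> e m = {}" if "x + M \<le> m" for m using nar that by (simp add: narrow_def)
  have U2: "?U \<inter> ?e2 m = {}" if "x' + M \<le> m" for m using narU2 that unfolding narrow_def by blast
  have amono: "q j \<subseteq> q i" if "i \<le> j" for i j using line_mono[OF a that] .
  have Zq: "?Z \<subseteq> q j" if "j \<le> i + 2 * p - 1" for j using NF_step(10) amono[OF that] by blast
  have nocross: "?U \<subseteq> q j \<or> ?U \<inter> q j = {}" for j
    using foreign_not_crosses[OF NF_step(7,8) aN, of j] unfolding crosses_def by blast
  let ?m = "x + M + p"
  have c1: "q (i + p - 1) \<subseteq> e m" if "x + M + p \<le> m" "m \<le> x + l - M - p" for m
    by (rule overtake[OF x(1) NF_step(7) ne1(1,2) W_V nar Zne core1[OF that] Zq _ NF_step(9)])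
      (use that p_pos in auto)
  have "\<exists>t. 0 \<le> t \<and> t < p \<and> q i \<subseteq> e (?m + t)"
  proof (rule overtake_first[OF x(1) NF_step(7) ne1(3,4) W_V W_ne Zne _ _ NF_step(9), of _ "i + p - 1"])
    show "?Z \<subseteq> q i" by (rule Zq) (use p_pos in simp)
    fix t assume "0 \<le> t" "t < p"
    then show "W \<inter> e (?m + t) = {} \<and> ?Z \<subseteq> e (?m + t) \<and> q (i + p - 1) \<subseteq> e (?m + t)"
      using W1[of "?m + t"] core1[of "?m + t"] c1[of "?m + t"] l_large p_pos by simp
  qed
  then obtain s where s: "0 \<le> s" "s < p" "q i \<subseteq> e (?m + s)" by blast
  define m where "m = ?m + s"
  have m: "x + M + p \<le> m" "m < x + M + 2 * p" "q i \<subseteq> e m" using s by (simp_all add: m_def)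
  \<comment> \<open>Otherwise \<open>q\<close> is squeezed between \<open>e m\<close> and the part
    of the first axis at \<open>?U\<close>, and overlaps that axis in \<open>p\<close>
    edges.\<close>
  have Up: "?U \<inter> q (i + p - 1) = {}"
  proof (rule ccontr)
    assume "\<not> ?thesis"
    then have U: "?U \<subseteq> q (i + p - 1)" using nocross by blast
    let ?r = "\<lambda>i. V - e (- i)"
    have "V - q (i + t) \<in> range ?r" if t: "0 \<le> t" "t < p" for t
    proof (rule line_sandwich[OF line_rev[OF b] HS_compl[OF lineD(2)[OF a]] UV, of _ "- (x + int k * l)" "- m"])
      show "?U \<inter> (V - q (i + t)) = {}" using U amono[of "i + t" "i + p - 1"] t by auto
      have "crosses ?U (e (x + int k * l))" using narU by (simp add: narrow_def)
      then show "crosses ?U (V - e (- (- (x + int k * l))))" using crosses_compl[OF UV] by (simp only: minus_minus)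
      show "V - e (- (- m)) \<subseteq> V - q (i + t)" using m(3) amono[of i "i + t"] t by auto
      show "- (x + int k * l) \<le> - m" using m l_le_mult[OF NF_step(2)] l_large p_pos by linarith
    qed
    then have "- h1 = h \<or> - h1 = - h" by (rule SC_range_rev[OF NF_step(7) LL_rev[OF x(1)]])
    then show False using ne1 by auto
  qed
  have Up': "?U \<inter> q (i + p) = {}" using Up amono[of "i + p - 1" "i + p"] by auto
  have c2: "q (i + p + p - 1) \<subseteq> ?e2 m" if "x' + M + p \<le> m" "m \<le> x' + l - M - p" for m
    by (rule overtake[OF L2 NF_step(7) ne2(1,2) UV narU2 Zne core2[OF that] Zq _ Up']) (use that p_pos in auto)
  \<comment> \<open>The far part of the second axis lies inside \<open>e m\<close>, away from
    \<open>W\<close>; so \<open>W\<close> can take the same role for the second axis as for the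
    first.\<close>
  have W2: "W \<inter> ?e2 m' = {}" if "x' + M + p \<le> m'" for m'
  proof -
    have "?e2 m' \<subseteq> e m"
      by (rule branch[OF x(1) L2 mult_nat_conj_neq[OF NF_step(4,5)] UV narU narU2 _ that])
        (use m l_le_mult[OF NF_step(2)] l_large p_pos in linarith)
    then show ?thesis using W1[of m] m p_pos by auto
  qed
  let ?m' = "x' + M + p"
  have "\<exists>t. 0 \<le> t \<and> t < p \<and> q i \<subseteq> ?e2 (?m' + t)"
  proof (rule overtake_first[OF L2 NF_step(7) ne2(3,4) W_V W_ne Zne _ _ NF_step(9), of _ "i + p + p - 1"])
    show "?Z \<subseteq> q i" by (rule Zq) (use p_pos in simp)
    fix t assume "0 \<le> t" "t < p"
    then show "W \<inter> ?e2 (?m' + t) = {} \<and> ?Z \<subseteq> ?e2 (?m' + t) \<and> q (i + p + p - 1) \<subseteq> ?e2 (?m' + t)"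
      using W2[of "?m' + t"] core2[of "?m' + t"] c2[of "?m' + t"] l_large p_pos by simp
  qed
  then obtain s' where s': "0 \<le> s'" "s' < p" "q i \<subseteq> ?e2 (?m' + s')" by blast
  define m' where "m' = ?m' + s'"
  have m': "x' + M \<le> m'" "q i \<subseteq> ?e2 m'" using s' p_pos by (simp_all add: m'_def)
  have Ui: "?U \<inter> q i = {}" using U2[OF m'(1)] m'(2) by blast
  have naF: "- ?a \<in> F" using aF by (rule F_neg)
  \<comment> \<open>Translating back by the first syllable leaves the shorter word \<open>n\<close>
    with a conjugate of the foreign axis.\<close>
  show False
  proof (rule NF_step.IH[OF LL_conj[OF NF_step(7) naF]])
    show "- ?a + h - - ?a \<notin> N'"
      by (rule N'_conj[OF aN NF_step(8)])
    have "act (- ?a) ` (?U \<inter> q i) = {}" using Ui by simp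
    then show "W \<inter> act (- ?a) ` q i = {}" by (simp add: act_image_Int)
    have "act (- ?a) ` ?Z \<subseteq> act (- ?a) ` q (i + 2 * p - 1)" using NF_step(10) by (simp add: act_image_subset_iff)
    then show "act n ` W \<subseteq> act (- ?a) ` q (i + 2 * p - 1)" by (simp add: act_image_add)
  qed
qed


lemma NF_greendlinger:
  assumes "NF n h" "v \<in> W"
  shows "\<exists>\<sigma> e i. (\<sigma>, e) \<in> LL \<and> (\<forall>t. 0 \<le> t --> t < l - 6 * p - 1 --> v \<notin> e (i + t) \<and> act n v \<in> e (i + t))"
proof -
  obtain e x where b: "(h, e) \<in> LL" "h \<notin> N" "crosses W (e x)"
    using NF_S2[OF assms(1)] by (auto simp: S2_def)
  have "v \<notin> e (x + M + p + t) \<and> act n v \<in> e (x + M + p + t)" if "0 \<le> t" "t < l - 6 * p - 1" for t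
  proof
    have "W \<inter> e (x + M + p + t) = {}" using narrow_W[OF b] that p_pos by (simp add: narrow_def)
    then show "v \<notin> e (x + M + p + t)" using assms(2) by blast
    have "act n ` W \<subseteq> e (x + M + p + t)"
      by (rule NF_core[OF assms(1) b(1,3)]) (use that in simp_all)
    then show "act n v \<in> e (x + M + p + t)" using assms(2) by blast
  qed
  then show ?thesis using b(1) by blast
qed

text \<open>The neighbourhood of radius 1 makes the stages exhaust the tree.\<close>

definition W' :: "'v set"
  where "W' = {v \<in> V. \<exists>n\<in>N'. \<exists>u\<in>W. card (sep v (act n u)) \<le> 1}"

lemma act_n_V: "n \<in> N' ==> u \<in> W ==> act n u \<in> V"
  using N'_F W_V act_V by blast

lemma two_sep:
  assumes "line l h q" "u \<in> V" "v \<in> V" "u \<in> q (i + 1)" "v \<notin> q i"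
  shows "\<not> card (sep u v) \<le> 1"
proof -
  have mono: "q (i + 1) \<subset> q i" by (rule lineD(3)[OF assms(1)])
  then have "{q i, q (i + 1)} \<subseteq> sep u v" using assms lineD(2)[OF assms(1)] unfolding sep_def by blast
  then have "card {q i, q (i + 1)} \<le> card (sep u v)" by (intro card_mono finite_sep assms)
  moreover have "card {q i, q (i + 1)} = 2" using mono by (auto simp: card_2_iff)
  ultimately show ?thesis by simp
qed

text \<open>Going from \<open>W'\<close> to the orbit of \<open>W\<close> costs one half-space at
  each end, and \<open>NF_foreign\<close> leaves room for at most \<open>2 * p - 1\<close> between
  two translates. This is the origin of \<open>M = 2 * p + 1\<close>.\<close>

lemma W'_inv:
  assumes LL: "(h, q) \<in> LL" and h: "h \<notin> N'"
  shows "W' \<subseteq> q i \<or> W' \<inter> q (i + M) = {}"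
proof (rule ccontr)
  assume "\<not> ?thesis"
  then obtain v v' where v: "v \<in> W'" "v \<notin> q i" "v' \<in> W'" "v' \<in> q (i + M)" by blast
  note a = lines[OF LL]
  obtain n u where n: "n \<in> N'" "u \<in> W" "card (sep v (act n u)) \<le> 1" "v \<in> V" using v(1) by (auto simp: W'_def)
  obtain n' u' where n': "n' \<in> N'" "u' \<in> W" "card (sep v' (act n' u')) \<le> 1" "v' \<in> V" using v(3) by (auto simp: W'_def)
  have "act n u \<notin> q (i + 1)"
    using two_sep[OF a act_n_V[OF n(1,2)] n(4) _ v(2)] n(3) card_sep_commute[OF n(4) act_n_V[OF n(1,2)]] by auto
  then have 1: "act n ` W \<inter> q (i + 1) = {}"
    using foreign_not_crosses[OF LL h n(1), of "i + 1"] n(2) unfolding crosses_def by blast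
  have "v' \<in> q (i + 2 * p + 1)" using v(4) by (simp add: add.assoc)
  then have "act n' u' \<in> q (i + 2 * p)"
    using two_sep[OF a n'(4) act_n_V[OF n'(1,2)], of "i + 2 * p"] n'(3) by auto
  then have 2: "act n' ` W \<subseteq> q (i + 2 * p)"
    using foreign_not_crosses[OF LL h n'(1), of "i + 2 * p"] n'(2) unfolding crosses_def by blast
  let ?n = "- n + n'"
  have nN: "?n \<in> N'" by (intro N'_add N'_neg n n')
  have nF: "- n \<in> F" using N'_neg[OF n(1)] N'_F by auto
  have "- n + h - - n \<notin> N'" by (rule N'_conj[OF n(1) h])
  moreover have 3: "W \<inter> act (- n) ` q (i + 1) = {}"
  proof -
    have "act (- n) ` (act n ` W \<inter> q (i + 1)) = {}" using 1 by simp
    then show ?thesis by (simp add: act_image_Int)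
  qed
  moreover have 4: "act ?n ` W \<subseteq> act (- n) ` q ((i + 1) + 2 * p - 1)"
    using 2 by (simp add: act_image_add act_image_subset_iff)
  ultimately have "\<not> NF ?n h1" for h1
    using NF_foreign[OF _ LL_conj[OF LL nF]] by blast
  \<comment> \<open>An element of \<open>N'\<close> that is no reduced word fixes \<open>W\<close>,
    which would then be both inside and outside the half-spaces of the axis.\<close>
  then have "?n \<in> N" using NF_exists[OF nN] by blast
  then have "W \<subseteq> act (- n) ` q ((i + 1) + 2 * p - 1)" using 4 N_W by simp
  moreover have "q ((i + 1) + 2 * p - 1) \<subseteq> q (i + 1)" using p_pos by (intro line_mono[OF a]) simp
  ultimately show False using 3 W_ne by blast
qed

lemma W_W': "W \<subseteq> W'"
proof
  fix u assume u: "u \<in> W"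
  have "sep u (act 0 u) = {}" by (auto simp: sep_def act_0)
  then have "card (sep u (act 0 u)) \<le> 1" by simp
  moreover have "0 \<in> N'" using N_0 N_N' by blast
  moreover have "u \<in> V" using u W_V by blast
  ultimately show "u \<in> W'" using u unfolding W'_def by blast
qed

lemma mill_next: "mill F V act HS LL l p W' N'"
proof unfold_locales
  show "W' \<subseteq> V" by (auto simp: W'_def)
  show "W' \<noteq> {}" using W_W' W_ne by blast
  show "N' \<subseteq> F" by (rule N'_F)
  show "0 \<in> N'" using N_0 N_N' by blast
  show "a + b \<in> N'" if "a \<in> N'" "b \<in> N'" for a b using that by (rule N'_add)
  show "- a \<in> N'" if "a \<in> N'" for a using that by (rule N'_neg)
  have sub: "act n ` W' \<subseteq> W'" if n: "n \<in> N'" for n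
  proof
    fix x assume "x \<in> act n ` W'"
    then obtain v m u where v: "x = act n v" "v \<in> V" "m \<in> N'" "u \<in> W" "card (sep v (act m u)) \<le> 1"
      by (auto simp: W'_def)
    have nF: "n \<in> F" using n N'_F by blast
    have "sep x (act (n + m) u) = (\<lambda>A. act n ` A) ` sep v (act m u)" using nF by (simp add: v(1) act_add sep_act)
    moreover have "card ((\<lambda>A. act n ` A) ` sep v (act m u)) \<le> card (sep v (act m u))"
      by (intro card_image_le finite_sep v(2) act_n_V v)
    ultimately have "card (sep x (act (n + m) u)) \<le> 1" using v(5) by simp
    then show "x \<in> W'" using N'_add[OF n v(3)] v(1,2,4) act_V[OF nF] unfolding W'_def by blast
  qed
  show "act n ` W' = W'" if n: "n \<in> N'" for n
  proof
    show "act n ` W' \<subseteq> W'" by (rule sub[OF n])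
    have "act n ` act (- n) ` W' \<subseteq> act n ` W'" using sub[OF N'_neg[OF n]] by blast
    then show "W' \<subseteq> act n ` W'" by simp
  qed
  show "W' \<subseteq> e i \<or> W' \<inter> e (i + M) = {}" if "(h, e) \<in> LL" "h \<notin> N'" for h e i
    using that by (rule W'_inv)
qed

lemma mill_step:
  "\<exists>W1 N1. mill F V act HS LL l p W1 N1 \<and> N \<subseteq> N1 \<and> W \<subseteq> W1 \<and>
     (\<forall>v u. v \<in> V --> u \<in> W --> card (sep v u) \<le> 1 --> v \<in> W1) \<and>
     (\<forall>h e i. (h, e) \<in> LL --> crosses W (e i) --> h \<in> N1) \<and>
     (\<forall>n v. n \<in> N1 --> n \<notin> N --> v \<in> W --> (\<exists>\<sigma> e i. (\<sigma>, e) \<in> LL \<and>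
        (\<forall>t. 0 \<le> t --> t < l - 6 * p - 1 --> v \<notin> e (i + t) \<and> act n v \<in> e (i + t))))"
proof (rule exI[of _ W'], rule exI[of _ N'], intro conjI allI impI)
  show "mill F V act HS LL l p W' N'" by (rule mill_next)
  show "N \<subseteq> N'" by (rule N_N')
  show "W \<subseteq> W'" by (rule W_W')
  show "v \<in> W'" if "v \<in> V" "u \<in> W" "card (sep v u) \<le> 1" for v u
  proof -
    have "0 \<in> N'" using N_0 N_N' by blast
    moreover have "card (sep v (act 0 u)) \<le> 1" using that by (simp add: act_0)
    ultimately show ?thesis using that(1,2) unfolding W'_def by blast
  qed
  show "h \<in> N'" if "(h, e) \<in> LL" "crosses W (e i)" for h e i
  proof (cases "h \<in> N")
    case False
    then have "(h, e) \<in> S2" using that unfolding S2_def by blast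
    then show ?thesis by (rule S2_N')
  qed (use N_N' in blast)
  show "\<exists>\<sigma> e i. (\<sigma>, e) \<in> LL \<and> (\<forall>t. 0 \<le> t --> t < l - 6 * p - 1 --> v \<notin> e (i + t) \<and> act n v \<in> e (i + t))"
    if n: "n \<in> N'" "n \<notin> N" "v \<in> W" for n v
  proof -
    obtain h where "NF n h" using NF_exists[OF n(1)] n(2) by blast
    then show ?thesis using n(3) by (rule NF_greendlinger)
  qed
qed

end

section \<open>The Greendlinger lemma for the normal closure\<close>

context windmill
begin

definition NN :: "'g set"
  where "NN = gen {h. \<exists>e. (h, e) \<in> LL}"

lemma mill_start:
  assumes "v \<in> V" shows "mill F V act HS LL l p {v} {0}"
proof unfold_locales
  show "{v} \<subseteq> e i \<or> {v} \<inter> e (i + M) = {}" if "(h, e) \<in> LL" for h e i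
  proof -
    have "e (i + M) \<subseteq> e i" using p_pos by (intro line_mono[OF lines[OF that]]) simp
    then show ?thesis by blast
  qed
qed (use assms F_0 in \<open>auto simp: act_0\<close>)

text \<open>Windmills started at \<open>{v}\<close> exhaust the tree, so each translation is
  absorbed at some stage. A nonzero \<open>n\<close> enters at a successor stage, and its reduced
  word there supplies the long overlap with an axis.\<close>

theorem greendlinger:
  assumes "n \<in> NN" "n \<noteq> 0" "v \<in> V"
  shows "\<exists>\<sigma> e i. (\<sigma>, e) \<in> LL \<and> (\<forall>t. 0 \<le> t --> t < l - 6 * p - 1 --> v \<notin> e (i + t) \<and> act n v \<in> e (i + t))"
proof -
  let ?P = "\<lambda>(W, N). mill F V act HS LL l p W N"
  let ?Q = "\<lambda>(W, N) (W1, N1). N \<subseteq> N1 \<and> W \<subseteq> W1 \<and>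
     (\<forall>v u. v \<in> V --> u \<in> W --> card (sep v u) \<le> 1 --> v \<in> W1) \<and>
     (\<forall>h e i. (h, e) \<in> LL --> crosses W (e i) --> h \<in> N1) \<and>
     (\<forall>n v. n \<in> N1 --> n \<notin> N --> v \<in> W --> (\<exists>\<sigma> e i. (\<sigma>, e) \<in> LL \<and>
        (\<forall>t. 0 \<le> t --> t < l - 6 * p - 1 --> v \<notin> e (i + t) \<and> act n v \<in> e (i + t))))"
  have "\<exists>f. \<forall>k::nat. (?P (f k) \<and> (k = 0 --> f k = ({v}, {0}))) \<and> ?Q (f k) (f (Suc k))"
  proof (rule dependent_nat_choice)
    show "\<exists>x. ?P x \<and> ((0::nat) = 0 --> x = ({v}, {0}))" using mill_start[OF assms(3)] by auto
    show "\<exists>y. (?P y \<and> (Suc k = 0 --> y = ({v}, {0}))) \<and> ?Q x y" if "?P x \<and> (k = 0 --> x = ({v}, {0}))" for x k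
    proof -
      have "mill F V act HS LL l p (fst x) (snd x)" using that by (simp add: case_prod_beta)
      from mill.mill_step[OF this] obtain W1 N1 where "?P (W1, N1) \<and> ?Q x (W1, N1)"
        unfolding case_prod_beta fst_conv snd_conv by (elim exE)
      then show ?thesis by (intro exI[of _ "(W1, N1)"]) simp
    qed
  qed
  then obtain f where f0: "\<forall>k::nat. (?P (f k) \<and> (k = 0 --> f k = ({v}, {0}))) \<and> ?Q (f k) (f (Suc k))" by (elim exE)
  then have f: "\<And>k. ?P (f k)" "f 0 = ({v}, {0})" "\<And>k. ?Q (f k) (f (Suc k))" by simp_all
  define W N where "W k = fst (f k)" and "N k = snd (f k)" for k
  have mill: "mill F V act HS LL l p (W k) (N k)" for k using f(1)[of k] by (simp add: W_def N_def case_prod_beta)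
  have 0: "W 0 = {v}" "N 0 = {0}" using f(2) by (simp_all add: W_def N_def)
  have Q: "N k \<subseteq> N (Suc k) \<and> W k \<subseteq> W (Suc k) \<and>
     (\<forall>v u. v \<in> V --> u \<in> W k --> card (sep v u) \<le> 1 --> v \<in> W (Suc k)) \<and>
     (\<forall>h e i. (h, e) \<in> LL --> crosses (W k) (e i) --> h \<in> N (Suc k)) \<and>
     (\<forall>n v. n \<in> N (Suc k) --> n \<notin> N k --> v \<in> W k --> (\<exists>\<sigma> e i. (\<sigma>, e) \<in> LL \<and>
        (\<forall>t. 0 \<le> t --> t < l - 6 * p - 1 --> v \<notin> e (i + t) \<and> act n v \<in> e (i + t))))" for k
    using f(3)[of k] unfolding W_def N_def case_prod_beta .
  note st = Q[THEN conjunct1] Q[THEN conjunct2, THEN conjunct1]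
    Q[THEN conjunct2, THEN conjunct2, THEN conjunct1, rule_format]
    Q[THEN conjunct2, THEN conjunct2, THEN conjunct2, THEN conjunct1, rule_format]
    Q[THEN conjunct2, THEN conjunct2, THEN conjunct2, THEN conjunct2, THEN spec, THEN spec, THEN mp, THEN mp, THEN mp]
  have Nmono: "N i \<subseteq> N j" if "i \<le> j" for i j using that st(1) by (rule lift_Suc_mono_le[rotated])
  have Wmono: "W i \<subseteq> W j" if "i \<le> j" for i j using that st(2) by (rule lift_Suc_mono_le[rotated])
  have cover: "\<exists>k. u \<in> W k" if "u \<in> V" for u
    using connected[OF assms(3) that]
  proof (induction rule: rtrancl_induct)
    case base
    then show ?case using 0 by auto
  next
    case (step y z)
    then obtain k where "y \<in> W k" by blast
    moreover have "card (sep z y) \<le> 1" using step(2) card_sep_commute[of y z] by (auto simp: sep_def)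
    ultimately show ?case using st(3)[of z y k] step(2) by blast
  qed
  have gens: "\<exists>k. h \<in> N k" if h: "(h, e) \<in> LL" for h e
  proof -
    note b = lines[OF h]
    obtain u where u: "u \<in> e 0" using HS_ne[OF lineD(2)[OF b, of 0]] by blast
    obtain u' where u': "u' \<in> e (0 - 1)" "u' \<notin> e 0" using lineD(3)[OF b, of "0 - 1"] by auto
    have "u \<in> V" "u' \<in> V" using HS_sub[OF lineD(2)[OF b]] u u'(1) by blast+
    then obtain i j where "u \<in> W i" "u' \<in> W j" using cover by blast
    then have "u \<in> W (max i j)" "u' \<in> W (max i j)" using Wmono[of i "max i j"] Wmono[of j "max i j"] by auto
    then have "crosses (W (max i j)) (e 0)" using u u' by (auto simp: crosses_def)
    then show ?thesis using st(4)[OF h] by blast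
  qed
  have "NN \<subseteq> (\<Union>k. N k)"
    unfolding NN_def
  proof (rule gen_least)
    show "0 \<in> (\<Union>k. N k)" using 0 by blast
    fix a b assume "a \<in> (\<Union>k. N k)" "b \<in> (\<Union>k. N k)"
    then obtain i j where "a \<in> N i" "b \<in> N j" by blast
    then have "a \<in> N (max i j)" "b \<in> N (max i j)" using Nmono[of i "max i j"] Nmono[of j "max i j"] by auto
    then show "a + b \<in> (\<Union>k. N k)" using mill.N_add[OF mill] by blast
  qed (use gens in blast)
  then obtain k where "n \<in> N k" using assms(1) by blast
  then have "\<exists>k. n \<in> N k \<and> (\<forall>j<k. n \<notin> N j)" by (rule exists_least_iff[THEN iffD1, OF exI])
  then obtain k where k: "n \<in> N k" "\<forall>j<k. n \<notin> N j" by blast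
  have "k \<noteq> 0" using k(1) 0 assms(2) by auto
  then obtain j where j: "k = Suc j" by (cases k) auto
  have "v \<in> W j" using 0 Wmono[of 0 j] by auto
  then show ?thesis using st(5)[of n j v] k j by simp
qed

end

section \<open>Shortening along an axis and elements with a fixed vertex\<close>

context tree_action
begin

lemma same_side:
  assumes "u \<in> V" "v \<in> V" "sep u v = {}" "A \<in> HS" shows "u \<in> A \<longleftrightarrow> v \<in> A"
proof -
  have "u \<in> A ==> v \<in> A" if "A \<in> HS" for A using assms(3) that unfolding sep_def by blast
  from this[OF assms(4)] this[OF HS_compl[OF assms(4)]] show ?thesis using assms(1,2) by blast
qed

lemma line_no_between:
  assumes "line l h e" "A \<in> HS" "e (i + 1) \<subset> A" "A \<subset> e i" shows False
proof -
  obtain j where j: "A = e j" using line_convex[OF assms(1,2), of "i + 1" i] assms(3,4) by blast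
  have "i < j" using line_subset_iff[OF assms(1), of i j] assms(4) unfolding j by auto
  then show False using line_mono[OF assms(1), of "i + 1" j] assms(3) unfolding j by auto
qed

lemma card_sep_triangle:
  assumes "u \<in> V" "v \<in> V" "w \<in> V" shows "card (sep u w) \<le> card (sep u v) + card (sep v w)"
proof -
  have "card (sep u w) \<le> card (sep u v \<union> sep v w)"
    using assms by (intro card_mono sep_trans finite_UnI finite_sep)
  then show ?thesis using card_Un_le[of "sep u v" "sep v w"] by simp
qed

lemma card_sep_line:
  assumes "\<And>i. z i \<in> V" "\<And>i. sep (z i) (z (i - 1)) = {e i}"
  shows "int (card (sep (z i) (z j))) \<le> \<bar>i - j\<bar>"
proof -
  have le: "int (card (sep (z i) (z j))) \<le> i - j" if "j \<le> i" for i j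
    using that
  proof (induction i rule: int_ge_induct)
    case base
    then show ?case by (simp add: sep_def)
  next
    case (step i)
    have "card (sep (z (i + 1)) (z j)) \<le> card (sep (z (i + 1)) (z i)) + card (sep (z i) (z j))"
      by (intro card_sep_triangle assms)
    also have "card (sep (z (i + 1)) (z i)) = 1" using assms(2)[of "i + 1"] by simp
    finally show ?case using step by simp
  qed
  show ?thesis
  proof (cases "j \<le> i")
    case False
    then show ?thesis using le[of i j] card_sep_commute[OF assms(1) assms(1), of i j] by simp
  qed (use le in simp)
qed

text \<open>The step of Dehn's algorithm. The path between \<open>w\<close> and \<open>v\<close>
  follows the axis from \<open>z i\<close> to \<open>z (i + a)\<close>; as \<open>h\<close> moves
  \<open>z i\<close> to \<open>z (i + l)\<close>, these \<open>a\<close> edges are replaced by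
  \<open>\<bar>l - a\<bar>\<close>, which is less.\<close>

lemma line_shortens:
  assumes b: "line l h e" and vw: "v \<in> V" "w \<in> V" "v \<in> e (i + a)" "w \<notin> e (i + 1)" and a: "l < 2 * a" "0 < l"
  shows "card (sep v (act h w)) < card (sep v w)"
proof -
  obtain z where z: "\<And>i. z i \<in> V" "\<And>i. sep (z i) (z (i - 1)) = {e i}" "\<And>i. act h (z i) = z (i + l)"
    by (rule lineE[OF b]) blast
  have zin: "z i \<in> e i" "z (i - 1) \<notin> e i" for i using z(2)[of i] by (auto simp: sep_def)
  have H: "e i \<in> HS" for i by (rule lineD(2)[OF b])
  \<comment> \<open>Edges between \<open>v\<close> and the axis lie strictly inside
    \<open>e (i + a)\<close>, and those between the axis and \<open>w\<close> strictly contain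
    \<open>e (i + 1)\<close>. So the three stretches of the path are counted without
    overlap.\<close>
  have A: "X \<in> HS \<and> v \<in> X \<and> X \<subset> e (i + a)" if X: "X \<in> sep v (z (i + a))" for X
  proof -
    have X': "X \<in> HS" "v \<in> X" "z (i + a) \<notin> X" using X by (auto simp: sep_def)
    have "X \<union> e (i + a) \<noteq> V"
    proof
      assume u: "X \<union> e (i + a) = V"
      then have "V - X \<in> sep (z (i + a)) (z (i + a - 1))"
        using X' zin(2)[of "i + a"] z(1) HS_compl unfolding sep_def by blast
      then have "V - X = e (i + a)" using z(2) by auto
      then show False using X'(2) vw(3) by blast
    qed
    then show ?thesis using nested[OF X'(1) H[of "i + a"]] X' vw(3) zin(1)[of "i + a"] by blast
  qed
  have C: "Y \<in> HS \<and> w \<notin> Y \<and> e (i + 1) \<subset> Y" if Y: "Y \<in> sep (z i) w" for Y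
  proof -
    have Y': "Y \<in> HS" "z i \<in> Y" "w \<notin> Y" using Y by (auto simp: sep_def)
    have zi: "z i \<notin> e (i + 1)" using zin(2)[of "i + 1"] by simp
    have "Y \<inter> e (i + 1) \<noteq> {}"
    proof
      assume d: "Y \<inter> e (i + 1) = {}"
      then have "Y \<in> sep (z i) (z (i + 1))" using Y' zin(1)[of "i + 1"] unfolding sep_def by blast
      then have "Y = V - e (i + 1)" using z(2)[of "i + 1"] sep_commute[of "z (i + 1)" "z i"] z(1) by auto
      then show False using Y'(3) vw(2,4) by blast
    qed
    then show ?thesis using nested[OF Y'(1) H[of "i + 1"]] Y' vw(2,4) zi by blast
  qed
  let ?B = "e ` {i + 1..i + a}"
  have sub: "e (i + a) \<subseteq> e j" "e j \<subseteq> e (i + 1)" if "j \<in> {i + 1..i + a}" for j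
    using that by (auto intro!: line_mono[OF b])
  have a0: "i + 1 \<in> {i + 1..i + a}" using a by simp
  have "sep v (z (i + a)) \<union> ?B \<union> sep (z i) w \<subseteq> sep v w"
  proof (intro Un_least subsetI)
    fix X assume "X \<in> sep v (z (i + a))"
    then show "X \<in> sep v w" using A[of X] sub(1)[OF a0] vw(4) unfolding sep_def by blast
  next
    fix X assume "X \<in> ?B"
    then show "X \<in> sep v w" using H sub vw unfolding sep_def by blast
  next
    fix X assume "X \<in> sep (z i) w"
    then show "X \<in> sep v w" using C[of X] sub(1)[OF a0] vw(3) unfolding sep_def by blast
  qed
  then have "card (sep v (z (i + a)) \<union> ?B \<union> sep (z i) w) \<le> card (sep v w)"
    using vw by (intro card_mono finite_sep)
  also have "card (sep v (z (i + a)) \<union> ?B \<union> sep (z i) w) = card (sep v (z (i + a)) \<union> ?B) + card (sep (z i) w)"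
  proof (intro card_Un_disjoint finite_UnI finite_imageI finite_sep z vw)
    show "(sep v (z (i + a)) \<union> ?B) \<inter> sep (z i) w = {}"
    proof (rule ccontr)
      assume "\<not> ?thesis"
      then obtain X where X: "X \<in> sep (z i) w" "X \<in> sep v (z (i + a)) \<or> X \<in> ?B" by blast
      then have "X \<subseteq> e (i + 1)" using A[of X] sub(1)[OF a0] sub(2) by blast
      then show False using C[OF X(1)] by blast
    qed
  qed simp
  also have "card (sep v (z (i + a)) \<union> ?B) = card (sep v (z (i + a))) + card ?B"
  proof (intro card_Un_disjoint finite_imageI finite_sep z vw)
    show "sep v (z (i + a)) \<inter> ?B = {}" using A sub(1) by blast
  qed simp
  also have "card ?B = nat a"
    using line_inj[OF b] by (subst card_image) (auto intro!: inj_onI)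
  finally have 1: "int (card (sep v (z (i + a)))) + a + int (card (sep (z i) w)) \<le> int (card (sep v w))" using a by simp
  have h: "h \<in> F" by (rule lineD(1)[OF b])
  have "card (sep v (act h w)) \<le> card (sep v (z (i + a))) + card (sep (z (i + a)) (act h w))"
    by (intro card_sep_triangle vw z act_V h)
  also have "card (sep (z (i + a)) (act h w)) \<le> card (sep (z (i + a)) (z (i + l))) + card (sep (z (i + l)) (act h w))"
    by (intro card_sep_triangle vw z act_V h)
  also have "sep (z (i + l)) (act h w) = (\<lambda>A. act h ` A) ` sep (z i) w"
    by (simp add: sep_act[OF h] flip: z(3))
  also have "card ((\<lambda>A. act h ` A) ` sep (z i) w) \<le> card (sep (z i) w)"
    by (intro card_image_le finite_sep z vw)
  finally have 2: "card (sep v (act h w)) \<le> card (sep v (z (i + a))) + (card (sep (z (i + a)) (z (i + l))) + card (sep (z i) w))"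
    by simp
  have "int (card (sep (z (i + a)) (z (i + l)))) \<le> \<bar>i + a - (i + l)\<bar>"
    by (rule card_sep_line[where z = z and e = e, OF z(1) z(2)])
  also have "\<dots> < a" using a by simp
  finally show ?thesis using 1 2 by linarith
qed

end

context windmill
begin

lemma LL_NN: "(h, e) \<in> LL ==> h \<in> NN"
  unfolding NN_def by (rule gen_base) blast

text \<open>As far as half-spaces can tell, \<open>k\<close> fixes \<open>v\<close> and
  \<open>n w\<close> equals \<open>k w\<close>, so \<open>k\<close> maps the path from
  \<open>v\<close> to \<open>w\<close> to the path from \<open>v\<close> to \<open>n w\<close>. If
  \<open>n\<close> were nonzero, the path from \<open>w\<close> to \<open>n w\<close> would follow
  an axis for almost a period, while minimality allows at most half a period on each leg. The axis
  then turns the corner with \<open>p\<close> edges on both legs, and \<open>k\<close> identifies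
  them: the axis overlaps a reversed translate of itself.\<close>

lemma no_fixed_displacement:
  assumes vw: "v \<in> V" "w \<in> V" and k: "k \<in> F" "sep v (act k v) = {}" and n: "n \<in> NN" "sep (act n w) (act k w) = {}"
    and nF: "n \<in> F" and min: "\<And>m. m \<in> NN ==> card (sep v w) \<le> card (sep v (act m w))"
  shows "n = 0"
proof (rule ccontr)
  assume "n \<noteq> 0"
  then obtain \<sigma> e i where LL: "(\<sigma>, e) \<in> LL"
    and sepn: "\<And>t. 0 \<le> t ==> t < l - 6 * p - 1 ==> w \<notin> e (i + t) \<and> act n w \<in> e (i + t)"
    using greendlinger[OF n(1) _ vw(2)] by blast
  note b = lines[OF LL]
  have H: "e j \<in> HS" for j by (rule lineD(2)[OF b])
  let ?c = "l - 6 * p - 1"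
  have kF: "- k \<in> F" using k(1) by (rule F_neg)
  have sk: "act k w \<in> A \<longleftrightarrow> act n w \<in> A" if "A \<in> HS" for A
    using same_side[OF _ _ n(2) that] act_V vw k(1) nF by blast
  have sv: "act k v \<in> A \<longleftrightarrow> v \<in> A" if "A \<in> HS" for A
    using same_side[OF vw(1) _ k(2) that] act_V vw k(1) by blast
  have w: "w \<notin> e (i + t)" "act k w \<in> e (i + t)" if "0 \<le> t" "t < ?c" for t
    using sepn[OF that] sk[OF H] by auto
  \<comment> \<open>\<open>a = Max T\<close> counts the half-spaces of the overlap that contain
    \<open>v\<close>. The tripod on \<open>v\<close>, \<open>w\<close>, \<open>k w\<close> branches
    between the edges \<open>i + a - 1\<close> and \<open>i + a\<close>.\<close>
  define T where "T = {t \<in> {0..?c}. t = 0 \<or> v \<in> e (i + t - 1)}"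
  have "finite T" unfolding T_def by (rule finite_subset[of _ "{0..?c}"]) auto
  moreover have "0 \<in> T" using p_pos l_large unfolding T_def by simp
  ultimately have T: "finite T" "0 \<in> T" by auto
  define a where "a = Max T"
  have aT: "a \<in> T" unfolding a_def using T by (intro Max_in) auto
  have a: "0 \<le> a" "a \<le> ?c" using aT by (auto simp: T_def)
  have va: "v \<in> e (i + t)" if "0 \<le> t" "t < a" for t
  proof -
    have "v \<in> e (i + a - 1)" using aT that by (auto simp: T_def)
    then show ?thesis using line_mono[OF b, of "i + t" "i + a - 1"] that by auto
  qed
  have vb: "v \<notin> e (i + t)" if "a \<le> t" "t < ?c" for t
  proof
    assume "v \<in> e (i + t)"
    then have "t + 1 \<in> T" using that a by (simp add: T_def)
    then have "t + 1 \<le> a" unfolding a_def using T by (intro Max_ge)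
    then show False using that by simp
  qed
  have a2: "2 * a \<le> l"
  proof (rule ccontr)
    assume c: "\<not> 2 * a \<le> l"
    have "card (sep v (act \<sigma> w)) < card (sep v w)"
    proof (rule line_shortens[OF b vw, of "i - 1" a])
      show "v \<in> e (i - 1 + a)" using va[of "a - 1"] c p_pos l_large by (simp add: algebra_simps)
      show "w \<notin> e (i - 1 + 1)" using w(1)[of 0] p_pos l_large by simp
    qed (use c p_pos l_large in auto)
    then show False using min[OF LL_NN[OF LL]] by simp
  qed
  let ?g = "\<lambda>j. act (- k) ` e j"
  have LLk: "(- k + \<sigma> - - k, ?g) \<in> LL" by (rule LL_conj[OF LL kF])
  note g = lines[OF LLk]
  have gH: "?g j \<in> HS" for j by (rule lineD(2)[OF g])
  have vg: "v \<in> ?g j \<longleftrightarrow> v \<in> e j" for j using sv[OF H] by (simp add: mem_act_image)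
  have wg: "w \<in> ?g j \<longleftrightarrow> act k w \<in> e j" for j by (simp add: mem_act_image)
  have b2: "2 * (?c - a) \<le> l"
  proof (rule ccontr)
    assume c: "\<not> 2 * (?c - a) \<le> l"
    have "card (sep v (act (- (- k + \<sigma> - - k)) w)) < card (sep v w)"
    proof (rule line_shortens[OF line_rev[OF g] vw, of "- (i + ?c)" "?c - a"])
      have "v \<notin> ?g (i + a)" using vb[of a] c p_pos l_large unfolding vg by simp
      then show "v \<in> V - ?g (- (- (i + ?c) + (?c - a)))" using vw(1) by (simp add: algebra_simps)
      have "w \<in> ?g (i + (?c - 1))" using w(2)[of "?c - 1"] p_pos l_large unfolding wg by simp
      then show "w \<notin> V - ?g (- (- (i + ?c) + 1))" by (simp add: algebra_simps)
    qed (use c p_pos l_large in auto)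
    then show False using min[OF LL_NN[OF LL_rev[OF LLk]]] by simp
  qed
  have pa: "p \<le> a" "p \<le> ?c - a" using a2 b2 l_large p_pos by auto
  \<comment> \<open>Both families separate \<open>w\<close> from \<open>v\<close> and start at the
    corner: \<open>X\<close> runs along the leg to \<open>w\<close>, and \<open>Y\<close> is the
    other leg brought over by \<open>- k\<close>.\<close>
  define X where "X t = V - e (i + a - 1 - t)" for t
  define Y where "Y t = ?g (i + a + t)" for t
  have XH: "X t \<in> HS" and YH: "Y t \<in> HS" for t unfolding X_def Y_def by (rule HS_compl[OF H], rule gH)
  have X: "w \<in> X t" "v \<notin> X t" "act k w \<notin> X t" if "0 \<le> t" "t < p" for t
    using va[of "a - 1 - t"] w[of "a - 1 - t"] that pa vw unfolding X_def by (auto simp: algebra_simps)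
  have Y: "w \<in> Y t" "v \<notin> Y t" if "0 \<le> t" "t < p" for t
    using vb[of "a + t"] w[of "a + t"] that pa unfolding Y_def wg vg by (auto simp: algebra_simps)
  have comp: "A \<subseteq> B \<or> B \<subseteq> A" if "A \<in> HS" "B \<in> HS" "w \<in> A" "w \<in> B" "v \<notin> A" "v \<notin> B" for A B
    using nest_sub[OF that(1,2), of "{v}"] that vw by blast
  let ?S1 = "{A \<in> HS. w \<in> A \<and> act k w \<in> A \<and> v \<notin> A}"
  have p0: "(0::int) \<le> 0" "0 < p" using p_pos by auto
  have bb: "e (i + a) \<subset> e (i + a - 1)" using lineD(3)[OF b, of "i + a - 1"] by simp
  have ba: "v \<notin> e (i + a)" "w \<notin> e (i + a)" "act k w \<in> e (i + a)" "v \<in> e (i + a - 1)" "w \<notin> e (i + a - 1)" "act k w \<in> e (i + a - 1)"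
    using vb[of a] w[of a] va[of "a - 1"] w[of "a - 1"] pa p_pos by (auto simp: algebra_simps)
  have kwV: "act k w \<in> V" by (rule act_V[OF k(1) vw(2)])
  \<comment> \<open>The number of half-spaces above \<open>X 0\<close> is the distance from
    \<open>v\<close> to the corner. These are the half-spaces keeping \<open>w\<close> and
    \<open>k w\<close> together away from \<open>v\<close>; \<open>- k\<close> carries them to those
    above \<open>Y 0\<close>.\<close>
  have r1: "{A \<in> sep w v. X 0 \<subset> A} = ?S1"
  proof (rule Set.set_eqI)
    fix A
    have "X 0 \<subset> A \<longleftrightarrow> act k w \<in> A" if A: "A \<in> HS" "w \<in> A" "v \<notin> A"
    proof
      assume kw: "act k w \<in> A"
      then show "X 0 \<subset> A" using comp[OF XH A(1) X(1)[OF p0] A(2) X(2)[OF p0] A(3)] X(3)[OF p0] by blast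
    next
      assume XA: "X 0 \<subset> A"
      show "act k w \<in> A"
      proof (rule ccontr)
        assume kw: "act k w \<notin> A"
        have "A \<inter> e (i + a) = {}" using nested[OF A(1) H[of "i + a"]] ba kw A(2,3) vw(1) by blast
        then have "e (i + a) \<subseteq> V - A" using HS_sub[OF H] by blast
        moreover have "V - A \<subset> e (i + a - 1)" using XA HS_sub[OF A(1)] HS_sub[OF H] unfolding X_def by auto
        moreover have "e (i + a) \<noteq> V - A" using A(3) ba(1) vw(1) by blast
        ultimately show False using line_no_between[OF b HS_compl[OF A(1)], of "i + a - 1"] by auto
      qed
    qed
    then show "A \<in> {A \<in> sep w v. X 0 \<subset> A} \<longleftrightarrow> A \<in> ?S1" unfolding sep_def by blast
  qed
  have r2: "{A \<in> sep w v. Y 0 \<subset> A} = (\<lambda>A. act (- k) ` A) ` ?S1"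
  proof -
    have key: "e (i + a) \<subset> A \<longleftrightarrow> w \<in> A" if A: "A \<in> HS" "act k w \<in> A" "v \<notin> A" for A
    proof
      assume "w \<in> A"
      then show "e (i + a) \<subset> A" using nested[OF A(1) H[of "i + a"]] ba A vw(1) by blast
    next
      assume s: "e (i + a) \<subset> A"
      show "w \<in> A"
      proof (rule ccontr)
        assume "w \<notin> A"
        then have "A \<subseteq> e (i + a - 1)" using nested[OF A(1) H[of "i + a - 1"]] ba A vw by blast
        moreover have "A \<noteq> e (i + a - 1)" using A(3) ba by blast
        ultimately show False using line_no_between[OF b A(1), of "i + a - 1"] s by auto
      qed
    qed
    show ?thesis
    proof (rule Set.set_eqI, rule iffI)
      fix A assume A: "A \<in> {A \<in> sep w v. Y 0 \<subset> A}"
      let ?A = "act k ` A"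
      have A': "?A \<in> HS" "act k w \<in> ?A" "v \<notin> ?A"
        using A HS_act[OF k(1)] sv[of "?A"] by (auto simp: sep_def inj_image_mem_iff[OF inj_act])
      have "e (i + a) \<subset> ?A"
      proof -
        have "act k ` Y 0 \<subset> ?A" using A by (simp add: psubset_eq act_image_subset_iff inj_image_eq_iff[OF inj_act])
        then show ?thesis by (simp add: Y_def)
      qed
      then have "?A \<in> ?S1" using key[OF A'] A' by simp
      then show "A \<in> (\<lambda>A. act (- k) ` A) ` ?S1" by (intro image_eqI[of _ _ "?A"]) auto
    next
      fix A assume "A \<in> (\<lambda>A. act (- k) ` A) ` ?S1"
      then obtain B where B: "A = act (- k) ` B" "B \<in> ?S1" by blast
      have "e (i + a) \<subset> B" using key[of B] B(2) by blast
      then have "Y 0 \<subset> A" by (simp add: Y_def B(1) psubset_eq act_image_subset_iff inj_image_eq_iff[OF inj_act])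
      moreover have "A \<in> sep w v" using B sv[of B] HS_act[OF kF] by (auto simp: sep_def mem_act_image)
      ultimately show "A \<in> {A \<in> sep w v. Y 0 \<subset> A}" by simp
    qed
  qed
  have fin: "finite (sep w v)" by (rule finite_sep[OF vw(2,1)])
  have "finite ?S1" by (rule finite_subset[OF _ fin]) (auto simp: sep_def)
  then have "card {A \<in> sep w v. Y 0 \<subset> A} \<le> card ?S1" unfolding r2 by (rule card_image_le)
  moreover have "?S1 = (\<lambda>A. act k ` A) ` ((\<lambda>A. act (- k) ` A) ` ?S1)" by (simp add: image_image)
  then have "card ?S1 \<le> card {A \<in> sep w v. Y 0 \<subset> A}"
    unfolding r2 using card_image_le[of "(\<lambda>A. act (- k) ` A) ` ?S1" "\<lambda>A. act k ` A"] \<open>finite ?S1\<close> by simp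
  ultimately have ranks: "card {A \<in> sep w v. X 0 \<subset> A} = card {A \<in> sep w v. Y 0 \<subset> A}" unfolding r1 by simp
  have rank_less: "card {A \<in> sep w v. B \<subset> A} < card {A \<in> sep w v. A' \<subset> A}" if "A' \<subset> B" "B \<in> sep w v" for A' B
    using that fin by (intro psubset_card_mono) auto
  have XS: "X t \<in> sep w v" "Y t \<in> sep w v" if "0 \<le> t" "t < p" for t
    using X[OF that] Y[OF that] XH YH by (auto simp: sep_def)
  \<comment> \<open>\<open>sep w v\<close> is a chain, so equal rank gives equality at 0. Beyond
    that, neither axis admits a half-space between neighbouring ones.\<close>
  have XY: "X t = Y t" if "0 \<le> t" "t < p" for t
    using that
  proof (induction t rule: int_ge_induct)
    case base
    have "X 0 \<subseteq> Y 0 \<or> Y 0 \<subseteq> X 0" by (rule comp) (use XH YH X[OF p0] Y[OF p0] in auto)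
    moreover have "\<not> X 0 \<subset> Y 0"
    proof
      assume "X 0 \<subset> Y 0"
      from rank_less[OF this XS(2)[OF p0]] show False unfolding ranks by simp
    qed
    moreover have "\<not> Y 0 \<subset> X 0"
    proof
      assume "Y 0 \<subset> X 0"
      from rank_less[OF this XS(1)[OF p0]] show False unfolding ranks by simp
    qed
    ultimately show ?case by blast
  next
    case (step t)
    have t: "0 \<le> t" "t < p" "0 \<le> t + 1" using step by auto
    have IH: "X t = Y t" using step t by simp
    have c: "X (t + 1) \<subseteq> Y (t + 1) \<or> Y (t + 1) \<subseteq> X (t + 1)"
      by (rule comp) (use XH YH X[OF t(3) step(3)] Y[OF t(3) step(3)] in auto)
    have Yd: "Y (t + 1) \<subset> Y t" using lineD(3)[OF g, of "i + a + t"] by (simp add: Y_def add.assoc)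
    have ix: "i + a - 1 - (t + 1) + 1 = i + a - 1 - t" by simp
    have Xd: "X (t + 1) \<subset> X t"
      using lineD(3)[OF b, of "i + a - 1 - (t + 1)"] HS_sub[OF H] unfolding X_def ix by blast
    have "\<not> X (t + 1) \<subset> Y (t + 1)"
    proof
      assume s: "X (t + 1) \<subset> Y (t + 1)"
      show False
      proof (rule line_no_between[OF b HS_compl[OF YH[of "t + 1"]], of "i + a - 1 - (t + 1)"])
        show "e (i + a - 1 - (t + 1) + 1) \<subset> V - Y (t + 1)"
          unfolding ix using Yd HS_sub[OF H] unfolding IH[symmetric] X_def by blast
        show "V - Y (t + 1) \<subset> e (i + a - 1 - (t + 1))"
          using s HS_sub[OF YH[of "t + 1"]] HS_sub[OF H] unfolding X_def by blast
      qed
    qed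
    moreover have "\<not> Y (t + 1) \<subset> X (t + 1)"
    proof
      assume s: "Y (t + 1) \<subset> X (t + 1)"
      show False
      proof (rule line_no_between[OF g XH[of "t + 1"], of "i + a + t"])
        show "?g (i + a + t + 1) \<subset> X (t + 1)" using s by (simp add: Y_def add.assoc)
        show "X (t + 1) \<subset> ?g (i + a + t)" using Xd unfolding IH Y_def .
      qed
    qed
    ultimately show ?case using c by blast
  qed
  show False
  proof (rule SC_opp[OF LL kF, of "i + a" "i + a - 1"])
    fix t :: int assume t: "0 \<le> t" "t < p"
    show "act (- k) ` e (i + a + t) = V - e (i + a - 1 - t)" using XY[OF t] by (simp add: X_def Y_def)
  qed
qed

end

section \<open>Small cancellation quotients of amalgams\<close>

inductive alt :: "'g::group_add set => 'g set => 'g => bool" where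
  alt_base: "k \<in> K ==> k \<notin> L ==> alt K L k"
| alt_step: "k \<in> K ==> k \<notin> L ==> alt L K y ==> alt K L (k + y)"

text \<open>\<open>alt K L\<close> describes the nonempty reduced words beginning in
  \<open>K - L\<close>. Such a word is neither one beginning in \<open>L - K\<close> nor an element
  of \<open>L\<close>. This much of the normal form theorem makes \<open>F\<close> the amalgamated
  product of \<open>K\<close> and \<open>L\<close> over \<open>H\<close>.\<close>

locale amalgam =
  fixes K L :: "'g::group_add set"
  assumes K_0: "0 \<in> K" and K_add: "\<And>a b. a \<in> K ==> b \<in> K ==> a + b \<in> K" and K_neg: "\<And>a. a \<in> K ==> - a \<in> K"
    and L_0: "0 \<in> L" and L_add: "\<And>a b. a \<in> L ==> b \<in> L ==> a + b \<in> L" and L_neg: "\<And>a. a \<in> L ==> - a \<in> L"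
    and alt_disj: "\<And>x. alt K L x ==> \<not> alt L K x"
    and alt_K: "\<And>x. alt K L x ==> x \<notin> L" and alt_L: "\<And>x. alt L K x ==> x \<notin> K"
begin

definition H where "H = K \<inter> L"

definition F where "F = {x. x \<in> H \<or> alt K L x \<or> alt L K x}"

end

text \<open>The hypotheses are symmetric in the two factors; each fact is proved for one of them and
  used for the other through \<open>swap\<close>.\<close>

sublocale amalgam \<subseteq> swap: amalgam L K
  rewrites "amalgam.H L K = H" and "amalgam.F L K = F"
proof -
  show s: "amalgam L K"
    by unfold_locales (use K_0 K_add K_neg L_0 L_add L_neg alt_disj alt_K alt_L in blast)+
  show "amalgam.H L K = H" unfolding amalgam.H_def[OF s] H_def by blast
  then show "amalgam.F L K = F" unfolding amalgam.F_def[OF s] F_def by blast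
qed

context amalgam
begin

lemma K_cancel_left: "h \<in> K ==> h + x \<in> K \<longleftrightarrow> x \<in> K"
  using K_add[of h x] K_add[of "- h" "h + x"] K_neg[of h] by (auto simp: add.assoc[symmetric])

lemma K_cancel_right: "h \<in> K ==> x + h \<in> K \<longleftrightarrow> x \<in> K"
  using K_add[of x h] K_add[of "x + h" "- h"] K_neg[of h] by (auto simp: add.assoc simp del: add_uminus_conv_diff)

end

context amalgam
begin

lemma alt_H_add:
  assumes "h \<in> H" "alt K L x" shows "alt K L (h + x)"
  using assms(2)
proof cases
  case alt_base
  then show ?thesis using assms(1) K_cancel_left swap.K_cancel_left by (intro alt.alt_base) (auto simp: H_def)
next
  case (alt_step k y)
  then have "alt K L ((h + k) + y)"
    using assms(1) K_cancel_left swap.K_cancel_left by (intro alt.alt_step) (auto simp: H_def)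
  then show ?thesis using alt_step by (simp add: add.assoc)
qed

end

context amalgam
begin

lemma alt_K_add:
  assumes "k \<in> K" "k \<notin> L" "x \<in> H \<or> alt L K x" shows "alt K L (k + x)"
  using assms(3)
proof
  assume "x \<in> H"
  then show ?thesis using assms K_add swap.K_cancel_right by (intro alt_base) (auto simp: H_def)
qed (use assms alt_step in auto)

end

context amalgam
begin

lemma F_K_add:
  assumes "k \<in> K" "x \<in> F" shows "k + x \<in> F"
proof (cases "k \<in> L")
  case True
  then have "k \<in> H" using assms by (simp add: H_def)
  then show ?thesis
    using assms(2) alt_H_add swap.alt_H_add K_cancel_left swap.K_cancel_left by (auto simp: F_def H_def)
next
  case False
  have "x \<in> H \<or> alt L K x ==> ?thesis" using alt_K_add[OF assms(1) False, of x] by (auto simp: F_def)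
  moreover have ?thesis if "alt K L x"
    using that
  proof cases
    case alt_base
    then have "k + x \<in> K" using assms(1) K_add by auto
    then show ?thesis using alt.alt_base[of "k + x"] by (auto simp: F_def H_def)
  next
    case (alt_step k' y)
    have "k + k' \<in> K" using alt_step assms K_add by auto
    then have "alt K L (k + k' + y) \<or> alt L K (k + k' + y)"
      using alt_step alt_K_add[of "k + k'" y] swap.alt_H_add[of "k + k'" y] by (auto simp: H_def)
    then show ?thesis using alt_step by (auto simp: F_def add.assoc)
  qed
  ultimately show ?thesis using assms(2) by (auto simp: F_def)
qed

text \<open>Both orders of the factors are treated at once because the induction alternates between
  them.\<close>

lemma alt_add_right_aux:
  assumes "alt A B x" "A = K \<and> B = L \<or> A = L \<and> B = K"
  shows "(\<forall>k\<in>A. x + k \<in> H \<or> alt A B (x + k)) \<and> (\<forall>l\<in>B. alt A B (x + l))"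
  using assms
proof (induction rule: alt.induct)
  case (alt_base k A B)
  interpret ab: amalgam A B rewrites "amalgam.H A B = H" using alt_base(3) amalgam_axioms swap.amalgam_axioms
    by (auto simp: swap.H_def H_def amalgam.H_def)
  show ?case
  proof (intro conjI ballI)
    fix a assume "a \<in> A"
    then have "k + a \<in> A" using alt_base ab.K_add by auto
    then show "k + a \<in> H \<or> alt A B (k + a)" by (auto simp: ab.H_def intro: alt.alt_base)
  next
    fix b assume b: "b \<in> B"
    show "alt A B (k + b)"
      by (rule ab.alt_K_add) (use b alt_base alt.alt_base[of b B A] in \<open>auto simp: ab.H_def\<close>)
  qed
next
  case (alt_step k A B y)
  interpret ab: amalgam A B rewrites "amalgam.H A B = H" using alt_step(5) amalgam_axioms swap.amalgam_axioms
    by (auto simp: swap.H_def H_def amalgam.H_def)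
  show ?case using alt_step ab.alt_K_add by (auto simp: add.assoc)
qed

lemma alt_add_L: "alt K L x ==> l \<in> L ==> alt K L (x + l)"
  using alt_add_right_aux by blast

lemma alt_add_K: "alt K L x ==> k \<in> K ==> x + k \<in> H \<or> alt K L (x + k)"
  using alt_add_right_aux by blast

lemma K_F: "k \<in> K ==> k \<in> F"
  by (auto simp: F_def H_def intro: alt_base)

end

context amalgam
begin

lemma F_add_K:
  assumes "x \<in> F" "k \<in> K" shows "x + k \<in> F"
proof -
  have "x \<in> H ==> x + k \<in> F" using assms K_add by (intro K_F) (auto simp: H_def)
  then show ?thesis using assms alt_add_K swap.alt_add_L by (auto simp: F_def)
qed

end

context amalgam
begin

lemma F_induct [consumes 1, case_names zero K L]:
  assumes "x \<in> F" "P 0" "\<And>k x. k \<in> K ==> x \<in> F ==> P x ==> P (k + x)" "\<And>l x. l \<in> L ==> x \<in> F ==> P x ==> P (l + x)"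
  shows "P x"
proof -
  have 0: "0 \<in> F" using K_F K_0 by blast
  have K: "P k" if "k \<in> K" for k using assms(3)[OF that 0 assms(2)] by simp
  have L: "P k" if "k \<in> L" for k using assms(4)[OF that 0 assms(2)] by simp
  have "P y" if "alt A B y" "A = K \<and> B = L \<or> A = L \<and> B = K" for A B y
    using that
  proof (induction rule: alt.induct)
    case (alt_base k A B)
    then show ?case using K L by auto
  next
    case (alt_step k A B y)
    then have "P y" "y \<in> F" by (auto simp: F_def)
    then show ?case using alt_step assms(3,4) by auto
  qed
  then show ?thesis using assms(1) K by (auto simp: F_def H_def)
qed

lemma F_add: "x \<in> F ==> y \<in> F ==> x + y \<in> F"
  by (induction rule: F_induct) (auto simp: add.assoc F_K_add swap.F_K_add)

lemma F_neg: "x \<in> F ==> - x \<in> F"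
proof (induction rule: F_induct)
  case zero
  then show ?case using K_F K_0 by simp
next
  case (K k x)
  then show ?case using F_add_K[of "- x" "- k"] K_neg by (simp add: minus_add)
next
  case (L l x)
  then show ?case using swap.F_add_K[of "- x" "- l"] L_neg by (simp add: minus_add)
qed

lemma H_0: "0 \<in> H" and H_add: "a \<in> H ==> b \<in> H ==> a + b \<in> H" and H_neg: "a \<in> H ==> - a \<in> H"
  using K_0 L_0 K_add L_add K_neg L_neg by (auto simp: H_def)

lemma H_F: "h \<in> H ==> h \<in> F"
  by (simp add: F_def)

lemma alt_not_H: "alt K L x ==> x \<notin> H"
  using alt_K by (auto simp: H_def)

end

section \<open>Half-spaces of the Bass-Serre tree\<close>

context amalgam
begin

text \<open>Half-spaces live on the vertices of the Bass--Serre tree: \<open>(f, True)\<close> stands for the coset \<open>fK\<close>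
  and \<open>(f, False)\<close> for \<open>fL\<close>. \<open>P\<close> is the side of \<open>L\<close> of the edge \<open>H\<close>.\<close>

definition V :: "('g \<times> bool) set" where "V = F \<times> UNIV"

definition act :: "'g => 'g \<times> bool => 'g \<times> bool" where "act g v = (g + fst v, snd v)"

definition P :: "('g \<times> bool) set" where "P = {(f, b). alt L K f \<or> \<not> b \<and> f \<in> H}"

definition HS :: "('g \<times> bool) set set" where "HS = {A. \<exists>g\<in>F. A = act g ` P \<or> A = V - act g ` P}"

lemma P_V: "P \<subseteq> V"
  by (auto simp: P_def V_def F_def)

lemma act_pair: "act g (f, b) = (g + f, b)"
  by (simp add: act_def)

lemma act_add': "act (g + h) v = act g (act h v)" and act_0': "act 0 v = v"
  by (simp_all add: act_def add.assoc)

lemma act_inv': "act (- g) (act g v) = v" "act g (act (- g) v) = v"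
  by (simp_all add: act_def add.assoc[symmetric])

lemma mem_act: "v \<in> act g ` A \<longleftrightarrow> act (- g) v \<in> A"
  by (metis act_inv' imageE imageI)

lemma inj_act': "inj (act g)"
  by (metis act_inv'(1) injI)

lemma act_V': "g \<in> F ==> v \<in> V ==> act g v \<in> V"
  by (auto simp: V_def act_def F_add)

lemma act_image_V': "g \<in> F ==> act g ` V = V"
  by (auto simp: mem_act F_neg act_V')

lemma act_compl: "g \<in> F ==> act g ` (V - A) = V - act g ` A"
  by (simp add: image_set_diff[OF inj_act'] act_image_V')

lemma act_image: "act (g + h) ` A = act g ` act h ` A"
  by (simp add: act_add' image_image)

lemma H_P: assumes "h \<in> H" shows "act h ` P = P"
proof -
  have "act h ` P \<subseteq> P" if "h \<in> H" for h
    using that by (auto simp: P_def act_def swap.alt_H_add H_add)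
  note sub = this[OF assms] this[OF H_neg[OF assms]]
  have "P = act h ` act (- h) ` P" by (simp add: image_image act_inv')
  also have "\<dots> \<subseteq> act h ` P" using sub(2) by (rule image_mono)
  finally show ?thesis using sub(1) by blast
qed

lemma K_P: "k \<in> K ==> k \<notin> L ==> act k ` P \<subseteq> V - P"
  using alt_K_add[of k] alt_disj alt_not_H by (fastforce simp: P_def V_def act_def F_def)

lemma L_P: "l \<in> L ==> l \<notin> K ==> act l ` (V - P) \<subseteq> P"
  using swap.alt_K_add[of l] by (fastforce simp: P_def V_def act_def F_def)

text \<open>Ping-pong: \<open>K - L\<close> moves \<open>P\<close> into its complement, and
  \<open>L - K\<close> moves the complement into \<open>P\<close>. Which of the two orientations of
  the edge starts the game depends on the last syllable, hence the disjunctions.\<close>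

lemma alt_P:
  assumes "alt A B g" "A = K \<and> B = L \<or> A = L \<and> B = K"
  shows "if A = K then act g ` P \<subseteq> V - P \<or> act g ` (V - P) \<subseteq> V - P else act g ` P \<subseteq> P \<or> act g ` (V - P) \<subseteq> P"
proof (cases "K = L")
  case True
  then have False using assms alt.cases by blast
  then show ?thesis ..
next
  case KL: False
  show ?thesis using assms
  proof (induction rule: alt.induct)
    case (alt_base k A B)
    then consider "A = K" "k \<in> K" "k \<notin> L" | "A = L" "k \<in> L" "k \<notin> K" by blast
    then show ?case
    proof cases
      case 1
      then show ?thesis using K_P by simp
    next
      case 2
      then show ?thesis using L_P[of k] KL by simp
    qed
  next
    case (alt_step k A B y)
    show ?case
    proof (cases "A = K")
      case True
      then have k: "k \<in> K" "k \<notin> L" and y: "act y ` P \<subseteq> P \<or> act y ` (V - P) \<subseteq> P" using alt_step KL by auto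
      have "act k ` act y ` P \<subseteq> act k ` P \<or> act k ` act y ` (V - P) \<subseteq> act k ` P" using y by blast
      then show ?thesis using True K_P[OF k] unfolding act_image by auto
    next
      case False
      then have k: "k \<in> L" "k \<notin> K" and y: "act y ` P \<subseteq> V - P \<or> act y ` (V - P) \<subseteq> V - P" using alt_step KL by auto
      have "act k ` act y ` P \<subseteq> act k ` (V - P) \<or> act k ` act y ` (V - P) \<subseteq> act k ` (V - P)" using y by blast
      then show ?thesis using False L_P[OF k] unfolding act_image by auto
    qed
  qed
qed

lemma nested_P:
  assumes "g \<in> F"
  shows "act g ` P \<subseteq> P \<or> P \<subseteq> act g ` P \<or> P \<inter> act g ` P = {} \<or> P \<union> act g ` P = V"
proof -
  have gV: "act g ` P \<subseteq> V" using P_V act_V'[OF assms] by blast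
  consider "g \<in> H" | "alt K L g" | "alt L K g" using assms by (auto simp: F_def)
  then show ?thesis
  proof cases
    case 1
    then show ?thesis using H_P by simp
  next
    case 2
    from alt_P[OF this] have "act g ` P \<subseteq> V - P \<or> V - act g ` P \<subseteq> V - P" using act_compl[OF assms] by simp
    then show ?thesis using P_V by blast
  next
    case 3
    then have "K \<noteq> L" by (auto elim: alt.cases)
    with alt_P[OF 3] have "act g ` P \<subseteq> P \<or> V - act g ` P \<subseteq> P" using act_compl[OF assms] by simp
    then show ?thesis using P_V gV by blast
  qed
qed

lemma base_mem: "(0, True) \<notin> P" "(0, False) \<in> P" "(0, b) \<in> V"
  using H_0 swap.alt_not_H H_F by (auto simp: P_def V_def)

lemma stab_P:
  assumes "g \<in> F" "act g ` P = P" shows "g \<in> H"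
proof -
  have "act g (0, False) \<in> P" using assms(2) base_mem(2) by blast
  moreover have "act g (0, True) \<notin> P"
    using base_mem(1) inj_image_mem_iff[OF inj_act', of g "(0, True)" P] unfolding assms(2) by simp
  ultimately show ?thesis by (auto simp: act_def P_def)
qed

text \<open>The ends of the edge are cosets of different kinds, and the action preserves the
  kind.\<close>

lemma no_inversion:
  assumes "g \<in> F" shows "act g ` P \<noteq> V - P"
proof
  assume e: "act g ` P = V - P"
  have "act g (0, False) \<in> V - P" using e base_mem(2) by blast
  moreover have "act g (0, True) \<in> P"
  proof (rule ccontr)
    assume "act g (0, True) \<notin> P"
    then have "act g (0, True) \<in> act g ` P" using e act_V'[OF assms base_mem(3)] by blast
    then show False using base_mem(1) by (simp add: inj_image_mem_iff[OF inj_act'])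
  qed
  ultimately show False by (auto simp: act_def P_def)
qed

lemma P_add_K: "f \<in> F ==> k \<in> K ==> (f + k, True) \<in> P \<longleftrightarrow> (f, True) \<in> P"
proof -
  have "(f, True) \<in> P ==> (f + k, True) \<in> P" if "k \<in> K" for f k
    using that swap.alt_add_L by (auto simp: P_def)
  from this[of k f] this[of "- k" "f + k"] show "k \<in> K ==> ?thesis" using K_neg by (auto simp: add.assoc)
qed

lemma P_add_L: "f \<in> F ==> l \<in> L ==> (f + l, False) \<in> P \<longleftrightarrow> (f, False) \<in> P"
proof -
  have "(f, False) \<in> P ==> (f + l, False) \<in> P" if "l \<in> L" for f l
    using that swap.alt_add_K[of f l] alt_base[of l L K] L_add by (auto simp: P_def H_def intro: alt.alt_base)
  from this[of l f] this[of "- l" "f + l"] show "l \<in> L ==> ?thesis" using L_neg by (auto simp: add.assoc)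
qed

end

section \<open>A rigid periodic pattern of marks\<close>

text \<open>A periodic set of integers whose consecutive gaps run through \<open>G, G + 1, \<dots>, 2G - 1\<close>:
  every window of length \<open>6G\<close> determines its position, its orientation, and which of the two
  classes are the marks.\<close>

definition gap_min :: nat where "gap_min = 170"

primrec mark_pos :: "nat => int" where
  "mark_pos 0 = 0"
| "mark_pos (Suc i) = mark_pos i + int gap_min + int i"

definition period :: int where "period = mark_pos gap_min"

definition mark :: "int => bool" where "mark x \<longleftrightarrow> (\<exists>i<gap_min. x mod period = mark_pos i)"

text \<open>Fewer than \<open>2 * gap_min\<close> positions pass before a mark, and two complete
  gaps, each shorter than \<open>2 * gap_min\<close>, are read to recognise the direction in which
  gaps grow.\<close>

definition window :: int where "window = 6 * int gap_min"

lemma mark_pos_formula: "2 * mark_pos i = 2 * int i * int gap_min + int i * (int i - 1)"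
  by (induction i) (auto simp: algebra_simps)

lemma period_eq: "period = 43265"
  using mark_pos_formula[of gap_min] unfolding period_def by (simp add: gap_min_def)

lemma gap_min_pos: "0 < int gap_min"
  by (simp add: gap_min_def)

lemma period_pos: "0 < period"
  by (simp add: period_eq)

lemma mark_pos_less: "i < j ==> mark_pos i < mark_pos j"
proof (induction j)
  case (Suc j)
  then show ?case by (cases "i = j") (auto simp: gap_min_def)
qed simp

lemma mark_pos_less_iff: "mark_pos i < mark_pos j \<longleftrightarrow> i < j"
  using mark_pos_less by (metis linorder_neqE_nat order_less_asym order_less_irrefl)

lemma mark_pos_nonneg: "0 \<le> mark_pos i"
  by (induction i) auto

lemma mark_period: "mark (x + period) = mark x" "mark (x + q * period) = mark x"
  by (simp_all add: mark_def)

lemma mark_gap: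
  assumes "mark x"
  obtains i where "i < gap_min" "x mod period = mark_pos i" "mark (x + int gap_min + int i)"
    "\<And>k. 0 < k ==> k < int gap_min + int i ==> \<not> mark (x + k)"
    "(x + int gap_min + int i) mod period = mark_pos (if Suc i = gap_min then 0 else Suc i)"
proof -
  obtain i where i: "i < gap_min" "x mod period = mark_pos i" using assms by (auto simp: mark_def)
  have shift: "(x + k) mod period = (mark_pos i + k) mod period" for k
    by (metis i(2) mod_add_left_eq)
  have le: "mark_pos (Suc i) \<le> period"
    using i(1) mark_pos_less[of "Suc i" gap_min] unfolding period_def by (cases "Suc i = gap_min") auto
  have next': "(x + int gap_min + int i) mod period = mark_pos (Suc i) mod period"
    using shift[of "int gap_min + int i"] by (simp add: add.assoc)
  have next_eq: "(x + int gap_min + int i) mod period = mark_pos (if Suc i = gap_min then 0 else Suc i)"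
  proof (cases "Suc i = gap_min")
    case True
    then have "mark_pos (Suc i) = period" by (simp only: period_def)
    then show ?thesis using next' True by simp
  next
    case False
    then have "mark_pos (Suc i) < period" using i(1) mark_pos_less[of "Suc i" gap_min] unfolding period_def by auto
    then have "mark_pos (Suc i) mod period = mark_pos (Suc i)" using mark_pos_nonneg by (intro mod_pos_pos_trivial)
    then show ?thesis using next' False by simp
  qed
  have "(if Suc i = gap_min then 0 else Suc i) < gap_min" using i(1) by auto
  then have m: "mark (x + int gap_min + int i)" unfolding mark_def next_eq by blast
  have "\<not> mark (x + k)" if k: "0 < k" "k < int gap_min + int i" for k
  proof
    assume "mark (x + k)"
    then obtain j where j: "(x + k) mod period = mark_pos j" by (auto simp: mark_def)
    have "mark_pos i + k < mark_pos (Suc i)" using k by simp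
    then have "(mark_pos i + k) mod period = mark_pos i + k"
      using le k mark_pos_nonneg[of i] by (intro mod_pos_pos_trivial) auto
    then have e: "mark_pos i + k = mark_pos j" using j shift by simp
    then have "mark_pos i < mark_pos j" "mark_pos j < mark_pos (Suc i)" using k by auto
    then show False unfolding mark_pos_less_iff by simp
  qed
  then show ?thesis using that i m next_eq by blast
qed

lemma mark_dense: "\<exists>k. 0 \<le> k \<and> k < 2 * int gap_min \<and> mark (x + k)"
proof -
  let ?r = "x mod period"
  have r: "0 \<le> ?r" "?r < period" using period_pos by auto
  have "\<exists>i. ?r \<le> mark_pos i" using r(2) unfolding period_def by (intro exI[of _ gap_min]) simp
  then obtain i where i: "?r \<le> mark_pos i" "\<forall>j<i. \<not> ?r \<le> mark_pos j" using exists_least_iff[of "\<lambda>i. ?r \<le> mark_pos i"] by auto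
  have ig: "i \<le> gap_min"
  proof (rule ccontr)
    assume "\<not> i \<le> gap_min"
    then have "\<not> ?r \<le> mark_pos gap_min" using i(2) by simp
    then show False using r(2) unfolding period_def[symmetric] by simp
  qed
  let ?k = "mark_pos i - ?r"
  have xk: "(x + ?k) mod period = mark_pos i mod period"
  proof -
    have "x + ?k = mark_pos i + (x div period) * period" using div_mult_mod_eq[of x period] by linarith
    then show ?thesis by (simp only: mod_mult_self1)
  qed
  have "mark (x + ?k)"
  proof (cases "i = gap_min")
    case True
    then have "(x + ?k) mod period = mark_pos 0" using xk by (simp add: period_def)
    moreover have "0 < gap_min" by (simp add: gap_min_def)
    ultimately show ?thesis unfolding mark_def by blast
  next
    case False
    then have lt: "i < gap_min" using ig by simp
    then have "mark_pos i < period" using mark_pos_less unfolding period_def by simp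
    then have "(x + ?k) mod period = mark_pos i" using xk mark_pos_nonneg by simp
    then show ?thesis using lt unfolding mark_def by blast
  qed
  moreover have "?k < 2 * int gap_min"
  proof (cases i)
    case 0
    then show ?thesis using r by (simp add: gap_min_def)
  next
    case (Suc j)
    then have "mark_pos j < ?r" using i(2) by auto
    then show ?thesis using Suc ig by simp
  qed
  ultimately show ?thesis using i(1) by (intro exI[of _ ?k]) auto
qed

lemma window_gaps:
  obtains k i where "0 \<le> k" "k < 2 * int gap_min" "mark (x + k)" "i < gap_min" "(x + k) mod period = mark_pos i"
    "mark (x + k + int gap_min + int i)" "\<And>d. 0 < d ==> d < int gap_min + int i ==> \<not> mark (x + k + d)"
    "(x + k + int gap_min + int i) mod period = mark_pos (if Suc i = gap_min then 0 else Suc i)"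
proof -
  obtain k where k: "0 \<le> k" "k < 2 * int gap_min" "mark (x + k)" using mark_dense[of x] by blast
  from k(3) show ?thesis by (rule mark_gap) (use that k in blast)
qed

text \<open>Within a period all gaps have different lengths, so the length of the gap after a mark
  reveals its residue.\<close>

lemma gap_unique:
  assumes "mark x" "mark y" "\<And>d. 0 < d ==> d < 2 * int gap_min ==> mark (x + d) = mark (y + d)"
  shows "x mod period = y mod period"
proof -
  obtain i where i: "i < gap_min" "x mod period = mark_pos i" "mark (x + int gap_min + int i)"
    "\<And>k. 0 < k ==> k < int gap_min + int i ==> \<not> mark (x + k)" using assms(1) by (rule mark_gap) blast
  obtain j where j: "j < gap_min" "y mod period = mark_pos j" "mark (y + int gap_min + int j)"
    "\<And>k. 0 < k ==> k < int gap_min + int j ==> \<not> mark (y + k)" using assms(2) by (rule mark_gap) blast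
  have "mark (y + (int gap_min + int i))" "mark (x + (int gap_min + int j))"
    using assms(3)[of "int gap_min + int i"] assms(3)[of "int gap_min + int j"] i(1,3) j(1,3)
    by (auto simp: add.assoc)
  then have "i = j" using i(4)[of "int gap_min + int j"] j(4)[of "int gap_min + int i"] by (cases i j rule: linorder_cases) (use gap_min_pos in auto)
  then show ?thesis using i j by simp
qed

lemma window_unique:
  assumes "\<And>k. 0 \<le> k ==> k < window ==> mark (x + k) = mark (y + k)"
  shows "x mod period = y mod period"
proof -
  obtain k where k: "0 \<le> k" "k < 2 * int gap_min" "mark (x + k)" using mark_dense[of x] by blast
  have "(x + k) mod period = (y + k) mod period"
  proof (rule gap_unique[OF k(3)])
    show "mark (y + k)" using assms[of k] k by (simp add: window_def)
    fix d assume "0 < d" "d < 2 * int gap_min"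
    then show "mark (x + k + d) = mark (y + k + d)" using assms[of "k + d"] k by (simp add: window_def add.assoc)
  qed
  then have "(x + k - k) mod period = (y + k - k) mod period" by (intro mod_diff_cong) simp_all
  then show ?thesis by simp
qed

lemma no_adjacent_marks: "mark x ==> \<not> mark (x + 1)"
proof -
  assume "mark x"
  then obtain i where "\<And>k. 0 < k ==> k < int gap_min + int i ==> \<not> mark (x + k)" by (rule mark_gap) blast
  from this[of 1] show ?thesis by (simp add: gap_min_def)
qed

lemma window_mark: "\<exists>k. 0 \<le> k \<and> k < window - 2 \<and> mark (x + k) \<and> \<not> mark (x + k + 1) \<and> \<not> mark (x + k + 2)"
proof -
  obtain k i where k: "0 \<le> k" "k < 2 * int gap_min" "mark (x + k)"
    "\<And>d. 0 < d ==> d < int gap_min + int i ==> \<not> mark (x + k + d)" by (rule window_gaps[of x]) blast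
  then show ?thesis using k(4)[of 1] k(4)[of 2] by (intro exI[of _ k]) (auto simp: window_def gap_min_def)
qed

text \<open>Every window has two neighbouring positions without a mark, whereas two marks are never
  neighbours.\<close>

lemma window_not_compl: "\<not> (\<forall>k. 0 \<le> k --> k < window --> mark (x + k) \<noteq> mark (y + k))"
proof
  assume a: "\<forall>k. 0 \<le> k --> k < window --> mark (x + k) \<noteq> mark (y + k)"
  obtain k where k: "0 \<le> k" "k < window - 2" "\<not> mark (x + k + 1)" "\<not> mark (x + k + 2)" using window_mark[of x] by blast
  then have "mark (y + (k + 1))" "mark (y + (k + 2))" using a[rule_format, of "k + 1"] a[rule_format, of "k + 2"] by (auto simp: add.assoc)
  then show False using no_adjacent_marks[of "y + (k + 1)"] by (simp add: add.assoc)
qed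

lemma window_not_rev_compl: "\<not> (\<forall>k. 0 \<le> k --> k < window --> mark (x + k) \<noteq> mark (y - k))"
proof
  assume a: "\<forall>k. 0 \<le> k --> k < window --> mark (x + k) \<noteq> mark (y - k)"
  obtain k where k: "0 \<le> k" "k < window - 2" "\<not> mark (x + k + 1)" "\<not> mark (x + k + 2)" using window_mark[of x] by blast
  then have "mark (y - (k + 1))" "mark (y - (k + 2))" using a[rule_format, of "k + 1"] a[rule_format, of "k + 2"] by (auto simp: add.assoc)
  then show False using no_adjacent_marks[of "y - (k + 2)"] by (simp add: algebra_simps)
qed

text \<open>Reading forwards, a gap \<open>g\<close> is followed by \<open>g + 1\<close> except at the wrap-around.\<close>

lemma window_not_rev: "\<not> (\<forall>k. 0 \<le> k --> k < window --> mark (x + k) = mark (y - k))"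
proof
  assume a: "\<forall>k. 0 \<le> k --> k < window --> mark (x + k) = mark (y - k)"
  let ?G = "int gap_min"
  obtain k i where k: "0 \<le> k" "k < 2 * ?G" "mark (x + k)" "i < gap_min" "(x + k) mod period = mark_pos i"
    "mark (x + k + ?G + int i)" "\<And>d. 0 < d ==> d < ?G + int i ==> \<not> mark (x + k + d)"
    "(x + k + ?G + int i) mod period = mark_pos (if Suc i = gap_min then 0 else Suc i)"
    by (rule window_gaps[of x]) blast
  define x1 where "x1 = x + k + ?G + int i"
  obtain i' where i': "i' < gap_min" "x1 mod period = mark_pos i'" "mark (x1 + ?G + int i')"
    "\<And>d. 0 < d ==> d < ?G + int i' ==> \<not> mark (x1 + d)" using k(6) unfolding x1_def by (rule mark_gap) blast
  have inj: "mark_pos u = mark_pos v ==> u = v" for u v using mark_pos_less_iff[of u v] mark_pos_less_iff[of v u] by auto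
  have e1: "i' = (if Suc i = gap_min then 0 else Suc i)" using k(8) i'(2) inj unfolding x1_def by metis
  \<comment> \<open>The mirror image of the right end of two consecutive gaps after
    \<open>x + k\<close>; going forwards from it, the same two gaps are met in the opposite
    order.\<close>
  define y0 where "y0 = y - (k + ?G + int i + ?G + int i')"
  have tr: "mark (y0 + d) = mark (x1 + ?G + int i' - d)" if "0 \<le> d" "d \<le> ?G + int i + ?G + int i'" for d
    using a[rule_format, of "k + ?G + int i + ?G + int i' - d"] that k(1,2,4) i'(1) by (simp add: y0_def x1_def window_def algebra_simps)
  have "mark y0" using tr[of 0] i'(3) by simp
  then obtain j where j: "j < gap_min" "y0 mod period = mark_pos j" "mark (y0 + ?G + int j)"
    "\<And>d. 0 < d ==> d < ?G + int j ==> \<not> mark (y0 + d)"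
    "(y0 + ?G + int j) mod period = mark_pos (if Suc j = gap_min then 0 else Suc j)" by (rule mark_gap) blast
  have m1: "mark (y0 + (?G + int i'))" using tr[of "?G + int i'"] k(6) by (simp add: x1_def[symmetric])
  have n1: "\<not> mark (y0 + d)" if "0 < d" "d < ?G + int i'" for d
    using tr[of d] i'(4)[of "?G + int i' - d"] that by (simp add: algebra_simps)
  have ji: "j = i'"
    using j(3) j(4)[of "?G + int i'"] m1 n1[of "?G + int j"] by (cases j i' rule: linorder_cases) (use gap_min_pos in \<open>auto simp: add.assoc\<close>)
  define y1 where "y1 = y0 + ?G + int j"
  obtain j' where j': "j' < gap_min" "y1 mod period = mark_pos j'" "mark (y1 + ?G + int j')"
    "\<And>d. 0 < d ==> d < ?G + int j' ==> \<not> mark (y1 + d)" using j(3) unfolding y1_def by (rule mark_gap) blast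
  have e2: "j' = (if Suc j = gap_min then 0 else Suc j)" using j(5) j'(2) inj unfolding y1_def by metis
  have m2: "mark (y1 + (?G + int i))" using tr[of "?G + int i' + (?G + int i)"] k(3) by (simp add: x1_def y1_def ji algebra_simps)
  have n2: "\<not> mark (y1 + d)" if "0 < d" "d < ?G + int i" for d
    using tr[of "?G + int i' + d"] k(7)[of "?G + int i - d"] that by (simp add: x1_def y1_def ji algebra_simps)
  have "j' = i"
    using j'(3) j'(4)[of "?G + int i"] m2 n2[of "?G + int j'"] by (cases j' i rule: linorder_cases) (use gap_min_pos in \<open>auto simp: add.assoc\<close>)
  \<comment> \<open>Each of the two gaps would be the cyclic successor of the other, which is
    impossible in a cycle of length 170.\<close>
  then show False using e1 e2 ji k(4) by (auto simp: gap_min_def split: if_splits)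
qed

section \<open>The tree axioms for the Bass-Serre tree\<close>

context amalgam
begin

definition sepa :: "'g \<times> bool => 'g \<times> bool => ('g \<times> bool) set set"
  where "sepa u v = {A \<in> HS. u \<in> A \<and> v \<notin> A}"

lemma HS_P: "g \<in> F ==> act g ` P \<in> HS" "g \<in> F ==> V - act g ` P \<in> HS"
  by (auto simp: HS_def)

lemma HS_V: "A \<in> HS ==> A \<subseteq> V"
proof -
  have "act g ` P \<subseteq> V" if "g \<in> F" for g using P_V act_V'[OF that] by blast
  then show "A \<in> HS ==> A \<subseteq> V" by (auto simp: HS_def)
qed

lemma HS_compl': assumes "A \<in> HS" shows "V - A \<in> HS"
proof -
  obtain g where g: "g \<in> F" "A = act g ` P \<or> A = V - act g ` P" using assms by (auto simp: HS_def)
  have "V - (V - act g ` P) = act g ` P" using HS_V[OF HS_P(1)[OF g(1)]] by blast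
  then show ?thesis using g HS_P[OF g(1)] by auto
qed

lemma HS_act': assumes "f \<in> F" "A \<in> HS" shows "act f ` A \<in> HS"
proof -
  obtain g where g: "g \<in> F" "A = act g ` P \<or> A = V - act g ` P" using assms by (auto simp: HS_def)
  have "act f ` act g ` P = act (f + g) ` P" by (simp add: act_image)
  then show ?thesis using g HS_P[OF F_add[OF assms(1) g(1)]] act_compl[OF assms(1)] by auto
qed

lemma nested_translates:
  assumes "g \<in> F" "h \<in> F"
  shows "act g ` P \<subseteq> act h ` P \<or> act h ` P \<subseteq> act g ` P \<or> act g ` P \<inter> act h ` P = {} \<or> act g ` P \<union> act h ` P = V"
proof -
  have m: "- g + h \<in> F" using assms by (intro F_add F_neg)
  have e: "act g ` act (- g + h) ` P = act h ` P" by (simp flip: act_image add: add.assoc[symmetric])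
  from nested_P[OF m] have "act g ` act (- g + h) ` P \<subseteq> act g ` P \<or> act g ` P \<subseteq> act g ` act (- g + h) ` P \<or>
      act g ` (P \<inter> act (- g + h) ` P) = act g ` {} \<or> act g ` (P \<union> act (- g + h) ` P) = act g ` V"
    using image_mono[of _ _ "act g"] by metis
  then show ?thesis unfolding e image_Int[OF inj_act'] image_Un act_image_V'[OF assms(1)] by blast
qed

lemma HS_nested:
  assumes "A \<in> HS" "B \<in> HS" shows "A \<subseteq> B \<or> B \<subseteq> A \<or> A \<inter> B = {} \<or> A \<union> B = V"
proof -
  obtain g h where g: "g \<in> F" "A = act g ` P \<or> A = V - act g ` P" and h: "h \<in> F" "B = act h ` P \<or> B = V - act h ` P"
    using assms by (auto simp: HS_def)
  show ?thesis
    using nested_translates[OF g(1) h(1)] HS_V[OF HS_P(1)[OF g(1)]] HS_V[OF HS_P(1)[OF h(1)]] g(2) h(2)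
    by (elim disjE) (hypsubst, blast)+
qed

lemma mem_translate: "(f, b) \<in> act g ` P \<longleftrightarrow> (- g + f, b) \<in> P"
  by (simp only: mem_act act_pair)

lemma sepa_edge:
  assumes "g \<in> F" shows "sepa (g, False) (g, True) = {act g ` P}" "sepa (g, True) (g, False) = {V - act g ` P}"
proof -
  have V: "(g, b) \<in> V" for b using assms by (simp add: V_def)
  have eq: "act h ` P = act g ` P" if h: "- h + g \<in> H" for h
  proof -
    have "act g ` P = act h ` act (- h + g) ` P" by (simp flip: act_image add: add.assoc[symmetric])
    then show ?thesis using H_P[OF h] by simp
  qed
  have in_P: "(x, True) \<in> P \<longleftrightarrow> alt L K x" "(x, False) \<in> P \<longleftrightarrow> alt L K x \<or> x \<in> H" for x by (auto simp: P_def)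
  have self: "(g, False) \<in> act g ` P" "(g, True) \<notin> act g ` P" using base_mem by (auto simp: mem_translate)
  show "sepa (g, False) (g, True) = {act g ` P}"
  proof (intro equalityI subsetI)
    fix A assume "A \<in> sepa (g, False) (g, True)"
    then obtain h where h: "h \<in> F" "A = act h ` P \<or> A = V - act h ` P" "(g, False) \<in> A" "(g, True) \<notin> A"
      by (auto simp: sepa_def HS_def)
    from h(2) show "A \<in> {act g ` P}"
    proof
      assume A: "A = act h ` P"
      have "- h + g \<in> H" using h(3,4) unfolding A mem_translate in_P by blast
      then show ?thesis using eq A by simp
    next
      assume A: "A = V - act h ` P"
      show ?thesis using h(3,4) V unfolding A Diff_iff mem_translate in_P by blast
    qed
  qed (use self HS_P(1)[OF assms] in \<open>auto simp: sepa_def\<close>)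
  show "sepa (g, True) (g, False) = {V - act g ` P}"
  proof (intro equalityI subsetI)
    fix A assume "A \<in> sepa (g, True) (g, False)"
    then obtain h where h: "h \<in> F" "A = act h ` P \<or> A = V - act h ` P" "(g, True) \<in> A" "(g, False) \<notin> A"
      by (auto simp: sepa_def HS_def)
    from h(2) show "A \<in> {V - act g ` P}"
    proof
      assume A: "A = act h ` P"
      show ?thesis using h(3,4) unfolding A mem_translate in_P by blast
    next
      assume A: "A = V - act h ` P"
      have "- h + g \<in> H" using h(3,4) V unfolding A Diff_iff mem_translate in_P by blast
      then show ?thesis using eq A by simp
    qed
  qed (use self V HS_P(2)[OF assms] in \<open>auto simp: sepa_def\<close>)
qed

lemma sepa_K: "g \<in> F ==> k \<in> K ==> sepa (g, True) (g + k, True) = {}"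
proof -
  assume g: "g \<in> F" and k: "k \<in> K"
  have "(g + k, True) \<in> act h ` P \<longleftrightarrow> (g, True) \<in> act h ` P" if "h \<in> F" for h
    using P_add_K[OF F_add[OF F_neg[OF that] g] k] by (simp add: mem_translate add.assoc)
  moreover have "(g + k, True) \<in> V" "(g, True) \<in> V" using g F_add_K[OF g k] by (auto simp: V_def)
  ultimately show ?thesis by (auto simp: sepa_def HS_def)
qed

lemma sepa_L: "g \<in> F ==> k \<in> L ==> sepa (g, False) (g + k, False) = {}"
proof -
  assume g: "g \<in> F" and k: "k \<in> L"
  have "(g + k, False) \<in> act h ` P \<longleftrightarrow> (g, False) \<in> act h ` P" if "h \<in> F" for h
    using P_add_L[OF F_add[OF F_neg[OF that] g] k] by (simp add: mem_translate add.assoc)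
  moreover have "(g + k, False) \<in> V" "(g, False) \<in> V" using g swap.F_add_K[OF g k] by (auto simp: V_def)
  ultimately show ?thesis by (auto simp: sepa_def HS_def)
qed

text \<open>Finiteness is demanded explicitly, since \<open>card\<close> is 0 on infinite sets;
  \<open>finite_sepa\<close> is then derived from paths in this relation.\<close>

definition near :: "(('g \<times> bool) \<times> ('g \<times> bool)) set"
  where "near = {(x, y). x \<in> V \<and> y \<in> V \<and> finite (sepa x y) \<and> card (sepa x y) \<le> 1}"

lemma near_act:
  assumes "f \<in> F" "(x, y) \<in> near" shows "(act f x, act f y) \<in> near"
proof -
  have "sepa (act f x) (act f y) \<subseteq> (\<lambda>A. act f ` A) ` sepa x y"
  proof
    fix A assume A: "A \<in> sepa (act f x) (act f y)"
    have "act (- f) ` A \<in> sepa x y"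
      using A HS_act'[OF F_neg[OF assms(1)]] by (auto simp: sepa_def mem_act)
    moreover have "A = act f ` act (- f) ` A" by (simp add: image_image act_inv')
    ultimately show "A \<in> (\<lambda>A. act f ` A) ` sepa x y" by (rule rev_image_eqI)
  qed
  moreover have f: "finite (sepa x y)" "card (sepa x y) \<le> 1" using assms(2) by (auto simp: near_def)
  ultimately have "finite (sepa (act f x) (act f y))" "card (sepa (act f x) (act f y)) \<le> card ((\<lambda>A. act f ` A) ` sepa x y)"
    by (auto intro: finite_subset card_mono)
  then show ?thesis using assms act_V' card_image_le[OF f(1), of "\<lambda>A. act f ` A"] f(2) by (auto simp: near_def)
qed

lemma near_act_path:
  assumes "(x, y) \<in> near\<^sup>*" "f \<in> F" shows "(act f x, act f y) \<in> near\<^sup>*"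
  using assms(1)
proof (induction rule: rtrancl_induct)
  case (step y z)
  then show ?case using near_act[OF assms(2) step(2)] by auto
qed simp

lemma near_edge: "g \<in> F ==> ((g, b), (g, b')) \<in> near"
proof -
  assume g: "g \<in> F"
  show ?thesis
    by (cases b; cases b') (use g sepa_edge[OF g] sepa_K[OF g K_0] sepa_L[OF g L_0] in \<open>auto simp: near_def V_def\<close>)
qed

lemma near_path_base: "f \<in> F ==> ((0, True), (f, True)) \<in> near\<^sup>*"
proof (induction rule: F_induct)
  case (K k x)
  have kF: "k \<in> F" by (rule K_F[OF K(1)])
  have "((0, True), (k, True)) \<in> near" using sepa_K[OF H_F[OF H_0] K(1)] kF H_F[OF H_0] by (auto simp: near_def V_def)
  moreover have "((k, True), (k + x, True)) \<in> near\<^sup>*" using near_act_path[OF K(3) kF] by (simp add: act_def)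
  ultimately show ?case by (rule converse_rtrancl_into_rtrancl)
next
  case (L k x)
  have kF: "k \<in> F" using swap.K_F[OF L(1)] .
  have "((0, True), (0, False)) \<in> near" by (rule near_edge[OF H_F[OF H_0]])
  moreover have "((0, False), (k, False)) \<in> near" using sepa_L[OF H_F[OF H_0] L(1)] kF H_F[OF H_0] by (auto simp: near_def V_def)
  moreover have "((k, False), (k, True)) \<in> near" by (rule near_edge[OF kF])
  moreover have "((k, True), (k + x, True)) \<in> near\<^sup>*" using near_act_path[OF L(3) kF] by (simp add: act_def)
  ultimately show ?case by (meson converse_rtrancl_into_rtrancl)
qed simp

lemma near_path: assumes "u \<in> V" "v \<in> V" shows "(u, v) \<in> near\<^sup>*"
proof -
  obtain f b g c where u: "u = (f, b)" "f \<in> F" and v: "v = (g, c)" "g \<in> F" using assms by (auto simp: V_def)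
  have "((0, True), (- f + g, True)) \<in> near\<^sup>*" by (intro near_path_base F_add F_neg u v)
  from near_act_path[OF this u(2)] have "((f, True), (g, True)) \<in> near\<^sup>*" by (simp add: act_def add.assoc[symmetric])
  moreover have "((f, b), (f, True)) \<in> near" "((g, True), (g, c)) \<in> near" using near_edge u v by blast+
  ultimately show ?thesis unfolding u v by (meson converse_rtrancl_into_rtrancl rtrancl_into_rtrancl)
qed

lemma finite_sepa: assumes "u \<in> V" "v \<in> V" shows "finite (sepa u v)"
  using near_path[OF assms]
proof (induction rule: rtrancl_induct)
  case base
  then show ?case by (simp add: sepa_def)
next
  case (step y z)
  have "sepa u z \<subseteq> sepa u y \<union> sepa y z" by (auto simp: sepa_def)
  then show ?case using step by (auto simp: near_def intro: finite_subset)
qed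

lemma tree_action: "tree_action F V act HS"
proof
  show "0 \<in> F" by (rule H_F[OF H_0])
  show "f + g \<in> F" if "f \<in> F" "g \<in> F" for f g using that by (rule F_add)
  show "- f \<in> F" if "f \<in> F" for f using that by (rule F_neg)
  show "act 0 v = v" for v by (rule act_0')
  show "act (f + g) v = act f (act g v)" for f g v by (rule act_add')
  show "act f v \<in> V" if "f \<in> F" "v \<in> V" for f v using that by (rule act_V')
  show "A \<subseteq> V" if "A \<in> HS" for A using that by (rule HS_V)
  show "A \<noteq> {}" if A: "A \<in> HS" for A
  proof -
    obtain g where g: "g \<in> F" "A = act g ` P \<or> A = V - act g ` P" using A by (auto simp: HS_def)
    then have "A = act g ` P \<or> A = act g ` (V - P)" using act_compl by simp
    then show ?thesis using base_mem by auto
  qed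
  show "V - A \<in> HS" if "A \<in> HS" for A using that by (rule HS_compl')
  show "act f ` A \<in> HS" if "f \<in> F" "A \<in> HS" for f A using that by (rule HS_act')
  show "A \<subseteq> B \<or> B \<subseteq> A \<or> A \<inter> B = {} \<or> A \<union> B = V" if "A \<in> HS" "B \<in> HS" for A B using that by (rule HS_nested)
  show "finite {A \<in> HS. u \<in> A \<and> v \<notin> A}" if "u \<in> V" "v \<in> V" for u v
    using finite_sepa[OF that] by (simp add: sepa_def)
  show "(u, v) \<in> {(x, y). x \<in> V \<and> y \<in> V \<and> card {A \<in> HS. x \<in> A \<and> y \<notin> A} \<le> 1}\<^sup>*" if "u \<in> V" "v \<in> V" for u v
  proof -
    have "near \<subseteq> {(x, y). x \<in> V \<and> y \<in> V \<and> card {A \<in> HS. x \<in> A \<and> y \<notin> A} \<le> 1}" by (auto simp: near_def sepa_def)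
    then show ?thesis using near_path[OF that] rtrancl_mono by blast
  qed
qed

end

text \<open>A relator is described by a tuple \<open>(a, s, t, g)\<close>: it says that the alternating product
  of the letters \<open>s\<close> (at marks) or \<open>t\<close> (elsewhere) with \<open>a\<close> equals \<open>g\<close>.\<close>

locale relators = amalgam K L for K L :: "'g::group_add set" +
  fixes R :: "('g \<times> 'g \<times> 'g \<times> 'g) set"
  assumes R_mem: "\<And>a s t g. (a, s, t, g) \<in> R ==> a \<in> L \<and> a \<notin> K \<and> s \<in> K \<and> s \<notin> L \<and> t \<in> K \<and> t \<notin> L \<and> s \<noteq> t \<and> g \<in> K \<and> g \<in> L"
    and R_conj: "\<And>a s t g a' s' t' g' h1 h2. (a, s, t, g) \<in> R ==> (a', s', t', g') \<in> R ==>
      h1 \<in> H ==> h2 \<in> H ==> a = - h2 + a' + h1 ==> s = - h1 + s' + h2 ==> t = - h1 + t' + h2 ==> g = - h1 + g' + h1"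
    and mal_K: "\<And>k h. k \<in> K ==> k \<notin> L ==> h \<in> H ==> - k + h + k \<in> H ==> h = 0"
    and mal_L: "\<And>k h. k \<in> L ==> k \<notin> K ==> h \<in> H ==> - k + h + k \<in> H ==> h = 0"

sublocale relators \<subseteq> tree: tree_action F V act HS
  by (rule tree_action)

definition per :: int where "per = 2 * period"

text \<open>A stretch of \<open>2 * window\<close> letters contains \<open>window\<close> letters
  from \<open>K\<close>; the spare positions allow it to begin at the required parity.\<close>

definition wid :: int where "wid = 2 * window + 2"

text \<open>So many edges enclose \<open>3 * wid\<close> letters: three blocks, one of which is free
  of exceptional letters.\<close>

definition piece :: int where "piece = 3 * wid + 1"

text \<open>Here the choice of \<open>gap_min\<close> is tested: \<open>14 * piece + 2\<close> is
  85780, just below \<open>per\<close>. In terms of \<open>gap_min\<close> the period is quadratic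
  and the piece linear, and the inequality first holds at 169.\<close>

lemma per_eq: "per = 86530" and wid_eq: "wid = 2042" and piece_eq: "piece = 6127" and window_eq: "window = 1020"
  by (simp_all add: per_def period_eq wid_def window_def gap_min_def piece_def)

text \<open>Three blocks of length \<open>w\<close> and at most one bad index of each of two kinds
  leave one block free of both.\<close>

lemma free_window:
  fixes w :: int
  assumes "0 < w"
    and A: "\<And>t t'. A t ==> A t' ==> 0 \<le> t ==> t < 3 * w ==> 0 \<le> t' ==> t' < 3 * w ==> t = t'"
    and B: "\<And>t t'. B t ==> B t' ==> 0 \<le> t ==> t < 3 * w ==> 0 \<le> t' ==> t' < 3 * w ==> t = t'"
  shows "\<exists>t0. 0 \<le> t0 \<and> t0 \<le> 2 * w \<and> (\<forall>t. t0 \<le> t --> t < t0 + w --> \<not> A t \<and> \<not> B t)"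
proof (rule ccontr)
  assume c: "\<not> ?thesis"
  have "\<exists>t. t0 \<le> t \<and> t < t0 + w \<and> (A t \<or> B t)" if "0 \<le> t0" "t0 \<le> 2 * w" for t0
    using c that by blast
  from this[of 0] this[of w] this[of "2 * w"] obtain x y z where
    "0 \<le> x" "x < w" "A x \<or> B x" "w \<le> y" "y < w + w" "A y \<or> B y" "2 * w \<le> z" "z < 2 * w + w" "A z \<or> B z"
    using assms(1) by auto
  then show False using A[of x y] A[of x z] A[of y z] B[of x y] B[of x z] B[of y z] by auto
qed

lemma mod_unique_window:
  fixes i t t' :: int
  assumes "(i + t) mod per = r" "(i + t') mod per = r" "0 \<le> t" "t < 3 * wid" "0 \<le> t'" "t' < 3 * wid"
  shows "t = t'"
proof -
  have "(i + t) mod per = (i + t') mod per" using assms by simp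
  then have "per dvd (i + t) - (i + t')" by (simp only: mod_eq_dvd_iff)
  then have "per dvd t - t'" by simp
  moreover have "\<bar>t - t'\<bar> < per" using assms by (simp add: per_eq wid_eq)
  ultimately show ?thesis using zdvd_imp_le[of per "\<bar>t - t'\<bar>"] by (cases "t = t'") auto
qed

section \<open>Axes of the relators and their overlaps\<close>

context relators
begin

text \<open>The last letter of a period absorbs the right-hand side: with \<open>a - g\<close> in
  place of \<open>a\<close>, the relator is a product that must become trivial.\<close>

fun letter :: "'g \<times> 'g \<times> 'g \<times> 'g => int => 'g" where
  "letter (a, s, t, g) i = (if even i then (if mark (i div 2) then s else t)
     else if i mod per = per - 1 then a - g else a)"

primrec up :: "'g \<times> 'g \<times> 'g \<times> 'g => nat => 'g" where
  "up x 0 = 0"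
| "up x (Suc n) = up x n + letter x (int n)"

primrec down :: "'g \<times> 'g \<times> 'g \<times> 'g => nat => 'g" where
  "down x 0 = 0"
| "down x (Suc n) = down x n - letter x (- int n - 1)"

definition edge :: "'g \<times> 'g \<times> 'g \<times> 'g => int => 'g"
  where "edge x i = (if 0 \<le> i then up x (nat i) else down x (nat (- i)))"

definition rel :: "'g \<times> 'g \<times> 'g \<times> 'g => 'g" where "rel x = edge x per"

text \<open>Along the axis the edges are entered alternately from the two kinds of vertices;
  choosing sides by parity makes the half-spaces decrease.\<close>

definition wall :: "'g \<times> 'g \<times> 'g \<times> 'g => int => ('g \<times> bool) set"
  where "wall x i = (if odd i then act (edge x i) ` P else V - act (edge x i) ` P)"

lemma edge_0 [simp]: "edge x 0 = 0"
  by (simp add: edge_def)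

lemma edge_step: "edge x (i + 1) = edge x i + letter x i"
proof (cases "0 \<le> i")
  case True
  then have "nat (i + 1) = Suc (nat i)" by simp
  then show ?thesis using True by (simp add: edge_def)
next
  case False
  define n where "n = nat (- i - 1)"
  have n: "i = - int n - 1" using False by (simp add: n_def)
  have "edge x i = down x n - letter x i" using n by (simp add: edge_def nat_add_distrib)
  moreover have "edge x (i + 1) = down x n" using n by (simp add: edge_def)
  ultimately show ?thesis by simp
qed

lemma letter_period: "letter x (q * per + i) = letter x i"
proof -
  obtain a s t g where x: "x = (a, s, t, g)" by (cases x) auto
  have "q * per + i = i + q * period * 2" by (simp add: per_def)
  then have "(q * per + i) div 2 = (i + q * period * 2) div 2" by (rule arg_cong)
  also have "\<dots> = q * period + i div 2" by simp
  finally have "(q * per + i) div 2 = q * period + i div 2" .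
  then have "mark ((q * per + i) div 2) = mark (i div 2)" 
    using mark_period(2)[of "i div 2" q] by (simp only: add.commute)
  moreover have "even (q * per + i) = even i" by (simp add: per_def)
  moreover have "(q * per + i) mod per = i mod per" by simp
  ultimately show ?thesis unfolding x letter.simps by (simp only:)
qed

lemma edge_add_period: "edge x (q * per + i) = edge x (q * per) + edge x i"
proof (induction i rule: int_induct[where k = 0])
  case base
  then show ?case by simp
next
  case (step1 i)
  then show ?case using edge_step[of x "q * per + i"] edge_step[of x i] letter_period[of x q i] by (simp add: add.assoc)
next
  case (step2 i)
  have "edge x (q * per + i) = edge x (q * per + (i - 1)) + letter x (q * per + (i - 1))"
    using edge_step[of x "q * per + (i - 1)"] by (simp add: algebra_simps)
  moreover have "edge x i = edge x (i - 1) + letter x (i - 1)" using edge_step[of x "i - 1"] by simp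
  ultimately have "edge x (q * per + (i - 1)) + letter x (i - 1) = edge x (q * per) + edge x (i - 1) + letter x (i - 1)"
    using step2 letter_period[of x q "i - 1"] by (simp add: add.assoc)
  then show ?case by simp
qed

lemma edge_rel: "edge x (i + per) = rel x + edge x i"
  using edge_add_period[of x 1 i] by (simp add: rel_def add.commute)

lemma edge_period_commute: "edge x (q * per) + rel x = rel x + edge x (q * per)"
  using edge_add_period[of x q per] edge_rel[of x "q * per"] by (simp add: rel_def)

lemma letter_K: "x \<in> R ==> even i ==> letter x i \<in> K \<and> letter x i \<notin> L"
  by (cases x) (use R_mem in \<open>auto simp: even_iff_mod_2_eq_zero\<close>)

lemma letter_L:
  assumes "x \<in> R" "odd i" shows "letter x i \<in> L \<and> letter x i \<notin> K"
proof -
  obtain a s t g where x: "x = (a, s, t, g)" by (cases x) auto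
  note r = R_mem[OF assms(1)[unfolded x]]
  have "a - g \<in> L" using L_add[of a "- g"] L_neg[of g] r by simp
  moreover have "a - g \<notin> K" using K_add[of "a - g" g] r by auto
  ultimately show ?thesis using r assms(2) by (simp add: x)
qed

lemma L_F: "l \<in> L ==> l \<in> F"
  by (rule swap.K_F)

lemma letter_F: "x \<in> R ==> letter x i \<in> F"
  using letter_K letter_L K_F L_F by (cases "even i") blast+

lemma edge_F: "x \<in> R ==> edge x i \<in> F"
proof (induction i rule: int_induct[where k = 0])
  case base
  then show ?case using tree.F_0 by simp
next
  case (step1 i)
  then show ?case using edge_step[of x i] F_add letter_F by simp
next
  case (step2 i)
  have "edge x (i - 1) = edge x i + - letter x (i - 1)" using edge_step[of x "i - 1"] by simp
  then show ?case using F_add[OF _ F_neg] letter_F step2 by metis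
qed

lemma rel_F: "x \<in> R ==> rel x \<in> F"
  by (simp add: rel_def edge_F)

lemma translate_eq:
  assumes "g \<in> F" "h \<in> F" "act g ` P = act h ` P" shows "- h + g \<in> H"
proof (rule stab_P)
  show "- h + g \<in> F" using assms by (intro F_add F_neg)
  show "act (- h + g) ` P = P" by (simp add: act_image assms(3) image_image act_inv')
qed

lemma translate_neq:
  assumes "g \<in> F" "h \<in> F" shows "act g ` P \<noteq> V - act h ` P"
proof
  assume e: "act g ` P = V - act h ` P"
  have "act (- h + g) ` P = act (- h) ` (V - act h ` P)" by (simp add: act_image e)
  also have "\<dots> = V - P" using act_compl[OF F_neg[OF assms(2)], of "act h ` P"] by (simp add: image_image act_inv')
  finally show False using no_inversion[OF F_add[OF F_neg[OF assms(2)] assms(1)]] by simp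
qed

lemma wall_HS: "x \<in> R ==> wall x i \<in> HS"
  by (simp add: wall_def HS_P edge_F)

lemma act_wall: "x \<in> R ==> f \<in> F ==>
    act f ` wall x i = (if odd i then act (f + edge x i) ` P else V - act (f + edge x i) ` P)"
  by (simp add: wall_def act_image act_compl)

lemma compl_inject: "A \<subseteq> V ==> B \<subseteq> V ==> V - A = V - B ==> A = B"
  by blast

lemma translate_V: "g \<in> F ==> act g ` P \<subseteq> V"
  using HS_V HS_P(1) by blast

lemma wall_eq:
  assumes "x \<in> R" "x' \<in> R" "f \<in> F" "act f ` wall x i = wall x' j"
  shows "even i = even j" "- edge x' j + (f + edge x i) \<in> H"
proof -
  have e: "f + edge x i \<in> F" "edge x' j \<in> F" using assms by (auto intro: F_add edge_F)
  have q: "(if odd i then act (f + edge x i) ` P else V - act (f + edge x i) ` P) = (if odd j then act (edge x' j) ` P else V - act (edge x' j) ` P)"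
    using assms(4) act_wall[OF assms(1,3), of i] wall_def[of x' j] by simp
  show par: "even i = even j"
    using q translate_neq[OF e] translate_neq[OF e(2,1)] by (auto split: if_splits)
  have "act (f + edge x i) ` P = act (edge x' j) ` P"
    using q par compl_inject[OF translate_V[OF e(1)] translate_V[OF e(2)]] by (auto split: if_splits)
  then show "- edge x' j + (f + edge x i) \<in> H" by (rule translate_eq[OF e])
qed

lemma wall_eq_opp:
  assumes "x \<in> R" "x' \<in> R" "f \<in> F" "act f ` wall x i = V - wall x' j"
  shows "even i \<noteq> even j" "- edge x' j + (f + edge x i) \<in> H"
proof -
  have e: "f + edge x i \<in> F" "edge x' j \<in> F" using assms by (auto intro: F_add edge_F)
  have c: "V - (V - act (edge x' j) ` P) = act (edge x' j) ` P" using translate_V[OF e(2)] by blast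
  have q: "(if odd i then act (f + edge x i) ` P else V - act (f + edge x i) ` P) = (if odd j then V - act (edge x' j) ` P else act (edge x' j) ` P)"
    using assms(4) act_wall[OF assms(1,3), of i] wall_def[of x' j] c by simp
  show par: "even i \<noteq> even j"
    using q translate_neq[OF e] translate_neq[OF e(2,1)] by (auto split: if_splits)
  have "act (f + edge x i) ` P = act (edge x' j) ` P"
    using q par compl_inject[OF translate_V[OF e(1)] translate_V[OF e(2)]] by (auto split: if_splits)
  then show "- edge x' j + (f + edge x i) \<in> H" by (rule translate_eq[OF e])
qed

lemma wall_line:
  assumes x: "x \<in> R" shows "tree.line per (rel x) (wall x)"
proof -
  have sepa: "tree.sep u v = sepa u v" for u v by (simp add: tree.sep_def sepa_def)
  have eF: "edge x i \<in> F" for i by (rule edge_F[OF x])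
  let ?z = "\<lambda>i. (edge x i, even i)"
  have zV: "?z i \<in> V" for i using eF by (simp add: V_def)
  have sz: "tree.sep (?z i) (?z (i - 1)) = {wall x i}" for i
  proof -
    have e: "edge x i = edge x (i - 1) + letter x (i - 1)" using edge_step[of x "i - 1"] by simp
    \<comment> \<open>A letter stays inside the coset of its own factor, so both points name the
      same vertex of the tree.\<close>
    have "tree.sep (?z (i - 1)) (edge x i, even (i - 1)) = {}"
    proof (cases "even (i - 1)")
      case True
      then show ?thesis using sepa_K[OF eF, of "letter x (i - 1)" "i - 1"] letter_K[OF x True] unfolding sepa e by simp
    next
      case False
      then show ?thesis using sepa_L[OF eF, of "letter x (i - 1)" "i - 1"] letter_L[OF x False] unfolding sepa e by simp
    qed
    then have "?z (i - 1) \<in> A \<longleftrightarrow> (edge x i, even (i - 1)) \<in> A" if "A \<in> HS" for A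
      using tree.same_side[OF zV, of "(edge x i, even (i - 1))" "i - 1"] eF that by (auto simp: V_def)
    then have "tree.sep (?z i) (?z (i - 1)) = sepa (?z i) (edge x i, even (i - 1))"
      unfolding tree.sep_def sepa_def by blast
    also have "\<dots> = {wall x i}" using sepa_edge[OF eF[of i]] by (simp add: wall_def)
    finally show ?thesis .
  qed
  show ?thesis
  proof (rule tree.lineI[where z = ?z])
    show "rel x \<in> F" by (rule rel_F[OF x])
    fix i
    show "wall x i \<in> HS" by (rule wall_HS[OF x])
    have ev: "even (i + per) = even i" by (simp add: per_def)
    have "act (rel x) ` wall x i = (if odd i then act (rel x + edge x i) ` P else V - act (rel x + edge x i) ` P)"
      by (rule act_wall[OF x rel_F[OF x]])
    also have "\<dots> = wall x (i + per)" by (simp only: wall_def edge_rel ev)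
    finally show "act (rel x) ` wall x i = wall x (i + per)" .
    show "?z i \<in> V" by (rule zV)
    show "tree.sep (?z i) (?z (i - 1)) = {wall x i}" by (rule sz)
    show "act (rel x) (?z i) = ?z (i + per)" using ev per_eq by (simp add: act_def edge_rel del: even_add)
    have "wall x (i + 1) \<subseteq> wall x i"
    proof (cases "even i")
      case True
      have "act (letter x i) ` P \<subseteq> V - P" using letter_K[OF x True] by (intro K_P) auto
      then have "act (edge x i) ` act (letter x i) ` P \<subseteq> act (edge x i) ` (V - P)" by (rule image_mono)
      then show ?thesis using True by (simp add: wall_def edge_step act_image act_compl[OF eF])
    next
      case False
      have "act (letter x i) ` (V - P) \<subseteq> P" using letter_L[OF x False] by (intro L_P) auto
      then have "act (edge x i) ` act (letter x i) ` (V - P) \<subseteq> act (edge x i) ` P" by (rule image_mono)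
      then show ?thesis using False by (simp add: wall_def edge_step act_image act_compl[OF eF] act_compl[OF letter_F[OF x]])
    qed
    moreover have "?z i \<in> wall x i" "?z i \<notin> wall x (i + 1)"
      using sz[of i] sz[of "i + 1"] by (auto simp: tree.sep_def)
    ultimately show "wall x (i + 1) \<subset> wall x i" by blast
  qed
qed

text \<open>Comparing the two expressions, \<open>a\<close> conjugates \<open>h' - h\<close> into
  \<open>H\<close>, and malnormality of \<open>H\<close> in \<open>L\<close> makes it 0.\<close>

lemma mal_L_unique:
  assumes "a \<in> L" "a \<notin> K" "h \<in> H" "h' \<in> H" "k \<in> H" "k' \<in> H" "- h + a + k = - h' + a + k'"
  shows "h = h'" "k = k'"
proof -
  have "h' + (- h + a + k) - k = h' + (- h' + a + k') - k" using assms(7) by simp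
  then have e: "h' - h + a = a + (k' - k)" by (simp add: diff_conv_add_uminus add.assoc del: add_uminus_conv_diff)
  then have "- a + (h' - h) + a = k' - k" by (simp add: add.assoc)
  then have "h' - h = 0"
    using mal_L[OF assms(1,2), of "h' - h"] H_add[OF _ H_neg] assms(3-6) by (metis diff_conv_add_uminus)
  then show "h = h'" by simp
  then show "k = k'" using assms(7) by simp
qed

text \<open>Long pieces: in a window of the common segment that avoids the exceptional letters, malnormality
  of \<open>H\<close> makes the elements of \<open>H\<close> relating the two reading frames alternate between two values.\<close>

lemma clean_window:
  assumes par: "\<And>t. 0 \<le> t ==> t < piece ==> h t \<in> H"
    and c: "\<And>t. 0 \<le> t ==> t < piece - 1 ==> c t = - h t + d t + h (t + 1)"
    and a': "a' \<in> L" "a' \<notin> K"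
    and ca: "\<And>t. odd (i + t) ==> \<not> A t ==> c t = a" and da: "\<And>t. odd (i + t) ==> \<not> B t ==> d t = a'"
    and A: "\<And>t t'. A t ==> A t' ==> 0 \<le> t ==> t < 3 * wid ==> 0 \<le> t' ==> t' < 3 * wid ==> t = t'"
    and B: "\<And>t t'. B t ==> B t' ==> 0 \<le> t ==> t < 3 * wid ==> 0 \<le> t' ==> t' < 3 * wid ==> t = t'"
  obtains t1 where "0 \<le> t1" "t1 + 2 * window + 1 < piece" "odd (i + t1)" "a = - h t1 + a' + h (t1 + 1)"
    "\<And>u. 0 \<le> u ==> u < window ==> c (t1 + 1 + 2 * u) = - h (t1 + 1) + d (t1 + 1 + 2 * u) + h t1"
proof -
  obtain t0 where t0: "0 \<le> t0" "t0 \<le> 2 * wid" "\<And>t. t0 \<le> t ==> t < t0 + wid ==> \<not> A t \<and> \<not> B t"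
    using free_window[of wid A B] A B by (auto simp: wid_eq)
  \<comment> \<open>The window must begin with a letter from \<open>L\<close>, to which malnormality
    of \<open>H\<close> in \<open>L\<close> applies; this may cost one spare position of
    \<open>wid\<close>.\<close>
  define t1 where "t1 = (if odd (i + t0) then t0 else t0 + 1)"
  have t1: "0 \<le> t1" "t0 \<le> t1" "t1 \<le> t0 + 1" "odd (i + t1)" using t0 by (auto simp: t1_def)
  have La: "a = - h (t1 + 2 * u) + a' + h (t1 + 2 * u + 1)" if "0 \<le> u" "u \<le> window" for u
  proof -
    let ?t = "t1 + 2 * u"
    have b: "t0 \<le> ?t" "?t < t0 + wid" "?t < piece - 1" "0 \<le> ?t" using that t0 t1 by (auto simp: wid_eq window_eq piece_eq)
    have o: "odd (i + ?t)" using t1(4) by simp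
    show ?thesis using c[OF b(4,3)] ca[OF o] da[OF o] t0(3)[OF b(1,2)] by simp
  qed
  have hs: "h (t1 + 2 * u) = h t1 \<and> h (t1 + 2 * u + 1) = h (t1 + 1)" if "0 \<le> u" "u \<le> window" for u
  proof -
    have "0 \<le> t1 + 2 * u" "t1 + 2 * u + 1 < piece" "t1 + 1 < piece"
      using that t0 t1 by (auto simp: wid_eq window_eq piece_eq)
    then have m: "h (t1 + 2 * u) \<in> H" "h (t1 + 2 * u + 1) \<in> H" "h t1 \<in> H" "h (t1 + 1) \<in> H"
      using par t1(1) by auto
    have "- h (t1 + 2 * u) + a' + h (t1 + 2 * u + 1) = - h t1 + a' + h (t1 + 1)"
      using La[OF that] La[of 0] by (simp add: window_eq)
    then show ?thesis using mal_L_unique[OF a' m(1) m(3) m(2) m(4)] by blast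
  qed
  have "c (t1 + 1 + 2 * u) = - h (t1 + 1) + d (t1 + 1 + 2 * u) + h t1" if "0 \<le> u" "u < window" for u
  proof -
    have b: "0 \<le> t1 + 1 + 2 * u" "t1 + 1 + 2 * u < piece - 1" using that t0 t1 by (auto simp: wid_eq window_eq piece_eq)
    have 1: "h (t1 + 1 + 2 * u) = h (t1 + 1)" using hs[of u] that by (simp add: algebra_simps)
    have 2: "h (t1 + 1 + 2 * u + 1) = h t1" using hs[of "u + 1"] that by (simp add: algebra_simps)
    show ?thesis using c[OF b] unfolding 1 2 .
  qed
  moreover have "t1 + 2 * window + 1 < piece" using t0 t1 by (auto simp: wid_eq window_eq piece_eq)
  ultimately show ?thesis using that[of t1] t1 La[of 0] by (simp add: window_eq)
qed

text \<open>An injective map can only match the two letters or exchange them, and the same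
  alternative holds at every position.\<close>

lemma pattern_dichotomy:
  assumes "s \<noteq> t" "inj \<phi>" "s' \<noteq> t'" "\<And>u. Q u ==> (if X u then s else t) = \<phi> (if Y u then s' else t')"
  shows "(\<forall>u. Q u --> X u = Y u) \<or> (\<forall>u. Q u --> X u \<noteq> Y u)"
proof (rule ccontr)
  assume "\<not> ?thesis"
  then obtain u v where "Q u" "X u \<noteq> Y u" "Q v" "X v = Y v" by blast
  then show False using assms(4)[of u] assms(4)[of v] assms(1,3) inj_eq[OF assms(2), of s' t']
    by (auto split: if_splits)
qed


lemma letter_even: "letter (a, s, t, g) (2 * k) = (if mark k then s else t)"
  by simp

lemma frame_step:
  "- (- edge x' j + (f + edge x i)) + letter x' j + (- edge x' (j + 1) + (f + edge x (i + 1))) = letter x i"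
  by (simp add: edge_step minus_add add.assoc diff_conv_add_uminus del: add_uminus_conv_diff)

lemma frame_step_rev:
  "- (- edge x' j + (f + edge x i)) + - letter x' (j - 1) + (- edge x' (j - 1) + (f + edge x (i + 1))) = letter x i"
proof -
  have e: "edge x' j = edge x' (j - 1) + letter x' (j - 1)" using edge_step[of x' "j - 1"] by simp
  show ?thesis unfolding e edge_step[of x i]
    by (simp add: minus_add add.assoc diff_conv_add_uminus del: add_uminus_conv_diff)
qed

text \<open>On a clean window the reading frames differ by two fixed elements of \<open>H\<close>,
  so the patterns of marks agree or are complementary, and the latter is impossible. Then the
  letters correspond, \<open>R_conj\<close> makes the values correspond too, and the agreement
  spreads from the window to the whole axes.\<close>

lemma same_piece:
  assumes x: "x \<in> R" "x' \<in> R" "f \<in> F" and w: "\<And>t. 0 \<le> t ==> t < piece ==> act f ` wall x (i + t) = wall x' (j + t)"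
  shows "f + rel x - f = rel x'"
proof -
  obtain a s t g where xa: "x = (a, s, t, g)" by (cases x) auto
  obtain a' s' t' g' where xa': "x' = (a', s', t', g')" by (cases x') auto
  note r = R_mem[OF x(1)[unfolded xa]] and r' = R_mem[OF x(2)[unfolded xa']]
  define h where "h u = - edge x' (j + u) + (f + edge x (i + u))" for u
  have hH: "h u \<in> H" if "0 \<le> u" "u < piece" for u unfolding h_def by (rule wall_eq(2)[OF x w[OF that]])
  have par: "even i = even j" using wall_eq(1)[OF x w[of 0]] by (simp add: piece_eq)
  obtain t1 where t1: "0 \<le> t1" "t1 + 2 * window + 1 < piece" "odd (i + t1)" "a = - h t1 + a' + h (t1 + 1)"
    "\<And>u. 0 \<le> u ==> u < window ==> letter x (i + (t1 + 1 + 2 * u)) = - h (t1 + 1) + letter x' (j + (t1 + 1 + 2 * u)) + h t1"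
  proof (rule clean_window[where h = h and c = "\<lambda>u. letter x (i + u)" and d = "\<lambda>u. letter x' (j + u)" and a = a and a' = a'
        and i = i and A = "\<lambda>u. (i + u) mod per = per - 1" and B = "\<lambda>u. (j + u) mod per = per - 1"])
    show "letter x (i + u) = - h u + letter x' (j + u) + h (u + 1)" if "0 \<le> u" "u < piece - 1" for u
      using frame_step[of x' "j + u" f x "i + u"] by (simp add: h_def add.assoc)
    show "letter x (i + u) = a" if "odd (i + u)" "\<not> (i + u) mod per = per - 1" for u using that by (simp add: xa)
    show "letter x' (j + u) = a'" if "odd (i + u)" "\<not> (j + u) mod per = per - 1" for u
      using that par by (simp add: xa')
    show "u = u'" if "(i + u) mod per = per - 1" "(i + u') mod per = per - 1"
      "0 \<le> u" "u < 3 * wid" "0 \<le> u'" "u' < 3 * wid" for u u'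
      using that by (rule mod_unique_window)
    show "u = u'" if "(j + u) mod per = per - 1" "(j + u') mod per = per - 1"
      "0 \<le> u" "u < 3 * wid" "0 \<le> u'" "u' < 3 * wid" for u u'
      using that by (rule mod_unique_window)
    show "h u \<in> H" if "0 \<le> u" "u < piece" for u using that by (rule hH)
  qed (use r' in simp_all)
  let ?hL = "h t1" and ?hR = "h (t1 + 1)"
  have H: "?hL \<in> H" "?hR \<in> H" using hH t1(1,2) by (auto simp: window_eq)
  obtain X where X: "i + t1 + 1 = 2 * X" using t1(3) by (metis even_plus_one_iff evenE)
  have "odd (j + t1)" using t1(3) par by simp
  then obtain Y where Y: "j + t1 + 1 = 2 * Y" by (metis even_plus_one_iff evenE)
  \<comment> \<open>The change of frame for letters from \<open>K\<close>, constant along the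
    window.\<close>
  let ?\<phi> = "\<lambda>y. - ?hR + y + ?hL"
  have inj: "inj ?\<phi>" by (intro injI) simp
  have pat: "(if mark (X + u) then s else t) = ?\<phi> (if mark (Y + u) then s' else t')" if "0 \<le> u" "u < window" for u
  proof -
    have e: "i + (t1 + 1 + 2 * u) = 2 * (X + u)" "j + (t1 + 1 + 2 * u) = 2 * (Y + u)" using X Y by auto
    show ?thesis using t1(5)[OF that] unfolding e xa xa' letter_even .
  qed
  have "(\<forall>u. 0 \<le> u \<and> u < window --> mark (X + u) = mark (Y + u)) \<or> (\<forall>u. 0 \<le> u \<and> u < window --> mark (X + u) \<noteq> mark (Y + u))"
    using pattern_dichotomy[OF _ inj, of s t s' t' "\<lambda>u. 0 \<le> u \<and> u < window" "\<lambda>u. mark (X + u)" "\<lambda>u. mark (Y + u)"] r r' pat by blast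
  then have eq: "mark (X + u) = mark (Y + u)" if "0 \<le> u" "u < window" for u
    using window_not_compl[of X Y] that by blast
  have XY: "X mod period = Y mod period" by (rule window_unique) (rule eq)
  obtain k where k: "0 \<le> k" "k < window - 2" "mark (X + k)" "\<not> mark (X + (k + 1))"
    using window_mark[of X] by (auto simp: add.assoc)
  have s: "s = - ?hR + s' + ?hL" using pat[of k] eq[of k] k by simp
  have t: "t = - ?hR + t' + ?hL" using pat[of "k + 1"] eq[of "k + 1"] k by simp
  \<comment> \<open>This makes the exceptional letters correspond as well, although the window
    avoided them.\<close>
  have g: "g = - ?hR + g' + ?hR"
    by (rule R_conj[OF x(1)[unfolded xa] x(2)[unfolded xa'] H(2,1) t1(4) s t])
  have le: "letter x (2 * k) = - ?hR + letter x' (2 * k) + ?hL" for k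
    unfolding xa xa' letter_even using s t by simp
  have lo: "letter x (2 * k + 1) = - ?hL + letter x' (2 * k + 1) + ?hR" for k
  proof -
    have "a - g = - ?hL + (a' - g') + ?hR"
      unfolding t1(4) g by (simp add: diff_conv_add_uminus minus_add add.assoc del: add_uminus_conv_diff)
    then show ?thesis using t1(4) unfolding xa xa' by simp
  qed
  have edges: "edge x (2 * k) = - ?hR + edge x' (2 * k) + ?hR" for k
  proof (induction k rule: int_induct[where k = 0])
    case base
    then show ?case by simp
  next
    case (step1 k)
    have e: "edge z (2 * (k + 1)) = edge z (2 * k) + letter z (2 * k) + letter z (2 * k + 1)" for z
      using edge_step[of z "2 * k"] edge_step[of z "2 * k + 1"] by (simp add: algebra_simps)
    show ?case unfolding e step1 le lo by (simp add: add.assoc)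
  next
    case (step2 k)
    have e: "edge z (2 * k) = edge z (2 * (k - 1)) + letter z (2 * (k - 1)) + letter z (2 * (k - 1) + 1)" for z
      using edge_step[of z "2 * (k - 1)"] edge_step[of z "2 * (k - 1) + 1"] by (simp add: algebra_simps)
    have "edge x (2 * (k - 1)) + letter x (2 * (k - 1)) + letter x (2 * (k - 1) + 1) =
      (- ?hR + edge x' (2 * (k - 1)) + ?hR) + letter x (2 * (k - 1)) + letter x (2 * (k - 1) + 1)"
      unfolding e[symmetric] step2 unfolding e le lo by (simp add: add.assoc)
    then show ?case by simp
  qed
  \<comment> \<open>Positions agree only modulo the period, so \<open>f\<close> is determined up to
    a translation along the axis of \<open>x'\<close> by whole periods; this commutes with
    \<open>rel x'\<close>.\<close>
  have "period dvd Y - X" using XY by (metis mod_eq_dvd_iff)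
  then obtain q where "Y - X = period * q" by (rule dvdE)
  then have q: "Y = q * period + X" by (simp add: algebra_simps)
  then have "2 * Y = q * per + 2 * X" by (simp add: per_def)
  then have eY: "edge x' (2 * Y) = edge x' (q * per) + edge x' (2 * X)" by (simp add: edge_add_period)
  let ?d = "edge x' (q * per)"
  have "?hR = - edge x' (2 * Y) + (f + edge x (2 * X))" using X Y by (simp add: h_def add.assoc)
  then have "edge x' (2 * Y) + ?hR = f + edge x (2 * X)" by (simp add: add.assoc[symmetric])
  then have "?d + edge x' (2 * X) + ?hR = f + (- ?hR + edge x' (2 * X) + ?hR)" unfolding eY edges[of X] .
  then have "(?d + ?hR) + (- ?hR + edge x' (2 * X) + ?hR) = f + (- ?hR + edge x' (2 * X) + ?hR)" by (simp add: add.assoc)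
  then have f: "f = ?d + ?hR" by simp
  have rx: "rel x = - ?hR + rel x' + ?hR" using edges[of period] by (simp add: rel_def per_def)
  have "f + rel x - f = ?d + rel x' - ?d"
    unfolding f rx by (simp add: diff_conv_add_uminus minus_add add.assoc del: add_uminus_conv_diff)
  then show ?thesis using edge_period_commute[of x' q] by simp
qed

text \<open>With opposite orientation the letters of \<open>x'\<close> are read backwards and
  inverted, and no window of marks equals a reversed one or the complement of one.\<close>

lemma opposite_piece:
  assumes x: "x \<in> R" "x' \<in> R" "f \<in> F" and w: "\<And>t. 0 \<le> t ==> t < piece ==> act f ` wall x (i + t) = V - wall x' (j - t)"
  shows False
proof -
  obtain a s t g where xa: "x = (a, s, t, g)" by (cases x) auto
  obtain a' s' t' g' where xa': "x' = (a', s', t', g')" by (cases x') auto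
  note r = R_mem[OF x(1)[unfolded xa]] and r' = R_mem[OF x(2)[unfolded xa']]
  define h where "h u = - edge x' (j - u) + (f + edge x (i + u))" for u
  have hH: "h u \<in> H" if "0 \<le> u" "u < piece" for u unfolding h_def by (rule wall_eq_opp(2)[OF x w[OF that]])
  have par: "even i \<noteq> even j" using wall_eq_opp(1)[OF x w[of 0]] by (simp add: piece_eq)
  obtain t1 where t1: "0 \<le> t1" "t1 + 2 * window + 1 < piece" "odd (i + t1)"
    "\<And>u. 0 \<le> u ==> u < window ==> letter x (i + (t1 + 1 + 2 * u)) = - h (t1 + 1) + - letter x' (j - (t1 + 1 + 2 * u) - 1) + h t1"
  proof (rule clean_window[where h = h and c = "\<lambda>u. letter x (i + u)" and d = "\<lambda>u. - letter x' (j - u - 1)" and a = a and a' = "- a'"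
        and i = i and A = "\<lambda>u. (i + u) mod per = per - 1" and B = "\<lambda>u. (j - u - 1) mod per = per - 1"])
    show "letter x (i + u) = - h u + - letter x' (j - u - 1) + h (u + 1)" if "0 \<le> u" "u < piece - 1" for u
      using frame_step_rev[of x' "j - u" f x "i + u"] by (simp add: h_def algebra_simps)
    show "letter x (i + u) = a" if "odd (i + u)" "\<not> (i + u) mod per = per - 1" for u using that by (simp add: xa)
    show "- letter x' (j - u - 1) = - a'" if "odd (i + u)" "\<not> (j - u - 1) mod per = per - 1" for u
      using that par by (simp add: xa')
    show "- a' \<in> L" "- a' \<notin> K" using r' L_neg K_neg[of "- a'"] by auto
    show "u = u'" if "(j - u - 1) mod per = per - 1" "(j - u' - 1) mod per = per - 1"
      "0 \<le> u" "u < 3 * wid" "0 \<le> u'" "u' < 3 * wid" for u u'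
      using mod_unique_window[of "j - 3 * wid" "3 * wid - 1 - u" "per - 1" "3 * wid - 1 - u'"] that by (simp add: algebra_simps)
    show "u = u'" if "(i + u) mod per = per - 1" "(i + u') mod per = per - 1"
      "0 \<le> u" "u < 3 * wid" "0 \<le> u'" "u' < 3 * wid" for u u'
      using that by (rule mod_unique_window)
    show "h u \<in> H" if "0 \<le> u" "u < piece" for u using that by (rule hH)
  qed (simp_all)
  let ?hL = "h t1" and ?hR = "h (t1 + 1)"
  obtain X where X: "i + t1 + 1 = 2 * X" using t1(3) by (metis even_plus_one_iff evenE)
  have "even (j - (t1 + 1) - 1)" using t1(3) par by simp
  then obtain Y where Y: "j - (t1 + 1) - 1 = 2 * Y" by (metis evenE)
  let ?\<phi> = "\<lambda>y. - ?hR + - y + ?hL"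
  have inj: "inj ?\<phi>" by (intro injI) (simp only: add_right_cancel add_left_cancel neg_equal_iff_equal)
  have pat: "(if mark (X + u) then s else t) = ?\<phi> (if mark (Y - u) then s' else t')" if "0 \<le> u" "u < window" for u
  proof -
    have e: "i + (t1 + 1 + 2 * u) = 2 * (X + u)" "j - (t1 + 1 + 2 * u) - 1 = 2 * (Y - u)" using X Y by auto
    show ?thesis using t1(4)[OF that] unfolding e xa xa' letter_even .
  qed
  have "(\<forall>u. 0 \<le> u \<and> u < window --> mark (X + u) = mark (Y - u)) \<or> (\<forall>u. 0 \<le> u \<and> u < window --> mark (X + u) \<noteq> mark (Y - u))"
    using pattern_dichotomy[OF _ inj, of s t s' t' "\<lambda>u. 0 \<le> u \<and> u < window" "\<lambda>u. mark (X + u)" "\<lambda>u. mark (Y - u)"] r r' pat by blast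
  then show False using window_not_rev[of X Y] window_not_rev_compl[of X Y] by blast
qed

end

section \<open>Malnormality of the factors in the amalgam\<close>

context amalgam
begin

text \<open>Suppose \<open>f\<close> begins with a syllable \<open>l\<close> from
  \<open>L - K\<close>. Then \<open>k\<close> lies in \<open>H\<close>, as otherwise
  \<open>k + f\<close> and \<open>f + k'\<close> begin on different sides; one syllable later the
  same reason puts the conjugate of \<open>k\<close> by \<open>l\<close> into \<open>H\<close>. Now
  malnormality of \<open>H\<close> in \<open>L\<close> applies. An initial syllable from
  \<open>K\<close> is removed by conjugation.\<close>

lemma K_malnormal:
  assumes mal: "\<And>l h. l \<in> L ==> l \<notin> K ==> h \<in> H ==> - l + h + l \<in> H ==> h = 0"
    and k: "k \<in> K" "k' \<in> K" and f: "f \<in> F" "f \<notin> K" and e: "k + f = f + k'"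
  shows "k = 0"
proof -
  have main: "k = 0" if k: "k \<in> K" "k' \<in> K" and f: "alt L K f" and e: "k + f = f + k'" for k k' f
  proof -
    obtain l y where l: "l \<in> L" "l \<notin> K" "f = l + y" and y: "y = 0 \<or> alt K L y"
      using f by (cases rule: alt.cases) (force, blast)
    have "k \<in> L"
    proof (rule ccontr)
      assume "k \<notin> L"
      then have "alt K L (k + f)" using k(1) f by (intro alt_step)
      moreover have "alt L K (f + k')" by (rule swap.alt_add_L[OF f k(2)])
      ultimately show False using alt_disj e by simp
    qed
    then have kH: "k \<in> H" using k by (simp add: H_def)
    let ?l = "- l + k + l"
    have eq: "?l + y = y + k'"
    proof -
      have "?l + y = - l + (k + f)" by (simp add: l(3) add.assoc)
      also have "\<dots> = y + k'" unfolding e by (simp add: l(3) add.assoc)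
      finally show ?thesis .
    qed
    have "?l \<in> K"
    proof (rule ccontr)
      assume n: "?l \<notin> K"
      have "?l \<in> L" using \<open>k \<in> L\<close> l(1) L_add L_neg by blast
      then have a: "alt L K (y + k')" using swap.alt_K_add[of ?l y] n y H_0 unfolding eq by blast
      show False
      proof (cases "y = 0")
        case True
        then show False using a alt_L k(2) by simp
      next
        case False
        then show False using y alt_add_K[of y k'] k(2) a alt_disj swap.alt_not_H by blast
      qed
    qed
    moreover have "?l \<in> L" using \<open>k \<in> L\<close> l(1) L_add L_neg by blast
    ultimately show "k = 0" using mal[OF l(1,2) kH] by (simp add: H_def)
  qed
  have "alt L K f \<or> alt K L f" using f by (auto simp: F_def H_def)
  then show ?thesis
  proof
    assume "alt K L f"
    then obtain k1 y where y: "k1 \<in> K" "f = k1 + y" "alt L K y" using f(2) by (cases rule: alt.cases) auto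
    have "(- k1 + k + k1) + y = - k1 + (k + f)" by (simp add: y(2) add.assoc)
    also have "\<dots> = y + k'" unfolding e by (simp add: y(2) add.assoc)
    finally have "- k1 + k + k1 = 0" using main[of "- k1 + k + k1" k' y] y k K_add K_neg by blast
    then have "k1 + (- k1 + k + k1) - k1 = 0" by simp
    then show "k = 0" by (simp add: add.assoc)
  qed (use main k e in blast)
qed

end

section \<open>The small cancellation family of all conjugates\<close>

context relators
begin

definition fam :: "('g \<times> (int => ('g \<times> bool) set)) set"
  where "fam = {(f + rel x - f, \<lambda>i. act f ` wall x i) | f x. f \<in> F \<and> x \<in> R}"

definition LL :: "('g \<times> (int => ('g \<times> bool) set)) set"
  where "LL = fam \<union> {(- \<rho>, \<lambda>i. V - \<beta> (- i)) | \<rho> \<beta>. (\<rho>, \<beta>) \<in> fam}"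

lemma fam_line: "(\<rho>, \<beta>) \<in> fam ==> tree.line per \<rho> \<beta>"
  unfolding fam_def using tree.line_act[OF wall_line] by blast

lemma fam_conj:
  assumes "(\<rho>, \<beta>) \<in> fam" "f \<in> F" shows "(f + \<rho> - f, \<lambda>i. act f ` \<beta> i) \<in> fam"
proof -
  obtain f' x where x: "\<rho> = f' + rel x - f'" "\<beta> = (\<lambda>i. act f' ` wall x i)" "f' \<in> F" "x \<in> R"
    using assms(1) unfolding fam_def by blast
  have "f + \<rho> - f = (f + f') + rel x - (f + f')"
    by (simp add: x(1) diff_conv_add_uminus minus_add add.assoc del: add_uminus_conv_diff)
  moreover have "(\<lambda>i. act f ` \<beta> i) = (\<lambda>i. act (f + f') ` wall x i)" by (simp add: x(2) act_image)
  ultimately show ?thesis using F_add[OF assms(2) x(3)] x(4) unfolding fam_def by blast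
qed

lemma fam_V: "(\<rho>, \<beta>) \<in> fam ==> \<beta> i \<subseteq> V"
  using tree.lineD(2)[OF fam_line] HS_V by blast

lemma fam_same:
  assumes "(\<rho>, \<beta>) \<in> fam" "(\<rho>', \<beta>') \<in> fam" "\<And>t. 0 \<le> t ==> t < piece ==> \<beta> (i + t) = \<beta>' (j + t)"
  shows "\<rho> = \<rho>'"
proof -
  obtain f x where x: "\<rho> = f + rel x - f" "\<beta> = (\<lambda>i. act f ` wall x i)" "f \<in> F" "x \<in> R"
    using assms(1) unfolding fam_def by blast
  obtain f' x' where x': "\<rho>' = f' + rel x' - f'" "\<beta>' = (\<lambda>i. act f' ` wall x' i)" "f' \<in> F" "x' \<in> R"
    using assms(2) unfolding fam_def by blast
  have "(- f' + f) + rel x - (- f' + f) = rel x'"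
  proof (rule same_piece[OF x(4) x'(4) F_add[OF F_neg[OF x'(3)] x(3)]])
    fix t assume "0 \<le> t" "t < piece"
    then have "act f ` wall x (i + t) = act f' ` wall x' (j + t)" using assms(3)[of t] unfolding x(2) x'(2) by blast
    then have "act (- f') ` act f ` wall x (i + t) = act (- f') ` act f' ` wall x' (j + t)" by simp
    then show "act (- f' + f) ` wall x (i + t) = wall x' (j + t)" by (simp add: act_image)
  qed
  then have "\<rho>' = f' + ((- f' + f) + rel x - (- f' + f)) - f'" unfolding x'(1) by simp
  also have "\<dots> = \<rho>" unfolding x(1) by (simp add: diff_conv_add_uminus minus_add add.assoc del: add_uminus_conv_diff)
  finally show ?thesis by simp
qed

lemma fam_opp:
  assumes "(\<rho>, \<beta>) \<in> fam" "(\<rho>', \<beta>') \<in> fam" "\<And>t. 0 \<le> t ==> t < piece ==> \<beta> (i + t) = V - \<beta>' (j - t)"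
  shows False
proof -
  obtain f x where x: "\<rho> = f + rel x - f" "\<beta> = (\<lambda>i. act f ` wall x i)" "f \<in> F" "x \<in> R"
    using assms(1) unfolding fam_def by blast
  obtain f' x' where x': "\<rho>' = f' + rel x' - f'" "\<beta>' = (\<lambda>i. act f' ` wall x' i)" "f' \<in> F" "x' \<in> R"
    using assms(2) unfolding fam_def by blast
  show False
  proof (rule opposite_piece[OF x(4) x'(4) F_add[OF F_neg[OF x'(3)] x(3)]])
    fix t assume "0 \<le> t" "t < piece"
    then have "act f ` wall x (i + t) = V - act f' ` wall x' (j - t)" using assms(3)[of t] unfolding x(2) x'(2) by blast
    then have "act (- f') ` act f ` wall x (i + t) = act (- f') ` (V - act f' ` wall x' (j - t))" by simp
    then show "act (- f' + f) ` wall x (i + t) = V - wall x' (j - t)"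
      using act_compl[OF F_neg[OF x'(3)], of "act f' ` wall x' (j - t)"] by (simp add: act_image)
  qed
qed

lemma LL_neg: "(\<sigma>, \<gamma>) \<in> fam ==> (- \<sigma>, \<lambda>i. V - \<gamma> (- i)) \<in> LL"
  unfolding LL_def by blast

lemma LL_cases:
  assumes "(\<rho>, \<beta>) \<in> LL"
  obtains (pos) "(\<rho>, \<beta>) \<in> fam" | (neg) \<sigma> \<gamma> where "(\<sigma>, \<gamma>) \<in> fam" "\<rho> = - \<sigma>" "\<beta> = (\<lambda>i. V - \<gamma> (- i))"
  using assms unfolding LL_def by blast

lemma rev_step: "\<gamma> (- (i + (piece - 1 - t))) = \<gamma> ((- i - piece + 1) + t)" for \<gamma> :: "int => 'x set"
  by (rule arg_cong[of _ _ \<gamma>]) simp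

lemma windmill: "windmill F V act HS LL per piece"
proof (unfold_locales)
  fix \<rho> \<beta> assume "(\<rho>, \<beta>) \<in> LL"
  then show "tree.line per \<rho> \<beta>" by (cases rule: LL_cases) (use fam_line tree.line_rev in blast)+
next
  fix \<rho> \<beta> f assume "(\<rho>, \<beta>) \<in> LL" and f: "f \<in> F"
  then show "(f + \<rho> - f, \<lambda>i. act f ` \<beta> i) \<in> LL"
  proof (cases rule: LL_cases)
    case pos
    then show ?thesis using fam_conj[OF _ f] unfolding LL_def by blast
  next
    case (neg \<sigma> \<gamma>)
    have "(\<lambda>i. act f ` \<beta> i) = (\<lambda>i. V - act f ` \<gamma> (- i))" by (simp add: neg(3) act_compl[OF f])
    moreover have "f + \<rho> - f = - (f + \<sigma> - f)"
      by (simp add: neg(2) diff_conv_add_uminus minus_add add.assoc del: add_uminus_conv_diff)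
    moreover have "(- (f + \<sigma> - f), \<lambda>i. V - act f ` \<gamma> (- i)) \<in> LL" by (rule LL_neg[OF fam_conj[OF neg(1) f]])
    ultimately show ?thesis by (simp only:)
  qed
next
  fix \<rho> \<beta> assume "(\<rho>, \<beta>) \<in> LL"
  then show "(- \<rho>, \<lambda>i. V - \<beta> (- i)) \<in> LL"
  proof (cases rule: LL_cases)
    case pos
    then show ?thesis by (rule LL_neg)
  next
    case (neg \<sigma> \<gamma>)
    have "V - (V - \<gamma> i) = \<gamma> i" for i using fam_V[OF neg(1)] by blast
    then have "(\<lambda>i. V - \<beta> (- i)) = \<gamma>" by (simp add: neg(3))
    then show ?thesis using neg(1,2) unfolding LL_def by simp
  qed
next
  fix \<rho> \<beta> \<rho>' \<beta>' i j
  assume a: "(\<rho>, \<beta>) \<in> LL" and a': "(\<rho>', \<beta>') \<in> LL" and e: "\<And>t. 0 \<le> t ==> t < piece ==> \<beta> (i + t) = \<beta>' (j + t)"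
  show "\<rho>' = \<rho> \<or> \<rho>' = - \<rho>"
    using a
  proof (cases rule: LL_cases)
    case p: pos
    show ?thesis
      using a'
    proof (cases rule: LL_cases)
      case pos
      then show ?thesis using fam_same[OF p pos e] by simp
    next
      case (neg \<sigma> \<gamma>)
      have "\<beta> (i + t) = V - \<gamma> (- j - t)" if "0 \<le> t" "t < piece" for t
        using e[OF that] by (simp add: neg(3))
      then show ?thesis using fam_opp[OF p neg(1)] by blast
    qed
  next
    case n: (neg \<sigma> \<gamma>)
    show ?thesis
      using a'
    proof (cases rule: LL_cases)
      case pos
      have "\<beta>' (j + t) = V - \<gamma> (- i - t)" if "0 \<le> t" "t < piece" for t
        using e[OF that] by (simp add: n(3))
      then show ?thesis using fam_opp[OF pos n(1)] by blast
    next
      case (neg \<sigma>' \<gamma>')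
      have "\<gamma> ((- i - piece + 1) + t) = \<gamma>' ((- j - piece + 1) + t)" if "0 \<le> t" "t < piece" for t
      proof -
        have "V - \<gamma> (- (i + (piece - 1 - t))) = V - \<gamma>' (- (j + (piece - 1 - t)))"
          using e[of "piece - 1 - t"] that by (simp add: n(3) neg(3))
        then have "\<gamma> (- (i + (piece - 1 - t))) = \<gamma>' (- (j + (piece - 1 - t)))"
          by (rule compl_inject[OF fam_V[OF n(1)] fam_V[OF neg(1)]])
        then show ?thesis unfolding rev_step .
      qed
      then have "\<sigma> = \<sigma>'" by (rule fam_same[OF n(1) neg(1)])
      then show ?thesis by (simp add: n(2) neg(2))
    qed
  qed
next
  fix \<rho> \<beta> f i j
  assume a: "(\<rho>, \<beta>) \<in> LL" and f: "f \<in> F" and e: "\<And>t. 0 \<le> t ==> t < piece ==> act f ` \<beta> (i + t) = V - \<beta> (j - t)"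
  show False
    using a
  proof (cases rule: LL_cases)
    case pos
    show False by (rule fam_opp[OF fam_conj[OF pos f] pos e])
  next
    case (neg \<sigma> \<gamma>)
    have c: "(f + \<sigma> - f, \<lambda>i. act f ` \<gamma> i) \<in> fam" by (rule fam_conj[OF neg(1) f])
    show False
    proof (rule fam_opp[OF c neg(1), of "- i - piece + 1" "- j + piece - 1"])
      fix t assume t: "0 \<le> t" "t < piece"
      have "V - act f ` \<gamma> (- (i + (piece - 1 - t))) = V - (V - \<gamma> (- (j - (piece - 1 - t))))"
        using e[of "piece - 1 - t"] t by (simp add: neg(3) act_compl[OF f])
      then have "act f ` \<gamma> (- (i + (piece - 1 - t))) = V - \<gamma> (- (j - (piece - 1 - t)))"
        by (rule compl_inject[OF fam_V[OF c] Diff_subset])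
      moreover have "- (i + (piece - 1 - t)) = (- i - piece + 1) + t" "- (j - (piece - 1 - t)) = (- j + piece - 1) - t" by auto
      ultimately show "act f ` \<gamma> (- i - piece + 1 + t) = V - \<gamma> (- j + piece - 1 - t)" by (simp only:)
    qed
  qed
next
  show "1 \<le> piece" "14 * piece + 2 \<le> per" by (simp_all add: piece_eq per_eq)
  show "V \<noteq> {}" using base_mem by blast
qed

end

sublocale relators \<subseteq> wind: windmill F V act HS LL per piece
  by (rule windmill)

section \<open>The quotient by the relators\<close>

context relators
begin

abbreviation "N \<equiv> wind.NN"

lemma N_F: "N \<subseteq> F"
  unfolding wind.NN_def using tree.lineD(1)[OF wind.lines] by (intro gen_least) (auto simp: tree.F_0 F_add)

lemma N_add: "a \<in> N ==> b \<in> N ==> a + b \<in> N"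
  unfolding wind.NN_def by (rule gen_closed_add)

lemma N_neg: "a \<in> N ==> - a \<in> N"
  unfolding wind.NN_def by (rule gen_closed_neg) (use wind.LL_rev in blast)

lemma N_0: "0 \<in> N"
  unfolding wind.NN_def by (rule gen_0)

lemma N_conj: assumes "n \<in> N" "f \<in> F" shows "f + n - f \<in> N"
  using assms(1) unfolding wind.NN_def
proof (induction rule: gen.induct)
  case gen_0
  then show ?case by (simp add: gen.gen_0)
next
  case (gen_add s n)
  have "f + (s + n) - f = (f + s - f) + (f + n - f)"
    by (simp add: diff_conv_add_uminus add.assoc del: add_uminus_conv_diff)
  moreover have "f + s - f \<in> {\<rho>. \<exists>\<beta>. (\<rho>, \<beta>) \<in> LL}" using gen_add(1) wind.LL_conj[OF _ assms(2)] by blast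
  ultimately show ?case using gen.gen_add[OF _ gen_add(3)] by (simp only:)
qed

lemma rel_N: "x \<in> R ==> rel x \<in> N"
proof -
  assume x: "x \<in> R"
  have "(0 + rel x - 0, \<lambda>i. act 0 ` wall x i) \<in> LL" unfolding LL_def fam_def using x tree.F_0 by blast
  then have "0 + rel x - 0 \<in> N" by (rule wind.LL_NN)
  then show ?thesis by simp
qed

text \<open>The distance by which the base vertex of \<open>K\<close> is moved. Words with few
  syllables move it little, whereas nonzero elements of \<open>N\<close> move it far.\<close>

definition len :: "'g => nat" where "len g = card (tree.sep (act g (0, True)) (0, True))"

lemma sep_sepa: "tree.sep u v = sepa u v"
  by (simp add: tree.sep_def sepa_def)

lemma base_V: "(0, b) \<in> V"
  by (rule base_mem)

lemma len_add:
  assumes "g \<in> F" "h \<in> F" shows "len (g + h) \<le> len g + len h"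
proof -
  have "card (tree.sep (act (g + h) (0, True)) (0, True)) \<le>
      card (tree.sep (act (g + h) (0, True)) (act g (0, True))) + card (tree.sep (act g (0, True)) (0, True))"
    using assms by (intro tree.card_sep_triangle act_V' F_add base_V)
  also have "tree.sep (act (g + h) (0, True)) (act g (0, True)) = (\<lambda>A. act g ` A) ` tree.sep (act h (0, True)) (0, True)"
    by (simp add: act_add' tree.sep_act[OF assms(1)])
  also have "card \<dots> \<le> len h"
    unfolding len_def using assms by (intro card_image_le tree.finite_sep act_V' base_V)
  finally show ?thesis by (simp add: len_def)
qed

lemma len_K: "k \<in> K ==> len k = 0"
proof -
  assume k: "k \<in> K"
  have "sepa (0 + k, True) (0 + k + - k, True) = {}"
    by (rule sepa_K) (use k K_neg K_F in auto)
  then show ?thesis by (simp add: len_def sep_sepa act_def)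
qed

lemma len_L: "l \<in> L ==> len l \<le> 2"
proof -
  assume l: "l \<in> L"
  have lF: "l \<in> F" using l by (rule L_F)
  have V: "(l, b) \<in> V" for b using lF by (simp add: V_def)
  have 1: "card (tree.sep (l, True) (l, False)) = 1" "card (tree.sep (0, False) (0, True)) = 1"
    using sepa_edge[OF lF] sepa_edge[OF tree.F_0] by (simp_all add: sep_sepa)
  have "sepa (l, False) (l + - l, False) = {}" by (rule sepa_L) (use lF l L_neg in auto)
  then have 2: "card (tree.sep (l, False) (0, False)) = 0" by (simp add: sep_sepa)
  have "card (tree.sep (l, True) (0, True)) \<le> card (tree.sep (l, True) (l, False)) + card (tree.sep (l, False) (0, True))"
    by (intro tree.card_sep_triangle V base_V)
  also have "card (tree.sep (l, False) (0, True)) \<le> card (tree.sep (l, False) (0, False)) + card (tree.sep (0, False) (0, True))"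
    by (intro tree.card_sep_triangle V base_V)
  finally show ?thesis using 1 2 by (simp add: len_def act_def)
qed

text \<open>A nonzero element of \<open>N\<close> moves the base vertex across
  \<open>per - 6 * piece - 1\<close> edges of an axis; five of them already give a
  contradiction.\<close>

lemma short_N:
  assumes "n \<in> N" "len n \<le> 4" shows "n = 0"
proof (rule ccontr)
  assume "n \<noteq> 0"
  then obtain \<sigma> \<beta> i where b: "(\<sigma>, \<beta>) \<in> LL"
    and t: "\<And>t. 0 \<le> t ==> t < per - 6 * piece - 1 ==> (0, True) \<notin> \<beta> (i + t) \<and> act n (0, True) \<in> \<beta> (i + t)"
    using wind.greendlinger[OF assms(1) _ base_V[of True]] by blast
  note line = wind.lines[OF b]
  have "\<beta> ` {i..i + 4} \<subseteq> tree.sep (act n (0, True)) (0, True)"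
  proof
    fix A assume "A \<in> \<beta> ` {i..i + 4}"
    then obtain j where j: "A = \<beta> j" "i \<le> j" "j \<le> i + 4" by auto
    then show "A \<in> tree.sep (act n (0, True)) (0, True)"
      using t[of "j - i"] tree.lineD(2)[OF line, of j] by (simp add: tree.sep_def per_eq piece_eq)
  qed
  then have "card (\<beta> ` {i..i + 4}) \<le> len n"
    unfolding len_def using assms(1) N_F by (intro card_mono tree.finite_sep act_V' base_V) auto
  moreover have "card (\<beta> ` {i..i + 4}) = card {i..i + 4}"
    using tree.line_inj[OF line] by (intro card_image inj_onI) blast
  ultimately show False using assms(2) by simp
qed

lemma N_K: "k \<in> K ==> k \<in> N ==> k = 0"
  using short_N len_K by simp

lemma N_L: "l \<in> L ==> l \<in> N ==> l = 0"
  using short_N[of l] len_L[of l] by simp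

lemma N_K_L:
  assumes "k \<in> K" "l \<in> L" "- k + l \<in> N" shows "k = l"
proof -
  have "len (- k + l) \<le> len (- k) + len l" using assms by (intro len_add F_neg K_F L_F)
  then have "len (- k + l) \<le> 4" using len_K[OF K_neg[OF assms(1)]] len_L[OF assms(2)] by simp
  then have "- k + l = 0" by (rule short_N[OF assms(3)])
  then show ?thesis by (metis add.left_neutral add_minus_cancel add.right_neutral)
qed

text \<open>Such a product has length at most 4 and is a reduced word, hence not 0. In the recursion
  this becomes \<open>alternating_free\<close>.\<close>

lemma N_alt4:
  assumes "k1 \<in> K" "k1 \<notin> L" "l1 \<in> L" "l1 \<notin> K" "k2 \<in> K" "k2 \<notin> L" "l2 \<in> L" "l2 \<notin> K"
  shows "k1 + l1 + k2 + l2 \<notin> N"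
proof
  assume n: "k1 + l1 + k2 + l2 \<in> N"
  have F: "k1 \<in> F" "l1 \<in> F" "k2 \<in> F" "l2 \<in> F" using assms K_F L_F by auto
  have "len (k1 + l1 + k2 + l2) \<le> len k1 + len l1 + len k2 + len l2"
    using len_add[of k1 l1] len_add[of "k1 + l1" k2] len_add[of "k1 + l1 + k2" l2] F F_add by fastforce
  also have "\<dots> \<le> 4" using len_K[OF assms(1)] len_K[OF assms(5)] len_L[OF assms(3)] len_L[OF assms(7)] by simp
  finally have z: "k1 + (l1 + (k2 + l2)) = 0" using short_N[OF n] by (simp add: add.assoc)
  have "alt K L (k1 + (l1 + (k2 + l2)))" using assms by (intro alt_step alt_base)
  then show False using alt_not_H H_0 unfolding z by blast
qed

text \<open>Replace \<open>f\<close> by the element of its class modulo \<open>N\<close> that moves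
  the base vertex least. Then \<open>no_fixed_displacement\<close> annihilates the error term, and
  the equation holds in the amalgam itself, where \<open>K_malnormal\<close> decides it.\<close>

lemma malnormal_aux:
  assumes E: "E = (if b then K else L)" and k: "k \<in> E" "k' \<in> E" and f: "f \<in> F" and n: "n \<in> N" and e: "k + f = n + f + k'"
  shows "k = 0 \<or> (\<exists>m\<in>N. m + f \<in> E)"
proof -
  let ?v = "(0 :: 'g, b)"
  have EF: "x \<in> F" if "x \<in> E" for x using that E K_F L_F by (auto split: if_splits)
  have v: "?v \<in> V" by (rule base_V)
  have kF: "k \<in> F" by (rule EF[OF k(1)])
  have stab: "tree.sep (act g ?v) (act g (act x ?v)) = {}" if "g \<in> F" "x \<in> E" for g x
    using sepa_K[OF that(1), of x] sepa_L[OF that(1), of x] that(2) E by (cases b) (auto simp: sep_sepa act_def)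
  define m where "m = arg_min (\<lambda>m. card (tree.sep ?v (act (m + f) ?v))) (\<lambda>m. m \<in> N)"
  have am: "m \<in> N \<and> (\<forall>m'. m' \<in> N --> card (tree.sep ?v (act (m + f) ?v)) \<le> card (tree.sep ?v (act (m' + f) ?v)))"
    unfolding m_def by (rule arg_min_nat_lemma[where P = "\<lambda>m. m \<in> N", OF N_0])
  have m: "m \<in> N" using am by (rule conjunct1)
  have m_min: "card (tree.sep ?v (act (m + f) ?v)) \<le> card (tree.sep ?v (act (m' + f) ?v))" if "m' \<in> N" for m'
    using am[THEN conjunct2, THEN spec, THEN mp, OF that] .
  have mF: "m \<in> F" using m N_F by blast
  let ?f = "m + f"
  let ?n = "(k + m - k) + n - m"
  have fF: "?f \<in> F" using mF f by (rule F_add)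
  have nN: "?n \<in> N" using N_add[OF N_add[OF N_conj[OF m kF] n] N_neg[OF m]] by simp
  then have nF: "?n \<in> F" using N_F by blast
  have e': "k + ?f = ?n + ?f + k'"
  proof -
    have "k + ?f = (k + m - k) + (k + f)" by (simp add: diff_conv_add_uminus add.assoc del: add_uminus_conv_diff)
    also have "\<dots> = ?n + ?f + k'" unfolding e by (simp add: diff_conv_add_uminus add.assoc del: add_uminus_conv_diff)
    finally show ?thesis .
  qed
  have "?n = 0"
  proof (rule wind.no_fixed_displacement[OF v _ kF _ nN _ nF, of "act ?f ?v"])
    show "act ?f ?v \<in> V" by (rule act_V'[OF fF v])
    show "tree.sep ?v (act k ?v) = {}" using stab[OF tree.F_0 k(1)] by (simp add: act_0')
    have "act k (act ?f ?v) = act (?n + ?f) (act k' ?v)" unfolding act_add'[symmetric] using e' by (simp add: add.assoc)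
    moreover have "act ?n (act ?f ?v) = act (?n + ?f) ?v" by (simp add: act_add')
    ultimately show "tree.sep (act ?n (act ?f ?v)) (act k (act ?f ?v)) = {}"
      using stab[OF F_add[OF nF fF] k(2)] by simp
    fix m' assume m': "m' \<in> N"
    show "card (tree.sep ?v (act ?f ?v)) \<le> card (tree.sep ?v (act m' (act ?f ?v)))"
      using m_min[OF N_add[OF m' m]] by (simp add: act_add' add.assoc)
  qed
  then have eq: "k + ?f = ?f + k'" using e' by simp
  have "k = 0" if nE: "?f \<notin> E"
  proof (cases b)
    case True
    then have KE: "E = K" using E by simp
    show ?thesis
      by (rule K_malnormal[OF _ k[unfolded KE] fF nE[unfolded KE] eq]) (rule mal_L)
  next
    case False
    then have LE: "E = L" using E by simp
    show ?thesis
      by (rule swap.K_malnormal[OF _ k[unfolded LE] fF nE[unfolded LE] eq]) (rule mal_K)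
  qed
  then show ?thesis using m by blast
qed

lemmas malnormal_quot_K = malnormal_aux[of K True, simplified]
lemmas malnormal_quot_L = malnormal_aux[of L False, simplified]

end

section \<open>Amalgams of two groups of terms\<close>

typedef 'x sym = "{f :: 'x => 'x. bij f}"
  by (rule exI[of _ id]) simp

setup_lifting type_definition_sym

instantiation sym :: (type) group_add
begin

lift_definition zero_sym :: "'a sym" is id by simp
lift_definition plus_sym :: "'a sym => 'a sym => 'a sym" is "(\<circ>)" by (rule bij_comp)
lift_definition uminus_sym :: "'a sym => 'a sym" is "inv_into UNIV" by (rule bij_imp_bij_inv)
definition minus_sym :: "'a sym => 'a sym => 'a sym" where "minus_sym f g = f + - g"

instance
proof
  fix a b c :: "'a sym"
  show "a + b + c = a + (b + c)" by transfer (rule comp_assoc)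
  show "0 + a = a" "a + 0 = a" by (transfer, simp)+
  show "- a + a = 0" by transfer (simp add: bij_is_inj)
  show "a + - b = a - b" by (rule minus_sym_def[symmetric])
qed

end

lift_definition app :: "'x sym => 'x => 'x" is "\<lambda>f. f" .

lemma app_add: "app (f + g) x = app f (app g x)"
  by transfer simp

lemma app_0: "app 0 x = x"
  by transfer simp

lemma sym_eqI: "(\<And>x. app f x = app g x) ==> f = g"
  by transfer auto

text \<open>One side of the van der Waerden construction: \<open>G\<close> acts on normal forms \<open>(h, ts)\<close>, standing for
  \<open>h t\<^sub>1 t\<^sub>2 \<dots>\<close> with \<open>h \<in> H\<close> and coset representatives \<open>t\<^sub>i\<close>; \<open>T\<close> consists of the tails
  that do not begin with a representative from \<open>G\<close>.\<close>

locale side = group G for G :: "'u monoid" (structure) +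
  fixes H :: "'u set" and T :: "'u list set"
  assumes H_sub: "subgroup H G" and T_hd: "\<And>t ts. t # ts \<in> T ==> t \<notin> carrier G"
begin

text \<open>The choice is made from the coset \<open>H x\<close>, so it depends only on that
  coset.\<close>

definition rep :: "'u => 'u" where "rep x = (SOME y. \<exists>h\<in>H. y = h \<otimes> x)"

definition is_rep :: "'u => bool" where "is_rep t \<longleftrightarrow> t \<in> carrier G \<and> t \<notin> H \<and> rep t = t"

definition nfs :: "('u \<times> 'u list) set"
  where "nfs = {(h, ts). h \<in> H \<and> (ts \<in> T \<or> (\<exists>t us. ts = t # us \<and> is_rep t \<and> us \<in> T))}"

definition norm :: "'u => 'u list => 'u \<times> 'u list"
  where "norm x ts = (if x \<in> H then (x, ts) else (x \<otimes> inv rep x, rep x # ts))"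

definition split :: "'u \<times> 'u list => 'u \<times> 'u list"
  where "split w = (case snd w of [] => w | t # ts => if t \<in> carrier G then (fst w \<otimes> t, ts) else w)"

text \<open>Multiplication by \<open>k\<close> acts on the first syllable, after
  \<open>split\<close> has merged it with the \<open>H\<close>-part. Outside the normal forms it is
  the identity, which makes it a permutation of the whole type.\<close>

definition move :: "'u => 'u \<times> 'u list => 'u \<times> 'u list"
  where "move k w = (if w \<in> nfs then norm (k \<otimes> fst (split w)) (snd (split w)) else w)"

lemma H_carrier: "h \<in> H ==> h \<in> carrier G"
  using subgroup.mem_carrier[OF H_sub] .

lemma H_mult: "h \<in> H ==> h' \<in> H ==> h \<otimes> h' \<in> H"
  using subgroup.m_closed[OF H_sub] .

lemma H_inv: "h \<in> H ==> inv h \<in> H"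
  using subgroup.m_inv_closed[OF H_sub] .

lemma H_one: "\<one> \<in> H"
  using subgroup.one_closed[OF H_sub] .

lemma H_mult_iff: "h \<in> H ==> x \<in> carrier G ==> h \<otimes> x \<in> H \<longleftrightarrow> x \<in> H"
  using H_mult[of h x] H_mult[of "inv h" "h \<otimes> x"] H_inv[of h] H_carrier by (auto simp: m_assoc[symmetric])

lemma rep_ex: "x \<in> carrier G ==> \<exists>h\<in>H. rep x = h \<otimes> x"
  unfolding rep_def by (rule someI_ex) (use H_one in blast)

lemma rep_closed: "x \<in> carrier G ==> rep x \<in> carrier G"
  using rep_ex[of x] H_carrier by auto

lemma rep_mult: "h \<in> H ==> x \<in> carrier G ==> rep (h \<otimes> x) = rep x"
proof -
  assume h: "h \<in> H" and x: "x \<in> carrier G"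
  have "(\<exists>h'\<in>H. y = h' \<otimes> (h \<otimes> x)) \<longleftrightarrow> (\<exists>h'\<in>H. y = h' \<otimes> x)" for y
  proof
    assume "\<exists>h'\<in>H. y = h' \<otimes> (h \<otimes> x)"
    then obtain h' where h': "h' \<in> H" "y = h' \<otimes> (h \<otimes> x)" by blast
    then have "y = (h' \<otimes> h) \<otimes> x" using h x H_carrier by (simp add: m_assoc)
    then show "\<exists>h'\<in>H. y = h' \<otimes> x" using H_mult[OF h'(1) h] by blast
  next
    assume "\<exists>h'\<in>H. y = h' \<otimes> x"
    then obtain h' where h': "h' \<in> H" "y = h' \<otimes> x" by blast
    have "(h' \<otimes> inv h) \<otimes> (h \<otimes> x) = h' \<otimes> ((inv h \<otimes> h) \<otimes> x)" using h' h x H_carrier by (simp only: m_assoc m_closed inv_closed)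
    then have "y = (h' \<otimes> inv h) \<otimes> (h \<otimes> x)" using h' h x H_carrier by simp
    then show "\<exists>h'\<in>H. y = h' \<otimes> (h \<otimes> x)" using H_mult[OF h'(1) H_inv[OF h]] by blast
  qed
  then show ?thesis unfolding rep_def by simp
qed

lemma rep_quot: assumes "x \<in> carrier G" shows "x \<otimes> inv rep x \<in> H" "x \<otimes> inv rep x \<otimes> rep x = x"
proof -
  obtain h where h: "h \<in> H" "rep x = h \<otimes> x" using rep_ex[OF assms] by blast
  have "x \<otimes> inv rep x = inv h" using h assms H_carrier by (simp add: inv_mult_group m_assoc[symmetric])
  then show "x \<otimes> inv rep x \<in> H" using H_inv[OF h(1)] by simp
  show "x \<otimes> inv rep x \<otimes> rep x = x" using assms rep_closed[OF assms] by (simp add: m_assoc)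
qed

lemma rep_is_rep: assumes "x \<in> carrier G" "x \<notin> H" shows "is_rep (rep x)"
proof -
  obtain h where h: "h \<in> H" "rep x = h \<otimes> x" using rep_ex[OF assms(1)] by blast
  then show ?thesis using rep_mult[OF h(1) assms(1)] H_mult_iff[OF h(1) assms(1)] rep_closed[OF assms(1)] assms(2)
    by (simp add: is_rep_def)
qed

lemma norm_nfs: "x \<in> carrier G ==> ts \<in> T ==> norm x ts \<in> nfs"
  using rep_quot rep_is_rep by (auto simp: norm_def nfs_def)

lemma split_closed: "w \<in> nfs ==> fst (split w) \<in> carrier G" "w \<in> nfs ==> snd (split w) \<in> T"
  using H_carrier T_hd by (auto simp: nfs_def split_def is_rep_def split: list.splits)

lemma split_norm:
  assumes "x \<in> carrier G" "ts \<in> T" shows "split (norm x ts) = (x, ts)"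
proof (cases "x \<in> H")
  case True
  then show ?thesis using assms(2) T_hd by (auto simp: norm_def split_def split: list.splits)
next
  case False
  then show ?thesis using rep_quot[OF assms(1)] rep_closed[OF assms(1)] by (simp add: norm_def split_def)
qed

lemma norm_split:
  assumes "w \<in> nfs" shows "norm (fst (split w)) (snd (split w)) = w"
proof -
  obtain h ts where w: "w = (h, ts)" by (cases w)
  have h: "h \<in> H" using assms by (simp add: w nfs_def)
  consider "ts \<in> T" | t us where "ts = t # us" "is_rep t" "us \<in> T" using assms by (auto simp: w nfs_def)
  then show ?thesis
  proof cases
    case 1
    then have "split w = w" using T_hd by (auto simp: w split_def split: list.splits)
    then show ?thesis using h by (simp add: w norm_def)
  next
    case (2 t us)
    have t: "t \<in> carrier G" "t \<notin> H" "rep t = t" using 2 by (auto simp: is_rep_def)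
    have "rep (h \<otimes> t) = t" using rep_mult[OF h t(1)] t(3) by simp
    moreover have "h \<otimes> t \<notin> H" using H_mult_iff[OF h t(1)] t(2) by simp
    moreover have "h \<otimes> t \<otimes> inv t = h" using h t H_carrier by (simp add: m_assoc)
    ultimately show ?thesis using t 2 by (simp add: w norm_def split_def)
  qed
qed

lemma move_nfs: "k \<in> carrier G ==> w \<in> nfs ==> move k w \<in> nfs"
  unfolding move_def using split_closed norm_nfs by auto

lemma move_mult:
  assumes "k \<in> carrier G" "k' \<in> carrier G" shows "move k (move k' w) = move (k \<otimes> k') w"
proof (cases "w \<in> nfs")
  case True
  have "split (move k' w) = (k' \<otimes> fst (split w), snd (split w))"
    using True split_closed[OF True] assms split_norm by (simp add: move_def)
  then show ?thesis using True move_nfs[OF assms(2) True] split_closed[OF True] assms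
    by (simp add: move_def[of k] move_def[of "k \<otimes> k'"] m_assoc)
qed (simp add: move_def)

lemma move_one: "move \<one> w = w"
  using split_closed[of w] norm_split[of w] by (simp add: move_def)

lemma move_H: "h \<in> H ==> (h', ts) \<in> nfs ==> move h (h', ts) = (h \<otimes> h', ts)"
proof -
  assume h: "h \<in> H" and w: "(h', ts) \<in> nfs"
  have h': "h' \<in> H" using w by (simp add: nfs_def)
  consider "ts \<in> T" | t us where "ts = t # us" "is_rep t" "us \<in> T" using w by (auto simp: nfs_def)
  then show ?thesis
  proof cases
    case 1
    then have "split (h', ts) = (h', ts)" using T_hd by (auto simp: split_def split: list.splits)
    then show ?thesis using h h' w H_mult by (simp add: move_def norm_def)
  next
    case (2 t us)
    have t: "t \<in> carrier G" "t \<notin> H" "rep t = t" using 2 by (auto simp: is_rep_def)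
    have m: "h \<otimes> (h' \<otimes> t) = (h \<otimes> h') \<otimes> t" using h h' t H_carrier by (simp add: m_assoc)
    have "rep ((h \<otimes> h') \<otimes> t) = t" using rep_mult[OF H_mult[OF h h'] t(1)] t(3) by simp
    moreover have "(h \<otimes> h') \<otimes> t \<notin> H" using H_mult_iff[OF H_mult[OF h h'] t(1)] t(2) by simp
    moreover have "h \<otimes> h' \<otimes> t \<otimes> inv t = h \<otimes> h'" using h h' t H_carrier by (simp add: m_assoc)
    ultimately show ?thesis using t 2 w by (simp add: move_def norm_def split_def m)
  qed
qed

lemma move_head:
  assumes "k \<in> carrier G" "k \<notin> H" "(h, ts) \<in> nfs" "ts \<in> T"
  shows "\<exists>h' t. move k (h, ts) = (h', t # ts) \<and> t \<in> carrier G \<and> t \<notin> H"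
proof -
  have h: "h \<in> H" using assms by (simp add: nfs_def)
  have "split (h, ts) = (h, ts)" using assms(4) T_hd by (auto simp: split_def split: list.splits)
  moreover have "k \<otimes> h \<notin> H"
  proof
    assume "k \<otimes> h \<in> H"
    then have "k \<otimes> h \<otimes> inv h \<in> H" using H_mult H_inv h by blast
    then show False using assms h H_carrier by (simp add: m_assoc)
  qed
  ultimately show ?thesis
    using assms rep_is_rep[of "k \<otimes> h"] h H_carrier by (auto simp: move_def norm_def is_rep_def)
qed

lemma bij_move: "k \<in> carrier G ==> bij (move k)"
  by (rule o_bij[of "move (inv k)"]) (auto simp: fun_eq_iff move_mult move_one)

definition emb :: "'u => ('u \<times> 'u list) sym" where "emb k = Abs_sym (move k)"

lemma app_emb: "k \<in> carrier G ==> app (emb k) = move k"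
  using bij_move by (simp add: emb_def app.rep_eq Abs_sym_inverse)

lemma emb_mult: "k \<in> carrier G ==> k' \<in> carrier G ==> emb (k \<otimes> k') = emb k + emb k'"
  by (rule sym_eqI) (simp add: app_emb app_add move_mult)

lemma emb_one: "emb \<one> = 0"
  by (rule sym_eqI) (simp add: app_emb app_0 move_one)

lemma emb_inv: "k \<in> carrier G ==> emb (inv k) = - emb k"
proof -
  assume k: "k \<in> carrier G"
  have "emb (inv k) + emb k = 0" using emb_mult[of "inv k" k] k emb_one by simp
  then show ?thesis by (simp add: eq_neg_iff_add_eq_0)
qed

end

inductive zigzag :: "('u => bool) => ('u => bool) => 'u list => bool" where
  zigzag_Nil: "zigzag P Q []"
| zigzag_Cons: "P t ==> zigzag Q P ts ==> zigzag P Q (t # ts)"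

text \<open>The two groups overlap as sets exactly in \<open>H\<close> and agree there, so that an
  amalgam can contain both literally.\<close>

locale group_pair =
  fixes A B :: "'u monoid" and H :: "'u set"
  assumes A: "group A" and B: "group B" and H_A: "subgroup H A" and H_B: "subgroup H B"
    and inter: "carrier A \<inter> carrier B = H"
    and mult_eq: "\<And>x y. x \<in> H ==> y \<in> H ==> x \<otimes>\<^bsub>A\<^esub> y = x \<otimes>\<^bsub>B\<^esub> y"
    and one_eq: "\<one>\<^bsub>A\<^esub> = \<one>\<^bsub>B\<^esub>"
begin

lemma group_pair_swap: "group_pair B A H"
  by (rule group_pair.intro) (use A B H_A H_B inter mult_eq one_eq in auto)

definition TA where "TA = {ts. zigzag (side.is_rep B H) (side.is_rep A H) ts}"

definition TB where "TB = {ts. zigzag (side.is_rep A H) (side.is_rep B H) ts}"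

end

sublocale group_pair \<subseteq> l: side A H TA
proof -
  interpret A: group A by (rule A)
  interpret b: side B H "{}" using B H_B by (simp add: side_def side_axioms_def)
  show "side A H TA"
  proof (intro side.intro side_axioms.intro A H_A)
    fix t ts assume "t # ts \<in> TA"
    then have "b.is_rep t" by (auto simp: TA_def elim: zigzag.cases)
    then show "t \<notin> carrier A" using inter by (auto simp: b.is_rep_def)
  qed
qed

sublocale group_pair \<subseteq> r: side B H TB
proof -
  interpret s: group_pair B A H by (rule group_pair_swap)
  have "s.TA = TB" by (simp add: s.TA_def TB_def)
  then show "side B H TB" using s.l.side_axioms by simp
qed

context group_pair
begin

lemma TA_iff: "ts \<in> TA \<longleftrightarrow> ts = [] \<or> (\<exists>t us. ts = t # us \<and> r.is_rep t \<and> us \<in> TB)"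
  unfolding TA_def TB_def by (auto intro: zigzag.intros elim: zigzag.cases)

lemma TB_iff: "ts \<in> TB \<longleftrightarrow> ts = [] \<or> (\<exists>t us. ts = t # us \<and> l.is_rep t \<and> us \<in> TA)"
  unfolding TA_def TB_def by (auto intro: zigzag.intros elim: zigzag.cases)

lemma Nil_T: "[] \<in> TA" "[] \<in> TB"
  using TA_iff TB_iff by blast+

lemma nfs_l: "(h, ts) \<in> l.nfs \<longleftrightarrow> h \<in> H \<and> (ts \<in> TA \<or> ts \<in> TB)"
  using TB_iff[of ts] Nil_T by (auto simp: l.nfs_def)

lemma nfs_r: "(h, ts) \<in> r.nfs \<longleftrightarrow> h \<in> H \<and> (ts \<in> TA \<or> ts \<in> TB)"
  using TA_iff[of ts] Nil_T by (auto simp: r.nfs_def)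

lemma nfs_eq: "r.nfs = l.nfs"
  using nfs_l nfs_r by auto

definition base :: "'u \<times> 'u list" where "base = (\<one>\<^bsub>A\<^esub>, [])"

lemma base_nfs: "base \<in> l.nfs" "base \<in> r.nfs"
  using l.H_one Nil_T by (auto simp: nfs_eq base_def nfs_l)

text \<open>From either side \<open>h\<close> only multiplies the \<open>H\<close>-part of a normal
  form, where the two products agree.\<close>

lemma emb_H: "h \<in> H ==> l.emb h = r.emb h"
proof -
  assume h: "h \<in> H"
  have "l.move h w = r.move h w" for w
  proof (cases "w \<in> l.nfs")
    case True
    obtain h' ts where w: "w = (h', ts)" by (cases w)
    have h': "h' \<in> H" using True by (simp add: w l.nfs_def)
    show ?thesis using True l.move_H[OF h] r.move_H[OF h] mult_eq[OF h h'] by (simp add: w nfs_eq)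
  next
    case False
    then show ?thesis by (simp add: l.move_def r.move_def nfs_eq)
  qed
  then have "l.move h = r.move h" by (rule ext)
  then show ?thesis unfolding l.emb_def r.emb_def by simp
qed

definition Kset where "Kset = l.emb ` carrier A"

definition Lset where "Lset = r.emb ` carrier B"

lemma l_move_tail:
  assumes "k \<in> carrier A" "k \<notin> H" "(h, ts) \<in> l.nfs" "ts \<in> TA"
  shows "\<exists>h' t. l.move k (h, ts) = (h', t # ts) \<and> l.is_rep t \<and> (h', t # ts) \<in> l.nfs"
proof -
  obtain h' t where m: "l.move k (h, ts) = (h', t # ts)" "t \<in> carrier A" using l.move_head[OF assms] by blast
  have "(h', t # ts) \<in> l.nfs" using l.move_nfs[OF assms(1,3)] m by simp
  moreover have "t # ts \<notin> TA" using l.T_hd m by blast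
  ultimately have "l.is_rep t" by (auto simp: l.nfs_def)
  then show ?thesis using m \<open>(h', t # ts) \<in> l.nfs\<close> by blast
qed

lemma r_move_tail:
  assumes "k \<in> carrier B" "k \<notin> H" "(h, ts) \<in> l.nfs" "ts \<in> TB"
  shows "\<exists>h' t. r.move k (h, ts) = (h', t # ts) \<and> r.is_rep t \<and> (h', t # ts) \<in> l.nfs"
proof -
  interpret s: group_pair B A H by (rule group_pair_swap)
  have T: "s.TA = TB" by (simp add: s.TA_def TB_def)
  show ?thesis using s.l_move_tail[of k h ts, unfolded T] assms nfs_eq by simp
qed

lemma Kset_rep: assumes "k \<in> Kset" "k \<notin> Lset" obtains a where "a \<in> carrier A" "k = l.emb a" "a \<notin> H"
proof -
  obtain a where a: "a \<in> carrier A" "k = l.emb a" using assms(1) unfolding Kset_def by (rule imageE)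
  have "a \<notin> H"
  proof
    assume "a \<in> H"
    have "k \<in> Lset" unfolding Lset_def a(2) emb_H[OF \<open>a \<in> H\<close>] using subgroup.mem_carrier[OF H_B \<open>a \<in> H\<close>] by (rule imageI)
    then show False using assms(2) by simp
  qed
  then show thesis using a that by simp
qed

lemma Lset_rep: assumes "k \<in> Lset" "k \<notin> Kset" obtains a where "a \<in> carrier B" "k = r.emb a" "a \<notin> H"
proof -
  obtain a where a: "a \<in> carrier B" "k = r.emb a" using assms(1) unfolding Lset_def by (rule imageE)
  have "a \<notin> H"
  proof
    assume "a \<in> H"
    have "k \<in> Kset" unfolding Kset_def a(2) emb_H[OF \<open>a \<in> H\<close>, symmetric] using subgroup.mem_carrier[OF H_A \<open>a \<in> H\<close>] by (rule imageI)
    then show False using assms(2) by simp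
  qed
  then show thesis using a that by simp
qed

text \<open>Each syllable of a reduced word puts one more representative, from its own side, in
  front of the normal form.\<close>

lemma alt_app:
  assumes "alt P Q x"
  shows "(P = Kset \<and> Q = Lset --> (\<exists>h t ts. app x base = (h, t # ts) \<and> l.is_rep t \<and> (h, t # ts) \<in> l.nfs \<and> ts \<in> TA)) \<and>
    (P = Lset \<and> Q = Kset --> (\<exists>h t ts. app x base = (h, t # ts) \<and> r.is_rep t \<and> (h, t # ts) \<in> l.nfs \<and> ts \<in> TB))"
  using assms
proof (induction rule: alt.induct)
  case (alt_base k P Q)
  show ?case
  proof (intro conjI impI)
    assume "P = Kset \<and> Q = Lset"
    then obtain a where a: "a \<in> carrier A" "k = l.emb a" "a \<notin> H"
      using alt_base Kset_rep by metis
    show "\<exists>h t ts. app k base = (h, t # ts) \<and> l.is_rep t \<and> (h, t # ts) \<in> l.nfs \<and> ts \<in> TA"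
      using l_move_tail[OF a(1,3), of "\<one>\<^bsub>A\<^esub>" "[]"] base_nfs a by (auto simp: base_def l.app_emb Nil_T)
  next
    assume "P = Lset \<and> Q = Kset"
    then obtain a where a: "a \<in> carrier B" "k = r.emb a" "a \<notin> H"
      using alt_base Lset_rep by metis
    show "\<exists>h t ts. app k base = (h, t # ts) \<and> r.is_rep t \<and> (h, t # ts) \<in> l.nfs \<and> ts \<in> TB"
      using r_move_tail[OF a(1,3), of "\<one>\<^bsub>A\<^esub>" "[]"] base_nfs a by (auto simp: base_def r.app_emb Nil_T)
  qed
next
  case (alt_step k P Q y)
  show ?case
  proof (intro conjI impI)
    assume PQ: "P = Kset \<and> Q = Lset"
    then obtain a where a: "a \<in> carrier A" "k = l.emb a" "a \<notin> H"
      using alt_step.hyps(1,2) PQ Kset_rep by metis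
    obtain h t ts where y: "app y base = (h, t # ts)" "r.is_rep t" "(h, t # ts) \<in> l.nfs" "ts \<in> TB"
      using alt_step.IH PQ by blast
    have T: "t # ts \<in> TA" using y TA_iff TB_iff by blast
    show "\<exists>h t ts. app (k + y) base = (h, t # ts) \<and> l.is_rep t \<and> (h, t # ts) \<in> l.nfs \<and> ts \<in> TA"
      using l_move_tail[OF a(1,3) y(3) T] T by (auto simp: app_add y(1) a l.app_emb)
  next
    assume PQ: "P = Lset \<and> Q = Kset"
    then obtain a where a: "a \<in> carrier B" "k = r.emb a" "a \<notin> H"
      using alt_step.hyps(1,2) PQ Lset_rep by metis
    obtain h t ts where y: "app y base = (h, t # ts)" "l.is_rep t" "(h, t # ts) \<in> l.nfs" "ts \<in> TA"
      using alt_step.IH PQ by blast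
    have T: "t # ts \<in> TB" using y TA_iff TB_iff by blast
    show "\<exists>h t ts. app (k + y) base = (h, t # ts) \<and> r.is_rep t \<and> (h, t # ts) \<in> l.nfs \<and> ts \<in> TB"
      using r_move_tail[OF a(1,3) y(3) T] T by (auto simp: app_add y(1) a r.app_emb)
  qed
qed

lemma app_l_emb_base: "a \<in> carrier A ==> app (l.emb a) base = l.norm a []"
  using base_nfs by (simp add: l.app_emb l.move_def base_def l.split_def)

lemma app_r_emb_base: "a \<in> carrier B ==> app (r.emb a) base = r.norm a []"
  using base_nfs one_eq by (simp add: r.app_emb r.move_def base_def r.split_def)

lemma l_emb_inj: "inj_on l.emb (carrier A)"
proof (rule inj_onI)
  fix a b assume "a \<in> carrier A" "b \<in> carrier A" "l.emb a = l.emb b"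
  moreover from this have "l.split (l.norm a []) = l.split (l.norm b [])" using app_l_emb_base by metis
  ultimately show "a = b" using l.split_norm[of _ "[]"] by (simp add: Nil_T)
qed

lemma r_emb_inj: "inj_on r.emb (carrier B)"
proof -
  interpret s: group_pair B A H by (rule group_pair_swap)
  have T: "s.TA = TB" by (simp add: s.TA_def TB_def)
  show ?thesis using s.l_emb_inj unfolding T .
qed

lemma emb_eqD:
  assumes "a \<in> carrier A" "b \<in> carrier B" "l.emb a = r.emb b" shows "a = b"
proof -
  have e: "l.norm a [] = r.norm b []" using assms app_l_emb_base app_r_emb_base by metis
  have "l.rep a \<in> carrier A \<and> l.rep a \<notin> H" if "a \<notin> H" using l.rep_is_rep[OF assms(1) that] by (simp add: l.is_rep_def)
  moreover have "r.rep b \<in> carrier B" using r.rep_closed assms by simp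
  ultimately show ?thesis using e inter by (auto simp: l.norm_def r.norm_def split: if_splits)
qed

lemma amalgam: "amalgam Kset Lset"
proof
  show "0 \<in> Kset" "0 \<in> Lset" using l.emb_one r.emb_one l.one_closed r.one_closed by (force simp: Kset_def Lset_def)+
  show "a + b \<in> Kset" if "a \<in> Kset" "b \<in> Kset" for a b
  proof -
    obtain x y where "x \<in> carrier A" "a = l.emb x" "y \<in> carrier A" "b = l.emb y"
      using \<open>a \<in> Kset\<close> \<open>b \<in> Kset\<close> unfolding Kset_def by (elim imageE)
    then show ?thesis unfolding Kset_def using l.emb_mult[of x y] l.m_closed[of x y] by (intro image_eqI[of _ _ "x \<otimes>\<^bsub>A\<^esub> y"]) simp_all
  qed
  show "- a \<in> Kset" if "a \<in> Kset" for a
  proof -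
    obtain x where "x \<in> carrier A" "a = l.emb x"
      using \<open>a \<in> Kset\<close> unfolding Kset_def by (elim imageE)
    then show ?thesis unfolding Kset_def using l.emb_inv[of x] by (intro image_eqI[of _ _ "inv\<^bsub>A\<^esub> x"]) simp_all
  qed
  show "a + b \<in> Lset" if "a \<in> Lset" "b \<in> Lset" for a b
  proof -
    obtain x y where "x \<in> carrier B" "a = r.emb x" "y \<in> carrier B" "b = r.emb y"
      using \<open>a \<in> Lset\<close> \<open>b \<in> Lset\<close> unfolding Lset_def by (elim imageE)
    then show ?thesis unfolding Lset_def using r.emb_mult[of x y] r.m_closed[of x y] by (intro image_eqI[of _ _ "x \<otimes>\<^bsub>B\<^esub> y"]) simp_all
  qed
  show "- a \<in> Lset" if "a \<in> Lset" for a
  proof -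
    obtain x where "x \<in> carrier B" "a = r.emb x"
      using \<open>a \<in> Lset\<close> unfolding Lset_def by (elim imageE)
    then show ?thesis unfolding Lset_def using r.emb_inv[of x] by (intro image_eqI[of _ _ "inv\<^bsub>B\<^esub> x"]) simp_all
  qed
  have K: "\<exists>h t ts. app x base = (h, t # ts) \<and> t \<in> carrier A \<and> t \<notin> carrier B" if "alt Kset Lset x" for x
    using alt_app[OF that] inter by (auto simp: l.is_rep_def)
  have L: "\<exists>h t ts. app x base = (h, t # ts) \<and> t \<in> carrier B \<and> t \<notin> carrier A" if "alt Lset Kset x" for x
    using alt_app[OF that] inter by (auto simp: r.is_rep_def)
  show "\<not> alt Lset Kset x" if "alt Kset Lset x" for x
    using K[OF that] L[of x] by auto
  show "x \<notin> Lset" if "alt Kset Lset x" for x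
  proof
    assume "x \<in> Lset"
    then obtain b where b: "b \<in> carrier B" "x = r.emb b" by (auto simp: Lset_def)
    then show False using K[OF that] app_r_emb_base r.rep_closed[of b] by (auto simp: r.norm_def split: if_splits)
  qed
  show "x \<notin> Kset" if "alt Lset Kset x" for x
  proof
    assume "x \<in> Kset"
    then obtain b where b: "b \<in> carrier A" "x = l.emb b" by (auto simp: Kset_def)
    then show False using L[OF that] app_l_emb_base l.rep_closed[of b] by (auto simp: l.norm_def split: if_splits)
  qed
qed

end

sublocale group_pair \<subseteq> amalgam Kset Lset
  by (rule amalgam)

context group_pair
begin

text \<open>A reduced word changes \<open>base\<close>, and an element of \<open>H\<close> is
  visible in the first component. Hence the elements of \<open>F\<close> can be coded by the normal
  forms to which they send \<open>base\<close>.\<close>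

lemma F_base: 
  assumes "x \<in> F" "y \<in> F" "app x base = app y base" shows "x = y"
proof -
  have F: "- x + y \<in> F" using assms F_add F_neg by blast
  have b: "app (- x + y) base = base" using assms(3) by (metis app_add app_0 left_minus)
  have "\<not> alt Kset Lset (- x + y)" "\<not> alt Lset Kset (- x + y)"
    using alt_app[of Kset Lset "- x + y"] alt_app[of Lset Kset "- x + y"] b unfolding base_def by auto
  then have "- x + y \<in> Kset" "- x + y \<in> Lset" using F unfolding F_def by (simp_all add: amalgam.H_def[OF amalgam_axioms])
  then obtain a b where ab: "a \<in> carrier A" "- x + y = l.emb a" "b \<in> carrier B" "- x + y = r.emb b"
    unfolding Kset_def Lset_def by (elim imageE)
  then have "a = b" using emb_eqD[of a b] by simp
  then have a: "a \<in> carrier A" "- x + y = l.emb a" "a \<in> carrier B" using ab by simp_all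
  then have "a \<in> H" using inter by blast
  then have "a = \<one>\<^bsub>A\<^esub>" using b a app_l_emb_base by (simp add: l.norm_def base_def)
  then have "- x + y = 0" using a l.emb_one by simp
  then show "x = y" by (metis add_0_right add_minus_cancel)
qed

end

section \<open>The quotient realised as a group extending both factors\<close>

primrec word :: "('u, 'b) monoid_scheme => 'u => 'u => 'u => nat => 'u" where
  "word G a s t 0 = \<one>\<^bsub>G\<^esub>"
| "word G a s t (Suc n) = word G a s t n \<otimes>\<^bsub>G\<^esub> ((if mark (int n) then s else t) \<otimes>\<^bsub>G\<^esub> a)"

definition malnormal :: "'u set => ('u, 'b) monoid_scheme => bool"
  where "malnormal X G \<longleftrightarrow> (\<forall>g\<in>carrier G - X. \<forall>x\<in>X. inv\<^bsub>G\<^esub> g \<otimes>\<^bsub>G\<^esub> (x \<otimes>\<^bsub>G\<^esub> g) \<in> X --> x = \<one>\<^bsub>G\<^esub>)"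

text \<open>\<open>\<iota>\<close> provides names for new elements. The conditions on
  \<open>R\<close> are those of \<open>relators\<close> in multiplicative form, cleared of
  inverses.\<close>

locale amalgam_data = group_pair A B H for A B :: "'u monoid" and H +
  fixes R :: "('u \<times> 'u \<times> 'u \<times> 'u) set" and \<iota> :: "'u list => 'u"
  assumes mal_A: "malnormal H A" and mal_B: "malnormal H B"
    and R_mem': "\<And>a s t g. (a, s, t, g) \<in> R ==> a \<in> carrier B - H \<and> s \<in> carrier A - H \<and> t \<in> carrier A - H \<and> s \<noteq> t \<and> g \<in> H"
    and R_conj': "\<And>a s t g a' s' t' g' h1 h2. (a, s, t, g) \<in> R ==> (a', s', t', g') \<in> R ==>
      h1 \<in> H ==> h2 \<in> H ==> h2 \<otimes>\<^bsub>B\<^esub> a = a' \<otimes>\<^bsub>B\<^esub> h1 ==> h1 \<otimes>\<^bsub>A\<^esub> s = s' \<otimes>\<^bsub>A\<^esub> h2 ==>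
      h1 \<otimes>\<^bsub>A\<^esub> t = t' \<otimes>\<^bsub>A\<^esub> h2 ==> h1 \<otimes>\<^bsub>A\<^esub> g = g' \<otimes>\<^bsub>A\<^esub> h1"
    and \<iota>_inj: "inj \<iota>" and \<iota>_new: "range \<iota> \<inter> (carrier A \<union> carrier B) = {}"
begin

definition R' where "R' = {(r.emb a, l.emb s, l.emb t, l.emb g) | a s t g. (a, s, t, g) \<in> R}"

lemma l_emb_eq: "a \<in> carrier A ==> b \<in> carrier A ==> l.emb a = l.emb b \<longleftrightarrow> a = b"
  using inj_onD[OF l_emb_inj] by auto

lemma r_emb_eq: "a \<in> carrier B ==> b \<in> carrier B ==> r.emb a = r.emb b \<longleftrightarrow> a = b"
  using inj_onD[OF r_emb_inj] by auto

lemma l_emb_K: "a \<in> carrier A ==> l.emb a \<in> Kset"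
  unfolding Kset_def by (rule imageI)

lemma r_emb_L: "a \<in> carrier B ==> r.emb a \<in> Lset"
  unfolding Lset_def by (rule imageI)

lemma l_emb_L: assumes "a \<in> carrier A" shows "l.emb a \<in> Lset \<longleftrightarrow> a \<in> H"
proof
  assume "l.emb a \<in> Lset"
  then obtain b where b: "b \<in> carrier B" "l.emb a = r.emb b" unfolding Lset_def by (elim imageE)
  then show "a \<in> H" using emb_eqD[OF assms b] assms inter by auto
next
  assume "a \<in> H"
  then show "l.emb a \<in> Lset" using r_emb_L[of a] emb_H[of a] inter by auto
qed

lemma r_emb_K: assumes "b \<in> carrier B" shows "r.emb b \<in> Kset \<longleftrightarrow> b \<in> H"
proof
  assume "r.emb b \<in> Kset"
  then obtain a where a: "a \<in> carrier A" "r.emb b = l.emb a" unfolding Kset_def by (elim imageE)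
  then show "b \<in> H" using emb_eqD[OF a(1) assms] assms inter by auto
next
  assume "b \<in> H"
  then show "r.emb b \<in> Kset" using l_emb_K[of b] emb_H[of b] inter by auto
qed

lemma H_obtain: assumes "h \<in> amalgam.H Kset Lset" obtains a where "a \<in> H" "h = l.emb a"
proof -
  have "h \<in> Kset" "h \<in> Lset" using assms unfolding amalgam.H_def[OF amalgam_axioms] by auto
  then obtain a where "a \<in> carrier A" "h = l.emb a" unfolding Kset_def by (elim imageE)
  then show thesis using that[of a] l_emb_L[of a] \<open>h \<in> Lset\<close> by auto
qed

lemma H_A': "h \<in> H ==> h \<in> carrier A" and H_B': "h \<in> H ==> h \<in> carrier B"
  using inter by auto

lemma relators_emb: "relators Kset Lset R'"
proof (intro relators.intro amalgam_axioms relators_axioms.intro)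
  fix a s t g assume "(a, s, t, g) \<in> R'"
  then obtain a' s' t' g' where e: "a = r.emb a'" "s = l.emb s'" "t = l.emb t'" "g = l.emb g'" and r: "(a', s', t', g') \<in> R"
    unfolding R'_def by auto
  have m: "a' \<in> carrier B" "a' \<notin> H" "s' \<in> carrier A" "s' \<notin> H" "t' \<in> carrier A" "t' \<notin> H" "s' \<noteq> t'" "g' \<in> carrier A" "g' \<in> H"
    using R_mem'[OF r] H_A' by auto
  show "a \<in> Lset \<and> a \<notin> Kset \<and> s \<in> Kset \<and> s \<notin> Lset \<and> t \<in> Kset \<and> t \<notin> Lset \<and> s \<noteq> t \<and> g \<in> Kset \<and> g \<in> Lset"
    unfolding e using m by (simp add: r_emb_L r_emb_K l_emb_K l_emb_L l_emb_eq)
next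
  fix a s t g a' s' t' g' h1 h2
  assume as: "(a, s, t, g) \<in> R'" "(a', s', t', g') \<in> R'" "h1 \<in> amalgam.H Kset Lset" "h2 \<in> amalgam.H Kset Lset"
    and e: "a = - h2 + a' + h1" "s = - h1 + s' + h2" "t = - h1 + t' + h2"
  obtain a1 s1 t1 g1 where e1: "a = r.emb a1" "s = l.emb s1" "t = l.emb t1" "g = l.emb g1" and r1: "(a1, s1, t1, g1) \<in> R"
    using as(1) unfolding R'_def by auto
  obtain a2 s2 t2 g2 where e2: "a' = r.emb a2" "s' = l.emb s2" "t' = l.emb t2" "g' = l.emb g2" and r2: "(a2, s2, t2, g2) \<in> R"
    using as(2) unfolding R'_def by auto
  obtain x where x: "x \<in> H" "h1 = l.emb x" using as(3) by (rule H_obtain)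
  obtain y where y: "y \<in> H" "h2 = l.emb y" using as(4) by (rule H_obtain)
  note m = H_A'[OF x(1)] H_B'[OF x(1)] H_A'[OF y(1)] H_B'[OF y(1)]
  have m1: "a1 \<in> carrier B" "s1 \<in> carrier A" "t1 \<in> carrier A" "g1 \<in> carrier A" using R_mem'[OF r1] H_A' by auto
  have m2: "a2 \<in> carrier B" "s2 \<in> carrier A" "t2 \<in> carrier A" "g2 \<in> carrier A" using R_mem'[OF r2] H_A' by auto
  have "h2 + a = a' + h1" unfolding e by (simp add: add.assoc)
  then have "r.emb (y \<otimes>\<^bsub>B\<^esub> a1) = r.emb (a2 \<otimes>\<^bsub>B\<^esub> x)"
    using m m1 m2 by (simp add: r.emb_mult e1 e2 x(2) y(2) emb_H[OF x(1)] emb_H[OF y(1)])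
  then have ea: "y \<otimes>\<^bsub>B\<^esub> a1 = a2 \<otimes>\<^bsub>B\<^esub> x" using r_emb_eq m m1 m2 r.m_closed by simp
  have "h1 + s = s' + h2" unfolding e by (simp add: add.assoc)
  then have "l.emb (x \<otimes>\<^bsub>A\<^esub> s1) = l.emb (s2 \<otimes>\<^bsub>A\<^esub> y)"
    using m m1 m2 by (simp add: l.emb_mult e1 e2 x(2) y(2))
  then have es: "x \<otimes>\<^bsub>A\<^esub> s1 = s2 \<otimes>\<^bsub>A\<^esub> y" using l_emb_eq m m1 m2 l.m_closed by simp
  have "h1 + t = t' + h2" unfolding e by (simp add: add.assoc)
  then have "l.emb (x \<otimes>\<^bsub>A\<^esub> t1) = l.emb (t2 \<otimes>\<^bsub>A\<^esub> y)"
    using m m1 m2 by (simp add: l.emb_mult e1 e2 x(2) y(2))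
  then have et: "x \<otimes>\<^bsub>A\<^esub> t1 = t2 \<otimes>\<^bsub>A\<^esub> y" using l_emb_eq m m1 m2 l.m_closed by simp
  have "x \<otimes>\<^bsub>A\<^esub> g1 = g2 \<otimes>\<^bsub>A\<^esub> x" by (rule R_conj'[OF r1 r2 x(1) y(1) ea es et])
  then have "l.emb x + l.emb g1 = l.emb g2 + l.emb x" using m m1 m2 l.emb_mult by metis
  then have "- l.emb x + (l.emb x + l.emb g1) = - l.emb x + (l.emb g2 + l.emb x)" by simp
  then show "g = - h1 + g' + h1" by (simp add: e1 e2 x(2) add.assoc)
next
  fix k h assume as: "k \<in> Kset" "k \<notin> Lset" "h \<in> amalgam.H Kset Lset" "- k + h + k \<in> amalgam.H Kset Lset"
  obtain a where a: "a \<in> carrier A" "k = l.emb a" "a \<notin> H" using as(1,2) by (rule Kset_rep)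
  obtain x where x: "x \<in> H" "h = l.emb x" using as(3) by (rule H_obtain)
  obtain y where y: "y \<in> H" "- k + h + k = l.emb y" using as(4) by (rule H_obtain)
  have "l.emb (inv\<^bsub>A\<^esub> a \<otimes>\<^bsub>A\<^esub> (x \<otimes>\<^bsub>A\<^esub> a)) = l.emb y"
    using a x(1) H_A'[OF x(1)] y(2)[symmetric] by (simp add: l.emb_mult l.emb_inv x(2) add.assoc)
  then have "inv\<^bsub>A\<^esub> a \<otimes>\<^bsub>A\<^esub> (x \<otimes>\<^bsub>A\<^esub> a) = y" using l_emb_eq a H_A'[OF x(1)] H_A'[OF y(1)] by simp
  then have "x = \<one>\<^bsub>A\<^esub>" using mal_A a x(1) y(1) unfolding malnormal_def by blast
  then show "h = 0" using x l.emb_one by simp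
next
  fix k h assume as: "k \<in> Lset" "k \<notin> Kset" "h \<in> amalgam.H Kset Lset" "- k + h + k \<in> amalgam.H Kset Lset"
  obtain a where a: "a \<in> carrier B" "k = r.emb a" "a \<notin> H" using as(1,2) by (rule Lset_rep)
  obtain x where x: "x \<in> H" "h = l.emb x" using as(3) by (rule H_obtain)
  obtain y where y: "y \<in> H" "- k + h + k = l.emb y" using as(4) by (rule H_obtain)
  have "r.emb (inv\<^bsub>B\<^esub> a \<otimes>\<^bsub>B\<^esub> (x \<otimes>\<^bsub>B\<^esub> a)) = r.emb y"
    using a x(1) H_B'[OF x(1)] y(2) by (simp add: r.emb_mult r.emb_inv x(2) emb_H add.assoc y(1))
  then have "inv\<^bsub>B\<^esub> a \<otimes>\<^bsub>B\<^esub> (x \<otimes>\<^bsub>B\<^esub> a) = y" using r_emb_eq a H_B'[OF x(1)] H_B'[OF y(1)] by simp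
  then have "x = \<one>\<^bsub>B\<^esub>" using mal_B a x(1) y(1) unfolding malnormal_def by blast
  then show "h = 0" using x l.emb_one one_eq by simp
qed

end

sublocale amalgam_data \<subseteq> relators Kset Lset R'
  by (rule relators_emb)

context amalgam_data
begin

definition code :: "('u \<times> 'u list) sym => 'u list"
  where "code x = fst (app x base) # snd (app x base)"

lemma code_inj: "x \<in> F ==> y \<in> F ==> code x = code y ==> x = y"
  by (rule F_base) (simp_all add: code_def prod_eq_iff)

lemma zigzag_set: "zigzag U W ts ==> t \<in> set ts ==> U t \<or> W t"
  by (induction rule: zigzag.induct) auto

lemma code_set:
  assumes "x \<in> F" shows "set (code x) \<subseteq> carrier A \<union> carrier B"
proof -
  obtain h ts where x: "app x base = (h, ts)" by (cases "app x base")
  consider "x \<in> amalgam.H Kset Lset" | "alt Kset Lset x" | "alt Lset Kset x" using assms unfolding F_def by blast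
  then have "app x base \<in> l.nfs"
  proof cases
    case 1
    then obtain a where a: "a \<in> H" "x = l.emb a" by (rule H_obtain)
    then have "app x base = l.norm a []" using app_l_emb_base[OF H_A'[OF a(1)]] by simp
    then show ?thesis using l.norm_nfs[OF H_A'[OF a(1)] Nil_T(1)] by simp
  next
    case 2
    from alt_app[OF this] show ?thesis by auto
  next
    case 3
    from alt_app[OF this] show ?thesis by auto
  qed
  then have "(h, ts) \<in> l.nfs" using x by simp
  then have h: "h \<in> H" and "ts \<in> TA \<or> ts \<in> TB" by (auto simp: nfs_l)
  then have "l.is_rep t \<or> r.is_rep t" if "t \<in> set ts" for t
    using that zigzag_set[of l.is_rep r.is_rep ts t] zigzag_set[of r.is_rep l.is_rep ts t] unfolding TA_def TB_def by auto
  then have "t \<in> carrier A \<union> carrier B" if "t \<in> set ts" for t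
    using that unfolding l.is_rep_def r.is_rep_def by blast
  then show ?thesis using H_A'[OF h] by (simp add: code_def x subset_iff)
qed

definition cls where "cls x = {y \<in> F. - x + y \<in> N}"

text \<open>Names the classes modulo \<open>N\<close> so that elements of \<open>A\<close> and
  \<open>B\<close> keep their names, and only classes without such an element get a fresh one. The
  quotient then extends both factors by inclusion.\<close>

definition q where "q x = (if \<exists>a\<in>carrier A. l.emb a \<in> cls x then SOME a. a \<in> carrier A \<and> l.emb a \<in> cls x
  else if \<exists>b\<in>carrier B. r.emb b \<in> cls x then SOME b. b \<in> carrier B \<and> r.emb b \<in> cls x
  else \<iota> (code (SOME y. y \<in> cls x)))"

lemma cls_refl: "x \<in> F ==> x \<in> cls x"
  using N_0 by (simp add: cls_def)

lemma cls_rel: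
  assumes "x \<in> F" "y \<in> F" "z \<in> cls x" "z \<in> cls y" shows "- x + y \<in> N"
proof -
  have "- x + z \<in> N" "- y + z \<in> N" using assms by (simp_all add: cls_def)
  then have "(- x + z) + - (- y + z) \<in> N" by (rule N_add[OF _ N_neg])
  then show ?thesis by (simp add: diff_conv_add_uminus minus_add add.assoc del: add_uminus_conv_diff)
qed

lemma cls_eq:
  assumes "x \<in> F" "y \<in> F" "- x + y \<in> N" shows "cls x = cls y"
proof -
  have "- x + z \<in> N \<longleftrightarrow> - y + z \<in> N" for z
  proof
    assume "- x + z \<in> N"
    then have "- (- x + y) + (- x + z) \<in> N" using N_add N_neg assms by blast
    then show "- y + z \<in> N" by (simp add: minus_add add.assoc)
  next
    assume "- y + z \<in> N"
    then have "(- x + y) + (- y + z) \<in> N" using N_add assms by blast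
    then show "- x + z \<in> N" by (simp add: add.assoc)
  qed
  then show ?thesis by (simp add: cls_def)
qed

lemma q_cases:
  assumes "x \<in> F"
  obtains (A) "q x \<in> carrier A" "l.emb (q x) \<in> cls x"
  | (B) "q x \<in> carrier B" "r.emb (q x) \<in> cls x"
  | (new) y where "q x = \<iota> (code y)" "y \<in> cls x"
proof (cases "\<exists>a\<in>carrier A. l.emb a \<in> cls x")
  case True
  then have ex: "\<exists>a. a \<in> carrier A \<and> l.emb a \<in> cls x" by blast
  have "q x = (SOME a. a \<in> carrier A \<and> l.emb a \<in> cls x)" using True by (simp add: q_def)
  then show thesis using someI_ex[OF ex] A by simp
next
  case nA: False
  show thesis
  proof (cases "\<exists>b\<in>carrier B. r.emb b \<in> cls x")
    case True
    then have ex: "\<exists>a. a \<in> carrier B \<and> r.emb a \<in> cls x" by blast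
    have "q x = (SOME a. a \<in> carrier B \<and> r.emb a \<in> cls x)" using nA True by (simp add: q_def)
    then show thesis using someI_ex[OF ex] B by simp
  next
    case False
    have "q x = \<iota> (code (SOME y. y \<in> cls x))" using nA False by (simp add: q_def)
    then show thesis using new cls_refl[OF assms] someI[of "\<lambda>y. y \<in> cls x" x] by simp
  qed
qed

lemma q_eq:
  assumes x: "x \<in> F" and y: "y \<in> F" shows "q x = q y \<longleftrightarrow> - x + y \<in> N"
proof
  assume "- x + y \<in> N"
  then show "q x = q y" using cls_eq[OF x y] by (simp add: q_def)
next
  assume e: "q x = q y"
  have new: "\<iota> c \<notin> carrier A" "\<iota> c \<notin> carrier B" for c using \<iota>_new by auto
  have AB: "l.emb a = r.emb a" if "a \<in> carrier A" "a \<in> carrier B" for a using emb_H that inter by blast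
  show "- x + y \<in> N"
    using x
  proof (cases rule: q_cases)
    case xA: A
    show ?thesis using y
    proof (cases rule: q_cases)
      case A show ?thesis using cls_rel[OF x y xA(2)] A e by simp
    next
      case B show ?thesis using cls_rel[OF x y xA(2)] B e xA AB by simp
    next
      case (new z) then show ?thesis using xA e \<open>\<And>c. \<iota> c \<notin> carrier A\<close> by simp
    qed
  next
    case xB: B
    show ?thesis using y
    proof (cases rule: q_cases)
      case A show ?thesis using cls_rel[OF x y xB(2)] A e xB AB by simp
    next
      case B show ?thesis using cls_rel[OF x y xB(2)] B e by simp
    next
      case (new z) then show ?thesis using xB e \<open>\<And>c. \<iota> c \<notin> carrier B\<close> by simp
    qed
  next
    case xn: (new z)
    show ?thesis using y
    proof (cases rule: q_cases)
      case A then show ?thesis using xn e new by simp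
    next
      case B then show ?thesis using xn e new by simp
    next
      case (new w)
      then have "code z = code w" using xn(1) e inj_eq[OF \<iota>_inj] by simp
      moreover have "z \<in> F" "w \<in> F" using new xn by (auto simp: cls_def)
      ultimately have "z = w" using code_inj by simp
      then show ?thesis using cls_rel[OF x y xn(2)] new by simp
    qed
  qed
qed

lemma emb_F: "a \<in> carrier A ==> l.emb a \<in> F" "b \<in> carrier B ==> r.emb b \<in> F"
  using K_F l_emb_K L_F r_emb_L by blast+

lemma q_A: assumes "a \<in> carrier A" shows "q (l.emb a) = a"
proof -
  have "l.emb a \<in> cls (l.emb a)" using cls_refl emb_F assms by blast
  then have ex: "\<exists>c. c \<in> carrier A \<and> l.emb c \<in> cls (l.emb a)" using assms by blast
  then have "q (l.emb a) = (SOME c. c \<in> carrier A \<and> l.emb c \<in> cls (l.emb a))" unfolding q_def by auto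
  then have c: "q (l.emb a) \<in> carrier A" "- l.emb a + l.emb (q (l.emb a)) \<in> N"
    using someI_ex[OF ex] by (simp_all add: cls_def)
  then have "- l.emb a + l.emb (q (l.emb a)) = 0"
    by (intro N_K K_add K_neg l_emb_K assms)
  then have "l.emb a = l.emb (q (l.emb a))" by (metis add_0_right add_minus_cancel)
  then show ?thesis using l_emb_eq assms c by simp
qed

lemma q_B: assumes b: "b \<in> carrier B" shows "q (r.emb b) = b"
proof (cases "\<exists>a\<in>carrier A. l.emb a \<in> cls (r.emb b)")
  case True
  then obtain a where a: "a \<in> carrier A" "- r.emb b + l.emb a \<in> N" by (auto simp: cls_def)
  have "- l.emb a + r.emb b \<in> N" using N_neg[OF a(2)] by (simp add: minus_add)
  then have "l.emb a = r.emb b" using N_K_L l_emb_K r_emb_L a b by blast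
  then show ?thesis using q_A a emb_eqD[OF a(1) b] by metis
next
  case False
  have "r.emb b \<in> cls (r.emb b)" using cls_refl emb_F assms by blast
  then have ex: "\<exists>c. c \<in> carrier B \<and> r.emb c \<in> cls (r.emb b)" using assms by blast
  then have "q (r.emb b) = (SOME c. c \<in> carrier B \<and> r.emb c \<in> cls (r.emb b))" using False unfolding q_def by auto
  then have c: "q (r.emb b) \<in> carrier B" "- r.emb b + r.emb (q (r.emb b)) \<in> N"
    using someI_ex[OF ex] by (simp_all add: cls_def)
  then have "- r.emb b + r.emb (q (r.emb b)) = 0"
    by (intro N_L L_add L_neg r_emb_L assms)
  then have "r.emb b = r.emb (q (r.emb b))" by (metis add_0_right add_minus_cancel)
  then show ?thesis using r_emb_eq assms c by simp
qed

definition M :: "'u monoid" where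
  "M = \<lparr>carrier = q ` F, mult = \<lambda>u v. q (inv_into F q u + inv_into F q v), one = q 0\<rparr>"

lemma F_0: "0 \<in> F"
  by (rule tree.F_0)

lemma q_add:
  assumes x: "x \<in> F" and y: "y \<in> F" shows "q (x + y) = q x \<otimes>\<^bsub>M\<^esub> q y"
proof -
  let ?x = "inv_into F q (q x)" and ?y = "inv_into F q (q y)"
  have x': "?x \<in> F" "q ?x = q x" using x by (auto intro: inv_into_into f_inv_into_f)
  have y': "?y \<in> F" "q ?y = q y" using y by (auto intro: inv_into_into f_inv_into_f)
  have nx: "- x + ?x \<in> N" and ny: "- y + ?y \<in> N" using q_eq x x' y y' by metis+
  have "- y + (- x + ?x) - (- y) \<in> N" by (rule N_conj[OF nx F_neg[OF y]])
  then have "(- y + (- x + ?x) - (- y)) + (- y + ?y) \<in> N" using ny by (rule N_add)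
  then have "- (x + y) + (?x + ?y) \<in> N" by (simp add: minus_add add.assoc diff_conv_add_uminus del: add_uminus_conv_diff)
  then have "q (x + y) = q (?x + ?y)" using q_eq F_add x y x' y' by simp
  then show ?thesis by (simp add: M_def)
qed

lemma M_carrier: "carrier M = q ` F" and M_one: "\<one>\<^bsub>M\<^esub> = q 0"
  by (simp_all add: M_def)

lemma M_group: "group M"
proof (rule groupI)
  fix x y assume "x \<in> carrier M" "y \<in> carrier M"
  then obtain a b where ab: "a \<in> F" "x = q a" "b \<in> F" "y = q b" unfolding M_carrier by (elim imageE)
  then show "x \<otimes>\<^bsub>M\<^esub> y \<in> carrier M" using q_add[of a b] F_add[of a b] unfolding M_carrier by (metis imageI)
next
  show "\<one>\<^bsub>M\<^esub> \<in> carrier M" unfolding M_carrier M_one using F_0 by (rule imageI)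
next
  fix x y z assume "x \<in> carrier M" "y \<in> carrier M" "z \<in> carrier M"
  then obtain a b c where abc: "a \<in> F" "x = q a" "b \<in> F" "y = q b" "c \<in> F" "z = q c" unfolding M_carrier by (elim imageE)
  have "q (a + b + c) = q (a + (b + c))" by (simp add: add.assoc)
  then show "x \<otimes>\<^bsub>M\<^esub> y \<otimes>\<^bsub>M\<^esub> z = x \<otimes>\<^bsub>M\<^esub> (y \<otimes>\<^bsub>M\<^esub> z)" using abc F_add q_add by simp
next
  fix x assume "x \<in> carrier M"
  then obtain a where a: "a \<in> F" "x = q a" unfolding M_carrier by (elim imageE)
  show "\<one>\<^bsub>M\<^esub> \<otimes>\<^bsub>M\<^esub> x = x" using q_add[of 0 a] F_0 a by (simp add: M_one)
  have "q (- a) \<otimes>\<^bsub>M\<^esub> x = \<one>\<^bsub>M\<^esub>" using q_add[of "- a" a] F_neg a by (simp add: M_one)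
  then show "\<exists>y\<in>carrier M. y \<otimes>\<^bsub>M\<^esub> x = \<one>\<^bsub>M\<^esub>" using F_neg a unfolding M_carrier by blast
qed

lemma q_one: "x \<in> F ==> q x = \<one>\<^bsub>M\<^esub> \<longleftrightarrow> x \<in> N"
  using q_eq[of x 0] F_0 N_neg[of x] N_neg[of "- x"] by (auto simp: M_one)

lemma M_A: "carrier A \<subseteq> carrier M" and M_B: "carrier B \<subseteq> carrier M"
  using q_A q_B emb_F unfolding M_carrier by (metis imageI subsetI)+

lemma M_mult_A: "a \<in> carrier A ==> b \<in> carrier A ==> a \<otimes>\<^bsub>M\<^esub> b = a \<otimes>\<^bsub>A\<^esub> b"
  using q_add[of "l.emb a" "l.emb b"] emb_F q_A[of a] q_A[of b] q_A[of "a \<otimes>\<^bsub>A\<^esub> b"] by (simp add: l.emb_mult)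

lemma M_mult_B: "a \<in> carrier B ==> b \<in> carrier B ==> a \<otimes>\<^bsub>M\<^esub> b = a \<otimes>\<^bsub>B\<^esub> b"
  using q_add[of "r.emb a" "r.emb b"] emb_F q_B[of a] q_B[of b] q_B[of "a \<otimes>\<^bsub>B\<^esub> b"] by (simp add: r.emb_mult)

lemma M_one_A: "\<one>\<^bsub>M\<^esub> = \<one>\<^bsub>A\<^esub>"
  using q_A[of "\<one>\<^bsub>A\<^esub>"] l.emb_one by (simp add: M_one)

text \<open>Fresh names are formed from lists over the factors; from this the recursion reads off
  the index and the stage of each element.\<close>

lemma M_new: "carrier M \<subseteq> carrier A \<union> carrier B \<union> \<iota> ` {ts. set ts \<subseteq> carrier A \<union> carrier B}"
proof
  fix m assume "m \<in> carrier M"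
  then obtain x where x: "x \<in> F" "m = q x" unfolding M_carrier by auto
  show "m \<in> carrier A \<union> carrier B \<union> \<iota> ` {ts. set ts \<subseteq> carrier A \<union> carrier B}"
    using x(1)
  proof (cases rule: q_cases)
    case (new y)
    then have "y \<in> F" by (simp add: cls_def)
    then show ?thesis using new x(2) code_set by blast
  qed (use x in auto)
qed

text \<open>A conjugacy equation in the quotient lifts to \<open>F\<close> with an error in
  \<open>N\<close>, which is the form of the hypothesis \<open>mal\<close>.\<close>

lemma malnormal_image:
  assumes X: "\<And>x. x \<in> X ==> \<epsilon> x \<in> S \<and> \<epsilon> x \<in> F \<and> q (\<epsilon> x) = x" and S: "S = \<epsilon> ` X"
    and mal: "\<And>k k' f n. k \<in> S ==> k' \<in> S ==> f \<in> F ==> n \<in> N ==> k + f = n + f + k' ==> k = 0 \<or> (\<exists>m\<in>N. m + f \<in> S)"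
  shows "malnormal X M"
  unfolding malnormal_def
proof (intro ballI impI)
  interpret M: group M by (rule M_group)
  fix g x assume g: "g \<in> carrier M - X" and x: "x \<in> X" and c: "inv\<^bsub>M\<^esub> g \<otimes>\<^bsub>M\<^esub> (x \<otimes>\<^bsub>M\<^esub> g) \<in> X"
  let ?y = "inv\<^bsub>M\<^esub> g \<otimes>\<^bsub>M\<^esub> (x \<otimes>\<^bsub>M\<^esub> g)"
  obtain f where f: "f \<in> F" "g = q f" using g unfolding M_carrier by auto
  have xM: "x \<in> carrier M" and yM: "?y \<in> carrier M" using X[OF x] X[OF c] unfolding M_carrier by force+
  have "x \<otimes>\<^bsub>M\<^esub> g = g \<otimes>\<^bsub>M\<^esub> ?y" using xM g M.m_assoc[symmetric] by simp
  define k where "k = \<epsilon> x"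
  define k' where "k' = \<epsilon> ?y"
  have k: "k \<in> S" "k' \<in> S" "q k = x" "q k' = ?y" "k \<in> F" "k' \<in> F"
    unfolding k_def k'_def using X[OF x] X[OF c] by auto
  have "q (k + f) = q (f + k')" using q_add k f \<open>x \<otimes>\<^bsub>M\<^esub> g = g \<otimes>\<^bsub>M\<^esub> ?y\<close> by simp
  then have "- (f + k') + (k + f) \<in> N" using q_eq F_add k f by metis
  then have "(f + k') + (- (f + k') + (k + f)) - (f + k') \<in> N" using F_add k f by (intro N_conj)
  then have n: "(k + f) - (f + k') \<in> N" by (simp only: add_minus_cancel)
  have "k + f = ((k + f) - (f + k')) + f + k'" by (simp add: add.assoc)
  then have "k = 0 \<or> (\<exists>m\<in>N. m + f \<in> S)" by (rule mal[OF k(1,2) f(1) n])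
  moreover have "\<not> (\<exists>m\<in>N. m + f \<in> S)"
  proof
    assume "\<exists>m\<in>N. m + f \<in> S"
    then obtain m where m: "m \<in> N" "m + f \<in> S" by blast
    obtain a where a: "a \<in> X" "m + f = \<epsilon> a" using m(2) unfolding S by (elim imageE)
    have mF: "m \<in> F" using m N_F by blast
    have "q (m + f) = q m \<otimes>\<^bsub>M\<^esub> q f" using q_add mF f by simp
    also have "\<dots> = g" using q_one[OF mF] m(1) f g by simp
    finally show False using a X[OF a(1)] g by auto
  qed
  ultimately have "k = 0" by blast
  then have "x = q 0" using k by simp
  then show "x = \<one>\<^bsub>M\<^esub>" by (simp add: M_one)
qed

lemma M_malnormal_A: "malnormal (carrier A) M"
  by (rule malnormal_image[OF _ Kset_def malnormal_quot_K]) (simp_all add: l_emb_K q_A emb_F)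

lemma M_malnormal_B: "malnormal (carrier B) M"
  by (rule malnormal_image[OF _ Lset_def malnormal_quot_L]) (simp_all add: r_emb_L q_B emb_F)

lemma M_alt4:
  assumes "k1 \<in> carrier A - H" "l1 \<in> carrier B - H" "k2 \<in> carrier A - H" "l2 \<in> carrier B - H"
  shows "k1 \<otimes>\<^bsub>M\<^esub> l1 \<otimes>\<^bsub>M\<^esub> k2 \<otimes>\<^bsub>M\<^esub> l2 \<noteq> \<one>\<^bsub>M\<^esub>"
proof
  assume e: "k1 \<otimes>\<^bsub>M\<^esub> l1 \<otimes>\<^bsub>M\<^esub> k2 \<otimes>\<^bsub>M\<^esub> l2 = \<one>\<^bsub>M\<^esub>"
  have F: "l.emb k1 \<in> F" "r.emb l1 \<in> F" "l.emb k2 \<in> F" "r.emb l2 \<in> F" using assms emb_F by auto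
  then have F': "l.emb k1 + r.emb l1 \<in> F" "l.emb k1 + r.emb l1 + l.emb k2 \<in> F" using F_add by auto
  have "q (l.emb k1 + r.emb l1 + l.emb k2 + r.emb l2) = \<one>\<^bsub>M\<^esub>"
    using F F' assms by (simp add: q_add q_A q_B e)
  then have "l.emb k1 + r.emb l1 + l.emb k2 + r.emb l2 \<in> N" using q_one[OF F_add[OF F'(2) F(4)]] by simp
  then show False using N_alt4 assms by (simp add: l_emb_K l_emb_L r_emb_L r_emb_K)
qed

lemma word_edge:
  assumes "(a, s, t, g) \<in> R" "int n < period"
  shows "edge (r.emb a, l.emb s, l.emb t, l.emb g) (2 * int n) \<in> F \<and>
    q (edge (r.emb a, l.emb s, l.emb t, l.emb g) (2 * int n)) = word M a s t n"
  using assms(2)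
proof (induction n)
  case 0
  then show ?case using F_0 by (simp add: M_one)
next
  case (Suc n)
  let ?x = "(r.emb a, l.emb s, l.emb t, l.emb g)"
  let ?u = "if mark (int n) then s else t"
  have m: "a \<in> carrier B" "?u \<in> carrier A" using R_mem'[OF assms(1)] by auto
  have l1: "letter ?x (2 * int n) = l.emb ?u" by (simp add: letter_even)
  have "2 * int n + 1 < per - 1" using Suc(2) by (simp add: per_def)
  then have "(2 * int n + 1) mod per \<noteq> per - 1" by (subst mod_pos_pos_trivial) auto
  then have l2: "letter ?x (2 * int n + 1) = r.emb a" by simp
  have "edge ?x (2 * int (Suc n)) = edge ?x (2 * int n) + (l.emb ?u + r.emb a)"
    using edge_step[of ?x "2 * int n"] edge_step[of ?x "2 * int n + 1"] l1 l2 by (simp add: add.assoc algebra_simps)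
  then show ?case using Suc m emb_F by (simp add: q_add F_add q_A q_B)
qed

text \<open>One period of letters is the word times the inverse of \<open>g\<close>, and it lies in
  \<open>N\<close>.\<close>

lemma M_word:
  assumes "(a, s, t, g) \<in> R" shows "word M a s t (nat period) = g"
proof -
  interpret M: group M by (rule M_group)
  let ?x = "(r.emb a, l.emb s, l.emb t, l.emb g)"
  define n where "n = nat period - 1"
  have n: "nat period = Suc n" "int n < period" "2 * int n + 1 = per - 1" using period_pos by (auto simp: n_def per_def)
  let ?u = "if mark (int n) then s else t"
  have m: "a \<in> carrier B" "?u \<in> carrier A" "g \<in> carrier A" using R_mem'[OF assms(1)] H_A' by auto
  have l1: "letter ?x (2 * int n) = l.emb ?u" by (simp add: letter_even)
  have "odd (2 * int n + 1)" "(2 * int n + 1) mod per = per - 1"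
    unfolding n(3) using n(3) by (auto simp: per_eq)
  then have l2: "letter ?x (2 * int n + 1) = r.emb a - l.emb g" by simp
  have r: "rel ?x = edge ?x (2 * int n) + (l.emb ?u + r.emb a) - l.emb g"
    using edge_step[of ?x "2 * int n"] edge_step[of ?x "2 * int n + 1"] l1 l2 n(3)
    by (simp add: rel_def add.assoc diff_conv_add_uminus del: add_uminus_conv_diff)
  have W: "edge ?x (2 * int n) + (l.emb ?u + r.emb a) \<in> F" (is "?W \<in> F")
    using conjunct1[OF word_edge[OF assms n(2)]] emb_F(1)[OF m(2)] emb_F(2)[OF m(1)] by (intro F_add)
  have "?x \<in> R'" unfolding R'_def using assms by blast
  then have "rel ?x \<in> N" by (rule rel_N)
  then have N: "?W - l.emb g \<in> N" unfolding r .
  have "q ?W = q ((?W - l.emb g) + l.emb g)" by (simp add: add.assoc)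
  also have "\<dots> = q (?W - l.emb g) \<otimes>\<^bsub>M\<^esub> q (l.emb g)" using N N_F m emb_F by (intro q_add) auto
  also have "\<dots> = g" using N N_F m q_A M_A by (subst iffD2[OF q_one]) auto
  finally have "q ?W = g" .
  moreover have "q ?W = word M a s t (Suc n)" using word_edge[OF assms n(2)] emb_F(1)[OF m(2)] emb_F(2)[OF m(1)] q_A[OF m(2)] q_B[OF m(1)]
    by (simp only: q_add F_add word.simps)
  ultimately show ?thesis using n by simp
qed

end

section \<open>Walks along a coherent sequence\<close>

text \<open>\<open>\<beta>\<close> is a limit of points of \<open>C\<close> and need not belong to
  \<open>C\<close>.\<close>

definition accp :: "'a::wellorder set => 'a => bool"
  where "accp C \<beta> \<longleftrightarrow> (\<exists>x. x < \<beta>) \<and> (\<forall>x<\<beta>. \<exists>y\<in>C. x < y \<and> y < \<beta>)"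

definition lim :: "'a::wellorder => bool" where "lim d \<longleftrightarrow> accp UNIV d"

lemma accp_lim: "accp C \<beta> ==> lim \<beta>"
  unfolding lim_def accp_def by blast

text \<open>An initial segment whose order type is a regular uncountable cardinal.\<close>

locale segment =
  fixes K :: "'a::wellorder set"
  assumes down: "x \<in> K ==> y \<le> x ==> y \<in> K"
    and regular: "X \<subseteq> K ==> |X| <o |K| ==> \<exists>b\<in>K. \<forall>x\<in>X. x < b"
    and initial: "y \<in> K ==> |{..y}| <o |K|"
    and uncountable: "natLeq <o |K|"
begin

lemma max_mem: "x \<in> K ==> y \<in> K ==> max x y \<in> K"
  by (simp add: max_def)

lemma bounded_image:
  assumes "\<And>x. x \<in> K ==> f x \<in> K" "y \<in> K" shows "\<exists>b\<in>K. \<forall>x\<le>y. f x < b"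
proof -
  have "|f ` {..y}| <o |K|" using initial[OF assms(2)] card_of_image ordLeq_ordLess_trans by blast
  then show ?thesis using regular[of "f ` {..y}"] assms down by blast
qed

lemma no_max: "x \<in> K ==> \<exists>y\<in>K. x < y"
  using bounded_image[of id x] by auto

lemma bounded_range:
  assumes "\<And>n. f n \<in> K" shows "\<exists>b\<in>K. \<forall>n::nat. f n < b"
proof -
  have "|range f| \<le>o |UNIV :: nat set|" by (rule card_of_image)
  then have "|range f| <o |K|" using uncountable card_of_nat ordLeq_ordIso_trans ordLeq_ordLess_trans by blast
  then show ?thesis using regular[of "range f"] assms by auto
qed

text \<open>Iterate a function dominating \<open>f\<close> countably often; the supremum stays in
  \<open>K\<close> by uncountable regularity and is closed under \<open>f\<close>.\<close>

lemma closure_point: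
  assumes f: "\<And>x. x \<in> K ==> f x \<in> K" and x: "x \<in> K"
  shows "\<exists>d\<in>K. lim d \<and> x < d \<and> (\<forall>y<d. f y < d)"
proof -
  have "\<exists>g. \<forall>y\<in>K. g y \<in> K \<and> y < g y \<and> (\<forall>z\<le>y. f z < g y)"
  proof (rule bchoice, intro ballI)
    fix y assume y: "y \<in> K"
    obtain b where "b \<in> K" "\<forall>z\<le>y. max z (f z) < b"
      using bounded_image[of "\<lambda>z. max z (f z)" y] max_mem f y by blast
    then show "\<exists>b. b \<in> K \<and> y < b \<and> (\<forall>z\<le>y. f z < b)" by auto
  qed
  then obtain g where g: "\<And>y. y \<in> K ==> g y \<in> K" "\<And>y. y \<in> K ==> y < g y"
    "\<And>y z. y \<in> K ==> z \<le> y ==> f z < g y" by blast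
  define s where "s n = (g ^^ n) x" for n
  have s: "s n \<in> K" for n by (induction n) (auto simp: s_def x g)
  have sS: "s (Suc n) = g (s n)" for n by (simp add: s_def)
  obtain b where b: "b \<in> K" "\<forall>n. s n < b" using bounded_range[of s] s by blast
  define d where "d = (LEAST b. \<forall>n. s n < b)"
  have d: "\<forall>n. s n < d" unfolding d_def by (rule LeastI[of _ b]) (rule b(2))
  have "d \<le> b" unfolding d_def by (rule Least_le) (rule b(2))
  have reach: "\<exists>n. y \<le> s n" if "y < d" for y
    using not_less_Least[of y "\<lambda>b. \<forall>n. s n < b"] that not_less unfolding d_def by blast
  show ?thesis
  proof (intro bexI[of _ d] conjI allI impI)
    show "d \<in> K" using down b \<open>d \<le> b\<close> by blast
    show "x < d" using d[rule_format, of 0] by (simp add: s_def)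
    then show "lim d"
      unfolding lim_def accp_def using reach d g(2)[OF s] sS by (metis UNIV_I order_le_less_trans)
    show "f y < d" if "y < d" for y
    proof -
      obtain n where "y \<le> s n" using reach \<open>y < d\<close> by blast
      then have "f y < s (Suc n)" using g(3)[OF s] sS by simp
      then show ?thesis using d order_less_trans by blast
    qed
  qed
qed

text \<open>The usual notion: the limit closure points of a function form a club, and every club
  contains the limit closure points of some function.\<close>

definition stationary :: "'a set => bool"
  where "stationary S \<longleftrightarrow> (\<forall>f. (\<forall>x\<in>K. f x \<in> K) --> (\<exists>d\<in>S. d \<in> K \<and> lim d \<and> (\<forall>y<d. f y < d)))"

lemma stationaryE:
  assumes "stationary S" "\<And>x. x \<in> K ==> f x \<in> K" "x \<in> K"
  obtains d where "d \<in> S" "d \<in> K" "lim d" "x < d" "\<And>y. y < d ==> f y < d"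
proof -
  have "\<forall>y\<in>K. max x (f y) \<in> K" using assms max_mem by simp
  then have "\<exists>d\<in>S. d \<in> K \<and> lim d \<and> (\<forall>y<d. max x (f y) < d)"
    by (rule spec[OF assms(1)[unfolded stationary_def], of "\<lambda>y. max x (f y)", THEN mp])
  then obtain d where "d \<in> S" "d \<in> K" "lim d" "\<And>y. y < d ==> max x (f y) < d" by blast
  moreover obtain y where "y < d" using \<open>lim d\<close> unfolding lim_def accp_def by blast
  ultimately show thesis using that by auto
qed

end

locale coherent_seq = segment K for K :: "'a::wellorder set" +
  fixes C :: "'a => 'a set"
  assumes C_below: "d \<in> K ==> lim d ==> C d \<subseteq> {..<d}"
    and C_cofinal: "d \<in> K ==> lim d ==> x < d ==> \<exists>y\<in>C d. x < y"
    and C_closed: "d \<in> K ==> lim d ==> \<beta> < d ==> accp (C d) \<beta> ==> \<beta> \<in> C d"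
    and C_coherent: "d \<in> K ==> lim d ==> \<beta> \<in> C d ==> accp (C d) \<beta> ==> C \<beta> = C d \<inter> {..<\<beta>}"
    and no_thread: "\<not> (\<exists>D\<subseteq>K. (\<forall>x\<in>K. \<exists>y\<in>D. x < y) \<and> (\<forall>\<beta>\<in>K. accp D \<beta> --> \<beta> \<in> D) \<and>
      (\<forall>\<alpha>\<in>D. accp D \<alpha> --> D \<inter> {..<\<alpha>} = C \<alpha>))"
begin

definition first :: "'a => 'a => 'a" where "first j d = (LEAST y. y \<in> C d \<and> j \<le> y)"

definition starts :: "'a => 'a => 'a set" where "starts j t = {d. j < d \<and> first j d = t}"

lemma first:
  assumes "d \<in> K" "lim d" "j < d"
  shows "first j d \<in> C d" "j \<le> first j d" "first j d < d" "\<And>y. y \<in> C d ==> j \<le> y ==> first j d \<le> y"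
proof -
  obtain y where "y \<in> C d \<and> j \<le> y" using C_cofinal[OF assms] less_imp_le by blast
  then have "first j d \<in> C d \<and> j \<le> first j d" unfolding first_def by (rule LeastI)
  then show "first j d \<in> C d" "j \<le> first j d" "first j d < d" using C_below[OF assms(1,2)] by auto
  show "first j d \<le> y" if "y \<in> C d" "j \<le> y" for y unfolding first_def using that by (intro Least_le) simp
qed

text \<open>If no \<open>j\<close> worked, a common bound for the first point of \<open>C d\<close> above \<open>j\<close> would make the
  closure points \<open>d\<close> of that bound accumulation points of each other's \<open>C\<close>, giving a thread.\<close>

lemma ex_starts: "\<exists>j\<in>K. \<forall>b\<in>K. \<exists>t\<in>K. b < t \<and> stationary (starts j t)"
proof (rule ccontr)
  assume "\<not> ?thesis"
  then have "\<forall>j\<in>K. \<exists>b\<in>K. \<forall>t\<in>K. b < t --> \<not> stationary (starts j t)" by meson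
  then obtain \<eta> where \<eta>: "\<And>j. j \<in> K ==> \<eta> j \<in> K"
    "\<And>j t. j \<in> K ==> t \<in> K ==> \<eta> j < t ==> \<not> stationary (starts j t)"
    using bchoice[of K "\<lambda>j b. b \<in> K \<and> (\<forall>t\<in>K. b < t --> \<not> stationary (starts j t))"] by blast
  have "\<exists>f. (\<forall>x\<in>K. f x \<in> K) \<and> (j \<in> K \<and> t \<in> K \<and> \<eta> j < t -->
      (\<forall>d\<in>K. lim d --> (\<forall>y<d. f y < d) --> d \<notin> starts j t))" for j t
  proof (cases "j \<in> K \<and> t \<in> K \<and> \<eta> j < t")
    case True
    then show ?thesis using \<eta>(2)[of j t] unfolding stationary_def by blast
  qed (auto intro: exI[of _ id])
  then obtain f where f: "\<And>j t x. x \<in> K ==> f j t x \<in> K"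
    "\<And>j t d. j \<in> K ==> t \<in> K ==> \<eta> j < t ==> d \<in> K ==> lim d ==> (\<And>y. y < d ==> f j t y < d) ==> d \<notin> starts j t"
    by metis
  have "\<exists>g. \<forall>x\<in>K. g x \<in> K \<and> \<eta> x < g x \<and> (\<forall>j\<le>x. \<forall>t\<le>x. \<forall>y\<le>x. f j t y < g x)"
  proof (rule bchoice, intro ballI)
    fix x assume x: "x \<in> K"
    have 1: "\<exists>b\<in>K. \<forall>y\<le>x. f j t y < b" for j t using bounded_image[of "f j t"] f x by blast
    obtain b1 where b1: "\<And>j t. b1 j t \<in> K" "\<And>j t y. y \<le> x ==> f j t y < b1 j t" using 1 by metis
    have 2: "\<exists>b\<in>K. \<forall>t\<le>x. b1 j t < b" for j using bounded_image[of "b1 j"] b1 x by blast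
    obtain b2 where b2: "\<And>j. b2 j \<in> K" "\<And>j t. t \<le> x ==> b1 j t < b2 j" using 2 by metis
    obtain b3 where b3: "b3 \<in> K" "\<And>j. j \<le> x ==> b2 j < b3" using bounded_image[of b2] b2 x by blast
    obtain c where c: "c \<in> K" "max (\<eta> x) b3 < c" using no_max[OF max_mem] b3(1) \<eta>(1)[OF x] by blast
    have "f j t y < c" if "j \<le> x" "t \<le> x" "y \<le> x" for j t y
      using b1(2)[OF that(3), of j t] b2(2)[OF that(2), of j] b3(2)[OF that(1)] c(2) by (meson max_less_iff_conj order_less_trans)
    then show "\<exists>b. b \<in> K \<and> \<eta> x < b \<and> (\<forall>j\<le>x. \<forall>t\<le>x. \<forall>y\<le>x. f j t y < b)" using c by auto
  qed
  then obtain g where g: "\<And>x. x \<in> K ==> g x \<in> K" "\<And>x. x \<in> K ==> \<eta> x < g x"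
    "\<And>x j t y. x \<in> K ==> j \<le> x ==> t \<le> x ==> y \<le> x ==> f j t y < g x" by blast
  define E where "E = {d \<in> K. lim d \<and> (\<forall>y<d. g y < d)}"
  have E_unb: "\<exists>d\<in>E. x < d" if "x \<in> K" for x
    using closure_point[of g x] g(1) that unfolding E_def by blast
  \<comment> \<open>Otherwise \<open>d\<close> is closed under the function witnessing that
    \<open>starts j (first j d)\<close> is not stationary, although \<open>d\<close> belongs to this
    set.\<close>
  have small: "first j d \<le> \<eta> j" if d: "d \<in> E" and j: "j < d" for j d
  proof (rule ccontr)
    assume n: "\<not> first j d \<le> \<eta> j"
    let ?t = "first j d"
    have d: "d \<in> K" "lim d" "\<And>y. y < d ==> g y < d" using d by (auto simp: E_def)
    have t: "?t < d" using first(3)[OF d(1,2) j] .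
    have O: "j \<in> K" "?t \<in> K" using down d(1) j t by (meson less_imp_le)+
    have "f j ?t y < d" if "y < d" for y
    proof -
      let ?x = "max y (max j ?t)"
      have "?x < d" using that j t by simp
      then have "?x \<in> K" using down[OF d(1)] less_imp_le by blast
      then have "f j ?t y < g ?x" by (rule g(3)) (simp_all add: le_max_iff_disj)
      then show ?thesis using d(3)[OF \<open>?x < d\<close>] by (rule order_less_trans)
    qed
    then have "d \<notin> starts j ?t" using f(2)[OF O _ d(1,2)] n by simp
    then show False using j by (simp add: starts_def)
  qed
  have acc: "accp (C d') d" if E: "d \<in> E" "d' \<in> E" "d < d'" for d d'
    unfolding accp_def
  proof (intro conjI allI impI)
    have d: "d \<in> K" "lim d" "\<And>y. y < d ==> g y < d" using E by (auto simp: E_def)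
    have d': "d' \<in> K" "lim d'" using E by (auto simp: E_def)
    show "\<exists>x. x < d" using d(2) unfolding lim_def accp_def by blast
    fix x assume x: "x < d"
    obtain j where j: "x < j" "j < d" using d(2) x unfolding lim_def accp_def by blast
    have "j < d'" using j E(3) by (meson order_less_trans)
    note F = first[OF d' this]
    have "j \<in> K" using down[OF d(1)] j by simp
    then have "first j d' < g j" using small[OF E(2) \<open>j < d'\<close>] g(2)[of j] by (simp add: order_le_less_trans)
    then have "first j d' < d" using d(3)[OF j(2)] by (rule order_less_trans)
    then show "\<exists>y\<in>C d'. x < y \<and> y < d" using F j by (meson order_less_le_trans)
  qed
  have coh: "C d = C d' \<inter> {..<d}" if E: "d \<in> E" "d' \<in> E" "d \<le> d'" for d d'
  proof (cases "d = d'")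
    case True
    then show ?thesis using C_below[of d] E by (auto simp: E_def)
  next
    case False
    then have a: "accp (C d') d" using acc E by simp
    then show ?thesis using C_closed[of d' d] C_coherent[of d' d] E False by (simp add: E_def)
  qed
  \<comment> \<open>By coherence the sets \<open>C d\<close> for \<open>d\<close> in
    \<open>E\<close> end-extend each other, so their union is the forbidden thread.\<close>
  define D where "D = (\<Union>d\<in>E. C d)"
  have D: "D \<inter> {..<d} = C d" if "d \<in> E" for d
  proof -
    have "C d' \<inter> {..<d} \<subseteq> C d" if "d' \<in> E" for d'
    proof (cases "d \<le> d'")
      case True
      show ?thesis using equalityD2[OF coh[OF \<open>d \<in> E\<close> \<open>d' \<in> E\<close> True]] .
    next
      case False
      then have le: "d' \<le> d" by simp
      show ?thesis using equalityD1[OF coh[OF \<open>d' \<in> E\<close> \<open>d \<in> E\<close> le]] by blast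
    qed
    moreover have "C d \<subseteq> {..<d}" using C_below[of d] that by (simp add: E_def)
    ultimately show ?thesis using that unfolding D_def by blast
  qed
  have acc_D: "\<alpha> \<in> D \<and> D \<inter> {..<\<alpha>} = C \<alpha>" if "\<alpha> \<in> K" "accp D \<alpha>" for \<alpha>
  proof -
    obtain d where d: "d \<in> E" "\<alpha> < d" using E_unb \<open>\<alpha> \<in> K\<close> by blast
    have dl: "d \<in> K" "lim d" using d by (auto simp: E_def)
    have eq: "y \<in> C d" if "y \<in> D" "y < \<alpha>" for y
    proof -
      have "y \<in> D \<inter> {..<d}" using that d(2) by simp
      then show ?thesis using D[OF d(1)] by simp
    qed
    have a: "accp (C d) \<alpha>" unfolding accp_def
    proof (intro conjI allI impI)
      show "\<exists>x. x < \<alpha>" using \<open>accp D \<alpha>\<close> by (auto simp: accp_def)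
      fix x assume "x < \<alpha>"
      then obtain y where "y \<in> D" "x < y" "y < \<alpha>" using \<open>accp D \<alpha>\<close> by (auto simp: accp_def)
      then show "\<exists>y\<in>C d. x < y \<and> y < \<alpha>" using eq by blast
    qed
    have "\<alpha> \<in> C d" using C_closed[OF dl d(2) a] .
    moreover have "C \<alpha> = C d \<inter> {..<\<alpha>}" using C_coherent[OF dl \<open>\<alpha> \<in> C d\<close> a] .
    moreover have "D \<inter> {..<\<alpha>} = (D \<inter> {..<d}) \<inter> {..<\<alpha>}" using d(2) by auto
    ultimately show ?thesis using D[OF d(1)] by blast
  qed
  have "D \<subseteq> K"
  proof
    fix y assume "y \<in> D"
    then obtain d where d: "d \<in> K" "lim d" "y \<in> C d" by (auto simp: D_def E_def)
    then have "y < d" using C_below[OF d(1,2)] by blast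
    then show "y \<in> K" using down[OF d(1)] by simp
  qed
  moreover have "\<exists>y\<in>D. x < y" if x: "x \<in> K" for x
  proof -
    obtain d where d: "d \<in> E" "x < d" using E_unb[OF x] by blast
    then obtain y where "y \<in> C d" "x < y" using C_cofinal[of d x] by (auto simp: E_def)
    then show ?thesis using d by (auto simp: D_def)
  qed
  ultimately have "\<exists>D\<subseteq>K. (\<forall>x\<in>K. \<exists>y\<in>D. x < y) \<and> (\<forall>\<beta>\<in>K. accp D \<beta> --> \<beta> \<in> D) \<and>
      (\<forall>\<alpha>\<in>D. accp D \<alpha> --> D \<inter> {..<\<alpha>} = C \<alpha>)" using acc_D by (intro exI[of _ D]) auto
  then show False using no_thread by (rule notE[rotated])
qed

end

text \<open>The sequence after truncation. The points \<open>\<theta> n\<close>, numbered by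
  \<open>hh\<close>, each occur stationarily often as first points of the sets; so does, for every
  colour, some point sent to it by \<open>\<pi>\<close>.\<close>

locale walks = segment K for K :: "'a::wellorder set" +
  fixes C :: "'a => 'a set" and hh :: "'a => nat" and \<theta> :: "nat => 'a" and \<pi> :: "'a => 'a"
  assumes C_lt: "b \<in> K ==> y \<in> C b ==> y < b"
    and C_cof: "b \<in> K ==> x < b ==> \<exists>y\<in>C b. x \<le> y"
    and C_acc: "b \<in> K ==> \<beta> < b ==> accp (C b) \<beta> ==> \<beta> \<in> C b \<and> C \<beta> = C b \<inter> {..<\<beta>}"
    and hh: "hh (\<theta> n) = n" and \<theta>_stat: "stationary {d. C d \<noteq> {} \<and> (LEAST y. y \<in> C d) = \<theta> n}"
    and \<pi>_stat: "\<tau> \<in> K ==> \<exists>t. \<pi> t = \<tau> \<and> stationary {d. C d \<noteq> {} \<and> (LEAST y. y \<in> C d) = t}"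
begin

definition minC where "minC b = (LEAST y. y \<in> C b)"

definition step where "step p b = (LEAST y. y \<in> C b \<and> p \<le> y)"

text \<open>The part of \<open>C b\<close> below \<open>a\<close> from its last accumulation point
  not exceeding \<open>a\<close> on; this is the interval used in Todorcevic's function rho for
  square sequences.\<close>

definition near where "near a b = {x \<in> C b. x < a \<and> (\<forall>z. accp (C b) z --> x < z --> a < z)}"

text \<open>The sublevel relations of a variant of Todorcevic's rho. Its value is 0 at accumulation
  points; elsewhere it is the maximum of \<open>hh (minC b)\<close>, of the value at the next step
  of the walk, and of the values at \<open>(x, a)\<close> for \<open>x\<close> in
  \<open>near a b\<close>. The last group makes both ultrametric inequalities hold.\<close>

inductive E :: "nat => 'a => 'a => bool" for n where
  E_refl: "E n a a"
| E_acc: "a < b ==> accp (C b) a ==> E n a b"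
| E_step: "a < b ==> \<not> accp (C b) a ==> hh (minC b) \<le> n ==> E n a (step a b) ==>
    (\<And>x. x \<in> near a b ==> E n x a) ==> E n a b"

lemma E_iff:
  "a < b ==> E n a b \<longleftrightarrow> accp (C b) a \<or> hh (minC b) \<le> n \<and> E n a (step a b) \<and> (\<forall>x\<in>near a b. E n x a)"
  by (subst E.simps) auto

lemma E_mono: "E n a b ==> n \<le> m ==> E m a b"
  by (induction rule: E.induct) (auto intro: E.intros)

lemma step:
  assumes "b \<in> K" "p < b"
  shows "step p b \<in> C b" "p \<le> step p b" "step p b < b" "\<And>y. y \<in> C b ==> p \<le> y ==> step p b \<le> y"
proof -
  obtain y where "y \<in> C b \<and> p \<le> y" using C_cof[OF assms] by blast
  then have "step p b \<in> C b \<and> p \<le> step p b" unfolding step_def by (rule LeastI)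
  then show "step p b \<in> C b" "p \<le> step p b" "step p b < b" using C_lt[OF assms(1)] by auto
  show "step p b \<le> y" if "y \<in> C b" "p \<le> y" for y unfolding step_def using that by (intro Least_le) simp
qed

lemma minC: assumes "b \<in> K" "y \<in> C b" shows "minC b \<in> C b" "minC b \<le> y"
  unfolding minC_def using assms(2) by (rule LeastI, rule Least_le)

lemma lessD: "b \<in> K ==> a < b ==> a \<in> K"
  using down less_imp_le by blast

text \<open>An infinite part of \<open>near a b\<close> would have an accumulation point not
  exceeding \<open>a\<close>, which the definition excludes.\<close>

lemma finite_near:
  assumes "b \<in> K" "a < b" shows "finite (near a b)"
proof (rule ccontr)
  let ?I = "\<lambda>z. infinite (near a b \<inter> {..<z})"
  assume "infinite (near a b)"
  moreover have "near a b \<inter> {..<a} = near a b" by (auto simp: near_def)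
  ultimately have a: "?I a" by simp
  define z where "z = (LEAST z. ?I z)"
  have z: "?I z" "z \<le> a" unfolding z_def by (rule LeastI[of ?I a], rule a, rule Least_le, rule a)
  have "accp (C b) z"
    unfolding accp_def
  proof (intro conjI allI impI)
    have "near a b \<inter> {..<z} \<noteq> {}" using z(1) by auto
    then show "\<exists>x. x < z" by blast
    fix x assume "x < z"
    then have "finite (near a b \<inter> {..<x})" using not_less_Least[of x ?I] by (simp add: z_def)
    then have "finite (near a b \<inter> {..<x} \<union> {x})" by simp
    then have "\<not> near a b \<inter> {..<z} \<subseteq> near a b \<inter> {..<x} \<union> {x}" using z(1) finite_subset by blast
    then show "\<exists>y\<in>C b. x < y \<and> y < z" by (auto simp: near_def not_less_iff_gr_or_eq)
  qed
  moreover obtain x where "x \<in> near a b" "x < z" using z(1) by (metis Int_iff all_not_in_conv finite.emptyI lessThan_iff)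
  ultimately show False using z(2) unfolding near_def by (auto simp: not_le[symmetric])
qed

lemma ex_E: "b \<in> K ==> a \<le> b ==> \<exists>n. E n a b"
proof (induction b arbitrary: a rule: less_induct)
  case (less b)
  show ?case
  proof (cases "a = b \<or> accp (C b) a")
    case True
    then show ?thesis using less.prems E_refl E_acc by (metis le_neq_trans)
  next
    case False
    then have ab: "a < b" using less.prems by (auto simp: less_le)
    note st = step[OF less.prems(1) ab]
    obtain n1 where n1: "E n1 a (step a b)" using less.IH[OF st(3) lessD[OF less.prems(1) st(3)] st(2)] by blast
    have "\<forall>x\<in>near a b. \<exists>n. E n x a"
      using less.IH[OF ab lessD[OF less.prems(1) ab]] less_imp_le unfolding near_def by blast
    then obtain f where f: "\<And>x. x \<in> near a b ==> E (f x) x a" by metis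
    obtain n2 where n2: "\<And>x. x \<in> near a b ==> f x \<le> n2"
      using finite_near[OF less.prems(1) ab] finite_nat_set_iff_bounded_le[of "f ` near a b"] by auto
    define n where "n = Max {n1, n2, hh (minC b)}"
    have le: "n1 \<le> n" "n2 \<le> n" "hh (minC b) \<le> n" by (auto simp: n_def)
    have F: "E n x a" if "x \<in> near a b" for x using E_mono[OF f[OF that]] n2[OF that] le by (meson order_trans)
    have "\<not> accp (C b) a" using False by simp
    then have "E n a b" by (intro E_step[OF ab _ le(3) E_mono[OF n1 le(1)] F])
    then show ?thesis by blast
  qed
qed

text \<open>A supremum of accumulation points is again one.\<close>

lemma last_acc:
  assumes "accp (C c) z0" "z0 \<le> b" shows "\<exists>z. accp (C c) z \<and> z \<le> b \<and> z0 \<le> z \<and> (\<forall>w. accp (C c) w --> w \<le> b --> w \<le> z)"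
proof -
  let ?U = "\<lambda>u. \<forall>w. accp (C c) w --> w \<le> b --> w \<le> u"
  define u where "u = (LEAST u. ?U u)"
  have u: "?U u" "u \<le> b" unfolding u_def by (rule LeastI[of ?U b], simp, rule Least_le, simp)
  have "accp (C c) u" unfolding accp_def
  proof (intro conjI allI impI)
    show "\<exists>x. x < u" using u(1) assms unfolding accp_def by (meson order_less_le_trans)
    fix x assume "x < u"
    then have "\<not> ?U x" using not_less_Least[of x ?U] by (simp add: u_def)
    then obtain w where w: "accp (C c) w" "w \<le> b" "x < w" by (auto simp: not_le)
    then obtain y where "y \<in> C c" "x < y" "y < w" unfolding accp_def by blast
    then show "\<exists>y\<in>C c. x < y \<and> y < u" using u(1) w by (meson order_less_le_trans)
  qed
  then show ?thesis using u assms by blast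
qed

text \<open>\<open>C b\<close> is an initial segment of \<open>C c\<close>, so the two recursions at
  \<open>a\<close> consult the same data.\<close>

lemma E_acc_eq:
  assumes c: "c \<in> K" and b: "accp (C c) b" "b < c" and a: "a < b"
  shows "E n a b \<longleftrightarrow> E n a c"
proof -
  have Cb: "C b = C c \<inter> {..<b}" using C_acc[OF c b(2,1)] by blast
  have acc: "accp (C b) z \<longleftrightarrow> accp (C c) z" if "z \<le> b" for z
    unfolding accp_def Cb using that by (meson IntD1 IntI lessThan_iff order_less_le_trans)
  have bO: "b \<in> K" by (rule lessD[OF c b(2)])
  obtain y where y: "y \<in> C b" "a \<le> y" using C_cof[OF bO a] by blast
  then have yc: "y \<in> C c" using Cb by blast
  have "minC b = minC c"
  proof (rule antisym)
    have "minC c \<in> C b" using minC[OF c yc] C_lt[OF bO y(1)] Cb by auto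
    then show "minC b \<le> minC c" using minC(2)[OF bO] by blast
    show "minC c \<le> minC b" using minC(1)[OF bO y(1)] minC(2)[OF c] Cb by blast
  qed
  moreover have "step a b = step a c"
  proof (rule antisym)
    have ac: "a < c" using a b by simp
    have "step a c < b" using step(4)[OF c ac yc y(2)] C_lt[OF bO y(1)] by simp
    then show "step a b \<le> step a c" using step[OF c ac] step(4)[OF bO a] Cb by blast
    show "step a c \<le> step a b" using step(1,2)[OF bO a] step(4)[OF c ac] Cb by blast
  qed
  moreover have "near a b = near a c"
  proof (rule Set.set_eqI)
    fix x
    have "a < z" if "\<not> z \<le> b" for z using that a by simp
    then have "(\<forall>z. accp (C b) z --> x < z --> a < z) \<longleftrightarrow> (\<forall>z. accp (C c) z --> x < z --> a < z)" using acc by blast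
    moreover have "x < a ==> x \<in> C b \<longleftrightarrow> x \<in> C c" unfolding Cb using a by auto
    ultimately show "x \<in> near a b \<longleftrightarrow> x \<in> near a c" unfolding near_def mem_Collect_eq by blast
  qed
  ultimately show ?thesis using E_iff[OF a] E_iff[of a c] a b acc[of a] by simp
qed

text \<open>Both ultrametric inequalities are combined into an equivalence so that the induction
  closes. If \<open>C c\<close> accumulates at some point above \<open>a\<close> and not above
  \<open>b\<close>, the last such point is in \<open>near b c\<close> and can replace
  \<open>c\<close>. Otherwise all points of \<open>C c\<close> from \<open>a\<close> up to
  \<open>b\<close> are in \<open>near b c\<close> and link the two walks.\<close>

lemma E_triangle:
  "c \<in> K ==> a \<le> b ==> b \<le> c ==> E n b c ==> E n a b \<longleftrightarrow> E n a c"
proof (induction c arbitrary: a b rule: less_induct)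
  case (less c)
  note c = less.prems(1)
  have IH: "E n x y \<longleftrightarrow> E n x z" if "z < c" "x \<le> y" "y \<le> z" "E n y z" for x y z
    using less.IH[OF that(1) lessD[OF c that(1)] that(2-4)] .
  consider "a = b" | "b = c" | "a < b" "b < c" using less.prems by fastforce
  then show ?case
  proof cases
    case 3
    note ab = 3(1) and bc = 3(2)
    have ac: "a < c" using ab bc by simp
    show ?thesis
    proof (cases "accp (C c) b")
      case True
      then show ?thesis using E_acc_eq[OF c True bc ab] by simp
    next
      case nb: False
      then have e: "hh (minC c) \<le> n" "E n b (step b c)" "\<And>x. x \<in> near b c ==> E n x b"
        using less.prems(4) E_iff[OF bc] by auto
      note sb = step[OF c bc] and sa = step[OF c ac]
      show ?thesis
      proof (cases "\<exists>z. accp (C c) z \<and> a < z \<and> z \<le> b")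
        case True
        then obtain z0 where "accp (C c) z0" "z0 \<le> b" "a < z0" by blast
        then obtain z where z: "accp (C c) z" "z \<le> b" "a < z" "\<And>w. accp (C c) w ==> w \<le> b ==> w \<le> z"
          using last_acc[of c z0 b] by (meson order_less_le_trans)
        have "z \<noteq> b" using nb z by blast
        then have zb: "z < b" using z by simp
        have zc: "z < c" using zb bc by simp
        have "z \<in> near b c"
          unfolding near_def using C_acc[OF c zc z(1)] zb z(4) by (auto simp: not_le[symmetric])
        then have Ez: "E n z b" by (rule e)
        show ?thesis using E_acc_eq[OF c z(1) zc z(3), of n] IH[OF bc _ z(2) Ez, of a] z(3) by simp
      next
        case no: False
        have nn: "x \<in> near b c" if "x \<in> C c" "x < b" "a \<le> x" for x
          unfolding near_def using that no by (auto simp: not_le[symmetric])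
        show ?thesis
        proof (cases "accp (C c) a")
          case True
          then have "a \<in> near b c" using nn[of a] C_acc[OF c ac] ab by blast
          then show ?thesis using e(3) E_acc[OF ac True] by blast
        next
          case na: False
          have "x \<in> near b c" if "x \<in> near a c" for x
            unfolding near_def using that no ab unfolding near_def by (auto simp: not_le[symmetric])
          then have nab: "E n x b" if "x \<in> near a c" for x using e(3) that by blast
          have near: "\<forall>x\<in>near a c. E n x a" if "E n a b"
          proof
            fix x assume x: "x \<in> near a c"
            then have "x < a" by (simp add: near_def)
            then have "x \<le> a" by simp
            then show "E n x a" using IH[OF bc _ _ \<open>E n a b\<close>, of x] nab[OF x] ab by simp
          qed
          have main: "E n a (step a c) \<longleftrightarrow> E n a b"
          proof (cases "b \<le> step a c")
            case True
            then have "step a c = step b c" using sa sb ab by (intro antisym) auto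
            then show ?thesis using IH[OF sb(3) _ sb(2) e(2), of a] ab by simp
          next
            case False
            then have "step a c < b" by simp
            then have "E n (step a c) b" using nn[OF sa(1)] sa(2) e(3) by blast
            then show ?thesis using IH[OF bc sa(2)] \<open>step a c < b\<close> by simp
          qed
          show ?thesis using E_iff[OF ac] na e(1) main near by blast
        qed
      qed
    qed
  qed (use less.prems E_refl in auto)
qed

text \<open>The walks to \<open>p\<close> and \<open>q\<close> are followed while they agree; the
  colour is read off the set at which they part or stop.\<close>

function col :: "'a => 'a => 'a => 'a" where
  "col p q b = (if p < b \<and> q < b \<and> step p b = step q b \<and> step p b < b then col p q (step p b) else \<pi> (minC b))"
  by auto
termination by (relation "inv_image {(x, y). x < y} (\<lambda>(p, q, b). b)") (auto intro: wf_inv_image wf)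

declare col.simps [simp del]

definition lev :: "'a => 'a => nat" where "lev a b = (LEAST n. E n a b)"

lemma lev_le: "b \<in> K ==> a \<le> b ==> lev a b \<le> n \<longleftrightarrow> E n a b"
  unfolding lev_def using ex_E[of b a] E_mono[of "LEAST n. E n a b" a b n]
  by (metis LeastI_ex Least_le)

text \<open>Walks from \<open>v\<close> to points just below \<open>d\<close> start like the walk to
  \<open>d\<close>, until they reach some \<open>s\<close> for which \<open>C s\<close> is
  \<open>C d\<close> below \<open>d\<close>. So levels and colours near \<open>d\<close> are
  governed by \<open>C d\<close>.\<close>

lemma passage:
  assumes d: "d \<in> K" "lim d"
  shows "v \<in> K ==> d \<le> v ==> \<exists>h s. h < d \<and> s \<in> K \<and> d \<le> s \<and> C s \<inter> {..<d} = C d \<and>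
    (\<forall>p. h < p --> p < d --> (\<forall>n. E n p v --> E n p s)) \<and>
    (\<forall>p q. h < p --> p < d --> h < q --> q < d --> col p q v = col p q s)"
proof (induction v rule: less_induct)
  case (less v)
  obtain x0 where x0: "x0 < d" using d(2) unfolding lim_def accp_def by blast
  note v = less.prems(1)
  consider "v = d" | "d < v" "accp (C v) d" | "d < v" "\<not> accp (C v) d" using less.prems(2) by fastforce
  then show ?case
  proof cases
    case 1
    have "C v \<inter> {..<d} = C d" using C_lt[OF d(1)] 1 by auto
    then show ?thesis using x0 v less.prems(2) by blast
  next
    case 2
    then have "C v \<inter> {..<d} = C d" using C_acc[OF v] by blast
    then show ?thesis using x0 v less.prems(2) by blast
  next
    case 3
    \<comment> \<open>\<open>C v\<close> is bounded below \<open>d\<close>, so targets beyond the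
      bound share their first step with \<open>d\<close> itself.\<close>
    obtain h1 where h1: "h1 < d" "\<And>y. y \<in> C v ==> y < d ==> y \<le> h1"
      using 3(2) x0 unfolding accp_def by (meson not_le)
    let ?v = "step d v"
    note sd = step[OF v 3(1)]
    obtain h2 s where IH: "h2 < d" "s \<in> K" "d \<le> s" "C s \<inter> {..<d} = C d"
      "\<And>p n. h2 < p ==> p < d ==> E n p ?v ==> E n p s"
      "\<And>p q. h2 < p ==> p < d ==> h2 < q ==> q < d ==> col p q ?v = col p q s"
      using less.IH[OF sd(3) lessD[OF v sd(3)] sd(2)] by blast
    have st: "step p v = ?v" if p: "h1 < p" "p < d" for p
    proof -
      have "p < v" using p 3(1) by simp
      note sp = step[OF v this]
      have "d \<le> step p v" using h1(2)[OF sp(1)] sp(2) p(1) by (meson not_le order_less_le_trans)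
      then show ?thesis using sp sd p by (intro antisym) auto
    qed
    show ?thesis
    proof (rule exI[of _ "max h1 h2"], rule exI[of _ s], intro conjI allI impI)
      fix p n assume p: "max h1 h2 < p" "p < d" and En: "E n p v"
      have pv: "p < v" using p 3(1) by simp
      have "p \<notin> C v" using h1(2)[of p] p by auto
      then have "\<not> accp (C v) p" using C_acc[OF v pv] by blast
      then have "E n p ?v" using En E_iff[OF pv] st[of p] p by simp
      then show "E n p s" using IH(5) p by simp
    next
      fix p q assume p: "max h1 h2 < p" "p < d" and q: "max h1 h2 < q" "q < d"
      have "p < v" "q < v" using p q 3(1) by (simp_all add: order_less_trans[of _ d])
      then have "col p q v = col p q ?v" using st[of p] st[of q] sd(3) p q by (subst col.simps) simp
      then show "col p q v = col p q s" using IH(6) p q by simp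
    qed (use h1 IH in auto)
  qed
qed

lemma minC_segment:
  assumes "s \<in> K" "d \<in> K" "C s \<inter> {..<d} = C d" "C d \<noteq> {}" shows "minC s = minC d"
proof -
  obtain y where y: "y \<in> C d" using assms(4) by blast
  then have y': "y \<in> C s" "y < d" using assms(3) by auto
  have "minC s < d" using minC(2)[OF assms(1) y'(1)] y'(2) by simp
  then have "minC s \<in> C d" using minC(1)[OF assms(1) y'(1)] assms(3) by auto
  moreover have "minC d \<in> C s" using minC(1)[OF assms(2) y] assms(3) by auto
  ultimately show ?thesis using minC(2) assms(1,2) by (intro antisym) auto
qed

definition starting where "starting t = {d. C d \<noteq> {} \<and> minC d = t}"

lemma stationary_\<theta>: "stationary (starting (\<theta> n))"
  using \<theta>_stat by (simp add: starting_def minC_def)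

definition unbounded :: "'a set => bool" where "unbounded B \<longleftrightarrow> B \<subseteq> K \<and> (\<forall>x\<in>K. \<exists>y\<in>B. x < y)"

text \<open>Suppose all levels are at most \<open>n\<close>, and let \<open>d\<close> be a limit
  whose first point is \<open>\<theta> m\<close> with \<open>m > n\<close>. Near \<open>d\<close>
  the step case of \<open>E\<close> is impossible, so points of \<open>B\<close> just below
  \<open>d\<close> are accumulation points of some \<open>C s\<close> and inherit the first point
  \<open>\<theta> m\<close>. Two values of \<open>m\<close> then meet in a common stretch.\<close>

lemma unbounded_E:
  assumes B: "unbounded B" shows "\<exists>a\<in>B. \<exists>b\<in>B. a < b \<and> \<not> E n a b"
proof (rule ccontr)
  assume "\<not> ?thesis"
  then have En: "\<And>a b. a \<in> B ==> b \<in> B ==> a < b ==> E n a b" by blast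
  have "\<exists>f. \<forall>x\<in>K. f x \<in> B \<and> x < f x" using B unfolding unbounded_def by (intro bchoice) blast
  then obtain f where f: "\<And>x. x \<in> K ==> f x \<in> B" "\<And>x. x \<in> K ==> x < f x" by blast
  have BK: "x \<in> K" if "x \<in> B" for x using B that unfolding unbounded_def by blast
  have tail: "\<exists>h<d. \<forall>p\<in>B. h < p --> p < d --> minC p = \<theta> m"
    if d: "d \<in> K" "lim d" "d \<in> starting (\<theta> m)" and m: "n < m" for d m
  proof -
    have v: "f d \<in> B" "d < f d" using f d(1) by auto
    obtain h s where W: "h < d" "s \<in> K" "d \<le> s" "C s \<inter> {..<d} = C d"
      "\<And>p n. h < p ==> p < d ==> E n p (f d) ==> E n p s"
      using passage[OF d(1,2) BK[OF v(1)] less_imp_le[OF v(2)]] by blast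
    have ms: "minC s = \<theta> m" using minC_segment[OF W(2) d(1) W(4)] d(3) by (simp add: starting_def)
    have "minC p = \<theta> m" if p: "p \<in> B" "h < p" "p < d" for p
    proof -
      have "p < f d" using p(3) v(2) by (rule order_less_trans)
      then have "E n p s" using W(5)[OF p(2,3)] En[OF p(1) v(1)] by blast
      have ps: "p < s" using p(3) W(3) by (rule order_less_le_trans)
      then have a: "accp (C s) p" using E_iff[OF ps] \<open>E n p s\<close> ms hh m by auto
      then have Cp: "C p = C s \<inter> {..<p}" using C_acc[OF W(2) ps] by blast
      moreover have "C p \<noteq> {}" unfolding Cp using a unfolding accp_def by blast
      ultimately show ?thesis using minC_segment[OF W(2) BK[OF p(1)]] ms by simp
    qed
    then show ?thesis using W(1) by blast
  qed
  have "\<exists>g. \<forall>x\<in>K. g x \<in> K \<and> lim (g x) \<and> g x \<in> starting (\<theta> (n + 1)) \<and> x < g x \<and> (\<forall>y<g x. f y < g x)"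
  proof (rule bchoice, intro ballI)
    fix x assume "x \<in> K"
    then obtain d where "d \<in> starting (\<theta> (n + 1))" "d \<in> K" "lim d" "x < d" "\<And>y. y < d ==> f y < d"
      using stationaryE[OF stationary_\<theta>, of f x "n + 1"] f(1) BK by blast
    then show "\<exists>d. d \<in> K \<and> lim d \<and> d \<in> starting (\<theta> (n + 1)) \<and> x < d \<and> (\<forall>y<d. f y < d)" by blast
  qed
  then obtain g where g: "\<And>x. x \<in> K ==> g x \<in> K" "\<And>x. x \<in> K ==> lim (g x)"
    "\<And>x. x \<in> K ==> g x \<in> starting (\<theta> (n + 1))" "\<And>x. x \<in> K ==> x < g x" "\<And>x y. x \<in> K ==> y < g x ==> f y < g x" by blast
  obtain z where z: "z \<in> K" using stationary_\<theta>[of 0, unfolded stationary_def, rule_format, of id] by auto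
  \<comment> \<open>Closure under \<open>g\<close> puts a limit with first point
    \<open>\<theta> (n + 1)\<close> into the stretch where all first points are
    \<open>\<theta> (n + 2)\<close>.\<close>
  obtain d' where d': "d' \<in> starting (\<theta> (n + 2))" "d' \<in> K" "lim d'" "\<And>y. y < d' ==> g y < d'"
    using stationaryE[OF stationary_\<theta>, of g z "n + 2"] g(1) z by blast
  obtain h' where h': "h' < d'" "\<And>p. p \<in> B ==> h' < p ==> p < d' ==> minC p = \<theta> (n + 2)"
    using tail[OF d'(2,3,1)] by auto
  have hK: "h' \<in> K" by (rule lessD[OF d'(2) h'(1)])
  note G = g[OF hK]
  obtain h where h: "h < g h'" "\<And>p. p \<in> B ==> h < p ==> p < g h' ==> minC p = \<theta> (n + 1)"
    using tail[OF G(1-3)] by auto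
  define x where "x = max h h'"
  have x: "x < g h'" using h(1) G(4) by (simp add: x_def)
  have xK: "x \<in> K" by (rule lessD[OF G(1) x])
  have p: "f x \<in> B" "f x < g h'" "h < f x" "h' < f x" "f x < d'"
    using f[OF xK] G(5)[OF x] d'(4)[OF h'(1)] by (auto simp: x_def intro: order_less_trans)
  have "\<theta> (n + 1) = \<theta> (n + 2)" using h(2)[OF p(1,3,2)] h'(2)[OF p(1,4,5)] by simp
  then have "hh (\<theta> (n + 1)) = hh (\<theta> (n + 2))" by simp
  then show False by (simp add: hh)
qed

text \<open>Let \<open>d\<close> be closed under all relevant functions, with a first point that
  \<open>\<pi>\<close> sends to \<open>\<tau>\<close>. A \<open>p\<close> above
  \<open>step (g x) d\<close> and a \<open>q\<close> below \<open>g x\<close> have different first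
  steps from \<open>d\<close>, so the walks from \<open>v\<close> split at a set extending
  \<open>C d\<close>. Levels are unbounded below each closure point, so \<open>p\<close> can be
  chosen with a large level and then \<open>q\<close> with a larger one.\<close>

lemma colouring:
  assumes B: "unbounded B" and h: "h \<in> K" and \<tau>: "\<tau> \<in> K"
  shows "\<exists>d\<in>K. \<forall>v\<in>K. d < v --> (\<exists>p\<in>B. \<exists>q\<in>B. h < q \<and> q < p \<and> p < d \<and>
    i < lev p v \<and> lev p v < lev q v \<and> col p q v = \<tau>)"
proof -
  have BK: "x \<in> K" if "x \<in> B" for x using B that unfolding unbounded_def by blast
  obtain t where t: "\<pi> t = \<tau>" "stationary (starting t)" using \<pi>_stat[OF \<tau>] by (auto simp: starting_def minC_def)
  \<comment> \<open>One bound \<open>k x\<close> serves all \<open>n\<close>, by uncountable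
    cofinality.\<close>
  have "\<exists>k. \<forall>x\<in>K. k x \<in> K \<and> (\<forall>n. \<exists>a\<in>B. \<exists>b\<in>B. x < a \<and> a < b \<and> b < k x \<and> \<not> E n a b)"
  proof (rule bchoice, intro ballI)
    fix x assume x: "x \<in> K"
    have "unbounded {b \<in> B. x < b}" unfolding unbounded_def
    proof (intro conjI ballI)
      show "{b \<in> B. x < b} \<subseteq> K" using BK by blast
      fix y assume "y \<in> K"
      then obtain b where "b \<in> B" "max x y < b" using B x max_mem unfolding unbounded_def by blast
      then show "\<exists>b\<in>{b \<in> B. x < b}. y < b" by auto
    qed
    then have "\<exists>b. b \<in> B \<and> (\<exists>a\<in>B. x < a \<and> a < b \<and> \<not> E n a b)" for n using unbounded_E[of "{b \<in> B. x < b}" n] by blast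
    then obtain w where w: "\<And>n. w n \<in> B" "\<And>n. \<exists>a\<in>B. x < a \<and> a < w n \<and> \<not> E n a (w n)" by metis
    obtain c where "c \<in> K" "\<And>n. w n < c" using bounded_range[of w] w(1) BK by blast
    then show "\<exists>c. c \<in> K \<and> (\<forall>n. \<exists>a\<in>B. \<exists>b\<in>B. x < a \<and> a < b \<and> b < c \<and> \<not> E n a b)" using w by blast
  qed
  then obtain k where k: "\<And>x. x \<in> K ==> k x \<in> K"
    "\<And>x n. x \<in> K ==> \<exists>a\<in>B. \<exists>b\<in>B. x < a \<and> a < b \<and> b < k x \<and> \<not> E n a b" by blast
  \<comment> \<open>If \<open>a\<close> and \<open>b\<close> both had level at most \<open>n\<close>
    towards \<open>v\<close>, the triangle property would give \<open>E n a b\<close>.\<close>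
  have high: "\<exists>p\<in>B. x < p \<and> p < d \<and> n < lev p v"
    if d: "d \<in> K" "\<And>y. y < d ==> k y < d" and v: "v \<in> K" "d < v" and x: "x < d" for x n d v
  proof -
    obtain a b where ab: "a \<in> B" "b \<in> B" "x < a" "a < b" "b < k x" "\<not> E n a b" using k(2)[OF lessD[OF d(1) x]] by blast
    have b: "b < d" using ab(5) d(2)[OF x] by (rule order_less_trans)
    have bg: "b \<le> v" "a \<le> v" using b ab(4) v(2) by simp_all
    have "\<not> E n a v \<or> \<not> E n b v" using E_triangle[OF v(1) less_imp_le[OF ab(4)] bg(1)] ab(6) by blast
    then have "n < lev a v \<or> n < lev b v" using lev_le[OF v(1) bg(1), of n] lev_le[OF v(1) bg(2), of n] by auto
    then show ?thesis using ab b by (meson order_less_trans)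
  qed
  have "\<exists>g. \<forall>x\<in>K. g x \<in> K \<and> x < g x \<and> (\<forall>y<g x. k y < g x)"
  proof (rule bchoice, intro ballI)
    fix x assume "x \<in> K"
    then show "\<exists>d. d \<in> K \<and> x < d \<and> (\<forall>y<d. k y < d)" using closure_point[of k x] k(1) by blast
  qed
  then obtain g where g: "\<And>x. x \<in> K ==> g x \<in> K" "\<And>x. x \<in> K ==> x < g x"
    "\<And>x y. x \<in> K ==> y < g x ==> k y < g x" by blast
  have "\<And>x. x \<in> K ==> max (k x) (g x) \<in> K" using k(1) g(1) max_mem by blast
  then obtain d where d: "d \<in> starting t" "d \<in> K" "lim d" "h < d" "\<And>y. y < d ==> max (k y) (g y) < d"
    using stationaryE[OF t(2), of "\<lambda>x. max (k x) (g x)" h] h by blast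
  have "\<exists>p\<in>B. \<exists>q\<in>B. h < q \<and> q < p \<and> p < d \<and> i < lev p v \<and> lev p v < lev q v \<and> col p q v = \<tau>"
    if v: "v \<in> K" "d < v" for v
  proof -
    obtain h1 s where W: "h1 < d" "s \<in> K" "d \<le> s" "C s \<inter> {..<d} = C d"
      "\<And>p q. h1 < p ==> p < d ==> h1 < q ==> q < d ==> col p q v = col p q s"
      using passage[OF d(2,3) v(1) less_imp_le[OF v(2)]] by blast
    define x where "x = max h h1"
    have x: "x < d" using d(4) W(1) by (simp add: x_def)
    have xK: "x \<in> K" by (rule lessD[OF d(2) x])
    have d0: "g x < d" using d(5)[OF x] by simp
    have d0v: "g x < v" using d0 v(2) by (rule order_less_trans)
    note sd = step[OF d(2) d0]
    obtain p where p: "p \<in> B" "step (g x) d < p" "p < d" "i < lev p v"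
      using high[OF d(2) _ v sd(3)] d(5) by (metis max_less_iff_conj)
    obtain q where q: "q \<in> B" "x < q" "q < g x" "lev p v < lev q v"
      using high[OF g(1)[OF xK] g(3)[OF xK] v(1) d0v g(2)[OF xK]] by blast
    have qd: "q < d" using q(3) d0 by (rule order_less_trans)
    note sp = step[OF d(2) p(3)] and sq = step[OF d(2) qd]
    have st: "step r s = step r d" if r: "r < d" for r
    proof -
      have rs: "r < s" using r W(3) by (rule order_less_le_trans)
      note s1 = step[OF d(2) r] and s2 = step[OF W(2) rs]
      have le: "step r s \<le> step r d" using s2(4)[of "step r d"] s1(1,2) W(4) by blast
      then have "step r s < d" using s1(3) by simp
      then have "step r s \<in> C d" using s2(1) W(4) by blast
      then show ?thesis using s1(4)[of "step r s"] s2(2) le by simp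
    qed
    have "q \<le> step (g x) d" using less_imp_le[OF q(3)] sd(2) by (rule order_trans)
    then have "step q d \<le> step (g x) d" using sq(4)[OF sd(1)] by simp
    then have "step p d \<noteq> step q d" using p(2) sp(2) by (metis not_le order_trans)
    then have "col p q s = \<pi> (minC s)" using st[OF p(3)] st[OF qd] by (subst col.simps) simp
    also have "\<dots> = \<tau>" using minC_segment[OF W(2) d(2) W(4)] d(1) t(1) by (simp add: starting_def)
    finally have "col p q s = \<tau>" .
    have pq: "q < p" using \<open>q \<le> step (g x) d\<close> p(2) by (rule order_le_less_trans)
    then have big: "h < q" "h1 < q" "h1 < p" using q(2) by (auto simp: x_def intro: order_less_trans)
    have "col p q v = \<tau>" using W(5)[OF big(3) p(3) big(2) qd] \<open>col p q s = \<tau>\<close> by simp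
    then show ?thesis using p q big pq by blast
  qed
  then show ?thesis using d(2) by blast
qed

lemma lev_triangle:
  assumes "c \<in> K" "a \<le> b" "b \<le> c"
  shows "lev a c \<le> max (lev a b) (lev b c)" "lev a b \<le> max (lev a c) (lev b c)"
proof -
  have b: "b \<in> K" and ac: "a \<le> c" using down assms by auto
  let ?n = "max (lev a b) (lev b c)" and ?m = "max (lev a c) (lev b c)"
  have "E ?n a b" "E ?n b c" using lev_le[OF b assms(2)] lev_le[OF assms(1,3)] by (meson max.cobounded1 max.cobounded2)+
  then show "lev a c \<le> ?n" using E_triangle[OF assms] lev_le[OF assms(1) ac] by blast
  have "E ?m a c" "E ?m b c" using lev_le[OF assms(1) ac] lev_le[OF assms(1,3)] by (meson max.cobounded1 max.cobounded2)+
  then show "lev a b \<le> ?m" using E_triangle[OF assms] lev_le[OF b assms(2)] by blast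
qed

end

section \<open>From coherent sequences to walks\<close>

context coherent_seq
begin

text \<open>Cutting at \<open>j\<close> turns \<open>first j d\<close> into the least point, and
  leaving limits up to \<open>j\<close> uncut preserves coherence. A successor gets its predecessor,
  so that the walk can continue, and 0 gets the empty set.\<close>

definition tails :: "'a => 'a => 'a set" where
  "tails j d = (if lim d then if j < d then {x \<in> C d. j \<le> x} else C d else {x. x < d \<and> (\<forall>y<d. y \<le> x)})"

lemma accp_subset: "accp A \<beta> ==> A \<subseteq> B ==> accp B \<beta>"
  unfolding accp_def by blast

lemma accp_witness: "accp A \<beta> ==> \<exists>y\<in>A. y < \<beta>"
  unfolding accp_def by blast

lemma tails_acc:
  assumes b: "b \<in> K" "\<beta> < b" and a: "accp (tails j b) \<beta>"
  shows "\<beta> \<in> tails j b \<and> tails j \<beta> = tails j b \<inter> {..<\<beta>}"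
proof (cases "lim b")
  case True
  then have "tails j b \<subseteq> C b" by (auto simp: tails_def)
  then have a': "accp (C b) \<beta>" using a accp_subset by blast
  have c: "\<beta> \<in> C b" by (rule C_closed[OF b(1) True b(2) a'])
  have eq: "C \<beta> = C b \<inter> {..<\<beta>}" by (rule C_coherent[OF b(1) True c a'])
  have l: "lim \<beta>" using a by (rule accp_lim)
  show ?thesis
  proof (cases "j < b")
    case j: True
    then have tb: "tails j b = {x \<in> C b. j \<le> x}" using True by (simp add: tails_def)
    then have "j < \<beta>" using accp_witness[OF a] by auto
    then have "tails j \<beta> = {x \<in> C \<beta>. j \<le> x}" using l by (simp add: tails_def)
    then show ?thesis using tb eq c \<open>j < \<beta>\<close> by auto
  next
    case False
    then have "\<not> j < \<beta>" using b(2) by simp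
    then show ?thesis using False True l eq c by (simp add: tails_def)
  qed
next
  case False
  then have t: "tails j b = {x. x < b \<and> (\<forall>y<b. y \<le> x)}" by (simp add: tails_def)
  obtain y where y: "y \<in> tails j b" "y < \<beta>" using accp_witness[OF a] by blast
  then obtain y' where "y' \<in> tails j b" "y < y'" using a unfolding accp_def by blast
  then show ?thesis using y t by auto
qed

lemma tails_cof:
  assumes b: "b \<in> K" "x < b" shows "\<exists>y\<in>tails j b. x \<le> y"
proof (cases "lim b")
  case True
  show ?thesis
  proof (cases "j < b")
    case j: True
    then obtain y where "y \<in> C b" "max x j < y" using C_cofinal[OF b(1) True, of "max x j"] b(2) by auto
    then show ?thesis using j True by (intro bexI[of _ y]) (auto simp: tails_def)
  next
    case False
    then show ?thesis using C_cofinal[OF b(1) True b(2)] True by (auto simp: tails_def intro: less_imp_le)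
  qed
next
  case False
  then obtain z where z: "z < b" "\<And>y. z < y ==> \<not> y < b" using b(2) unfolding lim_def accp_def by blast
  then have "z \<in> tails j b" using False by (auto simp: tails_def not_less[symmetric])
  then show ?thesis using z(2)[of x] b(2) by (auto simp: not_less[symmetric])
qed

text \<open>By regularity the unbounded set of stationary first points has the size of
  \<open>K\<close>; it can be mapped onto \<open>K\<close> and contains a countable sequence of
  distinct points.\<close>

theorem ex_walks: "\<exists>C' hh \<theta> \<pi>. walks K C' hh \<theta> \<pi>"
proof -
  obtain j where j: "j \<in> K" "\<And>b. b \<in> K ==> \<exists>\<tau>\<in>K. b < \<tau> \<and> stationary (starts j \<tau>)" using ex_starts by blast
  define \<Theta> where "\<Theta> = {\<tau> \<in> K. stationary (starts j \<tau>)}"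
  let ?S = "\<lambda>\<tau>. {d. tails j d \<noteq> {} \<and> (LEAST y. y \<in> tails j d) = \<tau>}"
  have S: "stationary (?S \<tau>)" if "\<tau> \<in> \<Theta>" for \<tau>
    unfolding stationary_def
  proof (intro allI impI)
    fix f assume f: "\<forall>x\<in>K. f x \<in> K"
    have "stationary (starts j \<tau>)" using \<open>\<tau> \<in> \<Theta>\<close> by (simp add: \<Theta>_def)
    then obtain d where d: "d \<in> starts j \<tau>" "d \<in> K" "lim d" "\<forall>y<d. f y < d"
      using f unfolding stationary_def by blast
    then have "tails j d = {y \<in> C d. j \<le> y}" by (simp add: tails_def starts_def)
    then have "d \<in> ?S \<tau>" using d first(1,2)[OF d(2,3), of j] by (auto simp: starts_def first_def)
    then show "\<exists>d\<in>?S \<tau>. d \<in> K \<and> lim d \<and> (\<forall>y<d. f y < d)" using d by blast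
  qed
  have "\<not> |\<Theta>| <o |K|"
  proof
    assume "|\<Theta>| <o |K|"
    then obtain b where "b \<in> K" "\<forall>x\<in>\<Theta>. x < b" using regular[of \<Theta>] by (auto simp: \<Theta>_def)
    moreover from \<open>b \<in> K\<close> obtain \<tau> where "\<tau> \<in> \<Theta>" "b < \<tau>" using j(2)[of b] unfolding \<Theta>_def by blast
    ultimately show False by (meson order_less_asym)
  qed
  then have le: "|K| \<le>o |\<Theta>|" by (simp add: card_of_Well_order not_ordLess_iff_ordLeq)
  then obtain \<pi> where \<pi>: "\<pi> ` \<Theta> = K" using j(1) card_of_ordLeq2[of K \<Theta>] by blast
  have "natLeq <o |\<Theta>|" using uncountable le by (rule ordLess_ordLeq_trans)
  then have "infinite \<Theta>" using finite_iff_ordLess_natLeq[of \<Theta>] ordLess_transitive[of natLeq "|\<Theta>|" natLeq] ordLess_irreflexive[of natLeq] by blast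
  then obtain \<theta> :: "nat => 'a" where \<theta>: "inj \<theta>" "range \<theta> \<subseteq> \<Theta>" using infinite_countable_subset by blast
  have "walks K (tails j) (inv_into UNIV \<theta>) \<theta> \<pi>"
  proof (intro walks.intro segment_axioms walks_axioms.intro)
    show "y < b" if "b \<in> K" "y \<in> tails j b" for b y
      using that C_below[of b] by (auto simp: tails_def split: if_splits)
    show "\<exists>y\<in>tails j b. x \<le> y" if "b \<in> K" "x < b" for b x using that by (rule tails_cof)
    show "\<beta> \<in> tails j b \<and> tails j \<beta> = tails j b \<inter> {..<\<beta>}" if "b \<in> K" "\<beta> < b" "accp (tails j b) \<beta>" for b \<beta>
      using that by (rule tails_acc)
    show "inv_into UNIV \<theta> (\<theta> n) = n" for n using \<theta>(1) by simp
    show "stationary (?S (\<theta> n))" for n using S \<theta>(2) by blast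
    show "\<exists>t. \<pi> t = \<tau> \<and> stationary (?S t)" if "\<tau> \<in> K" for \<tau> using \<pi> that S by blast
  qed
  then show ?thesis by blast
qed

end

section \<open>The recursive system of groups\<close>

definition sub :: "'u monoid => 'u monoid => bool" where
  "sub A B \<longleftrightarrow> group A \<and> group B \<and> carrier A \<subseteq> carrier B \<and>
    (\<forall>x\<in>carrier A. \<forall>y\<in>carrier A. x \<otimes>\<^bsub>A\<^esub> y = x \<otimes>\<^bsub>B\<^esub> y)"

lemma sub_refl: "group A ==> sub A A"
  by (simp add: sub_def)

lemma sub_trans: assumes "sub A B" "sub B C" shows "sub A C"
proof -
  have "x \<otimes>\<^bsub>A\<^esub> y = x \<otimes>\<^bsub>C\<^esub> y" if "x \<in> carrier A" "y \<in> carrier A" for x y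
    using assms that unfolding sub_def by (metis subsetD)
  then show ?thesis using assms unfolding sub_def by (meson order_trans)
qed

lemma sub_group: "sub A B ==> group A" "sub A B ==> group B"
  by (simp_all add: sub_def)

lemma sub_carrier: "sub A B ==> x \<in> carrier A ==> x \<in> carrier B"
  by (auto simp: sub_def)

lemma sub_mult: "sub A B ==> x \<in> carrier A ==> y \<in> carrier A ==> x \<otimes>\<^bsub>A\<^esub> y = x \<otimes>\<^bsub>B\<^esub> y"
  by (simp add: sub_def)

lemma sub_one: assumes "sub A B" shows "\<one>\<^bsub>A\<^esub> = \<one>\<^bsub>B\<^esub>"
proof -
  interpret A: group A by (rule sub_group[OF assms])
  interpret B: group B by (rule sub_group[OF assms])
  have "\<one>\<^bsub>A\<^esub> \<otimes>\<^bsub>B\<^esub> \<one>\<^bsub>A\<^esub> = \<one>\<^bsub>A\<^esub>" using sub_mult[OF assms, of "\<one>\<^bsub>A\<^esub>" "\<one>\<^bsub>A\<^esub>"] by simp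
  then show ?thesis using sub_carrier[OF assms, of "\<one>\<^bsub>A\<^esub>"] B.l_cancel_one' by (metis A.one_closed B.r_cancel_one')
qed

lemma sub_inv: assumes "sub A B" "x \<in> carrier A" shows "inv\<^bsub>A\<^esub> x = inv\<^bsub>B\<^esub> x"
proof -
  interpret A: group A by (rule sub_group[OF assms(1)])
  interpret B: group B by (rule sub_group[OF assms(1)])
  have "inv\<^bsub>A\<^esub> x \<otimes>\<^bsub>B\<^esub> x = \<one>\<^bsub>B\<^esub>"
    using sub_mult[OF assms(1), of "inv\<^bsub>A\<^esub> x" x] assms(2) sub_one[OF assms(1)] by simp
  then show ?thesis using assms sub_carrier[OF assms(1)] by (metis A.inv_closed B.inv_equality)
qed

lemma sub_subgroup: assumes "sub A B" shows "subgroup (carrier A) B"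
proof -
  interpret A: group A by (rule sub_group[OF assms])
  interpret B: group B by (rule sub_group[OF assms])
  show ?thesis
  proof (rule B.subgroupI)
    show "carrier A \<subseteq> carrier B" using sub_carrier[OF assms] by blast
    show "carrier A \<noteq> {}" using A.one_closed by blast
    show "inv\<^bsub>B\<^esub> a \<in> carrier A" if "a \<in> carrier A" for a using sub_inv[OF assms that] A.inv_closed[OF that] by simp
    show "a \<otimes>\<^bsub>B\<^esub> b \<in> carrier A" if "a \<in> carrier A" "b \<in> carrier A" for a b
      using sub_mult[OF assms that] A.m_closed[OF that] by simp
  qed
qed

lemma word_closed:
  assumes "group A" "a \<in> carrier A" "s \<in> carrier A" "t \<in> carrier A" shows "word A a s t n \<in> carrier A"
proof -
  interpret group A by fact
  show ?thesis using assms by (induction n) auto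
qed

lemma word_sub:
  assumes "sub A B" "a \<in> carrier A" "s \<in> carrier A" "t \<in> carrier A" shows "word A a s t n = word B a s t n"
proof (induction n)
  case 0
  then show ?case using sub_one[OF assms(1)] by simp
next
  case (Suc n)
  interpret A: group A by (rule sub_group[OF assms(1)])
  have "word A a s t n \<in> carrier A" using word_closed[OF A.group_axioms] assms by blast
  moreover define u where "u = (if mark (int n) then s else t)"
  ultimately have "word A a s t n \<otimes>\<^bsub>A\<^esub> (u \<otimes>\<^bsub>A\<^esub> a) = word B a s t n \<otimes>\<^bsub>B\<^esub> (u \<otimes>\<^bsub>B\<^esub> a)"
    using assms sub_mult[OF assms(1)] A.m_closed[of u a] Suc by (metis (full_types))
  then show ?case by (simp add: u_def)
qed

section \<open>Directed unions of groups\<close>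

definition directed :: "'u monoid set => bool" where
  "directed \<C> \<longleftrightarrow> \<C> \<noteq> {} \<and> (\<forall>A\<in>\<C>. \<forall>B\<in>\<C>. \<exists>C\<in>\<C>. sub A C \<and> sub B C)"

definition dunion :: "'u monoid set => 'u monoid" where
  "dunion \<C> = \<lparr>carrier = (\<Union>A\<in>\<C>. carrier A),
    mult = \<lambda>x y. x \<otimes>\<^bsub>(SOME A. A \<in> \<C> \<and> x \<in> carrier A \<and> y \<in> carrier A)\<^esub> y, one = \<one>\<^bsub>(SOME A. A \<in> \<C>)\<^esub>\<rparr>"

lemma dunion_carrier: "carrier (dunion \<C>) = (\<Union>A\<in>\<C>. carrier A)"
  by (simp add: dunion_def)

lemma dunion_mult:
  assumes d: "directed \<C>" and A: "A \<in> \<C>" "x \<in> carrier A" "y \<in> carrier A"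
  shows "x \<otimes>\<^bsub>dunion \<C>\<^esub> y = x \<otimes>\<^bsub>A\<^esub> y"
proof -
  define B where "B = (SOME A. A \<in> \<C> \<and> x \<in> carrier A \<and> y \<in> carrier A)"
  have B: "B \<in> \<C> \<and> x \<in> carrier B \<and> y \<in> carrier B" unfolding B_def by (rule someI[of _ A]) (use A in blast)
  then obtain C where "sub A C" "sub B C" using d A unfolding directed_def by blast
  then have "x \<otimes>\<^bsub>B\<^esub> y = x \<otimes>\<^bsub>A\<^esub> y" using sub_mult[of A C x y] sub_mult[of B C x y] A B by simp
  then show ?thesis by (simp add: dunion_def B_def)
qed

lemma dunion_one:
  assumes d: "directed \<C>" and A: "A \<in> \<C>" shows "\<one>\<^bsub>dunion \<C>\<^esub> = \<one>\<^bsub>A\<^esub>"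
proof -
  define B where "B = (SOME A. A \<in> \<C>)"
  have B: "B \<in> \<C>" unfolding B_def by (rule someI[of _ A]) (rule A)
  then obtain C where "sub A C" "sub B C" using d A unfolding directed_def by blast
  then have "\<one>\<^bsub>B\<^esub> = \<one>\<^bsub>A\<^esub>" using sub_one by metis
  then show ?thesis by (simp add: dunion_def B_def)
qed

lemma directed_member:
  assumes "directed \<C>" "x \<in> carrier (dunion \<C>)" "y \<in> carrier (dunion \<C>)"
  obtains A where "A \<in> \<C>" "x \<in> carrier A" "y \<in> carrier A" "group A"
proof -
  obtain A B where AB: "A \<in> \<C>" "x \<in> carrier A" "B \<in> \<C>" "y \<in> carrier B" using assms(2,3) unfolding dunion_carrier by blast
  then obtain C where C: "C \<in> \<C>" "sub A C" "sub B C" using assms(1) unfolding directed_def by blast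
  show thesis using that[OF C(1)] sub_carrier[OF C(2) AB(2)] sub_carrier[OF C(3) AB(4)] sub_group(2)[OF C(2)] by simp
qed

lemma dunion_group: assumes d: "directed \<C>" shows "group (dunion \<C>)"
proof (rule groupI)
  fix x y assume xy: "x \<in> carrier (dunion \<C>)" "y \<in> carrier (dunion \<C>)"
  obtain A where A: "A \<in> \<C>" "x \<in> carrier A" "y \<in> carrier A" "group A" using d xy by (rule directed_member)
  interpret A: group A by (rule A(4))
  show "x \<otimes>\<^bsub>dunion \<C>\<^esub> y \<in> carrier (dunion \<C>)"
    using dunion_mult[OF d A(1-3)] A.m_closed[OF A(2,3)] A(1) by (auto simp: dunion_carrier)
next
  obtain A where A: "A \<in> \<C>" "group A" using d unfolding directed_def sub_def by blast
  then show "\<one>\<^bsub>dunion \<C>\<^esub> \<in> carrier (dunion \<C>)"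
    using dunion_one[OF d A(1)] monoid.one_closed[OF group.is_monoid[OF A(2)]] by (auto simp: dunion_carrier)
next
  fix x y z assume xyz: "x \<in> carrier (dunion \<C>)" "y \<in> carrier (dunion \<C>)" "z \<in> carrier (dunion \<C>)"
  obtain A where A: "A \<in> \<C>" "x \<in> carrier A" "y \<in> carrier A" "group A" using d xyz(1,2) by (rule directed_member)
  obtain B where B: "B \<in> \<C>" "z \<in> carrier B" "group B" using d xyz(3,3) by (rule directed_member)
  obtain C where C: "C \<in> \<C>" "sub A C" "sub B C" using d A(1) B(1) unfolding directed_def by blast
  interpret C: group C by (rule sub_group[OF C(2)])
  have m: "x \<in> carrier C" "y \<in> carrier C" "z \<in> carrier C"
    using sub_carrier[OF C(2) A(2)] sub_carrier[OF C(2) A(3)] sub_carrier[OF C(3) B(2)] by simp_all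
  show "x \<otimes>\<^bsub>dunion \<C>\<^esub> y \<otimes>\<^bsub>dunion \<C>\<^esub> z = x \<otimes>\<^bsub>dunion \<C>\<^esub> (y \<otimes>\<^bsub>dunion \<C>\<^esub> z)"
    using dunion_mult[OF d C(1)] m by (simp add: C.m_assoc)
next
  fix x assume x: "x \<in> carrier (dunion \<C>)"
  obtain A where A: "A \<in> \<C>" "x \<in> carrier A" "group A" using d x x by (rule directed_member)
  interpret A: group A by (rule A(3))
  show "\<one>\<^bsub>dunion \<C>\<^esub> \<otimes>\<^bsub>dunion \<C>\<^esub> x = x" using dunion_one[OF d A(1)] dunion_mult[OF d A(1)] A by simp
  show "\<exists>y\<in>carrier (dunion \<C>). y \<otimes>\<^bsub>dunion \<C>\<^esub> x = \<one>\<^bsub>dunion \<C>\<^esub>"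
    using dunion_one[OF d A(1)] dunion_mult[OF d A(1)] A by (intro bexI[of _ "inv\<^bsub>A\<^esub> x"]) (auto simp: dunion_carrier)
qed

lemma sub_dunion: assumes d: "directed \<C>" and A: "A \<in> \<C>" shows "sub A (dunion \<C>)"
proof -
  have "group A" using assms unfolding directed_def sub_def by blast
  then show ?thesis using dunion_group[OF d] dunion_mult[OF d A] A unfolding sub_def by (auto simp: dunion_carrier)
qed

lemma dunion_sub:
  assumes d: "directed \<C>" and M: "\<And>A. A \<in> \<C> ==> sub A M" shows "sub (dunion \<C>) M"
proof -
  have "group M" using d sub_group(2)[OF M] unfolding directed_def by blast
  moreover have "x \<otimes>\<^bsub>dunion \<C>\<^esub> y = x \<otimes>\<^bsub>M\<^esub> y" if xy: "x \<in> carrier (dunion \<C>)" "y \<in> carrier (dunion \<C>)" for x y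
  proof -
    obtain A where A: "A \<in> \<C>" "x \<in> carrier A" "y \<in> carrier A" using d xy by (rule directed_member)
    show ?thesis using dunion_mult[OF d A] sub_mult[OF M[OF A(1)] A(2,3)] by simp
  qed
  moreover have "carrier (dunion \<C>) \<subseteq> carrier M" using sub_carrier[OF M] unfolding dunion_carrier by blast
  ultimately show ?thesis using dunion_group[OF d] by (simp add: sub_def)
qed

text \<open>Names of group elements. A new element carries the index and the stage of its creation,
  so membership in the groups of the system becomes a condition on names.\<close>

datatype 'a U = One | Gen 'a | New 'a nat "'a U" | Pair "'a U" "'a U"

text \<open>\<open>One\<close> lies in every group and is treated separately throughout, and
  \<open>Pair\<close> only codes lists; their value is a default.\<close>

fun tg :: "'a::wellorder U => 'a" where
  "tg (Gen v) = v" | "tg (New v j x) = v" | "tg x = (LEAST x. True)"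

fun idx :: "'a U => nat" where
  "idx (New v j x) = j" | "idx x = 0"

primrec tuple :: "'a U list => 'a U" where
  "tuple [] = One" | "tuple (x # xs) = Pair x (tuple xs)"

lemma tuple_inj: "tuple xs = tuple ys ==> xs = ys"
  by (induction xs arbitrary: ys) (case_tac ys; simp)+

lemma set_tuple: "set_U (tuple xs) = (\<Union>x\<in>set xs. set_U x)"
  by (induction xs) auto

text \<open>Minimisation, first by stage and then by a well-order. Minimality makes a choice persist
  in subsets containing it, and the preference for small stages makes it persist when a double coset
  grows at later stages.\<close>

lemma ex_pick:
  "\<exists>pick :: 'a U set => 'a U. (\<forall>S. S \<noteq> {} --> pick S \<in> S \<and> (\<forall>x\<in>S. idx (pick S) \<le> idx x)) \<and>
    (\<forall>S S'. S \<subseteq> S' --> pick S' \<in> S --> pick S = pick S')"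
proof -
  obtain r :: "'a U rel" where "well_order_on UNIV r" using well_order_on by blast
  then have wo: "Well_order r" "Field r = UNIV" using well_order_on_Well_order by blast+
  interpret wo_rel r using wo(1) by (simp add: wo_rel_def)
  define low where "low S = {x \<in> S. \<forall>y\<in>S. idx x \<le> idx y}" for S :: "'a U set"
  define pick where "pick S = minim (low S)" for S :: "'a U set"
  have ne: "low S \<noteq> {}" if "S \<noteq> {}" for S
  proof -
    obtain x where "x \<in> S" "\<And>y. y \<in> S ==> idx x \<le> idx y"
      using \<open>S \<noteq> {}\<close> ex_has_least_nat[of "\<lambda>x. x \<in> S" _ idx] by blast
    then show ?thesis by (auto simp: low_def)
  qed
  have in': "pick S \<in> low S" if "S \<noteq> {}" for S
    unfolding pick_def using minim_in[of "low S"] ne[OF that] wo(2) by simp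
  have least: "(pick S, x) \<in> r" if "x \<in> low S" for S x
    unfolding pick_def using minim_least[of "low S" x] that wo(2) by simp
  have "pick S = pick S'" if S: "S \<subseteq> S'" "pick S' \<in> S" for S S'
  proof -
    have a: "pick S' \<in> low S'" "pick S \<in> low S" using in'[of S'] in'[of S] S by auto
    then have b: "pick S' \<in> low S" using S by (auto simp: low_def)
    have "idx (pick S) \<le> idx (pick S')" using a(2) S(2) by (auto simp: low_def)
    then have "pick S \<in> low S'" using a S by (auto simp: low_def intro: order_trans)
    then show ?thesis using least b antisymD[OF ANTISYM] by blast
  qed
  then show ?thesis using in' by (intro exI[of _ pick]) (auto simp: low_def)
qed

definition terms :: "'a set => 'a U set" where "terms S = {x. set_U x \<subseteq> S}"

lemma card_terms:
  assumes S: "infinite S" shows "|terms S| \<le>o |S|"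
proof -
  define D where "D = rec_nat {} (\<lambda>_ X. {One} \<union> Gen ` S \<union> (\<lambda>(v, j, x). New v j x) ` (S \<times> UNIV \<times> X) \<union> (\<lambda>(x, y). Pair x y) ` (X \<times> X))"
  have D0: "D 0 = {}" and DS: "D (Suc n) = {One} \<union> Gen ` S \<union> (\<lambda>(v, j, x). New v j x) ` (S \<times> UNIV \<times> D n) \<union> (\<lambda>(x, y). Pair x y) ` (D n \<times> D n)" for n
    by (simp_all add: D_def)
  have DNew: "New v j x \<in> D (Suc n)" if "v \<in> S" "x \<in> D n" for v j x n
  proof -
    have "New v j x \<in> (\<lambda>(v, j, x). New v j x) ` (S \<times> UNIV \<times> D n)" by (rule image_eqI[of _ _ "(v, j, x)"]) (use that in auto)
    then show ?thesis unfolding DS by blast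
  qed
  have DPair: "Pair x y \<in> D (Suc n)" if "x \<in> D n" "y \<in> D n" for x y n
  proof -
    have "Pair x y \<in> (\<lambda>(x, y). Pair x y) ` (D n \<times> D n)" by (rule image_eqI[of _ _ "(x, y)"]) (use that in auto)
    then show ?thesis unfolding DS by blast
  qed
  have mono: "D n \<subseteq> D (Suc n)" for n
    by (induction n) (auto simp: D0 DS image_iff)
  then have mono': "n \<le> m ==> D n \<subseteq> D m" for n m by (rule lift_Suc_mono_le)
  have nat: "|UNIV :: nat set| \<le>o |S|" using S infinite_iff_card_of_nat by blast
  have card: "|D n| \<le>o |S|" for n
  proof (induction n)
    case 0
    show ?case unfolding D0 by (rule card_of_empty)
  next
    case (Suc n)
    have "|D n \<times> D n| \<le>o |S|" using S Suc by (intro card_of_Times_ordLeq_infinite_Field) (auto simp: Field_card_of card_of_card_order_on)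
    then have 1: "|(\<lambda>(x, y). Pair x y) ` (D n \<times> D n)| \<le>o |S|" using card_of_image ordLeq_transitive by blast
    have "|(UNIV :: nat set) \<times> D n| \<le>o |S|" using S Suc nat by (intro card_of_Times_ordLeq_infinite_Field) (auto simp: Field_card_of card_of_card_order_on)
    then have "|S \<times> (UNIV :: nat set) \<times> D n| \<le>o |S|"
      using S card_of_Times_ordLeq_infinite_Field[OF _ ordLeq_refl[OF card_of_Card_order] _ card_of_Card_order, of S] by (simp add: Field_card_of)
    then have 2: "|(\<lambda>(v, j, x). New v j x) ` (S \<times> UNIV \<times> D n)| \<le>o |S|" using card_of_image ordLeq_transitive by blast
    have 3: "|Gen ` S| \<le>o |S|" by (rule card_of_image)
    have 4: "|{One :: 'a U}| \<le>o |S|" using S by (intro card_of_singl_ordLeq) auto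
    show ?case unfolding DS
      using 1 2 3 4 S by (intro card_of_Un_ordLeq_infinite_Field) (auto simp: Field_card_of card_of_card_order_on)
  qed
  have "terms S \<subseteq> (\<Union>n. D n)"
  proof
    fix x assume "x \<in> terms S"
    then have "set_U x \<subseteq> S" by (simp add: terms_def)
    then show "x \<in> (\<Union>n. D n)"
    proof (induction x)
      case (New v j x)
      then obtain n where "x \<in> D n" by auto
      then have "New v j x \<in> D (Suc n)" using New by (intro DNew) auto
      then show ?case by blast
    next
      case (Pair x y)
      then obtain n m where "x \<in> D n" "y \<in> D m" by auto
      then have "x \<in> D (max n m)" "y \<in> D (max n m)" using mono'[of n "max n m"] mono'[of m "max n m"] by auto
      then have "Pair x y \<in> D (Suc (max n m))" by (rule DPair)
      then show ?case by blast
    next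
      case One
      have "One \<in> D (Suc 0)" by (simp add: DS)
      then show ?case by blast
    next
      case (Gen v)
      then have "Gen v \<in> D (Suc 0)" by (simp add: DS)
      then show ?case by blast
    qed
  qed
  moreover have "|\<Union>n. D n| \<le>o |S|" using card_of_UNION_ordLeq_infinite[OF S nat, of D] card by blast
  ultimately show ?thesis using card_of_mono1 ordLeq_transitive by blast
qed

section \<open>Double cosets and equivariant values\<close>

locale choice_fun =
  fixes pick :: "'u set => 'u"
  assumes pick_in: "S \<noteq> {} ==> pick S \<in> S"
begin

definition dcoset :: "'u monoid => 'u set => 'u => 'u set" where
  "dcoset A H s = {h1 \<otimes>\<^bsub>A\<^esub> s \<otimes>\<^bsub>A\<^esub> h2 | h1 h2. h1 \<in> H \<and> h2 \<in> H}"

definition left :: "'u monoid => 'u set => 'u => 'u" where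
  "left A H s = (SOME u. u \<in> H \<and> (\<exists>v\<in>H. s = u \<otimes>\<^bsub>A\<^esub> pick (dcoset A H s) \<otimes>\<^bsub>A\<^esub> v))"

definition lcos :: "'u monoid => 'u set => 'u => 'u set" where
  "lcos A Q u = {x \<otimes>\<^bsub>A\<^esub> u | x. x \<in> Q}"

text \<open>An element of \<open>Q\<close> that is multiplied by \<open>h\<close> when
  \<open>s\<close> is replaced by \<open>h s h'\<close>, for \<open>h\<close> in \<open>Q\<close>
  and \<open>h'\<close> in \<open>H\<close>. Conjugating a fixed element by it gives a value that
  transforms as \<open>R_conj'\<close> demands.\<close>

definition key :: "'u monoid => 'u set => 'u set => 'u => 'u" where
  "key A H Q s = left A H s \<otimes>\<^bsub>A\<^esub> inv\<^bsub>A\<^esub> pick (lcos A Q (left A H s))"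

definition val :: "'u monoid => 'u set => 'u set => 'u => 'u => 'u" where
  "val A H Q s c = key A H Q s \<otimes>\<^bsub>A\<^esub> c \<otimes>\<^bsub>A\<^esub> inv\<^bsub>A\<^esub> key A H Q s"

end

locale double_cosets = choice_fun pick + group A for pick :: "'u set => 'u" and A :: "'u monoid" (structure) +
  fixes H :: "'u set"
  assumes sub_H: "subgroup H A" and mal_H: "malnormal H A"
begin

lemma H_car: "h \<in> H ==> h \<in> carrier A"
  using subgroup.mem_carrier[OF sub_H] .

lemma H_cl: "h \<in> H ==> h' \<in> H ==> h \<otimes> h' \<in> H" "h \<in> H ==> inv h \<in> H" "\<one> \<in> H"
  using subgroup.m_closed[OF sub_H] subgroup.m_inv_closed[OF sub_H] subgroup.one_closed[OF sub_H] by simp_all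

lemma dcoset_self: "s \<in> carrier A ==> s \<in> dcoset A H s"
  unfolding dcoset_def using H_cl(3) by force

lemma dcoset_conj:
  assumes s: "s \<in> carrier A" and h: "h1 \<in> H" "h2 \<in> H" shows "dcoset A H (h1 \<otimes> s \<otimes> h2) = dcoset A H s"
proof
  show "dcoset A H (h1 \<otimes> s \<otimes> h2) \<subseteq> dcoset A H s"
  proof
    fix y assume "y \<in> dcoset A H (h1 \<otimes> s \<otimes> h2)"
    then obtain a b where ab: "a \<in> H" "b \<in> H" "y = a \<otimes> (h1 \<otimes> s \<otimes> h2) \<otimes> b" unfolding dcoset_def by blast
    then have "y = (a \<otimes> h1) \<otimes> s \<otimes> (h2 \<otimes> b)" using s h H_car by (simp add: m_assoc)
    then show "y \<in> dcoset A H s" unfolding dcoset_def using H_cl(1)[OF ab(1) h(1)] H_cl(1)[OF h(2) ab(2)] by blast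
  qed
  show "dcoset A H s \<subseteq> dcoset A H (h1 \<otimes> s \<otimes> h2)"
  proof
    fix y assume "y \<in> dcoset A H s"
    then obtain a b where ab: "a \<in> H" "b \<in> H" "y = a \<otimes> s \<otimes> b" unfolding dcoset_def by blast
    note c = H_car[OF ab(1)] H_car[OF ab(2)] H_car[OF h(1)] H_car[OF h(2)] s
    have "(a \<otimes> inv h1) \<otimes> (h1 \<otimes> s \<otimes> h2) \<otimes> (inv h2 \<otimes> b) = a \<otimes> (inv h1 \<otimes> (h1 \<otimes> (s \<otimes> (h2 \<otimes> (inv h2 \<otimes> b)))))"
      using c by (simp add: m_assoc)
    also have "\<dots> = y" using c ab(3) by (simp add: m_assoc[symmetric])
    finally show "y \<in> dcoset A H (h1 \<otimes> s \<otimes> h2)"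
      unfolding dcoset_def using H_cl(1)[OF ab(1) H_cl(2)[OF h(1)]] H_cl(1)[OF H_cl(2)[OF h(2)] ab(2)] by blast
  qed
qed

lemma left:
  assumes s: "s \<in> carrier A" shows "left A H s \<in> H" "\<exists>v\<in>H. s = left A H s \<otimes> pick (dcoset A H s) \<otimes> v"
proof -
  have "pick (dcoset A H s) \<in> dcoset A H s" using dcoset_self[OF s] pick_in by blast
  then obtain a b where ab: "a \<in> H" "b \<in> H" "pick (dcoset A H s) = a \<otimes> s \<otimes> b" unfolding dcoset_def by blast
  have "inv a \<otimes> (a \<otimes> s \<otimes> b) \<otimes> inv b = s" using H_car[OF ab(1)] H_car[OF ab(2)] s by (simp add: m_assoc) (simp add: m_assoc[symmetric])
  then have "\<exists>u. u \<in> H \<and> (\<exists>v\<in>H. s = u \<otimes> pick (dcoset A H s) \<otimes> v)"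
    using ab H_cl(2) by (metis (no_types, lifting))
  from someI_ex[OF this] show "left A H s \<in> H" "\<exists>v\<in>H. s = left A H s \<otimes> pick (dcoset A H s) \<otimes> v"
    unfolding left_def by blast+
qed

lemma pick_dcoset:
  assumes s: "s \<in> carrier A" "s \<notin> H" shows "pick (dcoset A H s) \<in> carrier A" "pick (dcoset A H s) \<notin> H"
proof -
  have "pick (dcoset A H s) \<in> dcoset A H s" using dcoset_self[OF s(1)] pick_in by blast
  then show "pick (dcoset A H s) \<in> carrier A" unfolding dcoset_def using H_car s(1) by auto
  obtain v where "v \<in> H" "s = left A H s \<otimes> pick (dcoset A H s) \<otimes> v" using left(2)[OF s(1)] by blast
  then show "pick (dcoset A H s) \<notin> H" using left(1)[OF s(1)] H_cl(1) s(2) by metis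
qed

text \<open>From two decompositions one obtains an element of \<open>H\<close> that the
  representative, which is not in \<open>H\<close>, conjugates into \<open>H\<close>.\<close>

lemma left_unique:
  assumes s: "s \<in> carrier A" "s \<notin> H" and u: "u \<in> H" "v \<in> H" "s = u \<otimes> pick (dcoset A H s) \<otimes> v"
  shows "left A H s = u"
proof -
  let ?p = "pick (dcoset A H s)" and ?u = "left A H s"
  note p = pick_dcoset[OF s]
  obtain w where w: "w \<in> H" "s = ?u \<otimes> ?p \<otimes> w" using left(2)[OF s(1)] by blast
  note c = H_car[OF u(1)] H_car[OF u(2)] H_car[OF w(1)] H_car[OF left(1)[OF s(1)]] p(1)
  have "u \<otimes> (?p \<otimes> v) = ?u \<otimes> (?p \<otimes> w)" using u(3) w(2) c by (simp add: m_assoc)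
  then have "inv ?p \<otimes> (inv ?u \<otimes> (u \<otimes> (?p \<otimes> v))) \<otimes> inv v = inv ?p \<otimes> (inv ?u \<otimes> (?u \<otimes> (?p \<otimes> w))) \<otimes> inv v" by simp
  moreover have "inv ?p \<otimes> (inv ?u \<otimes> (u \<otimes> (?p \<otimes> v))) \<otimes> inv v = inv ?p \<otimes> ((inv ?u \<otimes> u) \<otimes> ?p)" using c by (simp add: m_assoc)
  moreover have "inv ?p \<otimes> (inv ?u \<otimes> (?u \<otimes> (?p \<otimes> w))) \<otimes> inv v = w \<otimes> inv v" using c by (simp add: m_assoc[symmetric])
  ultimately have "inv ?p \<otimes> ((inv ?u \<otimes> u) \<otimes> ?p) \<in> H" using H_cl w u by simp
  then have "inv ?u \<otimes> u = \<one>" using mal_H p H_cl(1)[OF H_cl(2)[OF left(1)[OF s(1)]] u(1)] unfolding malnormal_def by blast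
  then show ?thesis using c by (metis inv_equality inv_inv inv_closed)
qed

lemma left_conj:
  assumes s: "s \<in> carrier A" "s \<notin> H" and h: "h1 \<in> H" "h2 \<in> H" shows "left A H (h1 \<otimes> s \<otimes> h2) = h1 \<otimes> left A H s"
proof -
  note c = H_car[OF h(1)] H_car[OF h(2)] s(1)
  have n: "h1 \<otimes> s \<otimes> h2 \<notin> H"
  proof
    assume "h1 \<otimes> s \<otimes> h2 \<in> H"
    then have "inv h1 \<otimes> (h1 \<otimes> s \<otimes> h2) \<otimes> inv h2 \<in> H" using H_cl(1)[OF H_cl(1)[OF H_cl(2)[OF h(1)]] H_cl(2)[OF h(2)]] by simp
    moreover have "inv h1 \<otimes> (h1 \<otimes> s \<otimes> h2) \<otimes> inv h2 = s" using c by (simp add: m_assoc) (simp add: m_assoc[symmetric])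
    ultimately show False using s(2) by simp
  qed
  obtain v where v: "v \<in> H" "s = left A H s \<otimes> pick (dcoset A H s) \<otimes> v" using left(2)[OF s(1)] by blast
  note l = H_car[OF left(1)[OF s(1)]] H_car[OF v(1)] pick_dcoset(1)[OF s]
  have "h1 \<otimes> s \<otimes> h2 = h1 \<otimes> (left A H s \<otimes> pick (dcoset A H s) \<otimes> v) \<otimes> h2"
    by (rule arg_cong[where f = "\<lambda>x. h1 \<otimes> x \<otimes> h2", OF v(2)])
  also have "\<dots> = (h1 \<otimes> left A H s) \<otimes> pick (dcoset A H s) \<otimes> (v \<otimes> h2)" using c l by (simp add: m_assoc)
  finally have e: "h1 \<otimes> s \<otimes> h2 = (h1 \<otimes> left A H s) \<otimes> pick (dcoset A H (h1 \<otimes> s \<otimes> h2)) \<otimes> (v \<otimes> h2)"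
    unfolding dcoset_conj[OF s(1) h] .
  show ?thesis
    by (rule left_unique[OF _ n H_cl(1)[OF h(1) left(1)[OF s(1)]] H_cl(1)[OF v(1) h(2)] e]) (use c in simp)
qed

lemma lcos_conj:
  assumes Q: "subgroup Q A" and h: "h \<in> Q" and u: "u \<in> carrier A" shows "lcos A Q (h \<otimes> u) = lcos A Q u"
proof
  note c = subgroup.mem_carrier[OF Q]
  show "lcos A Q (h \<otimes> u) \<subseteq> lcos A Q u"
    unfolding lcos_def using c h u subgroup.m_closed[OF Q] by (auto simp: m_assoc[symmetric])
  show "lcos A Q u \<subseteq> lcos A Q (h \<otimes> u)"
  proof
    fix y assume "y \<in> lcos A Q u"
    then obtain x where x: "x \<in> Q" "y = x \<otimes> u" unfolding lcos_def by blast
    have "(x \<otimes> inv h) \<otimes> (h \<otimes> u) = x \<otimes> (inv h \<otimes> (h \<otimes> u))" using c[OF x(1)] c[OF h] u by (simp add: m_assoc)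
    also have "\<dots> = y" using c[OF x(1)] c[OF h] u x(2) by (simp add: m_assoc[symmetric])
    finally show "y \<in> lcos A Q (h \<otimes> u)" unfolding lcos_def
      using subgroup.m_closed[OF Q x(1) subgroup.m_inv_closed[OF Q h]] by blast
  qed
qed

lemma key:
  assumes Q: "subgroup Q A" "Q \<subseteq> H" and s: "s \<in> carrier A"
  obtains x where "x \<in> Q" "key A H Q s = inv x" "pick (lcos A Q (left A H s)) = x \<otimes> left A H s"
proof -
  have "\<one> \<otimes> left A H s \<in> lcos A Q (left A H s)" unfolding lcos_def using subgroup.one_closed[OF Q(1)] by blast
  then have "pick (lcos A Q (left A H s)) \<in> lcos A Q (left A H s)" using pick_in by blast
  then obtain x where x: "x \<in> Q" "pick (lcos A Q (left A H s)) = x \<otimes> left A H s" unfolding lcos_def by blast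
  have c: "x \<in> carrier A" "left A H s \<in> carrier A" using x Q H_car left(1)[OF s] by auto
  have "key A H Q s = inv x" unfolding key_def x(2) using c by (simp add: inv_mult_group m_assoc[symmetric])
  then show thesis using that x by blast
qed

lemma val_H:
  assumes Q: "subgroup Q A" "Q \<subseteq> H" and s: "s \<in> carrier A" and c: "c \<in> H" shows "val A H Q s c \<in> H"
proof -
  obtain x where "x \<in> Q" "key A H Q s = inv x" using key[OF Q s] .
  then have "key A H Q s \<in> H" using Q(2) H_cl(2) by auto
  then show ?thesis unfolding val_def using H_cl c by simp
qed

lemma val_conj:
  assumes Q: "subgroup Q A" "Q \<subseteq> H" and s: "s \<in> carrier A" "s \<notin> H" and c: "c \<in> H" and h: "h1 \<in> Q" "h2 \<in> H"
  shows "h1 \<otimes> val A H Q s c = val A H Q (h1 \<otimes> s \<otimes> h2) c \<otimes> h1"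
proof -
  have h1: "h1 \<in> H" using h Q by blast
  obtain x where x: "x \<in> Q" "key A H Q s = inv x" using key[OF Q s(1)] .
  note cs = H_car[OF h1] H_car[OF h(2)] H_car[OF c] H_car[OF left(1)[OF s(1)]]
  have kc: "key A H Q s \<in> carrier A" using x Q H_car by auto
  have pc: "pick (lcos A Q (left A H s)) \<in> carrier A"
    using key[OF Q s(1)] Q(2) H_car cs(4) by (metis m_closed subsetD)
  have k: "key A H Q (h1 \<otimes> s \<otimes> h2) = h1 \<otimes> key A H Q s"
    unfolding key_def left_conj[OF s h1 h(2)] lcos_conj[OF Q(1) h(1) cs(4)] using cs pc by (simp add: m_assoc)
  show ?thesis unfolding val_def k using cs kc by (simp add: m_assoc inv_mult_group)
qed

end

lemma sub_conj:
  assumes "sub A B" "g \<in> carrier A" "x \<in> carrier A"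
  shows "inv\<^bsub>A\<^esub> g \<otimes>\<^bsub>A\<^esub> (x \<otimes>\<^bsub>A\<^esub> g) = inv\<^bsub>B\<^esub> g \<otimes>\<^bsub>B\<^esub> (x \<otimes>\<^bsub>B\<^esub> g)"
proof -
  interpret A: group A by (rule sub_group[OF assms(1)])
  have "inv\<^bsub>A\<^esub> g \<otimes>\<^bsub>A\<^esub> (x \<otimes>\<^bsub>A\<^esub> g) = inv\<^bsub>A\<^esub> g \<otimes>\<^bsub>B\<^esub> (x \<otimes>\<^bsub>A\<^esub> g)"
    using assms by (intro sub_mult[OF assms(1)]) simp_all
  then show ?thesis using sub_mult[OF assms(1,3,2)] sub_inv[OF assms(1,2)] by simp
qed

text \<open>For subgroups \<open>K\<close> and \<open>L\<close> it says that no product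
  \<open>k l\<close> equals a product \<open>l' k'\<close>, all factors being outside the
  intersection.\<close>

definition alternating_free :: "'u set => 'u set => 'u monoid => bool" where
  "alternating_free K L M \<longleftrightarrow> (\<forall>k1\<in>K - L. \<forall>l1\<in>L - K. \<forall>k2\<in>K - L. \<forall>l2\<in>L - K.
    k1 \<otimes>\<^bsub>M\<^esub> l1 \<otimes>\<^bsub>M\<^esub> k2 \<otimes>\<^bsub>M\<^esub> l2 \<noteq> \<one>\<^bsub>M\<^esub>)"

definition low :: "'a::wellorder => 'a U => bool" where "low v x \<longleftrightarrow> x = One \<or> tg x < v"

section \<open>Specification of the groups\<close>

locale system = segment K + choice_fun pick for K :: "'a::wellorder set" and pick :: "'a U set => 'a U" +
  fixes e :: "'a => 'a => nat" and col :: "'a => 'a => 'a => 'a" and \<phi> :: "'a => 'a U"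
  assumes e_refl: "e a a = 0" and e_pos: "a < b ==> 0 < e a b"
    and e_left: "c \<in> K ==> a \<le> b ==> b \<le> c ==> e a c \<le> max (e a b) (e b c)"
    and e_right: "c \<in> K ==> a \<le> b ==> b \<le> c ==> e a b \<le> max (e a c) (e b c)"
begin

definition inn :: "'a => nat => 'a U => bool" where
  "inn w n x \<longleftrightarrow> x = One \<or> tg x \<le> w \<and> e (tg x) w \<le> n \<and> idx x \<le> n"

definition Hs :: "'a U monoid => 'a => 'a U set" where "Hs A v = {x \<in> carrier A. low v x}"

definition Qs :: "'a U monoid => 'a => 'a => 'a U set" where "Qs A v q = {x \<in> Hs A v. low q x}"

text \<open>The level condition lets \<open>a\<close> enter only at stage \<open>Suc i\<close>,
  whereas \<open>s\<close> and \<open>b\<close> are present at stage \<open>i\<close>. So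
  \<open>a\<close> is a letter from the second factor, and \<open>s\<close> and \<open>s b\<close>
  are letters from the first.\<close>

definition admissible :: "'a U monoid => 'a => nat => 'a U => 'a U => 'a U => bool" where
  "admissible A v i a s b \<longleftrightarrow> a \<noteq> One \<and> tg a < tg b \<and> tg b < v \<and> e (tg a) v = Suc i \<and>
    s \<in> carrier A \<and> s \<noteq> One \<and> tg s = v \<and> b \<in> carrier A \<and> b \<noteq> One \<and> \<phi> (col (tg b) (tg a) v) \<in> Hs A v"

text \<open>By \<open>level_match\<close> only elements below \<open>tg a\<close> can act as the
  left multiplier \<open>h1\<close> between two relators, so equivariance under that subgroup is the
  right demand.\<close>

definition target :: "'a U monoid => 'a => 'a U => 'a U => 'a U => 'a U" where
  "target A v a s b = val A (Hs A v) (Qs A v (tg a)) s (\<phi> (col (tg b) (tg a) v))"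

text \<open>What the recursion maintains at \<open>(v, j)\<close>. Earlier groups are recovered by a
  condition on names; the malnormality clauses feed the hypotheses of later amalgams;
  \<open>alternating_free\<close> serves \<open>level_match\<close> and
  \<open>nonmerge\<close>.\<close>

definition Spec :: "('a => nat => 'a U monoid) => 'a => nat => 'a U monoid => bool" where
  "Spec f v j M \<longleftrightarrow> group M \<and> \<one>\<^bsub>M\<^esub> = One \<and> (\<forall>x\<in>carrier M. inn v j x \<and> set_U x \<subseteq> {..v}) \<and> Gen v \<in> carrier M \<and>
    (\<forall>w n. w \<le> v --> n \<le> j --> (w, n) \<noteq> (v, j) --> e w v \<le> j -->
      sub (f w n) M \<and> carrier (f w n) = {x \<in> carrier M. inn w n x}) \<and>
    malnormal (Hs M v) M \<and>
    (\<forall>i. j = Suc i --> malnormal (carrier (f v i)) M \<and> alternating_free (carrier (f v i)) (Hs M v) M \<and>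
      (\<forall>a\<in>carrier M. \<forall>s b. admissible (f v i) v i a s b -->
        word M a s (s \<otimes>\<^bsub>f v i\<^esub> b) (nat period) = target (f v i) v a s b))"

abbreviation "Sp f v j \<equiv> Spec f v j (f v j)"

lemma
  assumes "Spec f v j M"
  shows Sp_group: "group M" and Sp_one: "\<one>\<^bsub>M\<^esub> = One" and Sp_inn: "x \<in> carrier M ==> inn v j x"
    and Sp_set: "x \<in> carrier M ==> set_U x \<subseteq> {..v}" and Sp_Gen: "Gen v \<in> carrier M"
    and Sp_low: "malnormal (Hs M v) M"
  using assms unfolding Spec_def by blast+

lemma Sp_sub:
  assumes "Sp f v j" "w \<le> v" "n \<le> j" "e w v \<le> j"
  shows "sub (f w n) (f v j)" "x \<in> carrier (f w n) \<longleftrightarrow> x \<in> carrier (f v j) \<and> inn w n x"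
proof -
  have "sub (f w n) (f v j) \<and> carrier (f w n) = {x \<in> carrier (f v j). inn w n x}"
  proof (cases "(w, n) = (v, j)")
    case True
    then show ?thesis using sub_refl[OF Sp_group[OF assms(1)]] Sp_inn[OF assms(1)] by auto
  next
    case False
    then show ?thesis using assms unfolding Spec_def by blast
  qed
  then show "sub (f w n) (f v j)" "x \<in> carrier (f w n) \<longleftrightarrow> x \<in> carrier (f v j) \<and> inn w n x" by auto
qed

lemma Sp_own:
  assumes "Sp f v j" "x \<in> carrier (f v j)" "x \<noteq> One"
  shows "tg x \<le> v" "e (tg x) v \<le> j" "idx x \<le> j" "idx x \<le> n ==> n \<le> j ==> x \<in> carrier (f (tg x) n)"
proof -
  have i: "tg x \<le> v \<and> e (tg x) v \<le> j \<and> idx x \<le> j" using Sp_inn[OF assms(1,2)] assms(3) by (simp add: inn_def)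
  then show "tg x \<le> v" "e (tg x) v \<le> j" "idx x \<le> j" by blast+
  show "x \<in> carrier (f (tg x) n)" if "idx x \<le> n" "n \<le> j"
    using Sp_sub(2)[OF assms(1), of "tg x" n x] i that assms(2) by (simp add: inn_def e_refl)
qed

definition triv :: "'a U monoid" where "triv = \<lparr>carrier = {One}, mult = \<lambda>_ _. One, one = One\<rparr>"

lemma triv_group: "group triv"
  by (rule groupI) (auto simp: triv_def)

lemma triv_sub: "group M ==> \<one>\<^bsub>M\<^esub> = One ==> sub triv M"
  using triv_group group.is_monoid[of M] monoid.one_closed[of M] monoid.l_one[of M One] by (auto simp: sub_def triv_def)

text \<open>The trivial group keeps the union meaningful when no smaller index has level at most
  \<open>J\<close>.\<close>

definition family :: "('a => nat => 'a U monoid) => 'a => nat => 'a U monoid set" where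
  "family f v J = insert triv {f w J | w. w < v \<and> e w v \<le> J}"

end

section \<open>The union of the groups below an index\<close>

locale system_below = system K pick e col \<phi> for K :: "'a::wellorder set" and pick e col \<phi> +
  fixes f :: "'a => nat => 'a U monoid" and v :: 'a
  assumes v: "v \<in> K" and below: "\<And>w n. w < v ==> Sp f w n"
begin

abbreviation "LL J \<equiv> dunion (family f v J)"

lemma e_mono: "a \<le> b ==> b \<le> v ==> e a b \<le> n ==> e b v \<le> n ==> e a v \<le> n"
  using e_left[OF v, of a b] by simp

lemma e_mono': "a \<le> b ==> b \<le> v ==> e a v \<le> n ==> e b v \<le> n ==> e a b \<le> n"
  using e_right[OF v, of a b] by simp

lemma fam_sub:
  assumes "w \<le> w'" "w' < v" "e w v \<le> J" "e w' v \<le> J" "n \<le> J" shows "sub (f w n) (f w' J)"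
  using Sp_sub(1)[OF below[OF assms(2)] assms(1,5)] e_mono'[OF assms(1) _ assms(3,4)] assms(2) by simp

lemma directed: "directed (family f v J)"
  unfolding directed_def
proof (intro conjI ballI)
  show "family f v J \<noteq> {}" by (simp add: family_def)
  have tr: "sub triv A" if "A \<in> family f v J" for A
    using that below triv_sub[OF Sp_group Sp_one] sub_refl[OF triv_group] unfolding family_def by blast
  fix A B assume AB: "A \<in> family f v J" "B \<in> family f v J"
  consider "A = triv" | "B = triv" | w w' where "A = f w J" "B = f w' J" "w < v" "e w v \<le> J" "w' < v" "e w' v \<le> J"
    using AB unfolding family_def by blast
  then show "\<exists>C\<in>family f v J. sub A C \<and> sub B C"
  proof cases
    case 1
    then show ?thesis using AB tr[OF AB(2)] sub_refl[OF sub_group(2)[OF tr[OF AB(2)]]] by blast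
  next
    case 2
    then show ?thesis using AB tr[OF AB(1)] sub_refl[OF sub_group(2)[OF tr[OF AB(1)]]] by blast
  next
    case 3
    show ?thesis
    proof (cases "w \<le> w'")
      case True
      then show ?thesis using fam_sub[of w w' J J] fam_sub[of w' w' J J] 3 AB by auto
    next
      case False
      then show ?thesis using fam_sub[of w' w J J] fam_sub[of w w J J] 3 AB by auto
    qed
  qed
qed

lemma fam_LL: "w < v ==> e w v \<le> J ==> sub (f w J) (LL J)"
  by (rule sub_dunion[OF directed]) (auto simp: family_def)

lemma LL_group: "group (LL J)"
  by (rule dunion_group[OF directed])

lemma LL_one: "\<one>\<^bsub>LL J\<^esub> = One"
  using dunion_one[OF directed, of triv] by (simp add: family_def triv_def)

lemma LL_iff: "x \<in> carrier (LL J) \<longleftrightarrow> x = One \<or> tg x < v \<and> e (tg x) v \<le> J \<and> x \<in> carrier (f (tg x) J)"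
proof
  assume "x \<in> carrier (LL J)"
  then consider "x \<in> carrier triv" | w where "w < v" "e w v \<le> J" "x \<in> carrier (f w J)"
    unfolding dunion_carrier family_def by blast
  then show "x = One \<or> tg x < v \<and> e (tg x) v \<le> J \<and> x \<in> carrier (f (tg x) J)"
  proof cases
    case (2 w)
    show ?thesis
    proof (cases "x = One")
      case False
      note o = Sp_own[OF below[OF 2(1)] 2(3) False]
      have "tg x < v" using o(1) 2(1) by simp
      moreover have "e (tg x) v \<le> J" using e_mono[OF o(1) _ o(2) 2(2)] 2(1) by simp
      ultimately show ?thesis using o(4)[OF o(3) order_refl] by simp
    qed simp
  qed (simp add: triv_def)
next
  assume "x = One \<or> tg x < v \<and> e (tg x) v \<le> J \<and> x \<in> carrier (f (tg x) J)"
  then show "x \<in> carrier (LL J)"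
  proof
    assume "x = One"
    then show ?thesis using LL_one[of J] monoid.one_closed[OF group.is_monoid[OF LL_group[of J]]] by simp
  next
    assume "tg x < v \<and> e (tg x) v \<le> J \<and> x \<in> carrier (f (tg x) J)"
    then show ?thesis using sub_carrier[OF fam_LL[of "tg x" J]] by blast
  qed
qed

lemma LL_member:
  assumes "x \<in> carrier (LL J)" "x \<noteq> One" "tg x \<le> m" "m < v" "e m v \<le> J" shows "x \<in> carrier (f m J)"
proof -
  have x: "tg x < v" "e (tg x) v \<le> J" "x \<in> carrier (f (tg x) J)" using assms(1,2) by (auto simp: LL_iff)
  show ?thesis by (rule sub_carrier[OF fam_sub[OF assms(3,4) x(2) assms(5) order_refl] x(3)])
qed

lemma LL_pair:
  assumes "x \<in> carrier (LL J)" "y \<in> carrier (LL J)" "x \<noteq> One" "y \<noteq> One"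
  defines "m \<equiv> max (tg x) (tg y)"
  shows "m < v" "e m v \<le> J" "x \<in> carrier (f m J)" "y \<in> carrier (f m J)"
proof -
  show m: "m < v" "e m v \<le> J" using assms by (auto simp: LL_iff m_def max_def)
  show "x \<in> carrier (f m J)" "y \<in> carrier (f m J)"
    using LL_member[OF assms(1,3) _ m] LL_member[OF assms(2,4) _ m] by (auto simp: m_def)
qed

text \<open>Two elements live together in the group at the larger of their indices, and its members
  have no larger index.\<close>

lemma low_mult:
  assumes x: "x \<in> carrier (LL J)" and y: "y \<in> carrier (LL J)" and q: "low q x" "low q y"
  shows "low q (x \<otimes>\<^bsub>LL J\<^esub> y)"
proof -
  interpret L: group "LL J" by (rule LL_group)
  show ?thesis
  proof (cases "x = One \<or> y = One")
    case True
    then show ?thesis using L.l_one[OF y] L.r_one[OF x] q LL_one by auto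
  next
    case False
    let ?m = "max (tg x) (tg y)"
    have ne: "x \<noteq> One" "y \<noteq> One" using False by auto
    note m = LL_pair[OF x y ne]
    interpret M: group "f ?m J" by (rule Sp_group[OF below[OF m(1)]])
    have "x \<otimes>\<^bsub>LL J\<^esub> y = x \<otimes>\<^bsub>f ?m J\<^esub> y" using sub_mult[OF fam_LL[OF m(1,2)] m(3,4)] by simp
    moreover have "inn ?m J (x \<otimes>\<^bsub>f ?m J\<^esub> y)" using Sp_inn[OF below[OF m(1)]] M.m_closed[OF m(3,4)] by blast
    moreover have "?m < q" using q ne by (auto simp: low_def)
    ultimately show ?thesis unfolding inn_def low_def by (metis order_le_less_trans)
  qed
qed

lemma low_inv:
  assumes x: "x \<in> carrier (LL J)" and q: "low q x" shows "low q (inv\<^bsub>LL J\<^esub> x)"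
proof (cases "x = One")
  case True
  then show ?thesis using group.is_monoid[OF LL_group] monoid.inv_one LL_one q by metis
next
  case False
  have m: "tg x < v" "e (tg x) v \<le> J" "x \<in> carrier (f (tg x) J)" using x False by (auto simp: LL_iff)
  interpret M: group "f (tg x) J" by (rule Sp_group[OF below[OF m(1)]])
  have "inv\<^bsub>LL J\<^esub> x = inv\<^bsub>f (tg x) J\<^esub> x" using sub_inv[OF fam_LL[OF m(1,2)] m(3)] by simp
  moreover have "inn (tg x) J (inv\<^bsub>f (tg x) J\<^esub> x)" using Sp_inn[OF below[OF m(1)]] M.inv_closed[OF m(3)] by blast
  ultimately show ?thesis using q False unfolding inn_def low_def by (metis order_le_less_trans)
qed

lemma LL_mono: assumes "j \<le> J" shows "sub (LL j) (LL J)"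
proof (rule dunion_sub[OF directed])
  fix A assume "A \<in> family f v j"
  then consider "A = triv" | w where "A = f w j" "w < v" "e w v \<le> j" unfolding family_def by blast
  then show "sub A (LL J)"
  proof cases
    case 1
    then show ?thesis using triv_sub LL_group LL_one by blast
  next
    case 2
    then have "e w v \<le> J" using assms by simp
    then show ?thesis using sub_trans[OF fam_sub[of w w J j] fam_LL[of w J]] 2 assms by simp
  qed
qed

text \<open>An element \<open>g\<close> of level \<open>r\<close> and a pair of lower elements of level \<open>m\<close> already live in \<open>f (max r m)\<close>,
  where one of the two malnormality conditions of \<open>Spec\<close> applies.\<close>

lemma LL_malnormal: "malnormal (carrier (LL j)) (LL (Suc j))"
  unfolding malnormal_def
proof (intro ballI impI)
  let ?B = "LL (Suc j)"
  interpret B: group ?B by (rule LL_group)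
  note jJ = LL_mono[of j "Suc j"]
  fix g x assume g: "g \<in> carrier ?B - carrier (LL j)" and x: "x \<in> carrier (LL j)"
    and y: "inv\<^bsub>?B\<^esub> g \<otimes>\<^bsub>?B\<^esub> (x \<otimes>\<^bsub>?B\<^esub> g) \<in> carrier (LL j)" (is "?y \<in> _")
  have gB: "g \<in> carrier ?B" and xB: "x \<in> carrier ?B" and yB: "?y \<in> carrier ?B"
    using g x y sub_carrier[OF jJ] by auto
  have g1: "g \<noteq> One" using g by (auto simp: LL_iff)
  note r = gB[unfolded LL_iff, simplified g1 simp_thms]
  show "x = \<one>\<^bsub>?B\<^esub>"
  proof (rule ccontr)
    assume n: "x \<noteq> \<one>\<^bsub>?B\<^esub>"
    then have x1: "x \<noteq> One" by (simp add: LL_one)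
    have y1: "?y \<noteq> One"
    proof
      assume "?y = One"
      then have "g \<otimes>\<^bsub>?B\<^esub> ?y \<otimes>\<^bsub>?B\<^esub> inv\<^bsub>?B\<^esub> g = \<one>\<^bsub>?B\<^esub>" using gB LL_one[of "Suc j"] by (metis B.r_inv B.r_one)
      moreover have "g \<otimes>\<^bsub>?B\<^esub> ?y \<otimes>\<^bsub>?B\<^esub> inv\<^bsub>?B\<^esub> g = x" using gB xB by (simp add: B.m_assoc) (simp add: B.m_assoc[symmetric])
      ultimately show False using n by simp
    qed
    define m where "m = max (tg x) (tg ?y)"
    note m = LL_pair[OF x y x1 y1, folded m_def]
    have mJ: "e m v \<le> Suc j" using m(2) by simp
    show False
    proof (cases "tg g \<le> m")
      case True
      have gm: "g \<in> carrier (f m (Suc j))" using LL_member[OF gB g1 True m(1) mJ] .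
      have "g \<notin> carrier (f m j)" using g sub_carrier[OF fam_LL[OF m(1,2)]] by blast
      have s: "sub (f m j) (f m (Suc j))" using fam_sub[OF order_refl m(1) mJ mJ] by simp
      note sB = fam_LL[OF m(1) mJ]
      have xm: "x \<in> carrier (f m (Suc j))" using sub_carrier[OF s m(3)] .
      interpret M: group "f m (Suc j)" by (rule Sp_group[OF below[OF m(1)]])
      have "?y = inv\<^bsub>f m (Suc j)\<^esub> g \<otimes>\<^bsub>f m (Suc j)\<^esub> (x \<otimes>\<^bsub>f m (Suc j)\<^esub> g)"
        using sub_conj[OF sB gm xm] by simp
      then have c: "inv\<^bsub>f m (Suc j)\<^esub> g \<otimes>\<^bsub>f m (Suc j)\<^esub> (x \<otimes>\<^bsub>f m (Suc j)\<^esub> g) \<in> carrier (f m j)" using m(4) by simp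
      have "malnormal (carrier (f m j)) (f m (Suc j))" using below[OF m(1), of "Suc j"] unfolding Spec_def by blast
      then have "x = \<one>\<^bsub>f m (Suc j)\<^esub>" using m(3) gm \<open>g \<notin> carrier (f m j)\<close> c unfolding malnormal_def by blast
      then show False using x1 Sp_one[OF below[OF m(1)]] by simp
    next
      case False
      let ?r = "tg g"
      have mr: "m < ?r" using False by simp
      have rg: "?r < v" "e ?r v \<le> Suc j" "g \<in> carrier (f ?r (Suc j))" using r by auto
      note sB = fam_LL[OF rg(1,2)]
      have s: "sub (f m j) (f ?r (Suc j))" using fam_sub[OF less_imp_le[OF mr] rg(1) mJ rg(2)] by simp
      have xm: "x \<in> carrier (f ?r (Suc j))" and ym: "?y \<in> carrier (f ?r (Suc j))" using sub_carrier[OF s] m(3,4) by auto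
      interpret M: group "f ?r (Suc j)" by (rule Sp_group[OF below[OF rg(1)]])
      have "?y = inv\<^bsub>f ?r (Suc j)\<^esub> g \<otimes>\<^bsub>f ?r (Suc j)\<^esub> (x \<otimes>\<^bsub>f ?r (Suc j)\<^esub> g)"
        using sub_conj[OF sB rg(3) xm] by simp
      moreover have "?y \<in> Hs (f ?r (Suc j)) ?r" "x \<in> Hs (f ?r (Suc j)) ?r"
        using xm ym mr x1 y1 by (auto simp: Hs_def low_def m_def)
      moreover have "g \<notin> Hs (f ?r (Suc j)) ?r" using g1 by (simp add: Hs_def low_def)
      ultimately have "x = \<one>\<^bsub>f ?r (Suc j)\<^esub>"
        using Sp_low[OF below[OF rg(1), of "Suc j"]] rg(3) unfolding malnormal_def by (metis DiffI)
      then show False using x1 Sp_one[OF below[OF rg(1)]] by simp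
    qed
  qed
qed

end

context system_below
begin

text \<open>Let \<open>r\<close> be the largest index of \<open>h1\<close> and \<open>h2\<close>. If
  \<open>r\<close> exceeded the indices of \<open>a\<close> and \<open>a'\<close>, the equation
  would be a trivial alternating product of length 4 in the group at \<open>r\<close>: the
  \<open>h\<close> come from the previous stage, the \<open>a\<close> from below \<open>r\<close>.
  Hence \<open>h1\<close> and \<open>h2\<close> lie below the larger of the two indices and cannot
  change it.\<close>

lemma level_match:
  assumes B_def: "B = LL (Suc j)"
    and a: "a \<in> carrier B" "a \<noteq> One" "e (tg a) v = Suc j" and a': "a' \<in> carrier B" "a' \<noteq> One" "e (tg a') v = Suc j"
    and h: "h1 \<in> carrier (LL j)" "h2 \<in> carrier (LL j)" and eq: "h2 \<otimes>\<^bsub>B\<^esub> a = a' \<otimes>\<^bsub>B\<^esub> h1"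
  shows "tg a = tg a' \<and> low (tg a) h1 \<and> low (tg a) h2"
proof -
  interpret B: group B unfolding B_def by (rule LL_group)
  have hB: "h1 \<in> carrier B" "h2 \<in> carrier B" using h sub_carrier[OF LL_mono[of j "Suc j"]] by (auto simp: B_def)
  note c = hB a(1) a'(1)
  have e1: "h2 = a' \<otimes>\<^bsub>B\<^esub> h1 \<otimes>\<^bsub>B\<^esub> inv\<^bsub>B\<^esub> a" using eq c by (metis B.inv_solve_right' B.m_closed)
  have e2: "h1 = inv\<^bsub>B\<^esub> a' \<otimes>\<^bsub>B\<^esub> (h2 \<otimes>\<^bsub>B\<^esub> a)" using eq c by (metis B.inv_solve_left B.m_closed)
  have e3: "a' = h2 \<otimes>\<^bsub>B\<^esub> a \<otimes>\<^bsub>B\<^esub> inv\<^bsub>B\<^esub> h1" using eq c by (metis B.inv_solve_right B.m_closed)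
  have e4: "a = inv\<^bsub>B\<^esub> h2 \<otimes>\<^bsub>B\<^esub> (a' \<otimes>\<^bsub>B\<^esub> h1)" using eq c by (metis B.inv_solve_left B.m_closed)
  have lm: "low q (x \<otimes>\<^bsub>B\<^esub> y)" if "x \<in> carrier B" "y \<in> carrier B" "low q x" "low q y" for q x y
    using low_mult that unfolding B_def by blast
  have li: "low q (inv\<^bsub>B\<^esub> x)" if "x \<in> carrier B" "low q x" for q x using low_inv that unfolding B_def by blast
  have at: "tg a < v" "tg a' < v" using a a' unfolding B_def by (auto simp: LL_iff)
  have ht: "h = One \<or> tg h < v \<and> e (tg h) v \<le> j" if "h = h1 \<or> h = h2" for h using that h by (auto simp: LL_iff)
  define m where "m = max (tg a) (tg a')"
  have "low m h1 \<and> low m h2"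
  proof (rule ccontr)
    assume "\<not> (low m h1 \<and> low m h2)"
    then have "\<exists>h. (h = h1 \<or> h = h2) \<and> h \<noteq> One \<and> m \<le> tg h \<and> (h1 \<noteq> One --> tg h1 \<le> tg h) \<and> (h2 \<noteq> One --> tg h2 \<le> tg h)"
      unfolding low_def by (metis linear not_le order_trans)
    then obtain h where hh: "h = h1 \<or> h = h2" "h \<noteq> One" "m \<le> tg h" "h1 \<noteq> One ==> tg h1 \<le> tg h" "h2 \<noteq> One ==> tg h2 \<le> tg h"
      by blast
    let ?r = "tg h"
    have r: "?r < v" "e ?r v \<le> j" using ht[OF hh(1)] hh(2) by auto
    then have rJ: "e ?r v \<le> Suc j" by simp
    \<comment> \<open>The levels towards \<open>v\<close> differ: \<open>Suc j\<close> for
      \<open>a\<close> and \<open>a'\<close>, at most \<open>j\<close> for \<open>h\<close>.\<close>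
    have "tg a \<noteq> ?r" "tg a' \<noteq> ?r" using r(2) a(3) a'(3) by auto
    then have lt: "tg a < ?r" "tg a' < ?r" using hh(3) by (auto simp: m_def)
    let ?N = "f ?r (Suc j)" and ?K = "carrier (f ?r j)"
    note spN = below[OF r(1), of "Suc j"] and spK = below[OF r(1), of j]
    interpret N: group ?N by (rule Sp_group[OF spN])
    have NB: "sub ?N B" unfolding B_def by (rule fam_LL[OF r(1) rJ])
    have KN: "sub (f ?r j) ?N" using fam_sub[OF order_refl r(1) rJ rJ] by simp
    have oneK: "One \<in> ?K" using Sp_one[OF spK] group.is_monoid[OF Sp_group[OF spK]] monoid.one_closed by metis
    have hK: "h1 \<in> ?K" "h2 \<in> ?K" using LL_member[OF h(1) _ _ r] LL_member[OF h(2) _ _ r] hh(4,5) oneK by blast+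
    have hN: "h1 \<in> carrier ?N" "h2 \<in> carrier ?N" using sub_carrier[OF KN] hK by auto
    have aN: "a \<in> carrier ?N" "a' \<in> carrier ?N"
      using LL_member[OF a(1)[unfolded B_def] a(2) less_imp_le[OF lt(1)] r(1) rJ]
        LL_member[OF a'(1)[unfolded B_def] a'(2) less_imp_le[OF lt(2)] r(1) rJ] by auto
    have nK: "x \<notin> ?K" if "x \<noteq> One" "e (tg x) v = Suc j" for x
    proof
      assume x: "x \<in> ?K"
      have "e (tg x) v \<le> j"
        using e_mono[OF Sp_own(1)[OF spK x that(1)] less_imp_le[OF r(1)] Sp_own(2)[OF spK x that(1)] r(2)] .
      then show False using that(2) by simp
    qed
    have low: "low ?r a" "low ?r a'" using lt by (simp_all add: low_def)
    show False
    proof (cases "low ?r h1 \<or> low ?r h2")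
      case True
      then have "low ?r h1 \<and> low ?r h2"
        using e1 e2 lm li c low B.m_closed B.inv_closed by metis
      then show False using hh(1,2) by (auto simp: low_def)
    next
      case False
      let ?L = "Hs ?N ?r"
      have iN: "inv\<^bsub>?N\<^esub> h1 = inv\<^bsub>B\<^esub> h1" "inv\<^bsub>?N\<^esub> a' = inv\<^bsub>B\<^esub> a'" using sub_inv[OF NB] hN aN by auto
      have "inv\<^bsub>?N\<^esub> h1 \<in> ?K"
        using sub_inv[OF KN hK(1)] group.inv_closed[OF Sp_group[OF spK] hK(1)] by simp
      moreover have "\<not> low ?r (inv\<^bsub>?N\<^esub> h1)"
      proof
        assume "low ?r (inv\<^bsub>?N\<^esub> h1)"
        then have "low ?r (inv\<^bsub>B\<^esub> (inv\<^bsub>B\<^esub> h1))" unfolding iN using li[OF B.inv_closed[OF c(1)]] by simp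
        then show False using False c by simp
      qed
      ultimately have k2: "inv\<^bsub>?N\<^esub> h1 \<in> ?K - ?L" by (simp add: Hs_def)
      have k1: "h2 \<in> ?K - ?L" using hK False by (simp add: Hs_def)
      have l1: "a \<in> ?L - ?K" using aN low nK[OF a(2,3)] by (simp add: Hs_def)
      have "inv\<^bsub>?N\<^esub> a' \<notin> ?K"
      proof
        assume "inv\<^bsub>?N\<^esub> a' \<in> ?K"
        then have "inv\<^bsub>?N\<^esub> (inv\<^bsub>?N\<^esub> a') \<in> ?K"
          using sub_inv[OF KN, of "inv\<^bsub>?N\<^esub> a'"] group.inv_closed[OF Sp_group[OF spK], of "inv\<^bsub>?N\<^esub> a'"] by metis
        then show False using aN nK[OF a'(2,3)] by simp
      qed
      then have l2: "inv\<^bsub>?N\<^esub> a' \<in> ?L - ?K" using N.inv_closed[OF aN(2)] li[OF c(4) low(2)] iN by (simp add: Hs_def)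
      have "h2 \<otimes>\<^bsub>?N\<^esub> a = a' \<otimes>\<^bsub>?N\<^esub> h1" using eq sub_mult[OF NB] hN aN by simp
      then have "h2 \<otimes>\<^bsub>?N\<^esub> a \<otimes>\<^bsub>?N\<^esub> inv\<^bsub>?N\<^esub> h1 \<otimes>\<^bsub>?N\<^esub> inv\<^bsub>?N\<^esub> a' = a' \<otimes>\<^bsub>?N\<^esub> h1 \<otimes>\<^bsub>?N\<^esub> inv\<^bsub>?N\<^esub> h1 \<otimes>\<^bsub>?N\<^esub> inv\<^bsub>?N\<^esub> a'" by simp
      also have "\<dots> = \<one>\<^bsub>?N\<^esub>" using hN aN by (simp add: N.m_assoc)
      finally show False using spN k1 l1 k2 l2 unfolding Spec_def alternating_free_def by blast
    qed
  qed
  then have lowm: "low m h1" "low m h2" by auto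
  have "tg a = tg a'"
  proof (rule ccontr)
    assume "tg a \<noteq> tg a'"
    then consider "tg a < tg a'" | "tg a' < tg a" by fastforce
    then show False
    proof cases
      case 1
      then have "m = tg a'" "low m a" by (auto simp: m_def low_def)
      moreover have "low m (h2 \<otimes>\<^bsub>B\<^esub> a \<otimes>\<^bsub>B\<^esub> inv\<^bsub>B\<^esub> h1)" using lm li lowm \<open>low m a\<close> c by simp
      ultimately have "low (tg a') a'" using e3 by simp
      then show False using a'(2) by (simp add: low_def)
    next
      case 2
      then have "m = tg a" "low m a'" by (auto simp: m_def low_def)
      moreover have "low m (inv\<^bsub>B\<^esub> h2 \<otimes>\<^bsub>B\<^esub> (a' \<otimes>\<^bsub>B\<^esub> h1))" using lm li lowm \<open>low m a'\<close> c by simp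
      ultimately have "low (tg a) a" using e4 by simp
      then show False using a(2) by (simp add: low_def)
    qed
  qed
  then show ?thesis using lowm by (simp add: m_def)
qed

end

section \<open>One step of the recursion\<close>

locale system_step = system_below K pick e col \<phi> f v
  for K :: "'a::wellorder set" and pick e col \<phi> and f :: "'a => nat => 'a U monoid" and v +
  fixes j :: nat
  assumes here: "Sp f v j"
begin

abbreviation "A \<equiv> f v j"
abbreviation "B \<equiv> LL (Suc j)"
abbreviation "H \<equiv> carrier (LL j)"

lemma LA: "sub (LL j) A"
proof (rule dunion_sub[OF directed])
  fix C assume "C \<in> family f v j"
  then consider "C = triv" | w where "C = f w j" "w < v" "e w v \<le> j" unfolding family_def by blast
  then show "sub C A"
  proof cases
    case 1
    then show ?thesis using triv_sub[OF Sp_group[OF here] Sp_one[OF here]] by simp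
  next
    case 2
    then show ?thesis using Sp_sub(1)[OF here, of w j] by simp
  qed
qed

lemma LB: "sub (LL j) B"
  by (rule LL_mono) simp

lemma H_eq: "H = Hs A v"
proof
  show "H \<subseteq> Hs A v" using sub_carrier[OF LA] by (auto simp: Hs_def low_def LL_iff)
  show "Hs A v \<subseteq> H"
    using Sp_own(2)[OF here] Sp_own(4)[OF here _ _ Sp_own(3)[OF here] order_refl] by (auto simp: Hs_def low_def LL_iff)
qed

lemma H_inter: "carrier A \<inter> carrier B = H"
proof
  show "carrier A \<inter> carrier B \<subseteq> H" unfolding H_eq by (auto simp: Hs_def low_def LL_iff)
  show "H \<subseteq> carrier A \<inter> carrier B" using sub_carrier[OF LA] sub_carrier[OF LB] by blast
qed

lemma group_pair: "group_pair A B H"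
proof (rule group_pair.intro)
  show "group A" by (rule Sp_group[OF here])
  show "group B" by (rule LL_group)
qed (use sub_subgroup[OF LA] sub_subgroup[OF LB] H_inter sub_mult[OF LA] sub_mult[OF LB] Sp_one[OF here] LL_one in auto)

lemma double_cosets: "double_cosets pick A H"
  using choice_fun_axioms Sp_group[OF here] sub_subgroup[OF LA] Sp_low[OF here] H_eq
  by (simp add: double_cosets_def double_cosets_axioms_def)

lemma Qs_subgroup: "subgroup (Qs A v q) A"
proof -
  interpret A: group A by (rule Sp_group[OF here])
  have i: "inv\<^bsub>A\<^esub> x = inv\<^bsub>LL j\<^esub> x" if "x \<in> H" for x using sub_inv[OF LA that] by simp
  interpret L: group "LL j" by (rule LL_group)
  show ?thesis
  proof (rule A.subgroupI)
    show "Qs A v q \<subseteq> carrier A" using sub_carrier[OF LA] by (auto simp: Qs_def H_eq[symmetric])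
    have "One \<in> Qs A v q" using L.one_closed LL_one[of j] by (simp add: Qs_def H_eq[symmetric] low_def)
    then show "Qs A v q \<noteq> {}" by blast
    show "inv\<^bsub>A\<^esub> x \<in> Qs A v q" if "x \<in> Qs A v q" for x
      using that i low_inv L.inv_closed by (simp add: Qs_def H_eq[symmetric])
    show "x \<otimes>\<^bsub>A\<^esub> y \<in> Qs A v q" if "x \<in> Qs A v q" "y \<in> Qs A v q" for x y
      using that low_mult[of x j y q] sub_mult[OF LA, of x y] L.m_closed[of x y] by (simp add: Qs_def H_eq[symmetric])
  qed
qed

text \<open>The second letter is \<open>s b\<close> because \<open>b\<close> alone lies in
  \<open>H\<close>; the factor \<open>s\<close> moves it out of \<open>H\<close>.\<close>

definition R where "R = {(a, s, s \<otimes>\<^bsub>A\<^esub> b, target A v a s b) | a s b. a \<in> carrier B \<and> admissible A v j a s b}"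

definition new where "new l = New v (Suc j) (tuple l)"

lemma b_H:
  assumes "b \<in> carrier A" "b \<noteq> One" "tg b < v" shows "b \<in> H"
  using assms by (simp add: H_eq Hs_def low_def)

text \<open>The substantial point is the compatibility of values. \<open>level_match\<close> puts
  the multipliers below \<open>a\<close>; comparing the letters \<open>s b\<close> and
  \<open>s' b'\<close> shows that \<open>h2\<close> conjugates \<open>b\<close> to
  \<open>b'\<close>. As \<open>h2\<close> is below both, \<open>b\<close> and \<open>b'\<close> have
  the same index, so the same colour is prescribed, and equivariance of \<open>val\<close> does the
  rest.\<close>

lemma amalgam_data: "amalgam_data A B H R new"
proof (intro amalgam_data.intro group_pair amalgam_data_axioms.intro)
  interpret D: double_cosets pick A H by (rule double_cosets)
  interpret L: group "LL j" by (rule LL_group)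
  show "malnormal H A" by (rule D.mal_H)
  show "malnormal H B" by (rule LL_malnormal)
  show "inj new" by (rule injI) (auto simp: new_def dest: tuple_inj)
  have "new l \<notin> carrier A" for l using Sp_own(3)[OF here, of "new l"] by (auto simp: new_def)
  moreover have "new l \<notin> carrier B" for l by (simp add: LL_iff new_def)
  ultimately show "range new \<inter> (carrier A \<union> carrier B) = {}" by blast
  have Q: "subgroup (Qs A v q) A" "Qs A v q \<subseteq> H" for q using Qs_subgroup by (auto simp: Qs_def H_eq)
  have nH: "a \<notin> H" if "a \<noteq> One" "e (tg a) v = Suc j" for a using that by (auto simp: LL_iff)
  have sH: "s \<notin> H" if "s \<noteq> One" "tg s = v" for s using that by (auto simp: LL_iff)
  fix a s t g assume r: "(a, s, t, g) \<in> R"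
  then obtain b where b: "t = s \<otimes>\<^bsub>A\<^esub> b" "g = target A v a s b" "a \<in> carrier B" "admissible A v j a s b" unfolding R_def by blast
  then have ad: "a \<noteq> One" "tg a < tg b" "tg b < v" "e (tg a) v = Suc j" "s \<in> carrier A" "s \<noteq> One" "tg s = v"
    "b \<in> carrier A" "b \<noteq> One" "\<phi> (col (tg b) (tg a) v) \<in> H" by (auto simp: admissible_def H_eq)
  have bH: "b \<in> H" by (rule b_H[OF ad(8,9,3)])
  have tH: "t \<in> carrier A" "t \<notin> H"
  proof -
    show "t \<in> carrier A" using b ad by simp
    show "t \<notin> H"
    proof
      assume "t \<in> H"
      then have "t \<otimes>\<^bsub>A\<^esub> inv\<^bsub>A\<^esub> b \<in> H" using D.H_cl bH by blast
      then show False using sH[OF ad(6,7)] ad(5,8) by (simp add: b(1) D.m_assoc)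
    qed
  qed
  have "s \<noteq> t"
  proof
    assume "s = t"
    then have "b = \<one>\<^bsub>A\<^esub>" using b(1) ad(5,8) by (metis D.l_cancel_one)
    then show False using ad(9) Sp_one[OF here] by simp
  qed
  then show "a \<in> carrier B - H \<and> s \<in> carrier A - H \<and> t \<in> carrier A - H \<and> s \<noteq> t \<and> g \<in> H"
    using nH[OF ad(1,4)] sH[OF ad(6,7)] tH ad b(2,3) D.val_H[OF Q ad(5,10)] by (simp add: target_def H_eq[symmetric])
  fix a' s' t' g' h1 h2
  assume r': "(a', s', t', g') \<in> R" and h: "h1 \<in> H" "h2 \<in> H"
    and ea: "h2 \<otimes>\<^bsub>B\<^esub> a = a' \<otimes>\<^bsub>B\<^esub> h1" and es: "h1 \<otimes>\<^bsub>A\<^esub> s = s' \<otimes>\<^bsub>A\<^esub> h2" and et: "h1 \<otimes>\<^bsub>A\<^esub> t = t' \<otimes>\<^bsub>A\<^esub> h2"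
  obtain b' where b': "t' = s' \<otimes>\<^bsub>A\<^esub> b'" "g' = target A v a' s' b'" "a' \<in> carrier B" "admissible A v j a' s' b'"
    using r' unfolding R_def by blast
  then have ad': "a' \<noteq> One" "tg a' < tg b'" "tg b' < v" "e (tg a') v = Suc j" "s' \<in> carrier A" "b' \<in> carrier A" "b' \<noteq> One"
    by (auto simp: admissible_def)
  have b'H: "b' \<in> H" by (rule b_H[OF ad'(6,7,3)])
  have q: "tg a = tg a'" "low (tg a) h1" "low (tg a) h2"
    using level_match[OF refl b(3) ad(1,4) b'(3) ad'(1,4) h ea] by auto
  note hc = D.H_car[OF h(1)] D.H_car[OF h(2)]
  have s'_eq: "s' = h1 \<otimes>\<^bsub>A\<^esub> s \<otimes>\<^bsub>A\<^esub> inv\<^bsub>A\<^esub> h2" using es hc ad(5) ad'(5) by (metis D.inv_solve_right D.m_closed)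
  have "h1 \<otimes>\<^bsub>A\<^esub> s \<otimes>\<^bsub>A\<^esub> b = s' \<otimes>\<^bsub>A\<^esub> b' \<otimes>\<^bsub>A\<^esub> h2" using et hc ad ad' by (simp add: b(1) b'(1) D.m_assoc)
  then have "s' \<otimes>\<^bsub>A\<^esub> (h2 \<otimes>\<^bsub>A\<^esub> b) = s' \<otimes>\<^bsub>A\<^esub> (b' \<otimes>\<^bsub>A\<^esub> h2)" using es hc ad ad' by (simp add: D.m_assoc)
  then have eb: "h2 \<otimes>\<^bsub>A\<^esub> b = b' \<otimes>\<^bsub>A\<^esub> h2" using hc ad(8) ad'(5,6) by (metis D.Units_eq D.Units_l_cancel D.m_closed)
  have ebL: "h2 \<otimes>\<^bsub>LL j\<^esub> b = b' \<otimes>\<^bsub>LL j\<^esub> h2"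
    using eb sub_mult[OF LA h(2) bH] sub_mult[OF LA b'H h(2)] by simp
  have mono: "low q' x" if "low q x" "q \<le> q'" for q q' x using that by (auto simp: low_def)
  have "tg b = tg b'"
  proof (rule ccontr)
    assume "tg b \<noteq> tg b'"
    then consider "tg b < tg b'" | "tg b' < tg b" by fastforce
    then show False
    proof cases
      case 1
      have "b' = h2 \<otimes>\<^bsub>LL j\<^esub> b \<otimes>\<^bsub>LL j\<^esub> inv\<^bsub>LL j\<^esub> h2" using ebL h bH b'H by (metis L.inv_solve_right L.m_closed)
      moreover have "low (tg b') h2" using q(1,3) ad'(2) by (intro mono[OF q(3)]) simp
      moreover have "low (tg b') b" using 1 by (simp add: low_def)
      ultimately have "low (tg b') b'" using low_mult low_inv h bH L.inv_closed L.m_closed by metis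
      then show False using ad'(7) by (simp add: low_def)
    next
      case 2
      have "b = inv\<^bsub>LL j\<^esub> h2 \<otimes>\<^bsub>LL j\<^esub> (b' \<otimes>\<^bsub>LL j\<^esub> h2)" using ebL h bH b'H by (metis L.inv_solve_left L.m_closed)
      moreover have "low (tg b) h2" using ad(2) by (intro mono[OF q(3)]) simp
      moreover have "low (tg b) b'" using 2 by (simp add: low_def)
      ultimately have "low (tg b) b" using low_mult low_inv h b'H L.inv_closed L.m_closed by metis
      then show False using ad(9) by (simp add: low_def)
    qed
  qed
  moreover have "h1 \<in> Qs A v (tg a)" using h(1) q(2) by (simp add: Qs_def H_eq[symmetric])
  ultimately show "h1 \<otimes>\<^bsub>A\<^esub> g = g' \<otimes>\<^bsub>A\<^esub> h1"
    using D.val_conj[OF Q ad(5) sH[OF ad(6,7)] ad(10) _ D.H_cl(2)[OF h(2)]] q(1)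
    by (simp add: b(2) b'(2) target_def H_eq[symmetric] s'_eq)
qed

end

context system_step
begin

lemma step: "\<exists>M. Spec f v (Suc j) M"
proof -
  interpret am: amalgam_data A B H R new by (rule amalgam_data)
  define M where "M = am.M"
  have M: "group M" "\<one>\<^bsub>M\<^esub> = One" using am.M_group am.M_one_A Sp_one[OF here] by (auto simp: M_def)
  have AM: "sub A M" using Sp_group[OF here] M(1) am.M_A am.M_mult_A unfolding sub_def M_def by auto
  have BM: "sub B M" using LL_group M(1) am.M_B am.M_mult_B unfolding sub_def M_def by auto
  have car: "x \<in> carrier A \<or> x \<in> carrier B \<or> (\<exists>l. x = new l \<and> set l \<subseteq> carrier A \<union> carrier B)" if "x \<in> carrier M" for x
    using am.M_new that unfolding M_def by blast
  have setA: "set_U x \<subseteq> {..v}" if "x \<in> carrier A" for x using Sp_set[OF here that] .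
  have setB: "set_U x \<subseteq> {..v}" if "x \<in> carrier B" for x
  proof (cases "x = One")
    case False
    then have x: "tg x < v" "x \<in> carrier (f (tg x) (Suc j))" using that by (auto simp: LL_iff)
    then have "set_U x \<subseteq> {..tg x}" using Sp_set[OF below] by blast
    then show ?thesis using x(1) by auto
  qed simp
  have innB: "tg x < v \<and> e (tg x) v \<le> Suc j \<and> idx x \<le> Suc j" if "x \<in> carrier B" "x \<noteq> One" for x
    using that Sp_own(3)[OF below] unfolding LL_iff by blast
  have set: "inn v (Suc j) x \<and> set_U x \<subseteq> {..v}" if x: "x \<in> carrier M" for x
    using car[OF x]
  proof (elim disjE exE conjE)
    assume "x \<in> carrier A"
    then show ?thesis using Sp_inn[OF here, of x] setA[of x] by (auto simp: inn_def)
  next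
    assume "x \<in> carrier B"
    then show ?thesis using innB[of x] setB[of x] by (auto simp: inn_def)
  next
    fix l assume l: "x = new l" "set l \<subseteq> carrier A \<union> carrier B"
    then have "\<forall>y\<in>set l. set_U y \<subseteq> {..v}" using setA setB by blast
    then show ?thesis by (auto simp: l(1) new_def inn_def set_tuple e_refl)
  qed
  \<comment> \<open>Fresh names have index \<open>v\<close>, so no new element is below
    \<open>v\<close>.\<close>
  have lowM: "Hs M v = carrier B"
  proof
    show "Hs M v \<subseteq> carrier B"
    proof
      fix x assume x: "x \<in> Hs M v"
      then have "x \<in> carrier M" "low v x" by (auto simp: Hs_def)
      moreover have "\<not> low v (new l)" for l by (simp add: low_def new_def)
      ultimately have "x \<in> Hs A v \<or> x \<in> carrier B" using car[of x] by (auto simp: Hs_def)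
      then show "x \<in> carrier B" using sub_carrier[OF LB] H_eq by blast
    qed
    show "carrier B \<subseteq> Hs M v" using sub_carrier[OF BM] innB by (auto simp: Hs_def low_def)
  qed
  have low_own: "x \<in> carrier (f (tg x) n)" if x: "x \<in> carrier M" "x \<noteq> One" "tg x < v" "idx x \<le> n" "n \<le> Suc j" for x n
  proof -
    have "x \<in> carrier B" using x lowM by (auto simp: Hs_def low_def)
    then have "x \<in> carrier (f (tg x) (Suc j))" using x(2) by (simp add: LL_iff)
    then show ?thesis using Sp_own(4)[OF below[OF x(3)]] x by blast
  qed
  \<comment> \<open>Fresh names have index \<open>v\<close> and stage \<open>Suc j\<close>, so they
    violate the condition \<open>inn\<close> of every earlier group.\<close>
  have S2: "sub (f w n) M \<and> carrier (f w n) = {x \<in> carrier M. inn w n x}"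
    if bn: "w \<le> v" "n \<le> Suc j" "(w, n) \<noteq> (v, Suc j)" "e w v \<le> Suc j" for w n
  proof (cases "w = v")
    case True
    then have n: "n \<le> j" using bn by auto
    note s = Sp_sub[OF here order_refl n, unfolded e_refl, OF le0]
    have "sub (f v n) M" using sub_trans[OF s(1) AM] .
    moreover have "carrier (f v n) = {x \<in> carrier M. inn v n x}"
    proof
      show "carrier (f v n) \<subseteq> {x \<in> carrier M. inn v n x}" using s(2) sub_carrier[OF AM] by blast
      show "{x \<in> carrier M. inn v n x} \<subseteq> carrier (f v n)"
      proof
        fix x assume "x \<in> {x \<in> carrier M. inn v n x}"
        then have x: "x \<in> carrier M" "inn v n x" by auto
        have "x \<in> carrier A"
        proof (cases "x = One")
          case True
          then show ?thesis using Sp_one[OF here] group.is_monoid[OF Sp_group[OF here]] monoid.one_closed by metis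
        next
          case False
          then have i: "tg x \<le> v" "e (tg x) v \<le> n" "idx x \<le> n" using x(2) by (auto simp: inn_def)
          show ?thesis
          proof (cases "tg x < v")
            case True
            have "x \<in> carrier (f (tg x) j)" using low_own[OF x(1) False True _ le_SucI[OF order_refl]] i n by simp
            then show ?thesis using sub_carrier[OF Sp_sub(1)[OF here i(1) order_refl]] i(2) n by simp
          next
            case False
            then have "x \<notin> carrier B" using innB \<open>x \<noteq> One\<close> by blast
            moreover have "x \<noteq> new l" for l using i(3) n by (auto simp: new_def)
            ultimately show ?thesis using car[OF x(1)] by blast
          qed
        qed
        then show "x \<in> carrier (f v n)" using s(2) x(2) by blast
      qed
    qed
    ultimately show ?thesis using True by simp
  next
    case False
    then have b: "w < v" using bn(1) by simp
    have s1: "sub (f w n) (f w (Suc j))" using fam_sub[OF order_refl b bn(4,4,2)] .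
    have sM: "sub (f w n) M" using sub_trans[OF s1 sub_trans[OF fam_LL[OF b bn(4)] BM]] .
    moreover have "carrier (f w n) = {x \<in> carrier M. inn w n x}"
    proof
      show "carrier (f w n) \<subseteq> {x \<in> carrier M. inn w n x}" using sub_carrier[OF sM] Sp_inn[OF below[OF b]] by blast
      show "{x \<in> carrier M. inn w n x} \<subseteq> carrier (f w n)"
      proof
        fix x assume "x \<in> {x \<in> carrier M. inn w n x}"
        then have x: "x \<in> carrier M" "inn w n x" by auto
        show "x \<in> carrier (f w n)"
        proof (cases "x = One")
          case True
          then show ?thesis using Sp_one[OF below[OF b]] group.is_monoid[OF Sp_group[OF below[OF b]]] monoid.one_closed by metis
        next
          case False
          then have i: "tg x \<le> w" "e (tg x) w \<le> n" "idx x \<le> n" using x(2) by (auto simp: inn_def)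
          then have "tg x < v" using b by simp
          then have "x \<in> carrier (f (tg x) n)" using low_own[OF x(1) False _ i(3) bn(2)] by simp
          then show ?thesis using sub_carrier[OF Sp_sub(1)[OF below[OF b] i(1) order_refl i(2)]] by simp
        qed
      qed
    qed
    ultimately show ?thesis by simp
  qed
  have al: "alternating_free (carrier A) (Hs M v) M"
  proof -
    have d: "carrier A - carrier B = carrier A - H" "carrier B - carrier A = carrier B - H" using H_inter by auto
    show ?thesis unfolding alternating_free_def lowM d using am.M_alt4 by (simp add: M_def)
  qed
  have rl: "word M a s (s \<otimes>\<^bsub>A\<^esub> b) (nat period) = target A v a s b" if a: "a \<in> carrier M" and ad: "admissible A v j a s b" for a s b
  proof -
    have "tg a < v" using ad unfolding admissible_def by (meson order_less_trans)
    then have "a \<in> Hs M v" using a by (simp add: Hs_def low_def)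
    then have "a \<in> carrier B" using lowM by simp
    then have "(a, s, s \<otimes>\<^bsub>A\<^esub> b, target A v a s b) \<in> R" using ad unfolding R_def by blast
    then show ?thesis using am.M_word by (simp add: M_def)
  qed
  have "malnormal (Hs M v) M" "malnormal (carrier A) M" unfolding lowM using am.M_malnormal_A am.M_malnormal_B by (simp_all add: M_def)
  then have "Spec f v (Suc j) M"
    unfolding Spec_def using M set sub_carrier[OF AM Sp_Gen[OF here]] S2 al rl by blast
  then show ?thesis by blast
qed

end

section \<open>The recursion\<close>

context system
begin

text \<open>Levels of distinct indices are positive, so nothing from below has to be included at
  stage 0 and a group of order 2 will do.\<close>

lemma base: "\<exists>M. Spec f v 0 M"
proof -
  define M where "M = \<lparr>carrier = {One, Gen v}, mult = \<lambda>x y. if x = y then One else Gen v, one = One\<rparr>"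
  have g: "group M" by (rule groupI) (auto simp: M_def)
  have low: "Hs M v = {One}" by (auto simp: Hs_def low_def M_def)
  interpret group M by (rule g)
  have "malnormal (Hs M v) M" unfolding low malnormal_def by (simp add: M_def)
  moreover have "False" if "w \<le> v" "n \<le> 0" "(w, n) \<noteq> (v, 0)" "e w v \<le> 0" for w and n :: nat
  proof -
    have "n = 0" using that(2) by simp
    then have "w < v" using that by auto
    then show False using e_pos[of w v] that(4) by simp
  qed
  moreover have "\<one>\<^bsub>M\<^esub> = One" "Gen v \<in> carrier M" "\<forall>x\<in>carrier M. inn v 0 x \<and> set_U x \<subseteq> {..v}"
    by (auto simp: M_def inn_def e_refl)
  ultimately have "Spec f v 0 M" unfolding Spec_def using g by blast
  then show ?thesis by blast
qed

lemma Spec_cong: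
  assumes "\<And>w n. w < v \<or> w = v \<and> n < j ==> f w n = g w n" shows "Spec f v j M \<longleftrightarrow> Spec g v j M"
proof -
  have 1: "f w n = g w n" if "w \<le> v" "n \<le> j" "(w, n) \<noteq> (v, j)" for w n
    using assms[of w n] that by fastforce
  have 2: "f v i = g v i" if "j = Suc i" for i using assms[of v i] that by simp
  have "(\<forall>w n. w \<le> v --> n \<le> j --> (w, n) \<noteq> (v, j) --> e w v \<le> j -->
      sub (f w n) M \<and> carrier (f w n) = {x \<in> carrier M. inn w n x}) \<longleftrightarrow>
    (\<forall>w n. w \<le> v --> n \<le> j --> (w, n) \<noteq> (v, j) --> e w v \<le> j -->
      sub (g w n) M \<and> carrier (g w n) = {x \<in> carrier M. inn w n x})"
    using 1 by simp
  then show ?thesis unfolding Spec_def using 2 by simp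
qed

theorem ex_system: "\<exists>f. \<forall>v\<in>K. \<forall>j. Sp f v j"
proof -
  define r :: "(('a \<times> nat) \<times> 'a \<times> nat) set" where "r = {(x, y). x < y} <*lex*> {(x, y). x < y}"
  have r: "((w, n), (v, j)) \<in> r \<longleftrightarrow> w < v \<or> w = v \<and> n < j" for w v n j by (simp add: r_def)
  \<comment> \<open>Replacing all values that are not earlier by a default makes the requirement
    depend on earlier values only, as well-founded choice demands.\<close>
  define c where "c F v j w n = (if ((w, n), (v, j)) \<in> r then F (w, n) else undefined)"
    for F :: "'a \<times> nat => 'a U monoid" and v j w n
  define P where "P F x M \<longleftrightarrow> (fst x \<in> K --> Spec (c F (fst x) (snd x)) (fst x) (snd x) M)" for F x M
  have P: "P F (v, j) M \<longleftrightarrow> (v \<in> K --> Spec (curry F) v j M)" for F v j M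
    using Spec_cong[of v j "c F v j" "curry F" M] by (simp add: P_def c_def r)
  have "\<exists>F. \<forall>x. P F x (F x)"
  proof (rule dependent_wf_choice)
    show "wf r" unfolding r_def by (intro wf_lex_prod wf)
    show "P F x M = P F' x M" if "\<And>z. (z, x) \<in> r ==> F z = F' z" for F F' x M
    proof -
      have "c F (fst x) (snd x) = c F' (fst x) (snd x)" using that by (intro ext) (simp add: c_def)
      then show ?thesis by (simp add: P_def)
    qed
    show "\<exists>M. P F x M" if IH: "\<And>y. (y, x) \<in> r ==> P F y (F y)" for x F
    proof -
      obtain v j where x: "x = (v, j)" by (cases x)
      have sp: "Sp (curry F) w n" if "w \<in> K" "w < v \<or> w = v \<and> n < j" for w n
        using IH[of "(w, n)"] that by (simp add: x r P)
      have "\<exists>M. Spec (curry F) v j M" if v: "v \<in> K"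
      proof (cases j)
        case 0
        then show ?thesis using base by simp
      next
        case (Suc i)
        have "system_step K pick e col \<phi> (curry F) v i"
        proof (intro system_step.intro system_below.intro system_axioms system_below_axioms.intro system_step_axioms.intro)
          show "v \<in> K" by (rule v)
          show "Sp (curry F) w n" if "w < v" for w n using sp[of w n] that down[OF v] by simp
          show "Sp (curry F) v i" using sp[of v i] v Suc by simp
        qed
        then show ?thesis using system_step.step Suc by simp
      qed
      then show ?thesis by (simp add: x P)
    qed
  qed
  then obtain F where "\<And>v j. v \<in> K ==> Spec (curry F) v j (F (v, j))" using P by blast
  then show ?thesis by (intro exI[of _ "curry F"]) simp
qed

end

section \<open>Sets of full size\<close>

lemma sub_mult3:
  assumes "sub A B" "x \<in> carrier A" "y \<in> carrier A" "z \<in> carrier A"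
  shows "x \<otimes>\<^bsub>A\<^esub> y \<otimes>\<^bsub>A\<^esub> z = x \<otimes>\<^bsub>B\<^esub> y \<otimes>\<^bsub>B\<^esub> z"
proof -
  interpret A: group A by (rule sub_group[OF assms(1)])
  have "x \<otimes>\<^bsub>A\<^esub> y \<otimes>\<^bsub>A\<^esub> z = (x \<otimes>\<^bsub>A\<^esub> y) \<otimes>\<^bsub>B\<^esub> z" using assms by (intro sub_mult[OF assms(1)]) simp_all
  then show ?thesis using sub_mult[OF assms(1-3)] by simp
qed

primrec letters :: "'u => 'u => 'u => nat => 'u list" where
  "letters a s b 0 = []"
| "letters a s b (Suc n) = letters a s b n @ (if mark (int n) then [s, a] else [s, b, a])"

lemma set_letters: "set (letters a s b n) \<subseteq> {a, s, b}"
  by (induction n) auto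

context group
begin

lemma foldr_closed: "set xs \<subseteq> carrier G ==> foldr (\<otimes>) xs \<one> \<in> carrier G"
  by (induction xs) auto

lemma foldr_append_mult:
  "set xs \<subseteq> carrier G ==> set ys \<subseteq> carrier G ==> foldr (\<otimes>) (xs @ ys) \<one> = foldr (\<otimes>) xs \<one> \<otimes> foldr (\<otimes>) ys \<one>"
proof (induction xs)
  case (Cons x xs)
  then show ?case using foldr_closed[of xs] foldr_closed[of ys] by (simp add: m_assoc)
qed (simp add: foldr_closed)

lemma word_letters:
  assumes "a \<in> carrier G" "s \<in> carrier G" "b \<in> carrier G"
  shows "word G a s (s \<otimes> b) n = foldr (\<otimes>) (letters a s b n) \<one>"
proof (induction n)
  case (Suc n)
  have l: "set (letters a s b n) \<subseteq> carrier G" using set_letters[of a s b n] assms by blast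
  show ?case
  proof (cases "mark (int n)")
    case True
    then show ?thesis using Suc assms foldr_append_mult[OF l, of "[s, a]"] by simp
  next
    case False
    then show ?thesis using Suc assms foldr_append_mult[OF l, of "[s, b, a]"] by (simp add: m_assoc)
  qed
qed simp

end

context system_step
begin

lemma double_cosets_Hs: "double_cosets pick A (Hs A v)"
  using double_cosets H_eq by simp

end

section \<open>The union of all groups\<close>

locale full_system = system K pick e col \<phi> for K :: "'a::wellorder set" and pick e col \<phi> +
  fixes f :: "'a => nat => 'a U monoid"
  assumes Sp: "v \<in> K ==> Sp f v j"
    and pick_idx: "x \<in> S ==> idx (pick S) \<le> idx x"
    and pick_subset: "S \<subseteq> S' ==> pick S' \<in> S ==> pick S = pick S'"
    and \<phi>_onto: "x \<in> terms K ==> \<exists>\<tau>\<in>K. \<phi> \<tau> = x"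
    and colouring: "T \<subseteq> K ==> (\<And>x. x \<in> K ==> \<exists>y\<in>T. x < y) ==> \<epsilon> \<in> K ==> \<tau> \<in> K ==>
      \<exists>d\<in>K. \<forall>v\<in>K. d < v --> (\<exists>p\<in>T. \<exists>q\<in>T. \<epsilon> < q \<and> q < p \<and> p < d \<and>
        i < e p v \<and> e p v < e q v \<and> col p q v = \<tau>)"
begin

lemma step_at: "v \<in> K ==> system_step K pick e col \<phi> f v j"
  by (intro system_step.intro system_below.intro system_axioms system_below_axioms.intro system_step_axioms.intro Sp)
    (auto intro: down)

lemma cosets_at: "v \<in> K ==> double_cosets pick (f v j) (Hs (f v j) v)"
  using system_step.double_cosets_Hs[OF step_at] .

lemma up: "v \<in> K ==> i \<le> j ==> sub (f v i) (f v j)"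
  using Sp_sub(1)[OF Sp, of v v i j] by (simp add: e_refl)

definition \<G> where "\<G> = {f v n | v n. v \<in> K}"

definition \<Gamma> where "\<Gamma> = dunion \<G>"

lemma K_nonempty: "K \<noteq> {}"
  using uncountable card_of_empty1[of natLeq] natLeq_Well_order not_ordLess_ordLeq by blast

lemma directed_\<G>: "directed \<G>"
  unfolding directed_def
proof (intro conjI ballI)
  obtain v where "v \<in> K" using K_nonempty by blast
  then show "\<G> \<noteq> {}" by (auto simp: \<G>_def)
  fix A B assume "A \<in> \<G>" "B \<in> \<G>"
  then obtain \<alpha> n w m where AB: "A = f \<alpha> n" "\<alpha> \<in> K" "B = f w m" "w \<in> K" by (auto simp: \<G>_def)
  define N where "N = max (max n m) (max (e \<alpha> w) (e w \<alpha>))"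
  have N: "n \<le> N" "m \<le> N" "e \<alpha> w \<le> N" "e w \<alpha> \<le> N" by (auto simp: N_def)
  have "f v N \<in> \<G>" if "v \<in> K" for v using that by (auto simp: \<G>_def)
  moreover have "sub A (f w N) \<and> sub B (f w N)" if "\<alpha> \<le> w"
    using Sp_sub(1)[OF Sp[OF AB(4), of N] that N(1,3)] up[OF AB(4) N(2)] AB by simp
  moreover have "sub A (f \<alpha> N) \<and> sub B (f \<alpha> N)" if "w \<le> \<alpha>"
    using Sp_sub(1)[OF Sp[OF AB(2), of N] that N(2,4)] up[OF AB(2) N(1)] AB by simp
  ultimately show "\<exists>C\<in>\<G>. sub A C \<and> sub B C" using AB by (meson linear)
qed

lemma \<Gamma>_group: "group \<Gamma>"
  unfolding \<Gamma>_def by (rule dunion_group[OF directed_\<G>])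

lemma \<Gamma>_sub: "v \<in> K ==> sub (f v n) \<Gamma>"
  unfolding \<Gamma>_def by (rule sub_dunion[OF directed_\<G>]) (auto simp: \<G>_def)

lemma \<Gamma>_own:
  assumes "x \<in> carrier \<Gamma>" "x \<noteq> One"
  shows "tg x \<in> K" "idx x \<le> n ==> x \<in> carrier (f (tg x) n)"
proof -
  obtain v k where v: "v \<in> K" "x \<in> carrier (f v k)" using assms(1) by (auto simp: \<Gamma>_def dunion_carrier \<G>_def)
  note o = Sp_own[OF Sp[OF v(1)] v(2) assms(2)]
  show tg: "tg x \<in> K" using down[OF v(1) o(1)] .
  have "x \<in> carrier (f (tg x) (idx x))" using o(3,4) by simp
  then show "x \<in> carrier (f (tg x) n)" if "idx x \<le> n" using sub_carrier[OF up[OF tg that]] by blast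
qed

lemma One_f: "v \<in> K ==> One \<in> carrier (f v n)"
  using Sp_one[OF Sp] group.is_monoid[OF Sp_group[OF Sp]] monoid.one_closed by metis

lemma \<Gamma>_ev:
  assumes "v \<in> K" "x \<in> carrier \<Gamma>" "low v x" shows "\<exists>n. \<forall>m\<ge>n. x \<in> Hs (f v m) v"
proof (cases "x = One")
  case True
  then show ?thesis using One_f[OF assms(1)] by (auto simp: Hs_def low_def)
next
  case False
  then have t: "tg x < v" using assms(3) by (simp add: low_def)
  have "x \<in> Hs (f v m) v" if m: "max (idx x) (e (tg x) v) \<le> m" for m
  proof -
    have "x \<in> carrier (f (tg x) m)" using \<Gamma>_own(2)[OF assms(2) False] m by simp
    then have "x \<in> carrier (f v m)" using sub_carrier[OF Sp_sub(1)[OF Sp[OF assms(1)] less_imp_le[OF t] order_refl]] m by simp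
    then show ?thesis using assms(3) by (simp add: Hs_def)
  qed
  then show ?thesis by blast
qed

lemma \<Gamma>_terms: "x \<in> carrier \<Gamma> ==> low v x ==> x \<in> terms {..v}"
proof -
  assume x: "x \<in> carrier \<Gamma>" "low v x"
  show ?thesis
  proof (cases "x = One")
    case False
    then have "set_U x \<subseteq> {..tg x}" using Sp_set[OF Sp[OF \<Gamma>_own(1)] \<Gamma>_own(2)[OF _ _ order_refl]] x(1) by blast
    then show ?thesis using x(2) False by (auto simp: terms_def low_def)
  qed (simp add: terms_def)
qed

lemma \<Gamma>_terms': "carrier \<Gamma> \<subseteq> terms K"
proof
  fix x assume x: "x \<in> carrier \<Gamma>"
  show "x \<in> terms K"
  proof (cases "x = One")
    case False
    then have "set_U x \<subseteq> {..tg x}" using Sp_set[OF Sp[OF \<Gamma>_own(1)] \<Gamma>_own(2)[OF _ _ order_refl]] x by blast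
    then show ?thesis using \<Gamma>_own(1)[OF x False] down by (auto simp: terms_def)
  qed (simp add: terms_def)
qed

lemma small_terms: assumes "v \<in> K" shows "|terms {..v}| <o |K|"
proof -
  obtain d where d: "d \<in> K" "lim d" "v < d" using closure_point[of id v] assms by auto
  have "infinite {..d}"
  proof
    assume fin: "finite {..d}"
    have "{..<d} \<noteq> {}" using d(3) by blast
    moreover have "finite {..<d}" using fin by (rule rev_finite_subset) auto
    ultimately have "Max {..<d} \<in> {..<d}" "\<And>x. x < d ==> x \<le> Max {..<d}"
      using Max_in[of "{..<d}"] Max_ge[of "{..<d}"] by blast+
    then show False using d(2) unfolding lim_def accp_def by (metis UNIV_I lessThan_iff not_le)
  qed
  then have "|terms {..d}| \<le>o |{..d}|" by (rule card_terms)
  moreover have "terms {..v} \<subseteq> terms {..d}" using d(3) by (auto simp: terms_def)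
  ultimately have "|terms {..v}| \<le>o |{..d}|" using card_of_mono1 ordLeq_transitive by blast
  then show ?thesis using initial[OF d(1)] ordLeq_ordLess_trans by blast
qed

text \<open>Descend one stage at a time. Multipliers outside the previous stage would make
  \<open>s h2 (s')^-1 h1\<close> a trivial alternating product of length 4.\<close>

lemma nonmerge:
  assumes v: "v \<in> K" and ij: "i \<le> j" and s: "s \<in> carrier (f v i)" "\<not> low v s" and s': "s' \<in> carrier (f v i)" "\<not> low v s'"
  shows "h1 \<in> Hs (f v j) v ==> h2 \<in> Hs (f v j) v ==> s' = h1 \<otimes>\<^bsub>f v j\<^esub> s \<otimes>\<^bsub>f v j\<^esub> h2 ==>
    h1 \<in> carrier (f v i) \<and> h2 \<in> carrier (f v i)"
  using ij
proof (induction j rule: dec_induct)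
  case base
  then show ?case by (simp add: Hs_def)
next
  case (step j)
  let ?N = "f v (Suc j)" and ?K = "carrier (f v j)"
  interpret N: group ?N by (rule Sp_group[OF Sp[OF v]])
  interpret K: group "f v j" by (rule Sp_group[OF Sp[OF v]])
  have KN: "sub (f v j) ?N" by (rule up[OF v]) simp
  have sK: "s \<in> ?K" "s' \<in> ?K" using sub_carrier[OF up[OF v step(1)]] s s' by auto
  have c: "s \<in> carrier ?N" "s' \<in> carrier ?N" "h1 \<in> carrier ?N" "h2 \<in> carrier ?N"
    using sub_carrier[OF KN] sK step.prems by (auto simp: Hs_def)
  note eq = step.prems(3)
  have e1: "h1 = s' \<otimes>\<^bsub>?N\<^esub> inv\<^bsub>?N\<^esub> h2 \<otimes>\<^bsub>?N\<^esub> inv\<^bsub>?N\<^esub> s" using eq c by (simp add: N.m_assoc)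
  have e2: "h2 = inv\<^bsub>?N\<^esub> s \<otimes>\<^bsub>?N\<^esub> (inv\<^bsub>?N\<^esub> h1 \<otimes>\<^bsub>?N\<^esub> s')" using eq c by (simp add: N.m_assoc[symmetric])
  have Kc: "x \<otimes>\<^bsub>?N\<^esub> y \<in> ?K" if "x \<in> ?K" "y \<in> ?K" for x y using sub_mult[OF KN that] K.m_closed[OF that] by simp
  have Ki: "inv\<^bsub>?N\<^esub> x \<in> ?K" if "x \<in> ?K" for x using sub_inv[OF KN that] K.inv_closed[OF that] by simp
  have "h1 \<in> ?K"
  proof (rule ccontr)
    assume n1: "h1 \<notin> ?K"
    have n2: "h2 \<notin> ?K"
    proof
      assume "h2 \<in> ?K"
      then have "s' \<otimes>\<^bsub>?N\<^esub> inv\<^bsub>?N\<^esub> h2 \<otimes>\<^bsub>?N\<^esub> inv\<^bsub>?N\<^esub> s \<in> ?K" using Kc Ki sK by blast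
      then show False using n1 e1 by simp
    qed
    interpret D: double_cosets pick ?N "Hs ?N v" by (rule cosets_at[OF v])
    have "inv\<^bsub>?N\<^esub> s' \<notin> Hs ?N v"
    proof
      assume "inv\<^bsub>?N\<^esub> s' \<in> Hs ?N v"
      then have "inv\<^bsub>?N\<^esub> (inv\<^bsub>?N\<^esub> s') \<in> Hs ?N v" by (rule D.H_cl(2))
      then show False using c s'(2) by (simp add: Hs_def)
    qed
    then have k: "s \<in> ?K - Hs ?N v" "inv\<^bsub>?N\<^esub> s' \<in> ?K - Hs ?N v" using sK Ki s(2) by (auto simp: Hs_def)
    have l: "h1 \<in> Hs ?N v - ?K" "h2 \<in> Hs ?N v - ?K" using step.prems n1 n2 by auto
    have "s \<otimes>\<^bsub>?N\<^esub> h2 \<otimes>\<^bsub>?N\<^esub> inv\<^bsub>?N\<^esub> s' \<otimes>\<^bsub>?N\<^esub> h1 = inv\<^bsub>?N\<^esub> h1 \<otimes>\<^bsub>?N\<^esub> (h1 \<otimes>\<^bsub>?N\<^esub> s \<otimes>\<^bsub>?N\<^esub> h2) \<otimes>\<^bsub>?N\<^esub> inv\<^bsub>?N\<^esub> s' \<otimes>\<^bsub>?N\<^esub> h1"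
      using c by (simp add: N.m_assoc[symmetric])
    also have "\<dots> = \<one>\<^bsub>?N\<^esub>" unfolding eq[symmetric] using c by (simp add: N.m_assoc)
    finally have "s \<otimes>\<^bsub>?N\<^esub> h2 \<otimes>\<^bsub>?N\<^esub> inv\<^bsub>?N\<^esub> s' \<otimes>\<^bsub>?N\<^esub> h1 = \<one>\<^bsub>?N\<^esub>" .
    moreover have "alternating_free ?K (Hs ?N v) ?N" using Sp[OF v, of "Suc j"] unfolding Spec_def by blast
    ultimately show False using k l unfolding alternating_free_def by blast
  qed
  moreover have "h2 \<in> ?K" using e2 Kc Ki sK \<open>h1 \<in> ?K\<close> by metis
  ultimately have h: "h1 \<in> Hs (f v j) v" "h2 \<in> Hs (f v j) v" using step.prems by (auto simp: Hs_def)
  have "h1 \<otimes>\<^bsub>f v j\<^esub> s \<otimes>\<^bsub>f v j\<^esub> h2 = h1 \<otimes>\<^bsub>?N\<^esub> s \<otimes>\<^bsub>?N\<^esub> h2"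
    using sub_mult3[OF KN \<open>h1 \<in> ?K\<close> sK(1) \<open>h2 \<in> ?K\<close>] .
  then show ?case using step.IH[OF h] eq by simp
qed

text \<open>The representative chosen at the later stage has a stage no larger than that of
  \<open>s\<close>, so it is present earlier, and \<open>nonmerge\<close> keeps it in the earlier
  double coset. Both choices coincide, and the left coordinate is unique.\<close>

lemma left_stable:
  assumes v: "v \<in> K" and ij: "i \<le> j" and s: "s \<in> carrier (f v i)" "\<not> low v s"
  shows "left (f v j) (Hs (f v j) v) s = left (f v i) (Hs (f v i) v) s"
proof -
  let ?A = "f v i" and ?B = "f v j"
  let ?HA = "Hs ?A v" and ?HB = "Hs ?B v"
  interpret A: double_cosets pick ?A ?HA by (rule cosets_at[OF v])
  interpret B: double_cosets pick ?B ?HB by (rule cosets_at[OF v])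
  note AB = up[OF v ij]
  have sB: "s \<in> carrier ?B" "s \<notin> ?HB" using sub_carrier[OF AB s(1)] s(2) by (auto simp: Hs_def)
  have sA: "s \<notin> ?HA" using s(2) by (simp add: Hs_def)
  have HAB: "?HA \<subseteq> ?HB" using sub_carrier[OF AB] by (auto simp: Hs_def)
  have mult: "h1 \<otimes>\<^bsub>?A\<^esub> x \<otimes>\<^bsub>?A\<^esub> h2 = h1 \<otimes>\<^bsub>?B\<^esub> x \<otimes>\<^bsub>?B\<^esub> h2" if "h1 \<in> carrier ?A" "x \<in> carrier ?A" "h2 \<in> carrier ?A" for h1 x h2
    using sub_mult3[OF AB that] .
  define p where "p = pick (dcoset ?B ?HB s)"
  have pD: "p \<in> dcoset ?B ?HB s" unfolding p_def using B.dcoset_self[OF sB(1)] pick_in by blast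
  have pB: "p \<in> carrier ?B" "p \<notin> ?HB" using B.pick_dcoset[OF sB] by (auto simp: p_def)
  then have p: "\<not> low v p" by (auto simp: Hs_def)
  then have p1: "p \<noteq> One" by (auto simp: low_def)
  note op = Sp_own[OF Sp[OF v] pB(1) p1]
  have "tg p = v" using op(1) p by (auto simp: low_def)
  have s1: "s \<noteq> One" using s(2) by (auto simp: low_def)
  have "idx p \<le> idx s" unfolding p_def by (rule pick_idx[OF B.dcoset_self[OF sB(1)]])
  then have "idx p \<le> i" using Sp_own(3)[OF Sp[OF v] s(1) s1] by simp
  then have pA: "p \<in> carrier ?A" using op(4)[OF _ ij] \<open>tg p = v\<close> by simp
  obtain h1 h2 where h: "h1 \<in> ?HB" "h2 \<in> ?HB" "p = h1 \<otimes>\<^bsub>?B\<^esub> s \<otimes>\<^bsub>?B\<^esub> h2" using pD unfolding dcoset_def by blast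
  have hA: "h1 \<in> carrier ?A" "h2 \<in> carrier ?A" using nonmerge[OF v ij s pA p h] by auto
  then have "h1 \<in> ?HA" "h2 \<in> ?HA" using h by (auto simp: Hs_def)
  moreover have "p = h1 \<otimes>\<^bsub>?A\<^esub> s \<otimes>\<^bsub>?A\<^esub> h2" using h(3) mult[OF hA(1) s(1) hA(2)] by simp
  ultimately have pDA: "p \<in> dcoset ?A ?HA s" unfolding dcoset_def by blast
  have "dcoset ?A ?HA s \<subseteq> dcoset ?B ?HB s"
  proof
    fix y assume "y \<in> dcoset ?A ?HA s"
    then obtain h1 h2 where y: "h1 \<in> ?HA" "h2 \<in> ?HA" "y = h1 \<otimes>\<^bsub>?A\<^esub> s \<otimes>\<^bsub>?A\<^esub> h2" unfolding dcoset_def by blast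
    then have "y = h1 \<otimes>\<^bsub>?B\<^esub> s \<otimes>\<^bsub>?B\<^esub> h2" using mult[OF _ s(1)] A.H_car by simp
    then show "y \<in> dcoset ?B ?HB s" unfolding dcoset_def using y HAB by blast
  qed
  then have pp: "pick (dcoset ?A ?HA s) = p" using pick_subset pDA unfolding p_def by blast
  obtain w where w: "w \<in> ?HA" "s = left ?A ?HA s \<otimes>\<^bsub>?A\<^esub> p \<otimes>\<^bsub>?A\<^esub> w" using A.left(2)[OF s(1)] pp by auto
  have "left ?A ?HA s \<otimes>\<^bsub>?A\<^esub> p \<otimes>\<^bsub>?A\<^esub> w = left ?A ?HA s \<otimes>\<^bsub>?B\<^esub> p \<otimes>\<^bsub>?B\<^esub> w"
    using mult[OF _ pA] A.H_car[OF A.left(1)[OF s(1)]] A.H_car[OF w(1)] by simp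
  then have "s = left ?A ?HA s \<otimes>\<^bsub>?B\<^esub> p \<otimes>\<^bsub>?B\<^esub> w" using w(2) by simp
  then show ?thesis using B.left_unique[OF sB, of "left ?A ?HA s" w] HAB A.left(1)[OF s(1)] w(1) unfolding p_def by blast
qed

text \<open>An unbounded subset of \<open>K\<close> is not a countable union of bounded
  sets.\<close>

lemma unbounded_level:
  assumes T: "T \<subseteq> K" "\<And>x. x \<in> K ==> \<exists>y\<in>T. x < y"
  shows "\<exists>i::nat. \<forall>x\<in>K. \<exists>y\<in>{y \<in> T. g y \<le> i}. x < y"
proof (rule ccontr)
  assume "\<not> ?thesis"
  then have "\<forall>i. \<exists>x. x \<in> K \<and> (\<forall>y\<in>T. g y \<le> i --> \<not> x < y)" by blast
  then obtain b where b: "\<And>i. b i \<in> K" "\<And>i y. y \<in> T ==> g y \<le> i ==> \<not> b i < y" by metis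
  obtain c where c: "c \<in> K" "\<And>i. b i < c" using bounded_range[of b] b(1) by blast
  obtain y where y: "y \<in> T" "c < y" using T(2)[OF c(1)] by blast
  have "b (g y) < y" using c(2) y(2) by (rule order_less_trans)
  then show False using b(2)[OF y(1) order_refl] by simp
qed

definition below_set where "below_set \<xi> = {x \<in> carrier \<Gamma>. low \<xi> x}"

lemma below_bounded:
  assumes \<epsilon>: "\<epsilon> \<in> K" and D: "\<And>k (m::nat). D k m \<in> K" shows "\<exists>b\<in>K. \<forall>k\<in>below_set \<epsilon>. \<forall>m. D k m < b"
proof -
  have 1: "\<exists>b. b \<in> K \<and> (\<forall>k\<in>below_set \<epsilon>. D k m < b)" for m
  proof -
    have "below_set \<epsilon> \<subseteq> terms {..\<epsilon>}" using \<Gamma>_terms by (auto simp: below_set_def)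
    then have "|(\<lambda>k. D k m) ` below_set \<epsilon>| \<le>o |terms {..\<epsilon>}|" using card_of_image card_of_mono1 ordLeq_transitive by blast
    then have "|(\<lambda>k. D k m) ` below_set \<epsilon>| <o |K|" using small_terms[OF \<epsilon>] ordLeq_ordLess_trans by blast
    then show ?thesis using regular[of "(\<lambda>k. D k m) ` below_set \<epsilon>"] D by auto
  qed
  then obtain b where b: "\<And>m. b m \<in> K" "\<And>m k. k \<in> below_set \<epsilon> ==> D k m < b m" by metis
  obtain c where "c \<in> K" "\<And>m. b m < c" using bounded_range[of b] b(1) by blast
  then show ?thesis using b(2) order_less_trans by blast
qed

definition full_coset where "full_coset \<xi> u = {x \<otimes>\<^bsub>\<Gamma>\<^esub> u | x. x \<in> below_set \<xi>}"

lemma full_coset_mono: "\<xi> \<le> \<xi>' ==> full_coset \<xi> u \<subseteq> full_coset \<xi>' u"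
  unfolding full_coset_def below_set_def low_def by (force intro: order_less_le_trans)

definition conj_by where "conj_by k z = k \<otimes>\<^bsub>\<Gamma>\<^esub> z \<otimes>\<^bsub>\<Gamma>\<^esub> inv\<^bsub>\<Gamma>\<^esub> k"

text \<open>Pressing down. At a limit \<open>d\<close> closed under a function producing
  counterexamples, the element chosen from the coset of \<open>u v\<close> is \<open>k\<close> times
  \<open>u v\<close> with \<open>k\<close> below some \<open>\<epsilon> < d\<close>. The
  counterexample for \<open>\<epsilon>\<close> and \<open>k\<close> is below \<open>d\<close>; its
  smaller coset still contains the chosen element, which therefore remains the choice.\<close>

lemma stable_key:
  assumes T: "T \<subseteq> K" "\<And>x. x \<in> K ==> \<exists>y\<in>T. x < y" and z: "z \<in> carrier \<Gamma>"
  shows "\<exists>\<epsilon>\<in>K. \<exists>k\<in>below_set \<epsilon>. \<exists>m. \<forall>d\<in>K. \<epsilon> < d --> (\<exists>v\<in>T. d < v \<and> pick (full_coset d (u v)) = k \<otimes>\<^bsub>\<Gamma>\<^esub> u v \<and>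
    k \<in> carrier (f v m) \<and> conj_by k z \<in> Hs (f v m) v)"
proof (rule ccontr)
  assume contr: "\<not> ?thesis"
  define good where "good d k m v \<longleftrightarrow> pick (full_coset d (u v)) = k \<otimes>\<^bsub>\<Gamma>\<^esub> u v \<and>
    k \<in> carrier (f v m) \<and> conj_by k z \<in> Hs (f v m) v" for d k m v
  obtain \<omega> where \<omega>: "\<omega> \<in> K" using K_nonempty by blast
  have "\<exists>d. d \<in> K \<and> (\<epsilon> \<in> K \<and> k \<in> below_set \<epsilon> --> \<epsilon> < d \<and> (\<forall>v\<in>T. d < v --> \<not> good d k m v))" for \<epsilon> k m
    using contr \<omega> unfolding good_def by blast
  then obtain D where D: "\<And>\<epsilon> k m. D \<epsilon> k m \<in> K" "\<And>\<epsilon> k m. \<epsilon> \<in> K ==> k \<in> below_set \<epsilon> ==> \<epsilon> < D \<epsilon> k m"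
    "\<And>\<epsilon> k m v. \<epsilon> \<in> K ==> k \<in> below_set \<epsilon> ==> v \<in> T ==> D \<epsilon> k m < v ==> \<not> good (D \<epsilon> k m) k m v" by metis
  have "\<exists>F. \<forall>\<epsilon>\<in>K. F \<epsilon> \<in> K \<and> (\<forall>k\<in>below_set \<epsilon>. \<forall>m. D \<epsilon> k m < F \<epsilon>)"
    using below_bounded D(1) by (intro bchoice) blast
  then obtain F where F: "\<And>\<epsilon>. \<epsilon> \<in> K ==> F \<epsilon> \<in> K" "\<And>\<epsilon> k m. \<epsilon> \<in> K ==> k \<in> below_set \<epsilon> ==> D \<epsilon> k m < F \<epsilon>" by blast
  obtain d where d: "d \<in> K" "lim d" "\<And>y. y < d ==> F y < d" using closure_point[of F \<omega>] F(1) \<omega> by blast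
  have "\<exists>c\<in>K. low c z"
  proof (cases "z = One")
    case False
    then show ?thesis using no_max[OF \<Gamma>_own(1)[OF z False]] by (auto simp: low_def)
  qed (use \<omega> in \<open>auto simp: low_def\<close>)
  then obtain c where c: "c \<in> K" "low c z" by blast
  obtain v where v: "v \<in> T" "max d c < v" using T(2)[OF max_mem[OF d(1) c(1)]] by blast
  then have v': "v \<in> K" "d < v" "c < v" using T(1) by auto
  have "One \<in> below_set d" using sub_carrier[OF \<Gamma>_sub[OF \<omega>] One_f[OF \<omega>]] by (simp add: below_set_def low_def)
  then have "full_coset d (u v) \<noteq> {}" by (auto simp: full_coset_def)
  then have "pick (full_coset d (u v)) \<in> full_coset d (u v)" by (rule pick_in)
  then obtain k where k: "k \<in> below_set d" "pick (full_coset d (u v)) = k \<otimes>\<^bsub>\<Gamma>\<^esub> u v" unfolding full_coset_def by blast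
  have k\<Gamma>: "k \<in> carrier \<Gamma>" "low d k" using k(1) by (auto simp: below_set_def)
  \<comment> \<open>As \<open>d\<close> is a limit, an element below \<open>d\<close> is below some
    smaller \<open>\<epsilon>\<close>; this is the regressive step.\<close>
  have "\<exists>\<epsilon><d. low \<epsilon> k"
  proof (cases "k = One")
    case True
    then show ?thesis using d(2) unfolding lim_def accp_def low_def by blast
  next
    case False
    then show ?thesis using k\<Gamma>(2) d(2) unfolding lim_def accp_def low_def by blast
  qed
  then obtain \<epsilon> where \<epsilon>: "\<epsilon> < d" "low \<epsilon> k" by blast
  have \<epsilon>K: "\<epsilon> \<in> K" using down[OF d(1)] \<epsilon>(1) by simp
  have k\<epsilon>: "k \<in> below_set \<epsilon>" using k\<Gamma>(1) \<epsilon>(2) by (simp add: below_set_def)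
  have "low v k" "low v z" using k\<Gamma>(2) c(2) v'(2,3) by (auto simp: low_def)
  then obtain n1 n2 where n: "\<And>m. n1 \<le> m ==> k \<in> Hs (f v m) v" "\<And>m. n2 \<le> m ==> z \<in> Hs (f v m) v"
    using \<Gamma>_ev[OF v'(1) k\<Gamma>(1)] \<Gamma>_ev[OF v'(1) z] by blast
  define m where "m = max n1 n2"
  have km: "k \<in> Hs (f v m) v" "z \<in> Hs (f v m) v" using n by (auto simp: m_def)
  interpret D: double_cosets pick "f v m" "Hs (f v m) v" by (rule cosets_at[OF v'(1)])
  have kc: "k \<in> carrier (f v m)" "z \<in> carrier (f v m)" using km by (auto simp: Hs_def)
  have "conj_by k z = k \<otimes>\<^bsub>f v m\<^esub> z \<otimes>\<^bsub>f v m\<^esub> inv\<^bsub>f v m\<^esub> k"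
    using sub_mult3[OF \<Gamma>_sub[OF v'(1)] kc D.inv_closed[OF kc(1)]] sub_inv[OF \<Gamma>_sub[OF v'(1)] kc(1)] by (simp add: conj_by_def)
  then have cz: "conj_by k z \<in> Hs (f v m) v" using D.H_cl(1)[OF D.H_cl(1)[OF km] D.H_cl(2)[OF km(1)]] by simp
  let ?d = "D \<epsilon> k m"
  have "?d < d" using F(2)[OF \<epsilon>K k\<epsilon>] d(3)[OF \<epsilon>(1)] by (rule order_less_trans)
  have "k \<in> below_set ?d" using k\<epsilon> D(2)[OF \<epsilon>K k\<epsilon>, of m] by (auto simp: below_set_def low_def)
  then have "k \<otimes>\<^bsub>\<Gamma>\<^esub> u v \<in> full_coset ?d (u v)" by (auto simp: full_coset_def)
  then have "pick (full_coset ?d (u v)) = k \<otimes>\<^bsub>\<Gamma>\<^esub> u v"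
    using pick_subset[OF full_coset_mono[OF less_imp_le[OF \<open>?d < d\<close>]], of "u v"] k(2) by simp
  then have "good ?d k m v" using kc cz by (simp add: good_def)
  moreover have "?d < v" using \<open>?d < d\<close> v'(2) by (rule order_less_trans)
  ultimately show False using D(3)[OF \<epsilon>K k\<epsilon> v(1)] by blast
qed

text \<open>The colour is asked to name \<open>k z k^-1\<close>. For the index \<open>v\<close>
  supplied by \<open>stable_key\<close> the key of \<open>y v\<close> is the inverse of
  \<open>k\<close> for every \<open>q\<close> between \<open>\<epsilon>\<close> and
  \<open>d\<close>, so the prescribed value is \<open>z\<close> itself. The order of choices
  matters: \<open>k\<close> first, then the colour and \<open>d\<close>, then \<open>v\<close>, and
  finally \<open>p\<close> and \<open>q\<close>.\<close>

lemma hit: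
  assumes X: "X \<subseteq> carrier \<Gamma>" "\<And>x. x \<in> K ==> \<exists>y\<in>X. y \<noteq> One \<and> x < tg y" and z: "z \<in> carrier \<Gamma>"
  shows "\<exists>a\<in>X. \<exists>s\<in>X. \<exists>b\<in>X. word \<Gamma> a s (s \<otimes>\<^bsub>\<Gamma>\<^esub> b) (nat period) = z"
proof -
  define T0 where "T0 = {tg y | y. y \<in> X \<and> y \<noteq> One}"
  have T0: "T0 \<subseteq> K" using \<Gamma>_own(1) X(1) by (auto simp: T0_def)
  have T0u: "\<exists>y\<in>T0. x < y" if "x \<in> K" for x using X(2)[OF that] by (auto simp: T0_def)
  have "\<forall>v\<in>T0. \<exists>y. y \<in> X \<and> y \<noteq> One \<and> tg y = v" by (auto simp: T0_def)
  then obtain y where y: "\<And>v. v \<in> T0 ==> y v \<in> X" "\<And>v. v \<in> T0 ==> y v \<noteq> One" "\<And>v. v \<in> T0 ==> tg (y v) = v" by metis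
  obtain i where i: "\<And>x. x \<in> K ==> \<exists>v\<in>{v \<in> T0. idx (y v) \<le> i}. x < v"
    using unbounded_level[OF T0 T0u, of "\<lambda>v. idx (y v)"] by blast
  define T where "T = {v \<in> T0. idx (y v) \<le> i}"
  have T: "T \<subseteq> K" "\<And>x. x \<in> K ==> \<exists>y\<in>T. x < y" using T0 i by (auto simp: T_def)
  have yT: "y v \<in> X" "y v \<noteq> One" "tg (y v) = v" "y v \<in> carrier (f v i)" if "v \<in> T" for v
  proof -
    have t: "v \<in> T0" "idx (y v) \<le> i" using that by (auto simp: T_def)
    show 1: "y v \<in> X" "y v \<noteq> One" "tg (y v) = v" using y[OF t(1)] by auto
    show "y v \<in> carrier (f v i)" using \<Gamma>_own(2)[of "y v" i] 1 X(1) t(2) by auto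
  qed
  define u where "u v = left (f v i) (Hs (f v i) v) (y v)" for v
  obtain \<epsilon> k m where \<epsilon>: "\<epsilon> \<in> K" "k \<in> below_set \<epsilon>"
    "\<And>d. d \<in> K ==> \<epsilon> < d ==> \<exists>v\<in>T. d < v \<and> pick (full_coset d (u v)) = k \<otimes>\<^bsub>\<Gamma>\<^esub> u v \<and>
      k \<in> carrier (f v m) \<and> conj_by k z \<in> Hs (f v m) v"
    using stable_key[OF T z, of u] by blast
  interpret \<Gamma>: group \<Gamma> by (rule \<Gamma>_group)
  have k: "k \<in> carrier \<Gamma>" "low \<epsilon> k" using \<epsilon>(2) by (auto simp: below_set_def)
  have "conj_by k z \<in> carrier \<Gamma>" using k z by (simp add: conj_by_def)
  then obtain \<tau> where \<tau>: "\<tau> \<in> K" "\<phi> \<tau> = conj_by k z" using \<phi>_onto \<Gamma>_terms' by blast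
  obtain d where d: "d \<in> K" "\<And>v. v \<in> K ==> d < v ==> \<exists>p\<in>T. \<exists>q\<in>T. \<epsilon> < q \<and> q < p \<and> p < d \<and>
      max i m < e p v \<and> e p v < e q v \<and> col p q v = \<tau>"
    using colouring[OF T \<epsilon>(1) \<tau>(1), of "max i m"] by blast
  obtain v0 where "v0 \<in> K" "d < v0" using no_max[OF d(1)] by blast
  from d(2)[OF this] have "\<epsilon> < d" by (auto intro: order_less_trans)
  then obtain v where v: "v \<in> T" "d < v" "pick (full_coset d (u v)) = k \<otimes>\<^bsub>\<Gamma>\<^esub> u v"
      "k \<in> carrier (f v m)" "conj_by k z \<in> Hs (f v m) v" using \<epsilon>(3)[OF d(1)] by blast
  have vK: "v \<in> K" using T(1) v(1) by blast
  obtain p q where pq: "p \<in> T" "q \<in> T" "\<epsilon> < q" "q < p" "p < d" "max i m < e p v" "e p v < e q v" "col p q v = \<tau>"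
    using d(2)[OF vK v(2)] by blast
  have "0 < e q v" using pq(7) by simp
  \<comment> \<open>The level of \<open>q\<close> selects the stage. The inequalities between levels
    ensure that \<open>s\<close>, \<open>b\<close>, \<open>k\<close> and the named value are present
    at stage \<open>j\<close>, one stage before \<open>a\<close> enters.\<close>
  then obtain j where j: "e q v = Suc j" using gr0_implies_Suc by blast
  have jj: "i \<le> j" "m \<le> j" "e p v \<le> j" using pq(6,7) j by auto
  have pv: "p < v" using pq(5) v(2) by (rule order_less_trans)
  have qd: "q < d" using pq(4,5) by (rule order_less_trans)
  have qv: "q < v" using qd v(2) by (rule order_less_trans)
  have Kpq: "p \<in> K" "q \<in> K" using T(1) pq(1,2) by auto
  let ?A = "f v j" and ?M = "f v (Suc j)"
  let ?H = "Hs ?A v" and ?Q = "Qs ?A v q"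
  define a where "a = y q"
  define s where "s = y v"
  define b where "b = y p"
  note ya = yT[OF pq(2), folded a_def] and ys = yT[OF v(1), folded s_def] and yb = yT[OF pq(1), folded b_def]
  have aM: "a \<in> carrier ?M"
    using sub_carrier[OF Sp_sub(1)[OF Sp[OF vK] less_imp_le[OF qv], of i "Suc j"]] ya(4) jj(1) j by simp
  have sA: "s \<in> carrier ?A" using sub_carrier[OF up[OF vK jj(1)] ys(4)] .
  have bA: "b \<in> carrier ?A"
    using sub_carrier[OF Sp_sub(1)[OF Sp[OF vK] less_imp_le[OF pv], of i j]] yb(4) jj by simp
  have kA: "k \<in> carrier ?A" using sub_carrier[OF up[OF vK jj(2)] v(4)] .
  have zH: "conj_by k z \<in> ?H" using v(5) sub_carrier[OF up[OF vK jj(2)]] by (auto simp: Hs_def)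
  interpret D: double_cosets pick ?A ?H by (rule cosets_at[OF vK])
  have ad: "admissible ?A v j a s b"
    using ya ys yb pq(4,8) pv j sA bA zH \<tau>(2) by (simp add: admissible_def)
  have "word ?M a s (s \<otimes>\<^bsub>?A\<^esub> b) (nat period) = target ?A v a s b"
    using Sp[OF vK, of "Suc j"] aM ad unfolding Spec_def by blast
  moreover have "target ?A v a s b = val ?A ?H ?Q s (conj_by k z)"
    using ya(3) yb(3) pq(8) \<tau>(2) by (simp add: target_def)
  moreover have "val ?A ?H ?Q s (conj_by k z) = z"
  proof -
    have ns: "\<not> low v s" using ys by (simp add: low_def)
    have l: "left ?A ?H s = u v" using left_stable[OF vK jj(1) ys(4) ns] by (simp add: u_def s_def)
    have uA: "u v \<in> carrier ?A" using D.H_car[OF D.left(1)[OF sA]] l by simp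
    note A\<Gamma> = \<Gamma>_sub[OF vK, of j]
    \<comment> \<open>The coset occurring in \<open>key\<close> is a part of the full coset that
      still contains the chosen element, so the choice is the same.\<close>
    have "lcos ?A ?Q (u v) \<subseteq> full_coset d (u v)"
    proof
      fix w assume "w \<in> lcos ?A ?Q (u v)"
      then obtain x where x: "x \<in> ?Q" "w = x \<otimes>\<^bsub>?A\<^esub> u v" unfolding lcos_def by blast
      have xA: "x \<in> carrier ?A" "low q x" using x(1) by (auto simp: Qs_def Hs_def)
      then have "x \<in> below_set d" using sub_carrier[OF A\<Gamma>] qd by (auto simp: below_set_def low_def)
      then show "w \<in> full_coset d (u v)" unfolding full_coset_def using x(2) sub_mult[OF A\<Gamma> xA(1) uA] by auto
    qed
    moreover have "k \<otimes>\<^bsub>\<Gamma>\<^esub> u v \<in> lcos ?A ?Q (u v)"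
    proof -
      have "low q k" "low v k" using k(2) pq(3) qv by (auto simp: low_def)
      then have "k \<in> ?Q" using kA by (simp add: Qs_def Hs_def)
      then show ?thesis unfolding lcos_def sub_mult[OF A\<Gamma> kA uA, symmetric] by blast
    qed
    ultimately have "pick (lcos ?A ?Q (u v)) = k \<otimes>\<^bsub>\<Gamma>\<^esub> u v" using pick_subset v(3) by metis
    also have "\<dots> = k \<otimes>\<^bsub>?A\<^esub> u v" using sub_mult[OF A\<Gamma> kA uA] by simp
    finally have "key ?A ?H ?Q s = u v \<otimes>\<^bsub>?A\<^esub> inv\<^bsub>?A\<^esub> (k \<otimes>\<^bsub>?A\<^esub> u v)" unfolding key_def l by simp
    also have "\<dots> = inv\<^bsub>?A\<^esub> k" using kA uA by (simp add: D.inv_mult_group D.m_assoc[symmetric])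
    finally have key: "key ?A ?H ?Q s = inv\<^bsub>?A\<^esub> k" .
    have zA: "conj_by k z \<in> carrier ?A" by (rule D.H_car[OF zH])
    have "val ?A ?H ?Q s (conj_by k z) = inv\<^bsub>?A\<^esub> k \<otimes>\<^bsub>?A\<^esub> conj_by k z \<otimes>\<^bsub>?A\<^esub> k" unfolding val_def key using kA by simp
    also have "\<dots> = inv\<^bsub>\<Gamma>\<^esub> k \<otimes>\<^bsub>\<Gamma>\<^esub> conj_by k z \<otimes>\<^bsub>\<Gamma>\<^esub> k"
      using sub_mult3[OF A\<Gamma> D.inv_closed[OF kA] zA kA] sub_inv[OF A\<Gamma> kA] by simp
    also have "\<dots> = z" unfolding conj_by_def using k(1) z by (simp add: \<Gamma>.m_assoc) (simp add: \<Gamma>.m_assoc[symmetric])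
    finally show ?thesis .
  qed
  ultimately have w: "word ?M a s (s \<otimes>\<^bsub>?A\<^esub> b) (nat period) = z" by simp
  have AM: "sub ?A ?M" by (rule up[OF vK]) simp
  have "word ?M a s (s \<otimes>\<^bsub>?A\<^esub> b) (nat period) = word \<Gamma> a s (s \<otimes>\<^bsub>?A\<^esub> b) (nat period)"
    using sub_carrier[OF AM] sA bA aM by (intro word_sub[OF \<Gamma>_sub[OF vK]]) auto
  moreover have "s \<otimes>\<^bsub>?A\<^esub> b = s \<otimes>\<^bsub>\<Gamma>\<^esub> b" using sub_mult[OF \<Gamma>_sub[OF vK] sA bA] .
  ultimately show ?thesis using w ya(1) ys(1) yb(1) by auto
qed

end

context full_system
begin

lemma infinite_K: "infinite K"
proof
  assume "finite K"
  then have "|K| <o natLeq" by (simp add: finite_iff_ordLess_natLeq)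
  then show False using uncountable ordLess_transitive ordLess_irreflexive by blast
qed

lemma \<Gamma>_card: "|carrier \<Gamma>| =o |K|"
proof -
  have "|carrier \<Gamma>| \<le>o |terms K|" using \<Gamma>_terms' by (rule card_of_mono1)
  then have 1: "|carrier \<Gamma>| \<le>o |K|" using card_terms[OF infinite_K] ordLeq_transitive by blast
  have "Gen ` K \<subseteq> carrier \<Gamma>" using sub_carrier[OF \<Gamma>_sub] Sp_Gen[OF Sp] by blast
  then have "|K| \<le>o |carrier \<Gamma>|" using card_of_ordLeq[of K "carrier \<Gamma>"] by (metis U.inject(1) inj_onI)
  then show ?thesis using 1 ordIso_iff_ordLeq by blast
qed

text \<open>The number of factors depends only on the marks, so one \<open>n\<close> serves all
  elements. A set of full size has elements of arbitrarily large index, because fewer than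
  \<open>|K|\<close> terms lie below any given index.\<close>

theorem Shelah_\<Gamma>: "Shelah \<Gamma>"
proof -
  interpret group \<Gamma> by (rule \<Gamma>_group)
  define n where "n = length (letters () () () (nat period))"
  have len: "length (letters a s b (nat period)) = n" for a s b :: "'a U"
  proof -
    have "length (letters a s b k) = length (letters () () () k)" for k by (induction k) auto
    then show ?thesis by (simp add: n_def)
  qed
  obtain k where k: "nat period = Suc k" using period_pos by (cases "nat period") auto
  have "0 < n" unfolding n_def k by simp
  moreover have "power_set \<Gamma> X n = carrier \<Gamma>" if X: "full_size \<Gamma> X" for X
  proof
    have X\<Gamma>: "X \<subseteq> carrier \<Gamma>" "|X| =o |carrier \<Gamma>|" using X by (auto simp: full_size_def)
    show "power_set \<Gamma> X n \<subseteq> carrier \<Gamma>"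
    proof
      fix z assume "z \<in> power_set \<Gamma> X n"
      then obtain xs where "z = foldr (\<otimes>\<^bsub>\<Gamma>\<^esub>) xs \<one>\<^bsub>\<Gamma>\<^esub>" "set xs \<subseteq> X" unfolding power_set_def by blast
      then show "z \<in> carrier \<Gamma>" using foldr_closed[of xs] X\<Gamma>(1) by simp
    qed
    have unb: "\<exists>y\<in>X. y \<noteq> One \<and> x < tg y" if x: "x \<in> K" for x
    proof (rule ccontr)
      assume n: "\<not> ?thesis"
      obtain x' where x': "x' \<in> K" "x < x'" using no_max[OF x] by blast
      have "X \<subseteq> terms {..x'}"
      proof
        fix y assume y: "y \<in> X"
        then have "low x' y" using n x'(2) unfolding low_def by (meson not_le order_le_less_trans)
        then show "y \<in> terms {..x'}" using \<Gamma>_terms[of y x'] y X\<Gamma>(1) by blast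
      qed
      then have "|X| <o |K|" using card_of_mono1 small_terms[OF x'(1)] ordLeq_ordLess_trans by blast
      moreover have "|X| =o |K|" using X\<Gamma>(2) \<Gamma>_card by (rule ordIso_transitive)
      ultimately show False using not_ordLess_ordIso by blast
    qed
    show "carrier \<Gamma> \<subseteq> power_set \<Gamma> X n"
    proof
      fix z assume "z \<in> carrier \<Gamma>"
      then obtain a s b where w: "a \<in> X" "s \<in> X" "b \<in> X" "word \<Gamma> a s (s \<otimes>\<^bsub>\<Gamma>\<^esub> b) (nat period) = z"
        using hit[OF X\<Gamma>(1) unb] by blast
      then have "z = foldr (\<otimes>\<^bsub>\<Gamma>\<^esub>) (letters a s b (nat period)) \<one>\<^bsub>\<Gamma>\<^esub>"
        using word_letters[of a s b] X\<Gamma>(1) by auto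
      moreover have "set (letters a s b (nat period)) \<subseteq> X" using set_letters[of a s b] w by blast
      ultimately show "z \<in> power_set \<Gamma> X n" unfolding power_set_def using len by blast
    qed
  qed
  ultimately show ?thesis unfolding Shelah_def n_Shelah_def by blast
qed

end

section \<open>Transport between the given cardinal and a well-ordered type\<close>

lemma Shelah_transport:
  fixes G :: "'u monoid" and h :: "'u => 'v"
  assumes G: "group G" and S: "Shelah G" and h: "inj_on h (carrier G)"
  shows "group (image_group h G)" "Shelah (image_group h G)"
proof -
  interpret group G by (rule G)
  let ?G = "image_group h G"
  show g: "group ?G" using inj_imp_image_group_is_group[OF h] .
  interpret I: group ?G by (rule g)
  have one: "\<one>\<^bsub>?G\<^esub> = h \<one>\<^bsub>G\<^esub>" by (rule image_group_one)
  have mult: "h x \<otimes>\<^bsub>?G\<^esub> h y = h (x \<otimes>\<^bsub>G\<^esub> y)" if "x \<in> carrier G" "y \<in> carrier G" for x y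
    using that inv_into_f_f[OF h] by (simp add: image_group_def monoid.defs)
  have car: "carrier ?G = h ` carrier G" by (rule image_group_carrier)
  have fold: "set xs \<subseteq> carrier G ==> foldr (\<otimes>\<^bsub>G\<^esub>) xs \<one>\<^bsub>G\<^esub> \<in> carrier G \<and>
      foldr (\<otimes>\<^bsub>?G\<^esub>) (map h xs) \<one>\<^bsub>?G\<^esub> = h (foldr (\<otimes>\<^bsub>G\<^esub>) xs \<one>\<^bsub>G\<^esub>)" for xs
    by (induction xs) (auto simp: one mult)
  obtain n where n: "n > 0" "\<And>X. full_size G X ==> power_set G X n = carrier G"
    using S unfolding Shelah_def n_Shelah_def by blast
  have "power_set ?G Y n = carrier ?G" if Y: "full_size ?G Y" for Y
  proof
    have Y': "Y \<subseteq> h ` carrier G" "|Y| =o |h ` carrier G|" using Y by (auto simp: full_size_def car)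
    define X where "X = {x \<in> carrier G. h x \<in> Y}"
    have hX: "h ` X = Y" using Y'(1) by (auto simp: X_def)
    have "inj_on h X" by (rule inj_on_subset[OF h]) (auto simp: X_def)
    then have "bij_betw h X Y" using hX by (simp add: bij_betw_def)
    then have 1: "|X| =o |Y|" using card_of_ordIso by blast
    have "bij_betw h (carrier G) (h ` carrier G)" using h by (simp add: bij_betw_def)
    then have 2: "|carrier G| =o |h ` carrier G|" using card_of_ordIso by blast
    have "|X| =o |carrier G|" by (rule ordIso_transitive[OF ordIso_transitive[OF 1 Y'(2)] ordIso_symmetric[OF 2]])
    then have X: "full_size G X" by (auto simp: full_size_def X_def)
    show "power_set ?G Y n \<subseteq> carrier ?G"
    proof
      fix z assume "z \<in> power_set ?G Y n"
      then obtain ys where "z = foldr (\<otimes>\<^bsub>?G\<^esub>) ys \<one>\<^bsub>?G\<^esub>" "set ys \<subseteq> Y" unfolding power_set_def by blast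
      then show "z \<in> carrier ?G" using I.foldr_closed[of ys] Y'(1) car by blast
    qed
    show "carrier ?G \<subseteq> power_set ?G Y n"
    proof
      fix z assume "z \<in> carrier ?G"
      then obtain x where x: "x \<in> carrier G" "z = h x" using car by blast
      then have "x \<in> power_set G X n" using n(2)[OF X] by simp
      then obtain xs where xs: "x = foldr (\<otimes>\<^bsub>G\<^esub>) xs \<one>\<^bsub>G\<^esub>" "set xs \<subseteq> X" "length xs = n" unfolding power_set_def by blast
      have "set xs \<subseteq> carrier G" using xs(2) by (auto simp: X_def)
      then have "z = foldr (\<otimes>\<^bsub>?G\<^esub>) (map h xs) \<one>\<^bsub>?G\<^esub>" using fold x(2) xs(1) by simp
      moreover have "set (map h xs) \<subseteq> Y" using xs(2) hX by auto
      ultimately show "z \<in> power_set ?G Y n" unfolding power_set_def using xs(3) by (metis (mono_tags, lifting) length_map mem_Collect_eq)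
    qed
  qed
  then show "Shelah ?G" using n(1) unfolding Shelah_def n_Shelah_def by blast
qed

theorem (in coherent_seq) ex_Shelah:
  "\<exists>G :: 'a U monoid. group G \<and> |carrier G| =o |K| \<and> Shelah G"
proof -
  obtain C' hh \<theta> \<pi> where "walks K C' hh \<theta> \<pi>" using ex_walks by blast
  then interpret w: walks K C' hh \<theta> \<pi> .
  obtain pick :: "'a U set => 'a U" where pick: "\<And>S. S \<noteq> {} ==> pick S \<in> S"
    "\<And>S x. x \<in> S ==> idx (pick S) \<le> idx x" "\<And>S S'. S \<subseteq> S' ==> pick S' \<in> S ==> pick S = pick S'"
    using ex_pick[where 'a = 'a] by (metis empty_iff)
  have inf: "infinite K"
  proof
    assume "finite K"
    then have "|K| <o natLeq" by (simp add: finite_iff_ordLess_natLeq)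
    then show False using uncountable ordLess_transitive ordLess_irreflexive by blast
  qed
  have "terms K \<noteq> {}" by (auto simp: terms_def intro: exI[of _ One])
  then obtain \<phi> where \<phi>: "\<phi> ` K = terms K" using card_of_ordLeq2[of "terms K" K] card_terms[OF inf] by blast
  \<comment> \<open>Shifting by one makes the level of distinct indices positive, as stage 0 of the
    recursion requires.\<close>
  define e where "e a b = (if a = b then 0 else Suc (w.lev a b))" for a b
  have s: "system K pick e"
  proof (intro system.intro segment_axioms choice_fun.intro system_axioms.intro)
    show "pick S \<in> S" if "S \<noteq> {}" for S using pick(1) that .
    show "e a a = 0" for a by (simp add: e_def)
    show "0 < e a b" if "a < b" for a b using that by (simp add: e_def)
    fix a b c assume abc: "c \<in> K" "a \<le> b" "b \<le> c"
    show "e a c \<le> max (e a b) (e b c)" "e a b \<le> max (e a c) (e b c)"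
      using w.lev_triangle[OF abc] abc by (auto simp: e_def)
  qed
  then obtain f where f: "\<And>v j. v \<in> K ==> system.Spec pick e w.col \<phi> f v j (f v j)"
    using system.ex_system[OF s, of w.col \<phi>] by blast
  have "full_system K pick e w.col \<phi> f"
  proof (intro full_system.intro s full_system_axioms.intro f)
    show "idx (pick S) \<le> idx x" if "x \<in> S" for x S using pick(2) that .
    show "pick S = pick S'" if "S \<subseteq> S'" "pick S' \<in> S" for S S' using pick(3) that .
    show "\<exists>\<tau>\<in>K. \<phi> \<tau> = x" if "x \<in> terms K" for x using that unfolding \<phi>[symmetric] by auto
    fix T \<epsilon> \<tau> i assume T: "T \<subseteq> K" "\<And>x. x \<in> K ==> \<exists>y\<in>T. x < y" and \<epsilon>: "\<epsilon> \<in> K" "\<tau> \<in> K"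
    have "w.unbounded T" using T by (simp add: w.unbounded_def)
    then obtain d where d: "d \<in> K" "\<And>v. v \<in> K ==> d < v ==> \<exists>p\<in>T. \<exists>q\<in>T. \<epsilon> < q \<and> q < p \<and> p < d \<and>
      i < w.lev p v \<and> w.lev p v < w.lev q v \<and> w.col p q v = \<tau>"
      using w.colouring[of T \<epsilon> \<tau> i] \<epsilon> by blast
    have "\<exists>p\<in>T. \<exists>q\<in>T. \<epsilon> < q \<and> q < p \<and> p < d \<and> i < e p v \<and> e p v < e q v \<and> w.col p q v = \<tau>"
      if v: "v \<in> K" "d < v" for v
    proof -
      obtain p q where pq: "p \<in> T" "q \<in> T" "\<epsilon> < q" "q < p" "p < d" "i < w.lev p v" "w.lev p v < w.lev q v" "w.col p q v = \<tau>"
        using d(2)[OF v] by blast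
      have "p < v" using pq(5) v(2) by (rule order_less_trans)
      moreover have "q < v" using pq(4) \<open>p < v\<close> by (rule order_less_trans)
      ultimately have "e p v = Suc (w.lev p v)" "e q v = Suc (w.lev q v)" by (auto simp: e_def)
      then have "i < e p v" "e p v < e q v" using pq(6,7) by auto
      then show ?thesis using pq by blast
    qed
    then show "\<exists>d\<in>K. \<forall>v\<in>K. d < v --> (\<exists>p\<in>T. \<exists>q\<in>T. \<epsilon> < q \<and> q < p \<and> p < d \<and> i < e p v \<and> e p v < e q v \<and> w.col p q v = \<tau>)"
      using d(1) by blast
  qed
  then interpret F: full_system K pick e w.col \<phi> f .
  show ?thesis using F.\<Gamma>_group F.\<Gamma>_card F.Shelah_\<Gamma> by blast
qed

text \<open>\<open>lower\<close> makes the image an initial segment, so the ordinals below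
  \<open>r\<close> become elements of a well-ordered type with the same predecessors.\<close>

locale initial_embedding =
  fixes r :: "'a rel" and F :: "'a => 'b::wellorder"
  assumes card: "Card_order r" and inj: "inj_on F (Field r)"
    and lower: "a \<in> Field r ==> {..F a} = F ` under r a"
begin

lemma wo: "wo_rel r"
  using card by (simp add: wo_rel_def card_order_on_well_order_on)

definition K where "K = F ` Field r"

lemma le_iff: assumes "a \<in> Field r" "b \<in> Field r" shows "F a \<le> F b \<longleftrightarrow> (a, b) \<in> r"
proof -
  have "F a \<le> F b \<longleftrightarrow> F a \<in> F ` under r b" using lower[OF assms(2)] by auto
  also have "\<dots> \<longleftrightarrow> a \<in> under r b" by (rule inj_on_image_mem_iff[OF inj assms(1) under_Field])
  finally show ?thesis by (simp add: under_def)
qed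

lemma less_iff: assumes "a \<in> Field r" "b \<in> Field r" shows "F a < F b \<longleftrightarrow> a \<in> underS r b"
proof -
  have "F a = F b \<longleftrightarrow> a = b" using inj_onD[OF inj _ assms] by blast
  then show ?thesis using le_iff[OF assms] by (auto simp: less_le underS_def)
qed

lemma below: assumes "a \<in> Field r" "y \<le> F a" obtains b where "b \<in> Field r" "y = F b"
proof -
  have "y \<in> F ` under r a" using lower[OF assms(1)] assms(2) by blast
  then show thesis using that under_Field[of r a] by blast
qed

lemma underS_in: "x \<in> underS r a ==> x \<in> Field r"
  unfolding underS_def Field_def by blast

lemma supr_iff:
  assumes a: "a \<in> Field r" and S: "S \<subseteq> underS r a"
  shows "wo_rel.supr r S = a \<longleftrightarrow> (\<forall>x\<in>underS r a. \<exists>y\<in>S. x \<in> underS r y)"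
proof -
  have ab: "Above r S \<subseteq> Field r" "a \<in> Above r S" using a S by (auto simp: Above_def underS_def)
  have tot: "x \<in> underS r y \<or> (y, x) \<in> r" if "x \<in> Field r" "y \<in> Field r" for x y
    using wo_rel.TOTALS[OF wo] that unfolding underS_def by (metis (mono_tags, lifting) wo_rel.REFL[OF wo] mem_Collect_eq refl_onD)
  have anti: False if "x \<in> underS r y" "(y, x) \<in> r" for x y
    using that wo_rel.ANTISYM[OF wo] unfolding underS_def antisym_def by blast
  show ?thesis
  proof
    assume s: "wo_rel.supr r S = a"
    show "\<forall>x\<in>underS r a. \<exists>y\<in>S. x \<in> underS r y"
    proof (rule ballI, rule ccontr)
      fix x assume x: "x \<in> underS r a" and n: "\<not> (\<exists>y\<in>S. x \<in> underS r y)"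
      have xF: "x \<in> Field r" by (rule underS_in[OF x])
      have "(y, x) \<in> r" if "y \<in> S" for y
        using tot[OF xF, of y] n that S underS_in by blast
      then have x': "x \<in> Above r S" using xF by (simp add: Above_def)
      have "(a, x) \<in> r" using wo_rel.minim_least[OF wo ab(1) x'] unfolding wo_rel.supr_def[OF wo, symmetric] s .
      then show False using anti[OF x] by blast
    qed
  next
    assume r: "\<forall>x\<in>underS r a. \<exists>y\<in>S. x \<in> underS r y"
    have "a = wo_rel.minim r (Above r S)"
    proof (rule wo_rel.equals_minim[OF wo ab])
      fix b assume b: "b \<in> Above r S"
      then have bF: "b \<in> Field r" by (simp add: Above_def)
      show "(a, b) \<in> r"
      proof (rule ccontr)
        assume "(a, b) \<notin> r"
        then have "b \<in> underS r a" using tot[OF bF a] by blast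
        then obtain y where "y \<in> S" "b \<in> underS r y" using r by blast
        then show False using anti[of b y] b by (auto simp: Above_def)
      qed
    qed
    then show "wo_rel.supr r S = a" unfolding wo_rel.supr_def[OF wo] by (rule sym)
  qed
qed

lemma ex_less: "a \<in> Field r ==> (\<exists>x. x < F a) \<longleftrightarrow> underS r a \<noteq> {}"
proof
  assume a: "a \<in> Field r"
  show "underS r a \<noteq> {}" if "\<exists>x. x < F a"
  proof -
    obtain x where x: "x < F a" using \<open>\<exists>x. x < F a\<close> by blast
    then obtain b where "b \<in> Field r" "x = F b" using below[OF a less_imp_le] by metis
    then show ?thesis using less_iff[OF _ a] x by blast
  qed
  show "\<exists>x. x < F a" if "underS r a \<noteq> {}" using less_iff[OF underS_in a] that by blast
qed

lemma accp_iff: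
  assumes a: "a \<in> Field r" and D: "D \<subseteq> Field r" shows "accp (F ` D) (F a) \<longleftrightarrow> accumulates r D a"
proof -
  have "(\<forall>x<F a. \<exists>y\<in>F ` D. x < y \<and> y < F a) \<longleftrightarrow> (\<forall>x\<in>underS r a. \<exists>y\<in>D \<inter> underS r a. x \<in> underS r y)" (is "?l \<longleftrightarrow> ?r")
  proof
    assume l: ?l
    show ?r
    proof
      fix x assume x: "x \<in> underS r a"
      have xF: "x \<in> Field r" by (rule underS_in[OF x])
      obtain y where y: "y \<in> D" "F x < F y" "F y < F a" using l x less_iff[OF xF a] by auto
      then show "\<exists>y\<in>D \<inter> underS r a. x \<in> underS r y"
        using less_iff[OF xF, of y] less_iff[OF _ a, of y] D by auto
    qed
  next
    assume r: ?r
    show ?l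
    proof (intro allI impI)
      fix x assume x: "x < F a"
      then obtain b where b: "b \<in> Field r" "x = F b" using below[OF a less_imp_le] by metis
      then have "b \<in> underS r a" using x less_iff[OF b(1) a] by simp
      then obtain y where y: "y \<in> D" "y \<in> underS r a" "b \<in> underS r y" using r by auto
      then show "\<exists>y\<in>F ` D. x < y \<and> y < F a"
        using less_iff[OF b(1), of y] less_iff[OF _ a, of y] D b(2) by blast
    qed
  qed
  moreover have "wo_rel.supr r (D \<inter> underS r a) = a \<longleftrightarrow> ?r" by (rule supr_iff[OF a]) blast
  ultimately show ?thesis using ex_less[OF a] unfolding accp_def accumulates_def by blast
qed

lemma lim_iff: assumes a: "a \<in> Field r" shows "lim (F a) \<longleftrightarrow> nonzero_limit r a"
proof -
  have "accp UNIV (F a) \<longleftrightarrow> accp (F ` Field r) (F a)"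
    unfolding accp_def using below[OF a less_imp_le] by (metis UNIV_I imageI)
  moreover have "Field r \<inter> underS r a = underS r a" using underS_in by blast
  ultimately show ?thesis using accp_iff[OF a order_refl] a by (simp add: lim_def accumulates_def nonzero_limit_def)
qed

end

lemma (in initial_embedding) coherent_seq:
  assumes big: "natLeq <o r" and reg: "regularCard r" and sq: "square r"
  shows "\<exists>C. coherent_seq K C"
proof -
  have inf: "infinite (Field r)"
  proof
    assume "finite (Field r)"
    then have "|Field r| <o natLeq" by (simp add: finite_iff_ordLess_natLeq)
    then have "r <o natLeq" using card_of_Field_ordIso[OF card] ordIso_ordLess_trans ordIso_symmetric by blast
    then show False using big ordLess_transitive ordLess_irreflexive by blast
  qed
  have "bij_betw F (Field r) K" using inj by (simp add: bij_betw_def K_def)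
  then have "|Field r| =o |K|" using card_of_ordIso by blast
  then have rK: "r =o |K|" using card_of_Field_ordIso[OF card] ordIso_symmetric ordIso_transitive by blast
  have seg: "segment K"
  proof
    show "y \<in> K" if x: "x \<in> K" "y \<le> x" for x y
    proof -
      obtain a where "a \<in> Field r" "x = F a" using x(1) unfolding K_def by blast
      then obtain b where "b \<in> Field r" "y = F b" using below[of a y] x(2) by blast
      then show ?thesis unfolding K_def by blast
    qed
    show "natLeq <o |K|" using big rK by (rule ordLess_ordIso_trans)
    show "|{..y}| <o |K|" if "y \<in> K" for y
    proof -
      obtain a where a: "a \<in> Field r" "y = F a" using \<open>y \<in> K\<close> by (auto simp: K_def)
      obtain b where b: "b \<in> Field r" "a \<noteq> b" "(a, b) \<in> r" using infinite_Card_order_limit[OF card inf a(1)] by blast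
      have "under r a \<subseteq> underS r b"
        using b wo_rel.TRANS[OF wo] wo_rel.ANTISYM[OF wo] unfolding under_def underS_def trans_def antisym_def by blast
      then have "|under r a| <o r" using card_of_underS[OF card b(1)] card_of_mono1 ordLeq_ordLess_trans by blast
      then have "|F ` under r a| <o r" using card_of_image ordLeq_ordLess_trans by blast
      then show ?thesis unfolding a(2) lower[OF a(1)] using rK by (rule ordLess_ordIso_trans)
    qed
    show "\<exists>b\<in>K. \<forall>x\<in>X. x < b" if X: "X \<subseteq> K" "|X| <o |K|" for X
    proof -
      define A where "A = {a \<in> Field r. F a \<in> X}"
      have FA: "F ` A = X" using X(1) by (auto simp: A_def K_def)
      have "inj_on F A" by (rule inj_on_subset[OF inj]) (auto simp: A_def)
      then have "|A| =o |X|" using FA card_of_ordIso[of A X] by (metis bij_betw_def)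
      then have "|A| <o r" using X(2) rK ordIso_ordLess_trans ordLess_ordIso_trans ordIso_symmetric by blast
      then have "\<not> |A| =o r" using not_ordLess_ordIso by blast
      moreover have "A \<subseteq> Field r" by (auto simp: A_def)
      ultimately have "\<not> cofinal A r" using reg unfolding regularCard_def by blast
      then obtain a where a: "a \<in> Field r" "\<And>x. x \<in> A ==> a = x \<or> (a, x) \<notin> r" unfolding cofinal_def by blast
      obtain b where b: "b \<in> Field r" "a \<noteq> b" "(a, b) \<in> r" using infinite_Card_order_limit[OF card inf a(1)] by blast
      have "F x < F b" if x: "x \<in> A" for x
      proof -
        have xF: "x \<in> Field r" using x by (simp add: A_def)
        have "F x \<le> F a" using a(2)[OF x] le_iff[OF a(1) xF] linear by auto
        moreover have "F a < F b" using less_iff[OF a(1) b(1)] b by (simp add: underS_def)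
        ultimately show ?thesis by (rule order_le_less_trans)
      qed
      then show ?thesis using b(1) FA unfolding K_def by blast
    qed
  qed
  obtain C where C: "\<And>\<alpha>. nonzero_limit r \<alpha> ==> club_in r (underS r \<alpha>) (C \<alpha>)"
    "\<And>\<alpha> w. nonzero_limit r \<alpha> ==> w \<in> acc_pts r (C \<alpha>) ==> C w = C \<alpha> \<inter> underS r w"
    "\<not> (\<exists>D. club_in r (Field r) D \<and> (\<forall>\<alpha>\<in>acc_pts r D. D \<inter> underS r \<alpha> = C \<alpha>))"
    using sq unfolding square_def by blast
  define G where "G = inv_into (Field r) F"
  define C' where "C' y = F ` C (G y)" for y
  have G: "G (F a) = a" if "a \<in> Field r" for a using inv_into_f_f[OF inj that] by (simp add: G_def)
  have image_below: "F ` (A \<inter> underS r b) = F ` A \<inter> {..<F b}" if "A \<subseteq> Field r" "b \<in> Field r" for A b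
    using less_iff[OF _ that(2)] that(1) by auto
  have "coherent_seq K C'"
  proof (intro coherent_seq.intro seg coherent_seq_axioms.intro)
    fix d assume d: "d \<in> K" "lim d"
    obtain a where a: "a \<in> Field r" "d = F a" using d(1) by (auto simp: K_def)
    have nl: "nonzero_limit r a" using lim_iff[OF a(1)] d(2) a(2) by simp
    have cl: "C a \<subseteq> underS r a" "\<And>w. w \<in> underS r a ==> \<exists>v\<in>C a. w \<in> underS r v"
      "\<And>w. w \<in> underS r a ==> accumulates r (C a) w ==> w \<in> C a"
      using C(1)[OF nl] unfolding club_in_def by blast+
    have CF: "C a \<subseteq> Field r" using cl(1) underS_in by blast
    have C'd: "C' d = F ` C a" using G[OF a(1)] by (simp add: C'_def a(2))
    show "C' d \<subseteq> {..<d}" using cl(1) less_iff[OF _ a(1)] CF unfolding C'd unfolding a(2) by blast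
    show "\<exists>y\<in>C' d. x < y" if x: "x < d" for x
    proof -
      obtain b where b: "b \<in> Field r" "x = F b" using below[OF a(1) less_imp_le] x a(2) by metis
      then have "b \<in> underS r a" using x less_iff[OF b(1) a(1)] a(2) by simp
      then obtain c where c: "c \<in> C a" "b \<in> underS r c" using cl(2) by blast
      then have "F b < F c" using less_iff[OF b(1), of c] CF by blast
      then show ?thesis using c(1) b(2) C'd by blast
    qed
    show "w \<in> C' d" if w: "w < d" "accp (C' d) w" for w
    proof -
      obtain b where b: "b \<in> Field r" "w = F b" using below[OF a(1) less_imp_le] w(1) a(2) by metis
      then have "b \<in> underS r a" using w(1) less_iff[OF b(1) a(1)] a(2) by simp
      moreover have "accumulates r (C a) b" using accp_iff[OF b(1) CF] w(2) b(2) C'd by simp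
      ultimately show ?thesis using cl(3) b(2) C'd by blast
    qed
    show "C' w = C' d \<inter> {..<w}" if w: "w \<in> C' d" "accp (C' d) w" for w
    proof -
      obtain b where b: "b \<in> C a" "w = F b" using w(1) C'd by blast
      then have bF: "b \<in> Field r" using CF by blast
      have "b \<in> acc_pts r (C a)" using accp_iff[OF bF CF] w(2) b C'd by (simp add: acc_pts_def)
      then have "C b = C a \<inter> underS r b" by (rule C(2)[OF nl])
      then show ?thesis using image_below[OF CF bF] G[OF bF] by (simp add: C'_def[of "F b"] b(2) C'd)
    qed
  next
    show "\<not> (\<exists>D\<subseteq>K. (\<forall>x\<in>K. \<exists>y\<in>D. x < y) \<and> (\<forall>w\<in>K. accp D w --> w \<in> D) \<and>
      (\<forall>\<alpha>\<in>D. accp D \<alpha> --> D \<inter> {..<\<alpha>} = C' \<alpha>))"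
    proof
      assume "\<exists>D\<subseteq>K. (\<forall>x\<in>K. \<exists>y\<in>D. x < y) \<and> (\<forall>w\<in>K. accp D w --> w \<in> D) \<and>
        (\<forall>\<alpha>\<in>D. accp D \<alpha> --> D \<inter> {..<\<alpha>} = C' \<alpha>)"
      then obtain D where D1: "D \<subseteq> K" and D2: "\<forall>x\<in>K. \<exists>y\<in>D. x < y" and D3: "\<forall>w\<in>K. accp D w --> w \<in> D"
        and D4: "\<forall>\<alpha>\<in>D. accp D \<alpha> --> D \<inter> {..<\<alpha>} = C' \<alpha>" by (elim exE conjE)
      define E where "E = {a \<in> Field r. F a \<in> D}"
      have EF: "E \<subseteq> Field r" by (auto simp: E_def)
      have FE: "F ` E = D" using D1 by (auto simp: E_def K_def)
      have "club_in r (Field r) E" unfolding club_in_def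
      proof (intro conjI ballI impI EF)
        fix b assume b: "b \<in> Field r"
        then obtain c where c: "c \<in> E" "F b < F c" using D2 FE unfolding K_def by blast
        then show "\<exists>v\<in>E. b \<in> underS r v" using less_iff[OF b, of c] EF by blast
      next
        fix b assume b: "b \<in> Field r" "accumulates r E b"
        then have "accp D (F b)" using accp_iff[OF b(1) EF] FE by simp
        then have "F b \<in> D" using D3 b(1) unfolding K_def by blast
        then show "b \<in> E" using b(1) by (simp add: E_def)
      qed
      moreover have "E \<inter> underS r b = C b" if "b \<in> acc_pts r E" for b
      proof -
        have b: "b \<in> E" "accumulates r E b" "b \<in> Field r" using that EF by (auto simp: acc_pts_def)
        have ac: "accp D (F b)" using accp_iff[OF b(3) EF] FE b(2) by simp
        have "F b \<in> D" using FE b(1) by blast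
        then have "F ` (E \<inter> underS r b) = F ` C b"
          using D4[rule_format, OF _ ac] image_below[OF EF b(3)] FE G[OF b(3)] by (simp add: C'_def)
        moreover have "nonzero_limit r b" using accp_lim[OF ac] lim_iff[OF b(3)] by simp
        then have "C b \<subseteq> Field r" using C(1) underS_in unfolding club_in_def by blast
        ultimately show ?thesis using inj_on_image_eq_iff[OF inj, of "E \<inter> underS r b" "C b"] EF by blast
      qed
      ultimately show False using C(3) by blast
    qed
  qed
  then show ?thesis by blast
qed

text \<open>A copy of the type, to be ordered by the cardinal of its universe; every cardinal on the
  type embeds into this order as an initial segment.\<close>

typedef 'a wo = "UNIV :: 'a set" morphisms of_wo Wo
  by simp

instantiation wo :: (type) wellorder
begin

definition less_eq_wo :: "'a wo => 'a wo => bool" where "less_eq_wo x y \<longleftrightarrow> (of_wo x, of_wo y) \<in> |UNIV|"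

definition less_wo :: "'a wo => 'a wo => bool" where "less_wo x y \<longleftrightarrow> x \<le> y \<and> \<not> y \<le> x"

instance
proof
  have W: "well_order_on UNIV |UNIV :: 'a set|" using card_of_well_order_on by blast
  have wo: "refl_on UNIV |UNIV :: 'a set|" "trans |UNIV :: 'a set|" "antisym |UNIV :: 'a set|"
    "total_on UNIV |UNIV :: 'a set|" "wf ( |UNIV :: 'a set| - Id)"
    using W unfolding well_order_on_def linear_order_on_def partial_order_on_def preorder_on_def by blast+
  fix x y z :: "'a wo"
  show "x < y \<longleftrightarrow> x \<le> y \<and> \<not> y \<le> x" by (rule less_wo_def)
  show "x \<le> x" using wo(1) by (simp add: less_eq_wo_def refl_on_def)
  show "x \<le> z" if "x \<le> y" "y \<le> z" using that wo(2) by (auto simp: less_eq_wo_def dest: transD)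
  show "x = y" if "x \<le> y" "y \<le> x" using that wo(3) by (auto simp: less_eq_wo_def of_wo_inject dest: antisymD)
  show "x \<le> y \<or> y \<le> x" using wo(1,4) by (cases "x = y") (auto simp: less_eq_wo_def refl_on_def total_on_def of_wo_inject)
  show "P a" if step: "\<And>x. (\<And>y. y < x ==> P y) ==> P x" for P and a :: "'a wo"
  proof -
    have "P (Wo b)" for b
      using wo(5)
    proof (induction b rule: wf_induct_rule)
      case (less b)
      show ?case
      proof (rule step)
        fix y :: "'a wo" assume y: "y < Wo b"
        then have "(of_wo y, b) \<in> |UNIV|" "of_wo y \<noteq> b"
          using wo(1) by (auto simp: less_wo_def less_eq_wo_def Wo_inverse refl_on_def)
        then have "P (Wo (of_wo y))" using less by blast
        then show "P y" by (simp add: of_wo_inverse)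
      qed
    qed
    then show ?thesis using of_wo_inverse by metis
  qed
qed

end

theorem theorem2:
  fixes \<kappa> :: "'a rel"
  assumes "Card_order \<kappa>" and "natLeq <o \<kappa>" and "regularCard \<kappa>"
    and "square \<kappa>"
  shows "\<exists>G :: 'a monoid. group G \<and> |carrier G| =o \<kappa> \<and> Shelah G"
proof -
  have W: "Well_order \<kappa>" using assms(1) card_order_on_well_order_on by blast
  have eq: "|Field \<kappa>| =o \<kappa>" by (rule card_of_Field_ordIso[OF assms(1)])
  have "|Field \<kappa>| \<le>o |UNIV :: 'a set|" by (rule card_of_mono1) simp
  then have "\<kappa> \<le>o |UNIV :: 'a set|" using eq ordIso_symmetric ordIso_ordLeq_trans by blast
  then obtain g where g: "embed \<kappa> |UNIV :: 'a set| g" unfolding ordLeq_def by blast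
  define F where "F a = Wo (g a)" for a
  have "initial_embedding \<kappa> F"
  proof
    show "Card_order \<kappa>" by (rule assms(1))
    show "inj_on F (Field \<kappa>)" using embed_inj_on[OF W g] by (auto simp: F_def inj_on_def Wo_inject)
    fix a assume a: "a \<in> Field \<kappa>"
    have u: "g ` under \<kappa> a = under |UNIV| (g a)" using g a unfolding embed_def bij_betw_def by blast
    show "{..F a} = F ` under \<kappa> a"
    proof
      show "{..F a} \<subseteq> F ` under \<kappa> a"
      proof
        fix x assume "x \<in> {..F a}"
        then have "of_wo x \<in> under |UNIV| (g a)" by (simp add: less_eq_wo_def F_def Wo_inverse under_def)
        then obtain b where "b \<in> under \<kappa> a" "of_wo x = g b" using u by blast
        then show "x \<in> F ` under \<kappa> a" unfolding F_def by (metis image_eqI of_wo_inverse)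
      qed
      show "F ` under \<kappa> a \<subseteq> {..F a}"
      proof
        fix x assume "x \<in> F ` under \<kappa> a"
        then obtain b where "b \<in> under \<kappa> a" "x = F b" by blast
        then have "g b \<in> under |UNIV| (g a)" using u by blast
        then show "x \<in> {..F a}" by (simp add: \<open>x = F b\<close> less_eq_wo_def F_def Wo_inverse under_def)
      qed
    qed
  qed
  then interpret initial_embedding \<kappa> F .
  obtain C where "coherent_seq K C" using coherent_seq[OF assms(2-4)] by blast
  then obtain G :: "'a wo U monoid" where G: "group G" "|carrier G| =o |K|" "Shelah G" using coherent_seq.ex_Shelah by blast
  have "bij_betw F (Field \<kappa>) K" using inj by (simp add: bij_betw_def K_def)
  then have "|Field \<kappa>| =o |K|" using card_of_ordIso by blast
  then have "|carrier G| =o |Field \<kappa>|" using ordIso_transitive[OF G(2)] ordIso_symmetric by blast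
  \<comment> \<open>The group consists of terms; renaming its elements by
    \<open>Field \<kappa>\<close> brings it to the type of \<open>\<kappa>\<close>.\<close>
  then obtain h where h: "bij_betw h (carrier G) (Field \<kappa>)" using card_of_ordIso by blast
  then have hi: "inj_on h (carrier G)" "h ` carrier G = Field \<kappa>" by (auto simp: bij_betw_def)
  have "carrier (image_group h G) = Field \<kappa>" using hi(2) by (simp add: image_group_carrier)
  then show ?thesis using Shelah_transport[OF G(1,3) hi(1)] eq by metis
qed

end
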